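(* Let $\mathbf W\subset\mathbb R^{n+1}$ be compact with $\Omega=\mathbb R^{n+1}\setminus\mathbf W$ having smooth boundary, and let $\mathcal C$ be a spanning class for $\mathbf W$. Let $K$ be relatively closed in $\Omega$, $\mathcal H^n$-rectifiable, bounded, $\mathcal C$-spanning $\mathbf W$, and such that there are $c,r_0>0$ with $\mathcal H^n(K\cap B_r(x))\ge c\,r^n$ for every $x\in\overline K$ and $r<r_0$. Let $\nu:(0,1)\to(0,\infty)$ and $\delta:(0,1)\to(1/2,1)$ satisfy, as $\varepsilon\to0^+$, $\nu(\varepsilon)\to0^+$, $\delta(\varepsilon)\to\delta_0\in[1/2,1]$, and $\varepsilon/\nu(\varepsilon)\to0$. Then there exist $\varepsilon_j\to0^+$ and functions $u^j_\varepsilon\in(W^{1,2}_{\rm loc}\cap{\rm Lip})(\Omega;[0,1])$ (defined for each $j$ and each $\varepsilon<\varepsilon_j$) such that, for every $\varepsilon<\varepsilon_j$, $\{u^j_\varepsilon\ge\delta(\varepsilon)\}$ is $\mathcal C$-spanning $\mathbf W$ and $\mathcal V(u^j_\varepsilon;\Omega)=\nu(\varepsilon)$, and $$\limsup_{j\to\infty}\sup_{\varepsilon<\varepsilon_j}\frac{\mathcal{AC}_\varepsilon(u^j_\varepsilon;\Omega)}{2}\le 2\,\Phi(\delta_0)\,\mathcal H^n(K).$$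
   Context: $W\in C^{2,1}[0,1]$ satisfies $W(0)=W(1)=0$, $W>0$ on $(0,1)$, $W''(0),W''(1)>0$, $\int_0^1\sqrt W=1$; $\Phi(t)=\int_0^t\sqrt W$, $V(t)=\Phi(t)^{(n+1)/n}$; for $u:\Omega\to[0,1]$, $\mathcal{AC}_\varepsilon(u;\Omega)=\int_\Omega\varepsilon|\nabla u|^2+W(u)/\varepsilon$ and $\mathcal V(u;\Omega)=\int_\Omega V(u)$. Notation: $\mathcal H^n$ is $n$-dimensional Hausdorff measure, $|\cdot|$ Lebesgue measure; $A$ is $\mathcal H^n$-contained in $B$ if $\mathcal H^n(A\setminus B)=0$. For measurable $E$, $E^{(t)}$ = points of density $t$, $\partial^eE=\mathbb R^{n+1}\setminus(E^{(0)}\cup E^{(1)})$. Spanning class: a family $\mathcal C$ of smooth embeddings $\gamma:\mathbb S^1\to\Omega$ such that $\Phi(\cdot,1)\in\mathcal C$ whenever $\Phi\in C^\infty(\mathbb S^1\times[0,1];\Omega)$, each $\Phi(\cdot,t)$ is a smooth embedding, and $\Phi(\cdot,0)\in\mathcal C$. $\mathcal T(\mathcal C)$ is the set of triples $(\gamma,\Phi,T)$ with $\gamma\in\mathcal C$, $T=\Phi(\mathbb S^1\times B_1^n)\subset\subset\Omega$, $\Phi:\mathbb S^1\times\overline{B^n_1}\to\overline T$ a diffeomorphism with $\Phi(s,0)=\gamma(s)$; $T[s]=\Phi(\{s\}\times B_1^n)$. A Borel $K$ essentially disconnects a Borel $G$ into $\{G_1,G_2\}$ if $\{G_1,G_2\}$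 is a Lebesgue partition of $G$ with $|G_1||G_2|>0$ and $G^{(1)}\cap\partial^eG_1\cap\partial^eG_2$ is $\mathcal H^n$-contained in $K$. A Borel $S\subset\Omega$ is $\mathcal C$-spanning $\mathbf W$ if for every $(\gamma,\Phi,T)\in\mathcal T(\mathcal C)$, for $\mathcal H^1$-a.e. $s\in\mathbb S^1$ and $\mathcal H^n$-a.e. $x\in T[s]$, there is a partition $\{T_1,T_2\}$ of $T$ with $x\in\partial^eT_1\cap\partial^eT_2$ such that $S\cup T[s]$ essentially disconnects $T$ into $\{T_1,T_2\}$. *)

theory Defs
  imports "HOL-Analysis.Analysis"
begin

coinductive smooth_on :: "'a::real_normed_vector set \<Rightarrow> ('a \<Rightarrow> 'b::real_normed_vector) \<Rightarrow> bool" where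
  "(\<forall>x\<in>U. f differentiable (at x)) \<Longrightarrow>
   (\<forall>v. smooth_on U (\<lambda>x. frechet_derivative f (at x) v)) \<Longrightarrow> smooth_on U f"

definition smooth_on_set :: "'a::real_normed_vector set \<Rightarrow> ('a \<Rightarrow> 'b::real_normed_vector) \<Rightarrow> bool" where
  "smooth_on_set S f \<longleftrightarrow> (\<exists>U g. open U \<and> S \<subseteq> U \<and> smooth_on U g \<and> (\<forall>x\<in>S. g x = f x))"

abbreviation S1 :: "complex set" where "S1 \<equiv> sphere 0 1"

text \<open>smooth embedding of the circle (compact, so injective immersion = embedding)\<close>
definition smooth_embedding :: "'a::euclidean_space set \<Rightarrow> (complex \<Rightarrow> 'a) \<Rightarrow> bool" where
  "smooth_embedding \<Omega> \<gamma> \<longleftrightarrow> \<gamma> ` S1 \<subseteq> \<Omega> \<and> inj_on \<gamma> S1 \<and>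
     (\<exists>U g. open U \<and> S1 \<subseteq> U \<and> smooth_on U g \<and> (\<forall>z\<in>S1. g z = \<gamma> z) \<and>
        (\<forall>z\<in>S1. frechet_derivative g (at z) (\<i> * z) \<noteq> 0))"

definition smooth_boundary :: "'a::euclidean_space set \<Rightarrow> bool" where
  "smooth_boundary \<Omega> \<longleftrightarrow> (\<forall>p\<in>frontier \<Omega>. \<exists>U (f::'a \<Rightarrow> real). open U \<and> p \<in> U \<and> smooth_on U f \<and>
      (\<forall>x\<in>U. frechet_derivative f (at x) \<noteq> (\<lambda>_. 0)) \<and> \<Omega> \<inter> U = {x\<in>U. f x < 0})"

definition hausdorff_pre :: "nat \<Rightarrow> real \<Rightarrow> 'x::metric_space set \<Rightarrow> ennreal" where
  "hausdorff_pre m d A = (INF C \<in> {C::nat \<Rightarrow> 'x set. A \<subseteq> (\<Union>i. C i) \<and> (\<forall>i. bounded (C i) \<and> diameter (C i) \<le> d)}.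
      (\<Sum>i. ennreal (unit_ball_vol (real m) * (diameter (C i) / 2) ^ m)))"

definition hausdorff :: "nat \<Rightarrow> 'x::metric_space set \<Rightarrow> ennreal" where
  "hausdorff m A = (SUP d \<in> {0<..}. hausdorff_pre m d A)"

definition H_contained :: "nat \<Rightarrow> 'x::metric_space set \<Rightarrow> 'x set \<Rightarrow> bool" where
  "H_contained m A B \<longleftrightarrow> hausdorff m (A - B) = 0"

text \<open>H^n-rectifiable (Maggi's convention): countably H^n-rectifiable and H^n-finite;
  here n = DIM('b).\<close>
definition H_rectifiable :: "'b::euclidean_space itself \<Rightarrow> 'a::euclidean_space set \<Rightarrow> bool" where
  "H_rectifiable _ K \<longleftrightarrow>
     (\<exists>f::nat \<Rightarrow> 'b \<Rightarrow> 'a. (\<forall>i. \<exists>L. L-lipschitz_on UNIV (f i)) \<and>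
        hausdorff DIM('b) (K - (\<Union>i. range (f i))) = 0) \<and> hausdorff DIM('b) K < \<infinity>"

definition density_pts :: "'a::euclidean_space set \<Rightarrow> real \<Rightarrow> 'a set" where
  "density_pts E t = {x. ((\<lambda>r. measure lebesgue (E \<inter> ball x r) / measure lebesgue (ball x r)) \<longlongrightarrow> t) (at_right 0)}"

definition ess_boundary :: "'a::euclidean_space set \<Rightarrow> 'a set" where
  "ess_boundary E = UNIV - (density_pts E 0 \<union> density_pts E 1)"

definition lebesgue_partition :: "'a::euclidean_space set \<Rightarrow> 'a set \<Rightarrow> 'a set \<Rightarrow> bool" where
  "lebesgue_partition G G1 G2 \<longleftrightarrow> G1 \<in> sets lebesgue \<and> G2 \<in> sets lebesgue \<and>
     emeasure lebesgue (G1 \<inter> G2) = 0 \<and>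
     emeasure lebesgue ((G - (G1 \<union> G2)) \<union> ((G1 \<union> G2) - G)) = 0"

definition ess_disconnects :: "nat \<Rightarrow> 'a::euclidean_space set \<Rightarrow> 'a set \<Rightarrow> 'a set \<Rightarrow> 'a set \<Rightarrow> bool" where
  "ess_disconnects n K G G1 G2 \<longleftrightarrow> lebesgue_partition G G1 G2 \<and>
     emeasure lebesgue G1 * emeasure lebesgue G2 > 0 \<and>
     H_contained n (density_pts G 1 \<inter> ess_boundary G1 \<inter> ess_boundary G2) K"

definition spanning_class :: "'a::euclidean_space set \<Rightarrow> (complex \<Rightarrow> 'a) set \<Rightarrow> bool" where
  "spanning_class \<Omega> C \<longleftrightarrow> (\<forall>\<gamma>\<in>C. smooth_embedding \<Omega> \<gamma>) \<and>
     (\<forall>H::complex \<times> real \<Rightarrow> 'a. smooth_on_set (S1 \<times> {0..1}) H \<and> H ` (S1 \<times> {0..1}) \<subseteq> \<Omega> \<and>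
        (\<forall>t\<in>{0..1}. smooth_embedding \<Omega> (\<lambda>s. H (s, t))) \<and> (\<exists>\<gamma>\<in>C. \<forall>s\<in>S1. \<gamma> s = H (s, 0))
        \<longrightarrow> (\<forall>\<gamma>'. (\<forall>s\<in>S1. \<gamma>' s = H (s, 1)) \<longrightarrow> \<gamma>' \<in> C))"

text \<open>(gamma, Phi, T) in T(C); the ball B^n_1 lives in 'b with n = DIM('b).\<close>
definition tube :: "'a::euclidean_space set \<Rightarrow> (complex \<Rightarrow> 'a) set \<Rightarrow> (complex \<Rightarrow> 'a)
    \<Rightarrow> (complex \<times> 'b::euclidean_space \<Rightarrow> 'a) \<Rightarrow> 'a set \<Rightarrow> bool" where
  "tube \<Omega> C \<gamma> \<Phi> T \<longleftrightarrow> \<gamma> \<in> C \<and> T = \<Phi> ` (S1 \<times> ball 0 1) \<and>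
     compact (closure T) \<and> closure T \<subseteq> \<Omega> \<and>
     bij_betw \<Phi> (S1 \<times> cball 0 1) (closure T) \<and>
     smooth_on_set (S1 \<times> cball 0 1) \<Phi> \<and>
     smooth_on_set (closure T) (inv_into (S1 \<times> cball 0 1) \<Phi>) \<and>
     (\<forall>s\<in>S1. \<Phi> (s, 0) = \<gamma> s)"

definition spanning :: "'b::euclidean_space itself \<Rightarrow> 'a::euclidean_space set \<Rightarrow> (complex \<Rightarrow> 'a) set \<Rightarrow> 'a set \<Rightarrow> bool" where
  "spanning _ \<Omega> C S \<longleftrightarrow> S \<in> sets borel \<and> S \<subseteq> \<Omega> \<and>
     (\<forall>\<gamma> (\<Phi>::complex \<times> 'b \<Rightarrow> 'a) T. tube \<Omega> C \<gamma> \<Phi> T \<longrightarrow>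
       (\<exists>N. hausdorff 1 N = 0 \<and> (\<forall>s\<in>S1 - N. \<exists>M. hausdorff DIM('b) M = 0 \<and>
          (\<forall>x\<in>\<Phi> ` ({s} \<times> ball 0 1) - M. \<exists>T1 T2. T1 \<inter> T2 = {} \<and> T1 \<union> T2 = T \<and>
             x \<in> ess_boundary T1 \<inter> ess_boundary T2 \<and>
             ess_disconnects DIM('b) (S \<union> \<Phi> ` ({s} \<times> ball 0 1)) T T1 T2))))"

definition admissible_W :: "(real \<Rightarrow> real) \<Rightarrow> bool" where
  "admissible_W W \<longleftrightarrow>
    (\<exists>W1 W2. (\<forall>x\<in>{0..1}. (W has_real_derivative W1 x) (at x within {0..1}) \<and>
                          (W1 has_real_derivative W2 x) (at x within {0..1})) \<and>
             (\<exists>L. L-lipschitz_on {0..1} W2) \<and> W2 0 > 0 \<and> W2 1 > 0) \<and>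
    W 0 = 0 \<and> W 1 = 0 \<and> (\<forall>t\<in>{0<..<1}. W t > 0) \<and>
    integral {0..1} (\<lambda>t. sqrt (W t)) = 1"

definition Phi :: "(real \<Rightarrow> real) \<Rightarrow> real \<Rightarrow> real" where
  "Phi W t = integral {0..t} (\<lambda>s. sqrt (W s))"

definition Vpot :: "(real \<Rightarrow> real) \<Rightarrow> nat \<Rightarrow> real \<Rightarrow> real" where
  "Vpot W n t = Phi W t powr ((real n + 1) / real n)"

definition test_fun :: "'a::euclidean_space set \<Rightarrow> ('a \<Rightarrow> real) \<Rightarrow> bool" where
  "test_fun U \<phi> \<longleftrightarrow> smooth_on UNIV \<phi> \<and> compact (closure {x. \<phi> x \<noteq> 0}) \<and> closure {x. \<phi> x \<noteq> 0} \<subseteq> U"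

definition L2loc :: "'a::euclidean_space set \<Rightarrow> ('a \<Rightarrow> real) \<Rightarrow> bool" where
  "L2loc U f \<longleftrightarrow> f \<in> borel_measurable lebesgue \<and>
     (\<forall>K. compact K \<and> K \<subseteq> U \<longrightarrow> set_integrable lebesgue K (\<lambda>x. (f x)\<^sup>2))"

definition weak_gradient :: "'a::euclidean_space set \<Rightarrow> ('a \<Rightarrow> real) \<Rightarrow> ('a \<Rightarrow> 'a) \<Rightarrow> bool" where
  "weak_gradient U u g \<longleftrightarrow> (\<forall>i\<in>Basis. L2loc U (\<lambda>x. g x \<bullet> i)) \<and>
     (\<forall>\<phi>. test_fun U \<phi> \<longrightarrow> (\<forall>i\<in>Basis.
        (LINT x:U|lebesgue. u x * frechet_derivative \<phi> (at x) i) = - (LINT x:U|lebesgue. (g x \<bullet> i) * \<phi> x)))"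

definition W12loc :: "'a::euclidean_space set \<Rightarrow> ('a \<Rightarrow> real) \<Rightarrow> bool" where
  "W12loc U u \<longleftrightarrow> L2loc U u \<and> (\<exists>g. weak_gradient U u g)"

definition AC :: "(real \<Rightarrow> real) \<Rightarrow> real \<Rightarrow> ('a::euclidean_space \<Rightarrow> real) \<Rightarrow> 'a set \<Rightarrow> ennreal" where
  "AC W \<epsilon> u \<Omega> = (let g = (SOME g. weak_gradient \<Omega> u g) in
     \<integral>\<^sup>+ x\<in>\<Omega>. ennreal (\<epsilon> * (norm (g x))\<^sup>2 + W (u x) / \<epsilon>) \<partial>lebesgue)"

definition Vol :: "(real \<Rightarrow> real) \<Rightarrow> nat \<Rightarrow> ('a::euclidean_space \<Rightarrow> real) \<Rightarrow> 'a set \<Rightarrow> ennreal" where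
  "Vol W n u \<Omega> = (\<integral>\<^sup>+ x\<in>\<Omega>. ennreal (Vpot W n (u x)) \<partial>lebesgue)"

end

theory Submission
  imports Defs
begin

text \<open>
  Take \<open>u\<close> as the maximum of a one-dimensional profile composed with the distance to \<open>K\<close> and of a
  small bump placed far away from \<open>K\<close>.  The profile \<open>w\<close> starts at a height \<open>a\<close> slightly above
  \<open>\<delta>0\<close> and solves \<open>w' = - sqrt (W w + \<kappa>)\<close>, so that it reaches \<open>0\<close> at a finite time \<open>S\<close>; thus
  \<open>u(x) = w(dist x K / \<epsilon>)\<close> near \<open>K\<close>.  As \<open>u = a \<ge> \<delta> \<epsilon>\<close> on \<open>K\<close>, the superlevel set contains \<open>K\<close>, and
  being spanning is inherited by larger sets.  The profile part has energy at most \<open>2/\<epsilon>\<close> times the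
  integral of \<open>W w + \<kappa>\<close> over the \<open>S \<epsilon>\<close>-neighbourhood of \<open>K\<close>.  Slicing that neighbourhood into thin layers,
  the limit is governed by the Minkowski content of \<open>K\<close>, which equals the Hausdorff measure
  because \<open>K\<close> is rectifiable with a uniform lower density bound; and the integral of \<open>W w + \<kappa>\<close>
  over \<open>[0, S]\<close> is that of \<open>sqrt (W + \<kappa>)\<close> over \<open>[0, a]\<close>.  The volume of the profile part is \<open>O(\<epsilon>)\<close>, hence
  below \<open>\<nu> \<epsilon>\<close>; the radius of the bump is adjusted to make up the difference, and its energy is of
  the order of the boundary area of a ball whose volume tends to \<open>0\<close>.

  The energy is defined through a weak gradient chosen by \<open>SOME\<close>.  To evaluate it one needs that
  weak gradients are unique almost everywhere and, for Lipschitz functions, agree with the classical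
  gradient, which exists almost everywhere by Rademacher's theorem.
\<close>

section \<open>Smooth test functions and integration by parts\<close>

text \<open>Without \<kappa> the profile equation may need infinite time to reach 0, as W vanishes
  there, and for a = 1 the constant 1 solves it. With \<kappa> = k^2 the speed stays at least k,
  while sqrt (W + k^2) <= sqrt W + k keeps the extra energy under control before S is known. The
  height must exceed \<delta>0 because \<delta> \<epsilon> may approach its limit from above. This
  is what calls for a sequence of thresholds, with one height for each j. The energy carries two
  factors 2: one for the two sides of K in the Minkowski content, one because gradient and potential
  term receive the same bound. Halving the energy removes the second. The obstacle is the upper
  bound for the Minkowski content. Finitely many compact, nearly flat pieces exhaust K up to small
  Hausdorff measure, but a small remainder could still have large neighbourhoods; the lower density
  bound excludes this. Flat pieces also replace the area formula: each is compared with its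
  projection, which needs Hausdorff and Lebesgue measure to agree in full dimension. Since coverings
  by arbitrary sets compete, that rests on the isodiametric inequality.\<close>

definition flat_exp :: "nat \<Rightarrow> real \<Rightarrow> real" where
  "flat_exp k t = (if t > 0 then (1 / t) ^ k * exp (- (1 / t)) else 0)"

lemma flat_exp_tendsto_0: "(flat_exp k \<longlongrightarrow> 0) (at 0)"
proof -
  have "((\<lambda>t::real. (1 / t) ^ k * exp (- (1 / t))) \<longlongrightarrow> 0) (at_right 0)"
  proof -
    have "((\<lambda>x::real. x ^ k / exp x) \<longlongrightarrow> 0) at_top" by (rule tendsto_power_div_exp_0)
    then have "((\<lambda>t::real. (inverse t) ^ k / exp (inverse t)) \<longlongrightarrow> 0) (at_right 0)"
      by (rule filterlim_compose[OF _ filterlim_inverse_at_top_right])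
    then show ?thesis
      by (simp add: exp_minus divide_inverse)
  qed
  then have R: "(flat_exp k \<longlongrightarrow> 0) (at_right 0)"
    by (rule Lim_transform_eventually) (auto simp: flat_exp_def eventually_at_filter)
  have L: "(flat_exp k \<longlongrightarrow> 0) (at_left 0)"
    by (rule Lim_transform_eventually[where f="\<lambda>_. 0"])
      (auto simp: flat_exp_def eventually_at_filter)
  show ?thesis using L R by (simp add: filterlim_split_at)
qed

text \<open>The weight \<open>(1 / t) ^ k\<close> closes the family under differentiation up to
  linear combinations. At 0 the difference quotient of \<open>flat_exp k\<close> is
  \<open>flat_exp (Suc k)\<close> itself, so \<open>flat_exp_tendsto_0\<close> yields the derivative
  0.\<close>

lemma DERIV_flat_exp:
  "(flat_exp k has_real_derivative (flat_exp (k + 2) t - real k * flat_exp (k + 1) t)) (at t)"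
proof -
  consider "t > 0" | "t < 0" | "t = 0" by linarith
  then show ?thesis
  proof cases
    case 1
    have "((\<lambda>t. (1 / t) ^ k * exp (- (1 / t))) has_real_derivative
        (flat_exp (k + 2) t - real k * flat_exp (k + 1) t)) (at t)"
    proof -
      have "n = 0 \<or> t * t ^ (n - Suc 0) = t ^ n" for n :: nat by (cases n) auto
      from this[of "k - 1"] show ?thesis using 1 by (cases k)
        (auto intro!: derivative_eq_intros simp: flat_exp_def field_simps power2_eq_square)
    qed
    then show ?thesis
      by (rule has_field_derivative_transform_within_open[where S="{0<..}"])
        (use 1 in \<open>auto simp: flat_exp_def\<close>)
  next
    case 2
    have "((\<lambda>t. 0) has_real_derivative (flat_exp (k + 2) t - real k * flat_exp (k + 1) t)) (at t)"
      using 2 by (auto simp: flat_exp_def)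
    then show ?thesis
      by (rule has_field_derivative_transform_within_open[where S="{..<0}"])
        (use 2 in \<open>auto simp: flat_exp_def\<close>)
  next
    case 3
    have "((\<lambda>h. (flat_exp k (0 + h) - flat_exp k 0) / h) \<longlongrightarrow> 0) (at 0)"
      by (rule Lim_transform_eventually[OF flat_exp_tendsto_0[of "Suc k"]])
        (auto simp: flat_exp_def eventually_at_filter)
    then show ?thesis using 3 by (simp add: DERIV_def flat_exp_def)
  qed
qed

text \<open>\<open>smooth_on\<close> is coinductive, so smoothness follows from any class of
  differentiable functions that contains all directional derivatives of its members. Closure under
  sums and products makes this such a class, and products of one-dimensional cutoffs belong to
  it.\<close>

inductive bump_alg :: "('a::euclidean_space \<Rightarrow> real) \<Rightarrow> bool" where
  base: "bump_alg (\<lambda>x. flat_exp k (c + a \<bullet> x))"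
| const: "bump_alg (\<lambda>x. c)"
| add: "bump_alg f \<Longrightarrow> bump_alg g \<Longrightarrow> bump_alg (\<lambda>x. f x + g x)"
| mult: "bump_alg f \<Longrightarrow> bump_alg g \<Longrightarrow> bump_alg (\<lambda>x. f x * g x)"

lemma bump_alg_derivative:
  assumes "bump_alg f"
  shows "\<exists>D. (\<forall>x. (f has_derivative D x) (at x)) \<and> (\<forall>v. bump_alg (\<lambda>x. D x v))"
  using assms
proof induction
  case (base k c a)
  let ?E = "\<lambda>x. flat_exp (k + 2) (c + a \<bullet> x) + (- real k) * flat_exp (k + 1) (c + a \<bullet> x)"
  let ?D = "\<lambda>x v. ?E x * (a \<bullet> v)"
  have "((\<lambda>x. flat_exp k (c + a \<bullet> x)) has_derivative ?D x) (at x)" for x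
  proof -
    have "(flat_exp k has_derivative (\<lambda>h. ?E x * h)) (at (c + a \<bullet> x))"
      using DERIV_flat_exp[of k "c + a \<bullet> x"] by (simp add: has_field_derivative_def)
    moreover have "((\<lambda>x. c + a \<bullet> x) has_derivative (\<lambda>v. a \<bullet> v)) (at x)"
      by (auto intro!: derivative_eq_intros)
    ultimately show ?thesis
      using has_derivative_compose[of "\<lambda>x. c + a \<bullet> x" "\<lambda>v. a \<bullet> v" x UNIV "flat_exp k"] by simp
  qed
  moreover have "bump_alg (\<lambda>x. ?D x v)" for v
    by (intro bump_alg.intros)
  ultimately show ?case by (intro exI[of _ ?D]) blast
next
  case (const c)
  show ?case by (rule exI[of _ "\<lambda>_ _. 0"]) (auto intro: bump_alg.intros)
next
  case (add f g)
  then obtain D E where "\<And>x. (f has_derivative D x) (at x)" "\<And>v. bump_alg (\<lambda>x. D x v)"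
    "\<And>x. (g has_derivative E x) (at x)" "\<And>v. bump_alg (\<lambda>x. E x v)" by metis
  then show ?case
    by (intro exI[of _ "\<lambda>x v. D x v + E x v"]) (auto intro: bump_alg.intros has_derivative_add)
next
  case (mult f g)
  then obtain D E where D: "\<And>x. (f has_derivative D x) (at x)" "\<And>v. bump_alg (\<lambda>x. D x v)"
    "\<And>x. (g has_derivative E x) (at x)" "\<And>v. bump_alg (\<lambda>x. E x v)" by metis
  have "bump_alg (\<lambda>x. f x * E x v + D x v * g x)" for v
    by (intro bump_alg.add bump_alg.mult D mult)
  then show ?case using D
    by (intro exI[of _ "\<lambda>x v. f x * E x v + D x v * g x"]) (auto intro: has_derivative_mult)
qed

lemma bump_alg_smooth: "bump_alg f \<Longrightarrow> smooth_on UNIV f"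
proof (coinduction arbitrary: f rule: smooth_on.coinduct)
  case smooth_on
  then obtain D where D: "\<And>x. (f has_derivative D x) (at x)" "\<And>v. bump_alg (\<lambda>x. D x v)"
    using bump_alg_derivative by blast
  have "frechet_derivative f (at x) = D x" for x
    using D(1) frechet_derivative_at by metis
  then show ?case using D by (auto simp: differentiable_def)
qed

lemma bump_alg_prod: "finite I \<Longrightarrow> (\<And>i. i \<in> I \<Longrightarrow> bump_alg (f i)) \<Longrightarrow> bump_alg (\<lambda>x. \<Prod>i\<in>I. f i x)"
  by (induction I rule: finite_induct) (auto intro: bump_alg.intros)

section \<open>Bumps supported in boxes\<close>

definition box_bump :: "'a::euclidean_space \<Rightarrow> 'a \<Rightarrow> real \<Rightarrow> 'a \<Rightarrow> real" where
  "box_bump a b k x = (\<Prod>i\<in>Basis. flat_exp 0 (k * (x \<bullet> i - a \<bullet> i)) * flat_exp 0 (k * (b \<bullet> i - x \<bullet> i)))"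

lemma flat_exp_0_bounds: "0 \<le> flat_exp 0 t" "flat_exp 0 t \<le> 1"
  by (auto simp: flat_exp_def)

lemma box_bump_bounds: "0 \<le> box_bump a b k x" "box_bump a b k x \<le> 1"
  unfolding box_bump_def
  by (auto intro!: prod_nonneg prod_le_1 mult_le_one simp: flat_exp_0_bounds)

lemma box_bump_support:
  assumes "k > 0" "x \<notin> box a b" shows "box_bump a b k x = 0"
proof -
  obtain i where "i \<in> Basis" "x \<bullet> i \<le> a \<bullet> i \<or> b \<bullet> i \<le> x \<bullet> i"
    using assms by (auto simp: mem_box not_less)
  then show ?thesis unfolding box_bump_def using assms(1)
    by (intro prod_zero) (auto simp: flat_exp_def mult_le_0_iff zero_less_mult_iff not_less intro!: bexI[of _ i])
qed

lemma test_fun_box_bump: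
  fixes a b :: "'a::euclidean_space"
  assumes "k > 0" "cbox a b \<subseteq> U" shows "test_fun U (box_bump a b k)"
proof -
  have "bump_alg (\<lambda>x. flat_exp 0 (k * (x \<bullet> i - a \<bullet> i)) * flat_exp 0 (k * (b \<bullet> i - x \<bullet> i)))" for i
    using bump_alg.mult[OF bump_alg.base[of 0 "- k * (a \<bullet> i)" "k *\<^sub>R i"] bump_alg.base[of 0 "k * (b \<bullet> i)" "- k *\<^sub>R i"]]
    by (simp add: algebra_simps inner_commute)
  then have "smooth_on UNIV (box_bump a b k)"
    unfolding box_bump_def by (intro bump_alg_smooth bump_alg_prod) auto
  moreover have "closure {x. box_bump a b k x \<noteq> 0} \<subseteq> cbox a b"
    using box_bump_support[OF assms(1)] box_subset_cbox[of a b] by (intro closure_minimal) blast+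
  ultimately show ?thesis using assms(2) unfolding test_fun_def
    by (auto intro: compact_closure[THEN iffD2] bounded_subset[OF bounded_cbox] dest: subset_trans[OF closure_subset])
qed

text \<open>For growing k each factor \<open>flat_exp 0 (k * t)\<close> tends to 1 if t > 0 and is 0
  otherwise, so indicators of open boxes are pointwise limits of test functions.\<close>

lemma box_bump_tendsto: "(\<lambda>n. box_bump a b (real (Suc n)) x) \<longlonglongrightarrow> indicator (box a b) x"
proof (cases "x \<in> box a b")
  case True
  have *: "(\<lambda>n. flat_exp 0 (real (Suc n) * t)) \<longlonglongrightarrow> 1" if "t > 0" for t
  proof -
    have "(\<lambda>n. exp (- (1 / (real (Suc n) * t)))) \<longlonglongrightarrow> exp 0"
    proof (intro tendsto_intros)
      have "(\<lambda>n. - ((1 / t) * inverse (real (Suc n)))) \<longlonglongrightarrow> - ((1 / t) * 0)"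
        by (intro tendsto_intros LIMSEQ_inverse_real_of_nat)
      then show "(\<lambda>n. - (1 / (real (Suc n) * t))) \<longlonglongrightarrow> 0" by (simp add: field_simps)
    qed
    then show ?thesis using that by (simp add: flat_exp_def)
  qed
  have "(\<lambda>n. box_bump a b (real (Suc n)) x) \<longlonglongrightarrow> (\<Prod>i\<in>(Basis::'a set). 1 * 1)"
    unfolding box_bump_def using True by (intro tendsto_prod tendsto_mult *) (auto simp: mem_box)
  then show ?thesis using True by simp
next
  case False
  then show ?thesis by (simp add: box_bump_support)
qed


text \<open>Open boxes form an intersection-stable generator of the Borel sets, so the vanishing
  extends to all Borel sets; then f and 0 are densities of the same set function.\<close>

lemma AE_zero_if_box_integrals_zero:
  fixes f :: "'a::euclidean_space \<Rightarrow> real"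
  assumes f: "integrable lborel f" and z: "\<And>a b. (LINT x:box a b|lborel. f x) = 0"
  shows "AE x in lborel. f x = 0"
proof -
  \<comment> \<open>The complement step of the induction subtracts from the integral over the whole
    space, which therefore has to vanish first.\<close>
  have UN: "(LINT x|lborel. f x) = 0"
  proof -
    have "(\<lambda>n. LINT x:box (- real n *\<^sub>R One) (real n *\<^sub>R One :: 'a)|lborel. f x) \<longlonglongrightarrow> (LINT x:(\<Union>n. box (- real n *\<^sub>R One) (real n *\<^sub>R One))|lborel. f x)"
    proof (rule set_integral_cont_up)
      show "incseq (\<lambda>n. box (- real n *\<^sub>R One) (real n *\<^sub>R One) :: 'a set)"
        by (auto simp: incseq_def subset_box)
      show "set_integrable lborel (\<Union>n. box (- real n *\<^sub>R One) (real n *\<^sub>R One)) f"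
        unfolding set_integrable_def using f by (rule integrable_mult_indicator[rotated]) auto
    qed auto
    then show ?thesis using UN_box_eq_UNIV[where 'a='a] z by (simp add: LIMSEQ_const_iff set_lebesgue_integral_def del: UN_iff)
  qed
  have all: "(LINT x:A|lborel. f x) = 0" if "A \<in> sets borel" for A
  proof -
    have "Int_stable (range (\<lambda>(a, b). box a b :: 'a set))"
      by (auto simp: Int_stable_def box_Int_box)
    moreover have "range (\<lambda>(a, b). box a b :: 'a set) \<subseteq> Pow UNIV" by simp
    moreover have "A \<in> sigma_sets UNIV (range (\<lambda>(a, b). box a b))"
      using that by (simp add: borel_eq_box)
    ultimately show ?thesis
    proof (induction rule: sigma_sets_induct_disjoint)
      case (compl A)
      then have "A \<in> sets borel" by (simp add: borel_eq_box)
      then have "set_integrable lborel A f" "set_integrable lborel (UNIV - A) f"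
        using integrable_mult_indicator[of A lborel f] integrable_mult_indicator[of "UNIV - A" lborel f] f
        by (auto simp: set_integrable_def)
      from set_integral_Un[OF _ this] compl UN show ?case
        by (simp add: set_lebesgue_integral_def)
    next
      case (union A)
      then have "\<And>i. A i \<in> sets borel" by (simp add: borel_eq_box image_subset_iff)
      then have "(LINT x:(\<Union>i. A i)|lborel. f x) = (\<Sum>i. LINT x:A i|lborel. f x)"
        using union(1) by (intro lebesgue_integral_countable_add)
          (use integrable_mult_indicator[of "\<Union>i. A i" lborel f] f in \<open>auto simp: set_integrable_def disjoint_family_on_def\<close>)
      then show ?case using union by simp
    qed (use z in \<open>auto simp: set_lebesgue_integral_def\<close>)
  qed
  have "AE x in lborel. f x = (\<lambda>_. 0) x"
    by (rule density_unique_real) (use f all in \<open>auto simp: set_lebesgue_integral_def\<close>)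
  then show ?thesis by simp
qed

text \<open>The fundamental lemma of the calculus of variations. Bumps converge to the indicator of
  a box whose closed version lies in U, so dominated convergence gives h zero integral over such
  boxes. This is then localised to each of countably many closed boxes with union U.\<close>

lemma AE_zero_if_orthogonal_to_test_functions:
  fixes h :: "'a::euclidean_space \<Rightarrow> real"
  assumes U: "open U" and h: "h \<in> borel_measurable lebesgue"
    and int: "\<And>K. compact K \<Longrightarrow> K \<subseteq> U \<Longrightarrow> set_integrable lebesgue K h"
    and orth: "\<And>\<phi>. test_fun U \<phi> \<Longrightarrow> (LINT x:U|lebesgue. h x * \<phi> x) = 0"
  shows "AE x in lebesgue. x \<in> U \<longrightarrow> h x = 0"
proof -
  have box: "(LINT x:box a b|lebesgue. h x) = 0" if ab: "cbox a b \<subseteq> U" for a b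
  proof -
    let ?k = "\<lambda>x. indicator (cbox a b) x *\<^sub>R h x"
    have I: "integrable lebesgue ?k"
      using int[OF compact_cbox ab] by (simp add: set_integrable_def)
    have b: "box_bump a b k \<in> borel_measurable lebesgue" if "k > 0" for k
    proof -
      have "smooth_on UNIV (box_bump a b k)" using test_fun_box_bump[OF that ab] by (simp add: test_fun_def)
      then have "\<forall>x. box_bump a b k differentiable (at x)" by cases auto
      then have "continuous_on UNIV (box_bump a b k)"
        by (auto intro!: continuous_at_imp_continuous_on differentiable_imp_continuous_within)
      then show ?thesis by (intro measurable_completion) (simp add: borel_measurable_continuous_onI)
    qed
    have "(\<lambda>n. LINT x|lebesgue. ?k x * box_bump a b (real (Suc n)) x) \<longlonglongrightarrow> (LINT x|lebesgue. ?k x * indicator (box a b) x)"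
    proof (rule integral_dominated_convergence[where w="\<lambda>x. norm (?k x)"])
      show "AE x in lebesgue. (\<lambda>n. ?k x * box_bump a b (real (Suc n)) x) \<longlonglongrightarrow> ?k x * indicator (box a b) x"
        by (intro AE_I2 tendsto_mult tendsto_const box_bump_tendsto)
      show "AE x in lebesgue. norm (?k x * box_bump a b (real (Suc n)) x) \<le> norm (?k x)" for n
        using box_bump_bounds[of a b "real (Suc n)"]
        by (intro AE_I2) (auto simp del: of_nat_Suc simp: abs_mult intro!: mult_left_le split: split_indicator)
      show "(\<lambda>x. ?k x * indicator (box a b) x) \<in> borel_measurable lebesgue"
        by (intro borel_measurable_times borel_measurable_integrable[OF I] measurable_completion) auto
      show "(\<lambda>x. ?k x * box_bump a b (real (Suc n)) x) \<in> borel_measurable lebesgue" for n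
        by (intro borel_measurable_times borel_measurable_integrable[OF I] b) auto
    qed (use I in auto)
    moreover have "(LINT x|lebesgue. ?k x * box_bump a b (real (Suc n)) x) = 0" for n
    proof -
      have eq: "indicator U x *\<^sub>R (h x * box_bump a b (real (Suc n)) x) = ?k x * box_bump a b (real (Suc n)) x" for x
        using box_bump_support[of "real (Suc n)" x a b] ab box_subset_cbox[of a b]
        by (auto simp del: of_nat_Suc split: split_indicator)
      have "(LINT x|lebesgue. ?k x * box_bump a b (real (Suc n)) x) = (LINT x:U|lebesgue. h x * box_bump a b (real (Suc n)) x)"
        unfolding set_lebesgue_integral_def eq by (rule refl)
      also have "\<dots> = 0" by (rule orth[OF test_fun_box_bump[OF _ ab]]) simp
      finally show ?thesis .
    qed
    ultimately have "(LINT x|lebesgue. ?k x * indicator (box a b) x) = 0" by (simp add: LIMSEQ_const_iff)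
    moreover have "?k x * indicator (box a b) x = indicator (box a b) x *\<^sub>R h x" for x
      using box_subset_cbox[of a b] by (auto split: split_indicator)
    then have "(LINT x|lebesgue. ?k x * indicator (box a b) x) = (LINT x:box a b|lebesgue. h x)"
      unfolding set_lebesgue_integral_def by (rule Bochner_Integration.integral_cong[OF refl])
    ultimately show ?thesis by linarith
  qed
  have cb: "AE x in lebesgue. x \<in> cbox c d \<longrightarrow> h x = 0" if cd: "cbox c d \<subseteq> U" for c d
  proof -
    let ?f = "\<lambda>x. indicator (box c d) x *\<^sub>R h x"
    have I: "integrable lebesgue ?f"
    proof -
      have "set_integrable lebesgue (box c d) h"
        by (rule set_integrable_subset[OF int[OF compact_cbox cd] _ box_subset_cbox]) auto
      then show ?thesis by (simp add: set_integrable_def)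
    qed
    then have "?f \<in> borel_measurable (completion lborel)" by (rule borel_measurable_integrable)
    \<comment> \<open>The box criterion concerns \<open>lborel\<close>, while \<open>?f\<close> is
      only Lebesgue measurable; hence a Borel representative.\<close>
    from completion_ex_borel_measurable_real[OF this]
    obtain g where g: "g \<in> borel_measurable lborel" "AE x in lborel. ?f x = g x" by metis
    have g': "AE x in lebesgue. ?f x = g x" by (rule AE_completion[OF g(2)])
    have gl: "g \<in> borel_measurable lebesgue" using g(1) by (rule measurable_completion)
    have "integrable lebesgue g" by (rule integrable_cong_AE_imp[OF I gl g'])
    then have gi: "integrable lborel g" by (rule integrable_completion[OF g(1), THEN iffD1])
    have "AE x in lborel. g x = 0"
    proof (rule AE_zero_if_box_integrals_zero[OF gi])
      fix a b :: 'a
      obtain p q where pq: "box a b \<inter> box c d = box p q" by (auto simp: box_Int_box)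
      have m1: "indicator (box a b) \<in> borel_measurable lborel" by simp
      have m2: "(indicator (box a b) :: 'a \<Rightarrow> real) \<in> borel_measurable lebesgue"
        by (rule measurable_completion[OF m1])
      have "(LINT x:box a b|lborel. g x) = (LINT x:box a b|lebesgue. g x)"
        unfolding set_lebesgue_integral_def
        by (rule integral_completion[OF borel_measurable_scaleR[OF m1 g(1)], symmetric])
      also have "\<dots> = (LINT x:box a b|lebesgue. ?f x)"
        unfolding set_lebesgue_integral_def
      proof (rule integral_cong_AE)
        show "AE x in lebesgue. indicator (box a b) x *\<^sub>R g x = indicator (box a b) x *\<^sub>R ?f x"
          using g' by eventually_elim simp
      qed (rule borel_measurable_scaleR[OF m2 gl] borel_measurable_scaleR[OF m2 borel_measurable_integrable[OF I]])+
      also have "\<dots> = (LINT x:box p q|lebesgue. h x)"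
        unfolding set_lebesgue_integral_def pq[symmetric]
        by (rule Bochner_Integration.integral_cong[OF refl]) (simp add: indicator_def)
      also have "\<dots> = 0"
      \<comment> \<open>When the open box is empty, \<open>cbox p q\<close> can still be nonempty
        and leave U, so \<open>box\<close> does not apply to it.\<close>
      proof (cases "box p q = {}")
        case True then show ?thesis by (simp add: set_lebesgue_integral_def)
      next
        case False
        have "closure (box p q) \<subseteq> cbox c d" using pq box_subset_cbox[of c d] by (intro closure_minimal) auto
        then have "cbox p q \<subseteq> cbox c d" using closure_box[OF False] by simp
        then show ?thesis using cd by (intro box) auto
      qed
      finally show "(LINT x:box a b|lborel. g x) = 0" .
    qed
    then have "AE x in lebesgue. g x = 0" by (rule AE_completion)
    moreover have "AE x in lebesgue. x \<notin> cbox c d - box c d"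
      using null_sets_cbox_Diff_box[of c d] by (intro AE_completion AE_not_in)
    ultimately show ?thesis using g'
    proof eventually_elim
      case (elim x)
      then show ?case by (cases "x \<in> box c d") auto
    qed
  qed
  obtain D where D: "countable D" "D \<subseteq> Pow U" "\<And>X. X \<in> D \<Longrightarrow> \<exists>a b. X = cbox a b" "\<Union>D = U"
    using open_countable_Union_open_cbox[OF U] by metis
  have "AE x in lebesgue. \<forall>X\<in>D. x \<in> X \<longrightarrow> h x = 0"
  proof (rule AE_ball_countable')
    fix X assume "X \<in> D"
    with D obtain a b where "X = cbox a b" "cbox a b \<subseteq> U" by blast
    then show "AE x in lebesgue. x \<in> X \<longrightarrow> h x = 0" using cb by simp
  qed (use D in auto)
  then show ?thesis by eventually_elim (use D in blast)
qed

section \<open>Integration by parts against test functions\<close>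

lemma smooth_onD:
  assumes "smooth_on UNIV \<phi>"
  shows "(\<phi> has_derivative frechet_derivative \<phi> (at x)) (at x)" "continuous_on UNIV \<phi>"
    "continuous_on UNIV (\<lambda>x. frechet_derivative \<phi> (at x) v)"
proof -
  have d: "\<psi> differentiable (at x)" if "smooth_on UNIV \<psi>" for \<psi> :: "'a \<Rightarrow> 'b" and x
    using that by cases auto
  have c: "continuous_on UNIV \<psi>" if "smooth_on UNIV \<psi>" for \<psi> :: "'a \<Rightarrow> 'b"
    using d[OF that] by (auto intro!: continuous_at_imp_continuous_on differentiable_imp_continuous_within)
  show "(\<phi> has_derivative frechet_derivative \<phi> (at x)) (at x)" using d[OF assms] frechet_derivative_works by blast
  show "continuous_on UNIV \<phi>" by (rule c[OF assms])
  have "smooth_on UNIV (\<lambda>x. frechet_derivative \<phi> (at x) v)" using assms by cases auto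
  then show "continuous_on UNIV (\<lambda>x. frechet_derivative \<phi> (at x) v)" by (rule c)
qed

lemma continuous_vanishing_bounded:
  fixes f :: "'a::euclidean_space \<Rightarrow> real"
  assumes "continuous_on UNIV f" "compact C" "\<And>x. x \<notin> C \<Longrightarrow> f x = 0"
  obtains B where "B \<ge> 0" "\<And>x. \<bar>f x\<bar> \<le> B"
proof -
  have "bounded (f ` C)"
    using assms by (intro compact_imp_bounded compact_continuous_image) (auto intro: continuous_on_subset)
  then obtain B where "\<And>x. x \<in> C \<Longrightarrow> \<bar>f x\<bar> \<le> B" by (auto simp: bounded_iff)
  then have "\<bar>f x\<bar> \<le> max 0 B" for x using assms(3)[of x] by (cases "x \<in> C") (auto simp: le_max_iff_disj)
  then show ?thesis using that[of "max 0 B"] by auto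
qed

lemma integrable_continuous_vanishing:
  fixes f :: "'a::euclidean_space \<Rightarrow> real"
  assumes "continuous_on UNIV f" "compact C" "\<And>x. x \<notin> C \<Longrightarrow> f x = 0"
  shows "integrable lborel f"
proof -
  have "integrable lborel (\<lambda>x. indicator C x *\<^sub>R f x)"
    by (rule borel_integrable_compact) (use assms in \<open>auto intro: continuous_on_subset\<close>)
  moreover have "(\<lambda>x. indicator C x *\<^sub>R f x) = f" using assms(3) by (auto split: split_indicator)
  ultimately show ?thesis by simp
qed

lemma frechet_derivative_test_fun_outside:
  assumes "x \<notin> closure {x. \<phi> x \<noteq> (0::real)}"
  shows "frechet_derivative \<phi> (at x) v = 0"
proof -
  have "(\<phi> has_derivative (\<lambda>_. 0)) (at x)"
    by (rule has_derivative_transform_within_open[OF has_derivative_const[of 0], where s="- closure {x. \<phi> x \<noteq> 0}"])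
      (use assms closure_subset[of "{x. \<phi> x \<noteq> 0}"] in \<open>auto simp: subset_iff\<close>)
  then have "frechet_derivative \<phi> (at x) = (\<lambda>_. 0)" by (rule frechet_derivative_at[symmetric])
  then show ?thesis by simp
qed

lemma integral_lborel_translate:
  fixes f :: "'a::euclidean_space \<Rightarrow> real"
  assumes "f \<in> borel_measurable borel"
  shows "(LINT x|lborel. f (x + a)) = (LINT x|lborel. f x)"
proof -
  have "(LINT x|lborel. f x) = (LINT x|distr lborel borel ((+) a). f x)" by (simp add: lborel_distr_plus)
  also have "\<dots> = (LINT x|lborel. f (a + x))" using integral_distr[of "(+) a" lborel borel f] assms by simp
  finally show ?thesis by (simp add: add.commute)
qed

lemma integrable_lborel_translate:
  fixes f :: "'a::euclidean_space \<Rightarrow> real"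
  assumes "integrable lborel f"
  shows "integrable lborel (\<lambda>x. f (x + a))"
proof -
  have "integrable (distr lborel borel ((+) a)) f" using assms by (simp add: lborel_distr_plus)
  then have "integrable lborel (\<lambda>x. f (a + x))" 
    using assms by (subst (asm) integrable_distr_eq) (auto dest: borel_measurable_integrable)
  then show ?thesis by (simp add: add.commute)
qed

text \<open>By translation invariance the difference quotients of \<open>u * \<phi>\<close> in
  direction v integrate to 0. They are uniformly bounded with common bounded support and converge
  almost everywhere to the product rule. Only the derivative along the single direction v is
  assumed, so the result is available before Rademacher's theorem and can serve in its
  proof.\<close>

lemma integration_by_parts_lipschitz:
  fixes u :: "'a::euclidean_space \<Rightarrow> real"
  assumes u: "L-lipschitz_on UNIV u" and \<phi>: "test_fun U \<phi>"
    and g: "g \<in> borel_measurable lebesgue"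
    and d: "AE x in lebesgue. ((\<lambda>t. u (x + t *\<^sub>R v)) has_real_derivative g x) (at 0)"
  shows "integrable lebesgue (\<lambda>x. g x * \<phi> x)"
    and "(LINT x:U|lebesgue. u x * frechet_derivative \<phi> (at x) v) = - (LINT x:U|lebesgue. g x * \<phi> x)"
proof -
  define C where "C = closure {x. \<phi> x \<noteq> 0}"
  define \<phi>' where "\<phi>' = (\<lambda>x. frechet_derivative \<phi> (at x) v)"
  have C: "compact C" "C \<subseteq> U" using \<phi> by (auto simp: test_fun_def C_def)
  have sm: "smooth_on UNIV \<phi>" using \<phi> by (simp add: test_fun_def)
  have \<phi>0: "\<phi> x = 0" if "x \<notin> C" for x using that closure_subset[of "{x. \<phi> x \<noteq> 0}"] by (auto simp: C_def)
  have \<phi>'0: "\<phi>' x = 0" if "x \<notin> C" for x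
    using frechet_derivative_test_fun_outside that by (auto simp: C_def \<phi>'_def)
  have c\<phi>: "continuous_on UNIV \<phi>" "continuous_on UNIV \<phi>'" using smooth_onD[OF sm] by (auto simp: \<phi>'_def)
  have cu: "continuous_on UNIV u" using u by (rule lipschitz_on_continuous_on)
  obtain B1 where B1: "B1 \<ge> 0" "\<And>x. \<bar>\<phi> x\<bar> \<le> B1" using continuous_vanishing_bounded[OF c\<phi>(1) C(1) \<phi>0] by blast
  obtain B2 where B2: "B2 \<ge> 0" "\<And>x. \<bar>\<phi>' x\<bar> \<le> B2" using continuous_vanishing_bounded[OF c\<phi>(2) C(1) \<phi>'0] by blast
  define r where "r = (SOME r. r > 0 \<and> C \<subseteq> cball 0 r)"
  have r: "r > 0 \<and> C \<subseteq> cball 0 r" unfolding r_def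
    by (rule someI_ex) (use compact_imp_bounded[OF C(1)] in \<open>auto simp: bounded_pos subset_iff\<close>)
  \<comment> \<open>All increments \<open>h n\<close> are at most 1, so enlarging the ball around
    the support by \<open>norm v\<close> keeps every difference quotient supported in Q.\<close>
  define Q where "Q = cball (0::'a) (r + norm v)"
  have L: "\<bar>u x - u y\<bar> \<le> L * norm (x - y)" for x y
    using lipschitz_onD[OF u, of x y] by (simp add: dist_norm)
  have "L \<ge> 0" using u by (rule lipschitz_on_nonneg)
  have "bounded (u ` Q)"
    by (intro compact_imp_bounded compact_continuous_image) (auto simp: Q_def intro: continuous_on_subset[OF cu])
  then obtain B3' where B3': "\<And>x. x \<in> Q \<Longrightarrow> \<bar>u x\<bar> \<le> B3'" by (auto simp: bounded_iff)
  define B3 where "B3 = max 0 B3'"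
  have B3: "B3 \<ge> 0" "\<And>x. x \<in> Q \<Longrightarrow> \<bar>u x\<bar> \<le> B3" using B3' by (fastforce simp: B3_def le_max_iff_disj)+
  define F where "F = (\<lambda>x. u x * \<phi> x)"
  have F: "continuous_on UNIV F" unfolding F_def by (intro continuous_intros cu c\<phi>)
  have F0: "F x = 0" if "x \<notin> C" for x using \<phi>0[OF that] by (simp add: F_def)
  have FI: "integrable lborel F" by (rule integrable_continuous_vanishing[OF F C(1) F0])
  define h where "h = (\<lambda>n::nat. inverse (real (Suc n)))"
  have h: "h n > 0" "h n \<le> 1" for n by (auto simp: h_def field_simps)
  have hn0: "h n \<noteq> 0" for n using h(1)[of n] by simp
  have h0: "h \<longlonglongrightarrow> 0" unfolding h_def by (rule LIMSEQ_inverse_real_of_nat)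
  define q where "q = (\<lambda>n x. (F (x + h n *\<^sub>R v) - F x) / h n)"
  define G where "G = (\<lambda>x. u x * \<phi>' x + g x * \<phi> x)"
  have mvt: "\<bar>\<phi> (x + s *\<^sub>R v) - \<phi> x\<bar> \<le> B2 * s" if "s > 0" for x s
  proof -
    have "((\<lambda>t. \<phi> (x + t *\<^sub>R v)) has_real_derivative \<phi>' (x + t *\<^sub>R v)) (at t)" for t
    proof -
      have "(\<phi> has_derivative frechet_derivative \<phi> (at (x + t *\<^sub>R v))) (at (x + t *\<^sub>R v))"
        by (rule smooth_onD[OF sm])
      moreover have "((\<lambda>t. x + t *\<^sub>R v) has_derivative (\<lambda>s. s *\<^sub>R v)) (at t)" by (auto intro!: derivative_eq_intros)
      ultimately have "((\<lambda>t. \<phi> (x + t *\<^sub>R v)) has_derivative (\<lambda>s. frechet_derivative \<phi> (at (x + t *\<^sub>R v)) (s *\<^sub>R v))) (at t)"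
        by (rule has_derivative_compose[rotated])
      moreover have "linear (frechet_derivative \<phi> (at (x + t *\<^sub>R v)))"
        using smooth_onD(1)[OF sm] has_derivative_linear by blast
      ultimately show ?thesis by (simp add: has_field_derivative_def \<phi>'_def linear_cmul mult.commute[of _ "frechet_derivative _ _ _"])
    qed
    from MVT2[OF that, of "\<lambda>t. \<phi> (x + t *\<^sub>R v)" "\<lambda>t. \<phi>' (x + t *\<^sub>R v)"] this
    obtain z where "\<phi> (x + s *\<^sub>R v) - \<phi> (x + 0 *\<^sub>R v) = (s - 0) * \<phi>' (x + z *\<^sub>R v)" by blast
    then show ?thesis using B2(2)[of "x + z *\<^sub>R v"] that by (simp add: abs_mult mult.commute mult_right_mono)
  qed
  have q0: "(LINT x|lebesgue. q n x) = 0" for n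
  proof -
    have m: "F \<in> borel_measurable borel" by (rule borel_measurable_continuous_onI[OF F])
    have "(LINT x|lebesgue. q n x) = (LINT x|lborel. q n x)"
      unfolding q_def using m by (intro integral_completion) auto
    also have "\<dots> = ((LINT x|lborel. F (x + h n *\<^sub>R v)) - (LINT x|lborel. F x)) / h n"
      unfolding q_def using FI integrable_lborel_translate[OF FI] by simp
    also have "\<dots> = 0" using integral_lborel_translate[OF m] by simp
    finally show ?thesis .
  qed
  have qb: "norm (q n x) \<le> (B3 * B2 + L * norm v * B1) * indicator Q x" for n x
  proof -
    \<comment> \<open>Discrete product rule: u is evaluated at the shifted point and \<phi> at x, so
      each summand pairs a bounded factor with a bounded difference quotient.\<close>
    have e: "q n x = u (x + h n *\<^sub>R v) * ((\<phi> (x + h n *\<^sub>R v) - \<phi> x) / h n) + \<phi> x * ((u (x + h n *\<^sub>R v) - u x) / h n)"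
      by (simp add: q_def F_def add_divide_distrib[symmetric] diff_divide_distrib[symmetric] algebra_simps)
    show ?thesis
    proof (cases "x + h n *\<^sub>R v \<in> C \<or> x \<in> C")
      case False
      then show ?thesis using \<phi>0 e B1 B2 B3 \<open>L \<ge> 0\<close> by simp
    next
      case True
      have hv: "norm (h n *\<^sub>R v) \<le> norm v" using h[of n] by (simp add: mult_left_le_one_le)
      have xQ: "x \<in> Q"
      proof -
        have "norm x \<le> norm (x + h n *\<^sub>R v) + norm (h n *\<^sub>R v)" by (metis add_diff_cancel_right' norm_triangle_ineq4)
        moreover have "norm (x + h n *\<^sub>R v) \<le> r \<or> norm x \<le> r" using True r by (auto simp: subset_iff)
        ultimately have "norm x \<le> r + norm v" using hv norm_ge_zero[of v] by linarith
        then show ?thesis by (simp add: Q_def)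
      qed
      have 1: "\<bar>(\<phi> (x + h n *\<^sub>R v) - \<phi> x) / h n\<bar> \<le> B2" using mvt[OF h(1)[of n], of x] h[of n] by (simp add: field_simps)
      have 2: "\<bar>(u (x + h n *\<^sub>R v) - u x) / h n\<bar> \<le> L * norm v"
        using L[of "x + h n *\<^sub>R v" x] h[of n] by (simp add: field_simps)
      have 3: "\<bar>u (x + h n *\<^sub>R v) * ((\<phi> (x + h n *\<^sub>R v) - \<phi> x) / h n)\<bar> \<le> B3 * B2"
      proof (cases "x + h n *\<^sub>R v \<in> Q")
        case True then show ?thesis unfolding abs_mult by (intro mult_mono B3 1) (auto simp: B3)
      next
        case False
        have "x \<in> C \<Longrightarrow> norm (x + h n *\<^sub>R v) \<le> r + norm v"
          using r hv norm_triangle_ineq[of x "h n *\<^sub>R v"] by force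
        then have "x \<notin> C" using False by (auto simp: Q_def)
        moreover have "cball 0 r \<subseteq> Q" unfolding Q_def by (rule subset_cball) simp
        then have "C \<subseteq> Q" using r by auto
        then have "x + h n *\<^sub>R v \<notin> C" using False by auto
        ultimately show ?thesis using \<phi>0 B3 B2 by simp
      qed
      have "\<bar>\<phi> x * ((u (x + h n *\<^sub>R v) - u x) / h n)\<bar> \<le> B1 * (L * norm v)"
        unfolding abs_mult by (intro mult_mono B1 2) auto
      then have "\<bar>q n x\<bar> \<le> B3 * B2 + B1 * (L * norm v)"
        unfolding e using 3 by (intro order_trans[OF abs_triangle_ineq] add_mono)
      then show ?thesis using xQ by (simp add: mult_ac)
    qed
  qed
  have qlim: "AE x in lebesgue. (\<lambda>n. q n x) \<longlonglongrightarrow> G x"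
    using d
  proof eventually_elim
    case (elim x)
    have "(\<phi> has_derivative frechet_derivative \<phi> (at x)) (at (x + 0 *\<^sub>R v))"
      using smooth_onD(1)[OF sm, of x] by simp
    moreover have "((\<lambda>t. x + t *\<^sub>R v) has_derivative (\<lambda>s. s *\<^sub>R v)) (at 0)" by (auto intro!: derivative_eq_intros)
    ultimately have "((\<lambda>t. \<phi> (x + t *\<^sub>R v)) has_derivative (\<lambda>s. frechet_derivative \<phi> (at x) (s *\<^sub>R v))) (at 0)"
      by (rule has_derivative_compose[rotated])
    moreover have "linear (frechet_derivative \<phi> (at x))"
      using smooth_onD(1)[OF sm] has_derivative_linear by blast
    ultimately have "((\<lambda>t. \<phi> (x + t *\<^sub>R v)) has_real_derivative \<phi>' x) (at 0)"
      by (simp add: has_field_derivative_def \<phi>'_def linear_cmul mult.commute[of _ "frechet_derivative _ _ _"])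
    from DERIV_mult[OF elim this]
    have "((\<lambda>t. F (x + t *\<^sub>R v)) has_real_derivative G x) (at 0)"
      by (simp add: F_def G_def algebra_simps)
    then have "((\<lambda>s. (F (x + s *\<^sub>R v) - F x) / s) \<longlongrightarrow> G x) (at 0)" by (simp add: DERIV_def)
    moreover have "filterlim h (at 0) sequentially"
      using h0 hn0 by (simp add: filterlim_at)
    ultimately show ?case unfolding q_def by (rule filterlim_compose)
  qed
  have Gm: "G \<in> borel_measurable lebesgue"
    unfolding G_def by (intro borel_measurable_add borel_measurable_times g measurable_completion)
      (auto intro!: borel_measurable_continuous_onI cu c\<phi>)
  have qm: "q n \<in> borel_measurable lebesgue" for n
    unfolding q_def by (rule measurable_completion)
      (auto intro!: borel_measurable_continuous_onI continuous_intros continuous_on_compose2[OF F] F simp: hn0)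
  have QI: "integrable lebesgue (\<lambda>x. (B3 * B2 + L * norm v * B1) * indicator Q x)"
    using emeasure_lborel_cball_finite[of "0::'a" "r + norm v"]
    by (intro integrable_mult_right integrable_real_indicator) (simp_all add: Q_def)
  have "(\<lambda>n. LINT x|lebesgue. q n x) \<longlonglongrightarrow> (LINT x|lebesgue. G x)"
    by (rule integral_dominated_convergence[OF Gm qm QI qlim]) (use qb in auto)
  then have G0: "(LINT x|lebesgue. G x) = 0" by (simp add: q0 LIMSEQ_const_iff)
  have GI: "integrable lebesgue G"
    by (rule integrable_dominated_convergence[OF Gm qm QI qlim]) (use qb in auto)
  have I1: "integrable lebesgue (\<lambda>x. u x * \<phi>' x)"
    by (rule integrable_completion[THEN iffD2])
      (auto intro!: borel_measurable_continuous_onI continuous_intros cu c\<phi> integrable_continuous_vanishing[OF _ C(1)] simp: \<phi>'0)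
  have "integrable lebesgue (\<lambda>x. G x - u x * \<phi>' x)" by (intro Bochner_Integration.integrable_diff GI I1)
  then show I2: "integrable lebesgue (\<lambda>x. g x * \<phi> x)" by (simp add: G_def)
  have "(LINT x|lebesgue. u x * \<phi>' x) = - (LINT x|lebesgue. g x * \<phi> x)"
    using G0 I1 I2 by (simp add: G_def)
  moreover have "(LINT x:U|lebesgue. u x * \<phi>' x) = (LINT x|lebesgue. u x * \<phi>' x)"
    unfolding set_lebesgue_integral_def
    by (rule Bochner_Integration.integral_cong) (use \<phi>'0 C in \<open>auto split: split_indicator\<close>)
  moreover have "(LINT x:U|lebesgue. g x * \<phi> x) = (LINT x|lebesgue. g x * \<phi> x)"
    unfolding set_lebesgue_integral_def
    by (rule Bochner_Integration.integral_cong) (use \<phi>0 C in \<open>auto split: split_indicator\<close>)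
  ultimately show "(LINT x:U|lebesgue. u x * frechet_derivative \<phi> (at x) v) = - (LINT x:U|lebesgue. g x * \<phi> x)"
    by (simp add: \<phi>'_def)
qed

section \<open>Lipschitz functions of one variable\<close>

text \<open>The intervals need only contain x, not be centred there, so one-sided difference
  quotients qualify. The open set V allows a second selection to be nested inside a first
  one.\<close>

lemma lborel_interval_vitali:
  fixes E V :: "real set"
  assumes V: "open V" "E \<subseteq> V"
    and P: "\<And>x d. x \<in> E \<Longrightarrow> d > 0 \<Longrightarrow> \<exists>u v. u < v \<and> u \<le> x \<and> x \<le> v \<and> v - u < d \<and> P u v"
  obtains C where "countable C" "\<And>u v. (u, v) \<in> C \<Longrightarrow> u < v \<and> P u v \<and> {u..v} \<subseteq> V"
    "disjoint_family_on (\<lambda>(u, v). {u..v}) C" "negligible (E - (\<Union>(u, v)\<in>C. {u..v}))"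
proof -
  define I where "I = {(u, v). u < v \<and> P u v \<and> {u..v} \<subseteq> V}"
  define c where "c = (\<lambda>(u, v). (u + v) / 2 :: real)"
  define r where "r = (\<lambda>(u, v). (v - u) / 2 :: real)"
  have cb: "cball (c i) (r i) = (case i of (u, v) \<Rightarrow> {u..v})" for i
    by (cases i) (auto simp: c_def r_def cball_eq_atLeastAtMost field_simps)
  have near: "\<exists>i. i \<in> I \<and> x \<in> cball (c i) (r i) \<and> r i < d" if x: "x \<in> E" and d: "0 < d" for x d
  proof -
    obtain e where e: "e > 0" "ball x e \<subseteq> V" using V x by (meson open_contains_ball subsetD)
    obtain u v where uv: "u < v" "u \<le> x" "x \<le> v" "v - u < min d e" "P u v"
      using P[OF x, of "min d e"] d e by auto
    have "{u..v} \<subseteq> ball x e" using uv by (auto simp: dist_real_def)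
    then have "(u, v) \<in> I" using uv e by (auto simp: I_def)
    moreover have "x \<in> cball (c (u, v)) (r (u, v))" unfolding cb using uv by simp
    moreover have "r (u, v) < d" using uv d by (simp add: r_def)
    ultimately show ?thesis by blast
  qed
  have pos: "0 < r i" if "i \<in> I" for i using that by (auto simp: I_def r_def)
  obtain C where C: "countable C" "C \<subseteq> I" "pairwise (\<lambda>i j. disjnt (cball (c i) (r i)) (cball (c j) (r j))) C"
    "negligible (E - (\<Union>i\<in>C. cball (c i) (r i)))"
    by (rule Vitali_covering_theorem_cballs[where S=E and K=I and a=c and r=r, OF pos near])
  show ?thesis
  proof (rule that[OF C(1)])
    show "u < v \<and> P u v \<and> {u..v} \<subseteq> V" if "(u, v) \<in> C" for u v using C(2) that by (auto simp: I_def)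
    show "disjoint_family_on (\<lambda>(u, v). {u..v}) C"
      using C(3) unfolding cb by (auto simp: disjoint_family_on_def pairwise_def disjnt_def)
    show "negligible (E - (\<Union>(u, v)\<in>C. {u..v}))" using C(4) unfolding cb .
  qed
qed

text \<open>Two nested Vitali selections inside an open U containing E: first intervals on which f
  rises by less than p times their length, then, within these, intervals on which it rises by more
  than q times their length. The increment of f over the inner intervals is at most that over the
  outer ones, so E is covered, up to a null set, by a set of measure at most p / q times that of U.
  The outer measure of E thus shrinks by a factor below 1.\<close>

lemma negligible_slope_gap:
  fixes f :: "real \<Rightarrow> real"
  assumes mono: "mono f" and cont: "continuous_on UNIV f" and pq: "0 < p" "p < q" and E: "bounded E"
    and lo: "\<And>x d. x \<in> E \<Longrightarrow> d > 0 \<Longrightarrow> \<exists>u v. u < v \<and> u \<le> x \<and> x \<le> v \<and> v - u < d \<and> f v - f u < p * (v - u)"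
    and hi: "\<And>x d. x \<in> E \<Longrightarrow> d > 0 \<Longrightarrow> \<exists>u v. u < v \<and> u \<le> x \<and> x \<le> v \<and> v - u < d \<and> q * (v - u) < f v - f u"
  shows "negligible E"
proof -
  let ?\<mu> = "interval_measure f"
  have Icc: "emeasure ?\<mu> {u..v} = ennreal (f v - f u)" if "u \<le> v" for u v
    by (rule emeasure_interval_measure_Icc) (use that mono cont in \<open>auto simp: mono_def intro: continuous_on_subset\<close>)
  have sum_mu: "emeasure ?\<mu> (\<Union>(u, v)\<in>C. {u..v}) = (\<integral>\<^sup>+i. ennreal (f (snd i) - f (fst i)) \<partial>count_space C)"
    and sum_l: "emeasure lborel (\<Union>(u, v)\<in>C. {u..v}) = (\<integral>\<^sup>+i. ennreal (snd i - fst i) \<partial>count_space C)"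
    if "countable C" "disjoint_family_on (\<lambda>(u, v). {u..v}) C" "\<And>u v. (u, v) \<in> C \<Longrightarrow> u < v" for C
  proof -
    have "emeasure ?\<mu> (\<Union>i\<in>C. (case i of (u, v) \<Rightarrow> {u..v})) = (\<integral>\<^sup>+i. emeasure ?\<mu> (case i of (u, v) \<Rightarrow> {u..v}) \<partial>count_space C)"
      by (rule emeasure_UN_countable) (use that in auto)
    also have "\<dots> = (\<integral>\<^sup>+i. ennreal (f (snd i) - f (fst i)) \<partial>count_space C)"
      by (rule nn_integral_cong) (use that Icc in \<open>auto simp: less_imp_le\<close>)
    finally show "emeasure ?\<mu> (\<Union>(u, v)\<in>C. {u..v}) = (\<integral>\<^sup>+i. ennreal (f (snd i) - f (fst i)) \<partial>count_space C)" .
    have "emeasure lborel (\<Union>i\<in>C. (case i of (u, v) \<Rightarrow> {u..v})) = (\<integral>\<^sup>+i. emeasure lborel (case i of (u, v) \<Rightarrow> {u..v::real}) \<partial>count_space C)"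
      by (rule emeasure_UN_countable) (use that in auto)
    also have "\<dots> = (\<integral>\<^sup>+i. ennreal (snd i - fst i) \<partial>count_space C)"
      by (rule nn_integral_cong) (use that in \<open>auto simp: less_imp_le\<close>)
    finally show "emeasure lborel (\<Union>(u, v)\<in>C. {u..v}) = (\<integral>\<^sup>+i. ennreal (snd i - fst i) \<partial>count_space C)" .
  qed
  have shrink: "\<exists>T. T \<in> lmeasurable \<and> E \<subseteq> T \<and> measure lebesgue T \<le> (p / q) * measure lebesgue U"
    if U: "open U" "E \<subseteq> U" "bounded U" for U
  proof -
    obtain C where C: "countable C" "\<And>u v. (u, v) \<in> C \<Longrightarrow> u < v \<and> f v - f u < p * (v - u) \<and> {u..v} \<subseteq> U"
      "disjoint_family_on (\<lambda>(u, v). {u..v}) C" "negligible (E - (\<Union>(u, v)\<in>C. {u..v}))"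
      using lborel_interval_vitali[OF U(1,2), of "\<lambda>u v. f v - f u < p * (v - u)"] lo by metis
    \<comment> \<open>\<open>?V\<close> misses only countably many endpoints of \<open>?I\<close>
      and gives the second selection an open set to stay in.\<close>
    let ?I = "\<Union>(u, v)\<in>C. {u..v}" and ?V = "\<Union>(u, v)\<in>C. {u<..<v}"
    have oV: "open ?V" by auto
    have nV: "negligible (E - ?V)"
    proof -
      have sub: "E - ?V \<subseteq> (E - ?I) \<union> (fst ` C \<union> snd ` C)" by force
      have "negligible (fst ` C \<union> snd ` C)" unfolding negligible_iff_null_sets
        using C(1) by (intro null_sets_completionI countable_imp_null_set_lborel) simp
      from negligible_subset[OF negligible_Un[OF C(4) this] sub] show ?thesis .
    qed
    have VI: "?V \<subseteq> ?I" by fastforce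
    have "\<exists>u v. u < v \<and> u \<le> x \<and> x \<le> v \<and> v - u < d \<and> q * (v - u) < f v - f u" if xd: "x \<in> E \<inter> ?V" "d > 0" for x d
      by (rule hi[OF IntD1[OF xd(1)] xd(2)])
    then obtain D where D: "countable D" "\<And>u v. (u, v) \<in> D \<Longrightarrow> u < v \<and> q * (v - u) < f v - f u \<and> {u..v} \<subseteq> ?V"
      "disjoint_family_on (\<lambda>(u, v). {u..v}) D" "negligible (E \<inter> ?V - (\<Union>(u, v)\<in>D. {u..v}))"
      using lborel_interval_vitali[OF oV, of "E \<inter> ?V" "\<lambda>u v. q * (v - u) < f v - f u"] by (metis Int_lower2)
    let ?J = "\<Union>(u, v)\<in>D. {u..v}"
    have JV: "?J \<subseteq> ?V"
    proof
      fix x assume "x \<in> ?J"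
      then obtain u v where uv: "(u, v) \<in> D" "x \<in> {u..v}" by auto
      from D(2)[OF uv(1)] have "{u..v} \<subseteq> ?V" by (elim conjE)
      then show "x \<in> ?V" using uv(2) by (rule subsetD)
    qed
    have meas: "?I \<in> sets borel" "?J \<in> sets borel" "U \<in> sets borel"
      using C(1) D(1) U(1) by (auto intro!: sets.countable_UN')
    \<comment> \<open>The Stieltjes measure of f links the two selections: it exceeds q times
      Lebesgue measure on \<open>?J\<close> and stays below p times Lebesgue measure on
      \<open>?I\<close>.\<close>
    have "ennreal q * emeasure lborel ?J = (\<integral>\<^sup>+i. ennreal q * ennreal (snd i - fst i) \<partial>count_space D)"
      using sum_l[OF D(1,3)] D(2) by (simp add: nn_integral_cmult)
    also have "\<dots> \<le> (\<integral>\<^sup>+i. ennreal (f (snd i) - f (fst i)) \<partial>count_space D)"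
      by (rule nn_integral_mono) (use D(2) pq in \<open>auto simp: ennreal_mult[symmetric] less_imp_le intro!: ennreal_leI\<close>)
    also have "\<dots> = emeasure ?\<mu> ?J" using sum_mu[OF D(1,3)] D(2) by simp
    also have "\<dots> \<le> emeasure ?\<mu> ?I"
    proof (rule emeasure_mono)
      show "?J \<subseteq> ?I" using JV VI by (rule subset_trans)
    qed (use meas in simp)
    also have "\<dots> = (\<integral>\<^sup>+i. ennreal (f (snd i) - f (fst i)) \<partial>count_space C)" using sum_mu[OF C(1,3)] C(2) by simp
    also have "\<dots> \<le> (\<integral>\<^sup>+i. ennreal p * ennreal (snd i - fst i) \<partial>count_space C)"
      by (rule nn_integral_mono) (use C(2) pq in \<open>auto simp: ennreal_mult[symmetric] less_imp_le intro!: ennreal_leI\<close>)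
    also have "\<dots> = ennreal p * emeasure lborel ?I" using sum_l[OF C(1,3)] C(2) by (simp add: nn_integral_cmult)
    also have "\<dots> \<le> ennreal p * emeasure lborel U"
      by (intro mult_left_mono emeasure_mono) (use C(2) meas in auto)
    finally have le: "ennreal q * emeasure lborel ?J \<le> ennreal p * emeasure lborel U" .
    have Ufin: "emeasure lborel U = ennreal (measure lborel U)"
      using emeasure_bounded_finite[OF U(3)] by (intro emeasure_eq_ennreal_measure) simp
    have "?I \<subseteq> U"
    proof
      fix x assume "x \<in> ?I"
      then obtain u v where uv: "(u, v) \<in> C" "x \<in> {u..v}" by auto
      from C(2)[OF uv(1)] have "{u..v} \<subseteq> U" by (elim conjE)
      then show "x \<in> U" using uv(2) by (rule subsetD)
    qed
    then have JU: "?J \<subseteq> U" using JV VI by (meson subset_trans)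
    have Jf: "emeasure lborel ?J \<le> emeasure lborel U" using JU meas by (intro emeasure_mono) auto
    have Jfin: "emeasure lborel ?J = ennreal (measure lborel ?J)"
      using Jf Ufin by (intro emeasure_eq_ennreal_measure) (auto simp: top_unique)
    have "q * measure lborel ?J \<le> p * measure lborel U"
      using le pq unfolding Ufin Jfin by (simp add: ennreal_mult[symmetric] ennreal_le_iff)
    then have mJ: "measure lborel ?J \<le> (p / q) * measure lborel U" using pq by (simp add: field_simps)
    define N where "N = (E - ?V) \<union> (E \<inter> ?V - ?J)"
    have N: "negligible N" unfolding N_def using nV D(4) by (rule negligible_Un)
    have Jm: "?J \<in> lmeasurable"
      using meas Jfin by (intro fmeasurableI) (simp_all add: less_top[symmetric])
    show ?thesis
    proof (intro exI[of _ "?J \<union> N"] conjI)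
      show "?J \<union> N \<in> lmeasurable" by (intro fmeasurable.Un Jm negligible_imp_measurable N)
      show "E \<subseteq> ?J \<union> N" by (auto simp: N_def)
      have "measure lebesgue (?J \<union> N) = measure lebesgue ?J"
        by (rule measure_Un_null_set) (use N Jm in \<open>auto simp: negligible_iff_null_sets\<close>)
      then show "measure lebesgue (?J \<union> N) \<le> p / q * measure lebesgue U"
        using mJ meas by simp
    qed
  qed
  \<comment> \<open>The infimum of S is the outer measure of E; once it is bounded by p / q times
    itself it must be 0.\<close>
  define S where "S = {measure lebesgue U |U. open U \<and> E \<subseteq> U \<and> bounded U}"
  obtain B where B: "E \<subseteq> ball 0 B" using bounded_subset_ballD[OF E] by blast
  have Sne: "S \<noteq> {}" using B by (auto simp: S_def)
  have S0: "bdd_below S" by (rule bdd_belowI[of _ 0]) (auto simp: S_def)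
  define s where "s = Inf S"
  have s0: "0 \<le> s" unfolding s_def using Sne by (intro cInf_greatest) (auto simp: S_def)
  have sx: "s \<le> (p / q) * x" if xS: "x \<in> S" for x
  proof -
    obtain U where U: "open U" "E \<subseteq> U" "bounded U" "x = measure lebesgue U" using xS unfolding S_def by blast
    obtain T where T: "T \<in> lmeasurable" "E \<subseteq> T" "measure lebesgue T \<le> (p / q) * measure lebesgue U" using shrink[OF U(1-3)] by blast
    \<comment> \<open>T need not be open, so it is enlarged to an open set at cost e and cut by a
      ball; only then does it compete in S.\<close>
    have "s \<le> measure lebesgue T + e" if e: "e > 0" for e
    proof -
      obtain O' where O': "open O'" "T \<subseteq> O'" "O' - T \<in> lmeasurable" "emeasure lebesgue (O' - T) < ennreal e"
        by (rule sets_lebesgue_outer_open[OF fmeasurableD[OF T(1)] e])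
      have "measure lebesgue (O' \<inter> ball 0 B) \<le> measure lebesgue (T \<union> (O' - T))"
        using O' T by (intro measure_mono_fmeasurable fmeasurable.Un) auto
      also have "\<dots> \<le> measure lebesgue T + measure lebesgue (O' - T)"
        by (rule measure_Un_le) (use O' T in auto)
      also have "measure lebesgue (O' - T) \<le> e"
        using O'(4) e unfolding emeasure_eq_measure2[OF O'(3)] by (simp add: ennreal_less_iff)
      finally have "measure lebesgue (O' \<inter> ball 0 B) \<le> measure lebesgue T + e" by simp
      moreover have "s \<le> measure lebesgue (O' \<inter> ball 0 B)"
        unfolding s_def using O' T B by (intro cInf_lower S0) (auto simp: S_def intro!: exI[of _ "O' \<inter> ball 0 B"])
      ultimately show ?thesis by simp
    qed
    then have "s \<le> measure lebesgue T" by (rule field_le_epsilon)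
    then show ?thesis using T U by simp
  qed
  have "q / p * s \<le> x" if "x \<in> S" for x
  proof -
    have "q * s \<le> p * x" using sx[OF that] pq by (simp add: field_simps)
    then show ?thesis using pq by (simp add: field_simps)
  qed
  then have "q / p * s \<le> Inf S" by (rule cInf_greatest[OF Sne])
  then have "q / p * s \<le> s" by (simp only: s_def)
  then have "(q - p) * s \<le> 0" using pq by (simp add: field_simps)
  then have "s \<le> 0" using pq by (simp add: mult_le_0_iff)
  then have "Inf S < e" if "e > 0" for e using that s_def by simp
  then show ?thesis
    unfolding negligible_outer
  proof (intro allI impI)
    fix e :: real assume "e > 0" "\<And>e. 0 < e \<Longrightarrow> Inf S < e"
    then obtain x where "x \<in> S" "x < e" using cInf_lessD[OF Sne] by blast
    then show "\<exists>T. E \<subseteq> T \<and> T \<in> lmeasurable \<and> measure lebesgue T < e"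
      by (auto simp: S_def intro: lmeasurable_open)
  qed
qed

text \<open>Where differentiability fails, the lower and upper limits of the difference quotients
  are separated by two rationals p < q. The exceptional set is thus a countable union of sets to
  which the slope gap applies; the bound n makes these sets bounded.\<close>

lemma lipschitz_real_differentiable_AE:
  fixes f :: "real \<Rightarrow> real"
  assumes f: "L-lipschitz_on UNIV f"
  shows "negligible {x. \<not> f differentiable (at x)}"
proof -
  \<comment> \<open>Adding L + 1 to all slopes makes the function increasing with slopes at least 1,
    so that the rational p found below is positive.\<close>
  define g where "g x = f x + (L + 1) * x" for x
  have L0: "L \<ge> 0" using f by (rule lipschitz_on_nonneg)
  have fl: "\<bar>f x - f y\<bar> \<le> L * \<bar>x - y\<bar>" for x y using lipschitz_onD[OF f, of x y] by (simp add: dist_real_def)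
  have slope: "v - u \<le> g v - g u" "g v - g u \<le> (2 * L + 1) * (v - u)" if "u \<le> v" for u v
    using fl[of v u] that by (auto simp: g_def algebra_simps abs_le_iff)
  have mono: "mono g" unfolding mono_def using slope by (smt (verit))
  have cont: "continuous_on UNIV g" unfolding g_def
    by (intro continuous_intros lipschitz_on_continuous_on[OF f])
  define E where "E p q n = {x. \<bar>x\<bar> \<le> real n \<and>
     (\<forall>d>0. \<exists>u v. u < v \<and> u \<le> x \<and> x \<le> v \<and> v - u < d \<and> g v - g u < p * (v - u)) \<and>
     (\<forall>d>0. \<exists>u v. u < v \<and> u \<le> x \<and> x \<le> v \<and> v - u < d \<and> q * (v - u) < g v - g u)}" for p q n
  have negE: "negligible (E p q n)" if "0 < p" "p < q" for p q n
    by (rule negligible_slope_gap[OF mono cont that])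
      (auto simp: E_def bounded_iff)
  have "{x. \<not> f differentiable (at x)} \<subseteq> (\<Union>i\<in>{(p, q, n). (0::rat) < p \<and> p < q}. case i of (p, q, n) \<Rightarrow> E (of_rat p) (of_rat q) n)"
  proof
    fix x assume "x \<in> {x. \<not> f differentiable (at x)}"
    then have nd: "\<not> f differentiable (at x)" by simp
    define S where "S h = (g (x + h) - g x) / h" for h
    have Sb: "1 \<le> S h" "S h \<le> 2 * L + 1" if "h \<noteq> 0" for h
    proof -
      have *: "1 \<le> (g v - g u) / (v - u)" "(g v - g u) / (v - u) \<le> 2 * L + 1" if "u < v" for u v
        using slope[of u v] that by (simp_all add: pos_le_divide_eq pos_divide_le_eq)
      have "S h = (g x - g (x + h)) / (x - (x + h))" unfolding S_def using that by (simp add: field_simps)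
      then show "1 \<le> S h" "S h \<le> 2 * L + 1"
        using *[of x "x + h"] *[of "x + h" x] that by (cases "h > 0"; simp add: S_def)+
    qed
    let ?S = "\<lambda>h. ereal (S h)"
    have lower: "1 \<le> Liminf (at 0) ?S"
      by (rule Liminf_bounded) (use Sb in \<open>auto simp: eventually_at_filter\<close>)
    have upper: "Limsup (at 0) ?S \<le> ereal (2 * L + 1)"
      by (rule Limsup_bounded) (use Sb in \<open>auto simp: eventually_at_filter\<close>)
    have "Liminf (at 0) ?S \<noteq> Limsup (at 0) ?S"
    proof
      assume eq: "Liminf (at 0) ?S = Limsup (at 0) ?S"
      obtain D where D: "Limsup (at 0) ?S = ereal D"
        using lower upper eq by (cases "Limsup (at 0) ?S") auto
      then have "(?S \<longlongrightarrow> ereal D) (at 0)" using eq by (subst tendsto_iff_Liminf_eq_Limsup) auto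
      then have "(S \<longlongrightarrow> D) (at 0)" by simp
      then have "((\<lambda>h. (g (x + h) - g x) / h) \<longlongrightarrow> D) (at 0)" unfolding S_def .
      then have "(g has_real_derivative D) (at x)" by (simp only: DERIV_def)
      then have "((\<lambda>x. g x - (L + 1) * x) has_real_derivative D - (L + 1) * 1) (at x)"
        by (intro DERIV_diff DERIV_cmult DERIV_ident)
      then have "(f has_real_derivative D - (L + 1) * 1) (at x)" by (simp add: g_def)
      then show False using nd real_differentiable_def by blast
    qed
    then have "Liminf (at 0) ?S < Limsup (at 0) ?S"
      using Liminf_le_Limsup[of "at (0::real)" ?S] by (simp add: less_le)
    then obtain q where q: "Liminf (at 0) ?S < ereal (of_rat q)" "ereal (of_rat q) < Limsup (at 0) ?S"
      using ereal_dense3 by blast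
    then obtain p where p: "Liminf (at 0) ?S < ereal (of_rat p)" "ereal (of_rat p) < ereal (of_rat q)"
      using ereal_dense3 by blast
    have "ereal 1 < ereal (of_rat p)" using lower p by (metis le_less_trans one_ereal_def)
    then have "(0::real) < of_rat p" by simp
    then have pq: "0 < p" "p < q" using p(2) by (simp_all add: of_rat_less)
    have conv: "\<exists>u v. u < v \<and> u \<le> x \<and> x \<le> v \<and> v - u < d \<and> (g v - g u) / (v - u) = S h"
      if "h \<noteq> 0" "\<bar>h\<bar> < d" for h d
    proof (cases "h > 0")
      case True
      then show ?thesis using that by (intro exI[of _ x] exI[of _ "x + h"]) (auto simp: S_def)
    next
      case False
      then show ?thesis using that
        by (intro exI[of _ "x + h"] exI[of _ x]) (auto simp: S_def field_simps)
    qed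
    have "\<exists>u v. u < v \<and> u \<le> x \<and> x \<le> v \<and> v - u < d \<and> g v - g u < of_rat p * (v - u)" if d: "d > 0" for d
    proof -
      have "\<not> eventually (\<lambda>h. ereal (of_rat p) \<le> ?S h) (at 0)"
        using p(1) Liminf_bounded[of "ereal (of_rat p)" ?S "at 0"] by (meson not_le)
      then obtain h where h: "h \<noteq> 0" "\<bar>h\<bar> < d" "S h < of_rat p"
        unfolding eventually_at using d by (auto simp: not_le dist_real_def)
      obtain u v where uv: "u < v" "u \<le> x" "x \<le> v" "v - u < d" "(g v - g u) / (v - u) = S h" using conv[OF h(1,2)] by blast
      then have "g v - g u < of_rat p * (v - u)" using h(3) by (simp add: pos_divide_less_eq flip: uv(5))
      then show ?thesis using uv by blast
    qed
    moreover have "\<exists>u v. u < v \<and> u \<le> x \<and> x \<le> v \<and> v - u < d \<and> of_rat q * (v - u) < g v - g u" if d: "d > 0" for d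
    proof -
      have "\<not> eventually (\<lambda>h. ?S h \<le> ereal (of_rat q)) (at 0)"
        using q(2) Limsup_bounded[of ?S "ereal (of_rat q)" "at 0"] by (meson not_le)
      then obtain h where h: "h \<noteq> 0" "\<bar>h\<bar> < d" "of_rat q < S h"
        unfolding eventually_at using d by (auto simp: not_le dist_real_def)
      obtain u v where uv: "u < v" "u \<le> x" "x \<le> v" "v - u < d" "(g v - g u) / (v - u) = S h" using conv[OF h(1,2)] by blast
      then have "of_rat q * (v - u) < g v - g u" using h(3) by (simp add: pos_less_divide_eq flip: uv(5))
      then show ?thesis using uv by blast
    qed
    moreover obtain n where "\<bar>x\<bar> \<le> real n" using real_arch_simple by blast
    ultimately have "x \<in> E (of_rat p) (of_rat q) n" by (simp add: E_def)
    then show "x \<in> (\<Union>i\<in>{(p, q, n). (0::rat) < p \<and> p < q}. case i of (p, q, n) \<Rightarrow> E (of_rat p) (of_rat q) n)"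
      using pq by (intro UN_I[of "(p, q, n)"]) auto
  qed
  moreover have "negligible (\<Union>i\<in>{(p, q, n). (0::rat) < p \<and> p < q}. case i of (p, q, n) \<Rightarrow> E (of_rat p) (of_rat q) n)"
  proof (rule negligible_countable_Union)
    show "countable ((\<lambda>i. case i of (p, q, n) \<Rightarrow> E (of_rat p) (of_rat q) n) ` {(p, q, n). (0::rat) < p \<and> p < q})"
      by (intro countable_image countableI_type)
    fix X assume "X \<in> (\<lambda>i. case i of (p, q, n) \<Rightarrow> E (of_rat p) (of_rat q) n) ` {(p, q, n). (0::rat) < p \<and> p < q}"
    then show "negligible X" using negE by (auto simp: of_rat_less)
  qed
  ultimately show ?thesis by (rule negligible_subset[rotated])
qed

section \<open>Rademacher's theorem and weak gradients\<close>

definition diff_quot :: "('a::real_normed_vector \<Rightarrow> real) \<Rightarrow> 'a \<Rightarrow> real \<Rightarrow> 'a \<Rightarrow> real" where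
  "diff_quot u v h x = (u (x + h *\<^sub>R v) - u x) / h"

text \<open>Taking the limit along one fixed sequence gives a total function that is Borel
  measurable for continuous u; it agrees with the directional derivative wherever that
  exists.\<close>

definition quot_lim :: "('a::real_normed_vector \<Rightarrow> real) \<Rightarrow> 'a \<Rightarrow> 'a \<Rightarrow> real" where
  "quot_lim u v x = lim (\<lambda>n. diff_quot u v (inverse (real (Suc n))) x)"

lemma directional_derivative_iff:
  "((\<lambda>t. u (x + t *\<^sub>R v)) has_real_derivative D) (at 0) \<longleftrightarrow> ((\<lambda>h. diff_quot u v h x) \<longlongrightarrow> D) (at 0)"
  by (simp add: DERIV_def diff_quot_def)

lemma filterlim_inverse_Suc_at_0: "filterlim (\<lambda>n. inverse (real (Suc n))) (at 0) sequentially"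
proof -
  have "(\<lambda>n. inverse (real (Suc n))) \<longlonglongrightarrow> 0" by (rule LIMSEQ_inverse_real_of_nat)
  moreover have "inverse (real (Suc n)) \<noteq> 0" for n by simp
  ultimately show ?thesis by (simp only: filterlim_at simp_thms eventually_True UNIV_I)
qed

lemma quot_lim_eq:
  assumes "((\<lambda>t. u (x + t *\<^sub>R v)) has_real_derivative D) (at 0)" shows "quot_lim u v x = D"
proof -
  have "((\<lambda>h. diff_quot u v h x) \<longlongrightarrow> D) (at 0)" using assms by (simp only: directional_derivative_iff)
  from filterlim_compose[OF this filterlim_inverse_Suc_at_0] show ?thesis
    unfolding quot_lim_def by (rule limI)
qed

lemma continuous_diff_quot:
  fixes u :: "'a::real_normed_vector \<Rightarrow> real"
  assumes u: "continuous_on UNIV u" shows "continuous_on UNIV (diff_quot u v h)"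
proof (cases "h = 0")
  case True then show ?thesis by (simp add: diff_quot_def[abs_def])
next
  case False
  then show ?thesis unfolding diff_quot_def[abs_def]
    by (intro continuous_intros continuous_on_compose2[OF u] u) auto
qed

lemma borel_measurable_quot_lim:
  fixes u :: "'a::euclidean_space \<Rightarrow> real"
  assumes u: "continuous_on UNIV u" shows "quot_lim u v \<in> borel_measurable borel"
  unfolding quot_lim_def[abs_def]
  by (intro borel_measurable_lim_metric borel_measurable_continuous_onI continuous_diff_quot u)

text \<open>Differentiability in a direction is a Borel condition: by continuity the difference quotients
  need only be compared at rational increments.\<close>

lemma directional_differentiable_rational:
  fixes u :: "'a::real_normed_vector \<Rightarrow> real"
  assumes u: "continuous_on UNIV u"
  shows "(\<exists>D. ((\<lambda>t. u (x + t *\<^sub>R v)) has_real_derivative D) (at 0)) \<longleftrightarrow>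
    (\<forall>k::nat. \<exists>m::nat. \<forall>p::rat. \<forall>q::rat. p \<noteq> 0 \<longrightarrow> q \<noteq> 0 \<longrightarrow> \<bar>of_rat p\<bar> < inverse (real (Suc m)) \<longrightarrow> \<bar>of_rat q\<bar> < inverse (real (Suc m)) \<longrightarrow>
       \<bar>diff_quot u v (of_rat p) x - diff_quot u v (of_rat q) x\<bar> \<le> inverse (real (Suc k)))" (is "?L \<longleftrightarrow> ?R")
proof
  assume ?L
  then obtain D where D: "((\<lambda>h. diff_quot u v h x) \<longlongrightarrow> D) (at 0)" by (auto simp only: directional_derivative_iff)
  show ?R
  proof
    fix k :: nat
    have "inverse (real (Suc k)) / 2 > 0" by simp
    from tendstoD[OF D this] obtain d where d: "d > 0"
      "\<And>h. h \<noteq> 0 \<Longrightarrow> \<bar>h\<bar> < d \<Longrightarrow> \<bar>diff_quot u v h x - D\<bar> < inverse (real (Suc k)) / 2"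
      unfolding eventually_at dist_real_def by auto
    obtain m where m: "inverse (real (Suc m)) < d" using reals_Archimedean[OF d(1)] by blast
    have "\<bar>diff_quot u v (of_rat p) x - diff_quot u v (of_rat q) x\<bar> \<le> inverse (real (Suc k))"
      if "p \<noteq> 0" "q \<noteq> 0" "\<bar>of_rat p\<bar> < inverse (real (Suc m))" "\<bar>of_rat q\<bar> < inverse (real (Suc m))" for p q :: rat
    proof -
      have lt: "\<bar>real_of_rat p\<bar> < d" "\<bar>real_of_rat q\<bar> < d" using that(3,4) m by linarith+
      have n0: "real_of_rat p \<noteq> 0" "real_of_rat q \<noteq> 0" using that(1,2) by simp_all
      show ?thesis using d(2)[OF n0(1) lt(1)] d(2)[OF n0(2) lt(2)] by linarith
    qed
    then show "\<exists>m::nat. \<forall>p::rat. \<forall>q::rat. p \<noteq> 0 \<longrightarrow> q \<noteq> 0 \<longrightarrow> \<bar>of_rat p\<bar> < inverse (real (Suc m)) \<longrightarrow> \<bar>of_rat q\<bar> < inverse (real (Suc m)) \<longrightarrow>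
       \<bar>diff_quot u v (of_rat p) x - diff_quot u v (of_rat q) x\<bar> \<le> inverse (real (Suc k))" by blast
  qed
next
  assume R: ?R
  define S where "S h = diff_quot u v h x" for h
  have all: "\<exists>d>0. \<forall>g h. g \<noteq> 0 \<longrightarrow> h \<noteq> 0 \<longrightarrow> \<bar>g\<bar> < d \<longrightarrow> \<bar>h\<bar> < d \<longrightarrow> \<bar>S g - S h\<bar> < e" if e: "e > 0" for e
  proof -
    obtain k where k: "inverse (real (Suc k)) < e / 3" using reals_Archimedean[of "e / 3"] e by auto
    obtain m where m: "\<And>p q::rat. p \<noteq> 0 \<Longrightarrow> q \<noteq> 0 \<Longrightarrow> \<bar>of_rat p\<bar> < inverse (real (Suc m)) \<Longrightarrow> \<bar>of_rat q\<bar> < inverse (real (Suc m)) \<Longrightarrow>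
       \<bar>S (of_rat p) - S (of_rat q)\<bar> \<le> inverse (real (Suc k))" using R unfolding S_def by metis
    have approx: "\<exists>p::rat. p \<noteq> 0 \<and> \<bar>of_rat p\<bar> < inverse (real (Suc m)) \<and> \<bar>S (of_rat p) - S h\<bar> < e / 3"
      if h: "h \<noteq> 0" "\<bar>h\<bar> < inverse (real (Suc m))" for h
    proof -
      have "isCont S h"
        unfolding S_def diff_quot_def using h(1) u
        by (intro continuous_intros continuous_at_compose[unfolded o_def, of h "\<lambda>h. x + h *\<^sub>R v" u])
          (auto simp: continuous_on_eq_continuous_at)
      then have "(S \<longlongrightarrow> S h) (at h)" by (simp add: isCont_def)
      from tendstoD[OF this, of "e / 3"] e obtain d where d: "d > 0" "\<And>g. g \<noteq> h \<Longrightarrow> \<bar>g - h\<bar> < d \<Longrightarrow> \<bar>S g - S h\<bar> < e / 3"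
        unfolding eventually_at dist_real_def by auto
      define d' where "d' = min d (min \<bar>h\<bar> (inverse (real (Suc m)) - \<bar>h\<bar>))"
      have d': "d' > 0" using d h by (simp add: d'_def)
      obtain p :: rat where p: "h < of_rat p" "of_rat p < h + d'" using of_rat_dense[of h "h + d'"] d' by auto
      have "\<bar>of_rat p - h\<bar> < d'" using p by simp
      then have "\<bar>of_rat p - h\<bar> < d" "\<bar>of_rat p - h\<bar> < \<bar>h\<bar>" "\<bar>of_rat p - h\<bar> < inverse (real (Suc m)) - \<bar>h\<bar>" by (auto simp: d'_def)
      note near = this
      have "(of_rat p :: real) \<noteq> 0" using near(2) by auto
      then have "p \<noteq> 0" by simp
      moreover have "\<bar>real_of_rat p\<bar> < inverse (real (Suc m))" using near(3) by linarith
      moreover have "\<bar>S (of_rat p) - S h\<bar> < e / 3" by (rule d(2)[OF _ near(1)]) (use p(1) in linarith)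
      ultimately show ?thesis by (intro exI[of _ p] conjI)
    qed
    show ?thesis
    proof (intro exI[of _ "inverse (real (Suc m))"] conjI allI impI)
      fix g h :: real assume gh: "g \<noteq> 0" "h \<noteq> 0" "\<bar>g\<bar> < inverse (real (Suc m))" "\<bar>h\<bar> < inverse (real (Suc m))"
      obtain p where p: "p \<noteq> 0" "\<bar>of_rat p\<bar> < inverse (real (Suc m))" "\<bar>S (of_rat p) - S g\<bar> < e / 3" using approx[OF gh(1,3)] by blast
      obtain q where q: "q \<noteq> 0" "\<bar>of_rat q\<bar> < inverse (real (Suc m))" "\<bar>S (of_rat q) - S h\<bar> < e / 3" using approx[OF gh(2,4)] by blast
      show "\<bar>S g - S h\<bar> < e" using m[OF p(1) q(1) p(2) q(2)] p(3) q(3) k by linarith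
    qed simp
  qed
  have "Cauchy (\<lambda>n. S (inverse (real (Suc n))))"
  proof (rule metric_CauchyI)
    fix e :: real assume "e > 0"
    then obtain d where d: "d > 0" "\<And>g h. g \<noteq> 0 \<Longrightarrow> h \<noteq> 0 \<Longrightarrow> \<bar>g\<bar> < d \<Longrightarrow> \<bar>h\<bar> < d \<Longrightarrow> \<bar>S g - S h\<bar> < e" using all by metis
    obtain M where M: "inverse (real (Suc M)) < d" using reals_Archimedean[OF d(1)] by blast
    have "inverse (real (Suc n)) < d" if "n \<ge> M" for n
    proof -
      have "inverse (real (Suc n)) \<le> inverse (real (Suc M))" using that by (intro le_imp_inverse_le) auto
      then show ?thesis using M by linarith
    qed
    then show "\<exists>M. \<forall>m\<ge>M. \<forall>n\<ge>M. dist (S (inverse (real (Suc m)))) (S (inverse (real (Suc n)))) < e"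
      unfolding dist_real_def by (intro exI[of _ M] allI impI d(2)) auto
  qed
  then obtain D where D: "(\<lambda>n. S (inverse (real (Suc n)))) \<longlonglongrightarrow> D" by (auto simp: Cauchy_convergent_iff convergent_def)
  have "(S \<longlongrightarrow> D) (at 0)"
  proof (rule tendstoI)
    fix e :: real assume e: "e > 0"
    then obtain d where d: "d > 0" "\<And>g h. g \<noteq> 0 \<Longrightarrow> h \<noteq> 0 \<Longrightarrow> \<bar>g\<bar> < d \<Longrightarrow> \<bar>h\<bar> < d \<Longrightarrow> \<bar>S g - S h\<bar> < e / 2" using all[of "e / 2"] by auto
    have "\<bar>S h - D\<bar> \<le> e / 2" if h: "h \<noteq> 0" "\<bar>h\<bar> < d" for h
    proof (rule LIMSEQ_le_const2)
      show "(\<lambda>n. \<bar>S h - S (inverse (real (Suc n)))\<bar>) \<longlonglongrightarrow> \<bar>S h - D\<bar>" by (intro tendsto_intros D)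
      obtain M where M: "inverse (real (Suc M)) < d" using reals_Archimedean[OF d(1)] by blast
      have "\<bar>S h - S (inverse (real (Suc n)))\<bar> \<le> e / 2" if "n \<ge> M" for n
      proof -
        have "inverse (real (Suc n)) \<le> inverse (real (Suc M))" using that by (intro le_imp_inverse_le) auto
        moreover have "0 \<le> inverse (real (Suc n))" by simp
        ultimately have "\<bar>inverse (real (Suc n))\<bar> < d" using M by linarith
        then show ?thesis using d(2)[of h "inverse (real (Suc n))"] h by simp
      qed
      then show "\<exists>N. \<forall>n\<ge>N. \<bar>S h - S (inverse (real (Suc n)))\<bar> \<le> e / 2" by blast
    qed
    then have "\<bar>S h - D\<bar> < e" if "h \<noteq> 0" "\<bar>h\<bar> < d" for h using that e by fastforce
    then show "\<forall>\<^sub>F h in at 0. dist (S h) D < e" unfolding eventually_at dist_real_def using d(1) by auto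
  qed
  then show ?L unfolding directional_derivative_iff S_def by blast
qed

lemma lipschitz_along_line:
  fixes u :: "'a::real_normed_vector \<Rightarrow> real"
  assumes u: "L-lipschitz_on UNIV u" shows "(L * norm v)-lipschitz_on UNIV (\<lambda>t. u (x + t *\<^sub>R v))"
proof (rule lipschitz_onI)
  have L: "L \<ge> 0" using u by (rule lipschitz_on_nonneg)
  then show "0 \<le> L * norm v" by simp
  fix s t :: real
  have "dist (u (x + s *\<^sub>R v)) (u (x + t *\<^sub>R v)) \<le> L * dist (x + s *\<^sub>R v) (x + t *\<^sub>R v)"
    by (rule lipschitz_onD[OF u]) simp_all
  also have "dist (x + s *\<^sub>R v) (x + t *\<^sub>R v) = \<bar>s - t\<bar> * norm v"
    by (simp add: dist_norm scaleR_diff_left[symmetric])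
  finally show "dist (u (x + s *\<^sub>R v)) (u (x + t *\<^sub>R v)) \<le> L * norm v * dist s t" by (simp add: dist_real_def mult_ac)
qed

text \<open>Fubini in \<open>x\<close> and \<open>t\<close> for the indicator of \<open>x + t v \<in> N\<close>, together with translation
  invariance, reduces null sets in space to null sets on lines.\<close>

lemma lipschitz_directional_AE:
  fixes u :: "'a::euclidean_space \<Rightarrow> real"
  assumes u: "L-lipschitz_on UNIV u"
  shows "AE x in lborel. ((\<lambda>t. u (x + t *\<^sub>R v)) has_real_derivative quot_lim u v x) (at 0)"
proof -
  have cu: "continuous_on UNIV u" using u by (rule lipschitz_on_continuous_on)
  define N where "N = {x. \<not> (\<exists>D. ((\<lambda>t. u (x + t *\<^sub>R v)) has_real_derivative D) (at 0))}"
  have m: "(\<lambda>x. diff_quot u v h x) \<in> borel_measurable borel" for h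
    by (intro borel_measurable_continuous_onI continuous_diff_quot cu)
  have N: "N \<in> sets borel"
    unfolding N_def directional_differentiable_rational[OF cu] using m by measurable
  have line: "emeasure lborel {t. x + t *\<^sub>R v \<in> N} = 0" for x
  proof -
    define g where "g t = u (x + t *\<^sub>R v)" for t
    have g: "(L * norm v)-lipschitz_on UNIV g" unfolding g_def by (rule lipschitz_along_line[OF u])
    have "{t. x + t *\<^sub>R v \<in> N} \<subseteq> {t. \<not> g differentiable (at t)}"
    proof safe
      fix t assume t: "x + t *\<^sub>R v \<in> N" and d: "g differentiable (at t)"
      then obtain D where "(g has_real_derivative D) (at t)" by (auto simp: real_differentiable_def)
      then have "((\<lambda>s. g (s + t)) has_real_derivative D) (at 0)" by (subst DERIV_shift[symmetric]) simp
      then have "((\<lambda>s. u (x + t *\<^sub>R v + s *\<^sub>R v)) has_real_derivative D) (at 0)"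
        by (simp add: g_def algebra_simps)
      then show False using t by (auto simp: N_def)
    qed
    then have "negligible {t. x + t *\<^sub>R v \<in> N}"
      using lipschitz_real_differentiable_AE[OF g] negligible_subset by metis
    moreover have "{t. x + t *\<^sub>R v \<in> N} \<in> sets borel"
    proof -
      have "(\<lambda>t. x + t *\<^sub>R v) \<in> borel_measurable borel" by (intro borel_measurable_continuous_onI continuous_intros)
      from measurable_sets[OF this N] show ?thesis by (simp add: vimage_def)
    qed
    ultimately show ?thesis by (simp add: negligible_iff_null_sets null_sets_def)
  qed
  \<comment> \<open>The cutoff to \<open>{0..1}\<close> gives t total weight 1, so one order of
    integration returns \<open>emeasure lborel N\<close> and the other the measures of slices along
    lines.\<close>
  let ?f = "\<lambda>x t. indicator N (x + t *\<^sub>R v) * indicator {0..1::real} t :: ennreal"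
  have fm: "(\<lambda>(x, t). ?f x t) \<in> borel_measurable (lborel \<Otimes>\<^sub>M lborel)"
  proof -
    have [measurable]: "(\<lambda>z::'a \<times> real. fst z + snd z *\<^sub>R v) \<in> borel_measurable (borel \<Otimes>\<^sub>M borel)"
      unfolding borel_prod by (intro borel_measurable_continuous_onI continuous_intros)
    have [measurable]: "N \<in> sets borel" by (rule N)
    show ?thesis by (simp add: split_def) measurable
  qed
  have "emeasure lborel N = (\<integral>\<^sup>+t. emeasure lborel N * indicator {0..1::real} t \<partial>lborel)"
    by (simp add: nn_integral_cmult)
  also have "\<dots> = (\<integral>\<^sup>+t. (\<integral>\<^sup>+x. ?f x t \<partial>lborel) \<partial>lborel)"
  proof (rule nn_integral_cong)
    fix t :: real
    have im: "(\<lambda>x. indicator N x :: ennreal) \<in> borel_measurable borel" using N by simp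
    have "emeasure lborel N = (\<integral>\<^sup>+x. indicator N x \<partial>lborel)" using N by simp
    also have "\<dots> = (\<integral>\<^sup>+x. indicator N x \<partial>distr lborel borel ((+) (t *\<^sub>R v)))" by (simp add: lborel_distr_plus)
    also have "\<dots> = (\<integral>\<^sup>+x. indicator N (t *\<^sub>R v + x) \<partial>lborel)" by (rule nn_integral_distr) (use im in simp_all)
    finally have "emeasure lborel N = (\<integral>\<^sup>+x. indicator N (x + t *\<^sub>R v) \<partial>lborel)" by (simp only: add.commute)
    then show "emeasure lborel N * indicator {0..1} t = (\<integral>\<^sup>+x. ?f x t \<partial>lborel)"
      by (cases "t \<in> {0..1}") simp_all
  qed
  also have "\<dots> = (\<integral>\<^sup>+x. (\<integral>\<^sup>+t. ?f x t \<partial>lborel) \<partial>lborel)" by (rule lborel_pair.Fubini'[OF fm])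
  also have "\<dots> = (\<integral>\<^sup>+x. 0 \<partial>(lborel :: 'a measure))"
  proof (rule nn_integral_cong)
    fix x :: 'a
    have b: "{t. x + t *\<^sub>R v \<in> N} \<in> sets borel"
    proof -
      have "(\<lambda>t. x + t *\<^sub>R v) \<in> borel_measurable borel" by (intro borel_measurable_continuous_onI continuous_intros)
      from measurable_sets[OF this N] show ?thesis by (simp add: vimage_def)
    qed
    have "(\<integral>\<^sup>+t. ?f x t \<partial>lborel) \<le> (\<integral>\<^sup>+t. indicator {t. x + t *\<^sub>R v \<in> N} t \<partial>lborel)"
      by (rule nn_integral_mono) (auto simp: indicator_def)
    also have "\<dots> = 0" using b line by simp
    finally show "(\<integral>\<^sup>+t. ?f x t \<partial>lborel) = 0" by simp
  qed
  finally have "N \<in> null_sets lborel" using N by (simp add: null_sets_def)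
  from AE_not_in[OF this] show ?thesis
  proof eventually_elim
    case (elim x)
    then obtain D where "((\<lambda>t. u (x + t *\<^sub>R v)) has_real_derivative D) (at 0)" by (auto simp: N_def)
    then show ?case using quot_lim_eq by metis
  qed
qed

lemma quot_lim_bound:
  fixes u :: "'a::euclidean_space \<Rightarrow> real"
  assumes u: "L-lipschitz_on UNIV u" and d: "((\<lambda>t. u (x + t *\<^sub>R v)) has_real_derivative D) (at 0)"
  shows "\<bar>D\<bar> \<le> L * norm v"
proof -
  have "((\<lambda>h. diff_quot u v h x) \<longlongrightarrow> D) (at 0)" using d by (simp only: directional_derivative_iff)
  then have "((\<lambda>h. \<bar>diff_quot u v h x\<bar>) \<longlongrightarrow> \<bar>D\<bar>) (at 0)" by (rule tendsto_rabs)
  then show ?thesis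
  proof (rule tendsto_upperbound)
    have "\<bar>diff_quot u v h x\<bar> \<le> L * norm v" if "h \<noteq> 0" for h
    proof -
      have "dist (u (x + h *\<^sub>R v)) (u (x + 0 *\<^sub>R v)) \<le> L * norm v * dist h 0"
        using lipschitz_onD[OF lipschitz_along_line[OF u, of v x], of h 0] by simp
      then show ?thesis using that by (simp add: diff_quot_def dist_real_def pos_divide_le_eq)
    qed
    then show "\<forall>\<^sub>F h in at 0. \<bar>diff_quot u v h x\<bar> \<le> L * norm v" by (auto simp: eventually_at_filter)
  qed simp
qed

lemma lipschitz_quot_lim_facts:
  fixes u :: "'a::euclidean_space \<Rightarrow> real"
  assumes u: "L-lipschitz_on UNIV u"
  shows "quot_lim u v \<in> borel_measurable lebesgue"
    and "AE x in lebesgue. ((\<lambda>t. u (x + t *\<^sub>R v)) has_real_derivative quot_lim u v x) (at 0)"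
    and "AE x in lebesgue. \<bar>quot_lim u v x\<bar> \<le> L * norm v"
proof -
  have "quot_lim u v \<in> borel_measurable lborel"
    using borel_measurable_quot_lim[OF lipschitz_on_continuous_on[OF u]] by simp
  then show "quot_lim u v \<in> borel_measurable lebesgue" by (rule measurable_completion)
  show 1: "AE x in lebesgue. ((\<lambda>t. u (x + t *\<^sub>R v)) has_real_derivative quot_lim u v x) (at 0)"
    by (rule AE_completion[OF lipschitz_directional_AE[OF u]])
  from 1 show "AE x in lebesgue. \<bar>quot_lim u v x\<bar> \<le> L * norm v"
    by eventually_elim (rule quot_lim_bound[OF u])
qed

lemma set_integrable_AE_bounded:
  fixes h :: "'a::euclidean_space \<Rightarrow> real"
  assumes h: "h \<in> borel_measurable lebesgue" "AE x in lebesgue. \<bar>h x\<bar> \<le> B" and K: "compact K"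
  shows "set_integrable lebesgue K h"
  unfolding set_integrable_def
proof (rule integrableI_bounded_set[where A=K and B=B])
  have Kl: "K \<in> lmeasurable" using K by (rule lmeasurable_compact)
  show "K \<in> sets lebesgue" using Kl by (rule fmeasurableD)
  show "emeasure lebesgue K < \<infinity>" using Kl by (auto simp only: fmeasurable_def mem_Collect_eq)
  have "(indicator K :: 'a \<Rightarrow> real) \<in> borel_measurable lebesgue" using fmeasurableD[OF Kl] by (rule borel_measurable_indicator)
  then show "(\<lambda>x. indicator K x *\<^sub>R h x) \<in> borel_measurable lebesgue" using h(1) by (rule borel_measurable_scaleR)
  from h(2) show "AE x in lebesgue. x \<in> K \<longrightarrow> norm (indicator K x *\<^sub>R h x) \<le> B"
    by eventually_elim (simp add: indicator_def)
  show "AE x in lebesgue. x \<notin> K \<longrightarrow> indicator K x *\<^sub>R h x = 0" by (rule AE_I2) simp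
qed

text \<open>Linearity in v cannot be read off pointwise before differentiability is known. Paired
  with a test function \<phi>, both sides turn into integrals of u against derivatives of \<phi>,
  which are linear in the direction.\<close>

lemma quot_lim_linear_AE:
  fixes u :: "'a::euclidean_space \<Rightarrow> real"
  assumes u: "L-lipschitz_on UNIV u"
  shows "AE x in lebesgue. quot_lim u v x = (\<Sum>i\<in>Basis. (v \<bullet> i) * quot_lim u i x)"
proof -
  note F = lipschitz_quot_lim_facts[OF u]
  define h where "h x = quot_lim u v x - (\<Sum>i\<in>Basis. (v \<bullet> i) * quot_lim u i x)" for x
  have hm: "h \<in> borel_measurable lebesgue"
    unfolding h_def[abs_def] by (intro borel_measurable_diff borel_measurable_sum borel_measurable_times borel_measurable_const F(1))
  have hb: "AE x in lebesgue. \<bar>h x\<bar> \<le> L * norm v + (\<Sum>i\<in>(Basis::'a set). \<bar>v \<bullet> i\<bar> * L)"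
  proof -
    have "AE x in lebesgue. \<forall>i\<in>(Basis::'a set). \<bar>quot_lim u i x\<bar> \<le> L * norm i"
      by (rule AE_ball_countable'[OF _ countable_finite[OF finite_Basis]]) (rule F(3))
    with F(3)[of v] show ?thesis
    proof eventually_elim
      case (elim x)
      have "\<bar>\<Sum>i\<in>Basis. (v \<bullet> i) * quot_lim u i x\<bar> \<le> (\<Sum>i\<in>(Basis::'a set). \<bar>v \<bullet> i\<bar> * L)"
        by (rule order_trans[OF sum_abs]) (use elim in \<open>auto simp: abs_mult intro!: sum_mono mult_left_mono\<close>)
      then show ?case using elim(1) by (simp add: h_def abs_le_iff)
    qed
  qed
  have "AE x in lebesgue. x \<in> UNIV \<longrightarrow> h x = 0"
  proof (rule AE_zero_if_orthogonal_to_test_functions[OF open_UNIV hm])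
    show "set_integrable lebesgue K h" if "compact K" for K by (rule set_integrable_AE_bounded[OF hm hb that])
    fix \<phi> :: "'a \<Rightarrow> real" assume \<phi>: "test_fun UNIV \<phi>"
    have lin: "linear (frechet_derivative \<phi> (at x))" for x
      using smooth_onD(1)[of \<phi> x] \<phi> has_derivative_linear by (auto simp: test_fun_def)
    have I: "integrable lebesgue (\<lambda>x. quot_lim u w x * \<phi> x)" for w
      by (rule integration_by_parts_lipschitz(1)[OF u \<phi> F(1) F(2)])
    have E: "(LINT x|lebesgue. quot_lim u w x * \<phi> x) = - (LINT x|lebesgue. u x * frechet_derivative \<phi> (at x) w)" for w
      using integration_by_parts_lipschitz(2)[OF u \<phi> F(1) F(2), of w] by (simp add: set_lebesgue_integral_def)
    have cu: "continuous_on UNIV u" using u by (rule lipschitz_on_continuous_on)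
    have J: "integrable lebesgue (\<lambda>x. u x * frechet_derivative \<phi> (at x) w)" for w
    proof -
      have c: "continuous_on UNIV (\<lambda>x. u x * frechet_derivative \<phi> (at x) w)"
        using smooth_onD(3)[of \<phi> w] \<phi> cu by (intro continuous_intros) (auto simp: test_fun_def)
      have "integrable lborel (\<lambda>x. u x * frechet_derivative \<phi> (at x) w)"
        by (rule integrable_continuous_vanishing[OF c, of "closure {x. \<phi> x \<noteq> 0}"])
          (use \<phi> frechet_derivative_test_fun_outside[of _ \<phi> w] in \<open>auto simp: test_fun_def\<close>)
      then show ?thesis
        using integrable_completion[of "\<lambda>x. u x * frechet_derivative \<phi> (at x) w" lborel] borel_measurable_continuous_onI[OF c] by simp
    qed
    have sumE: "(LINT x|lebesgue. (\<Sum>i\<in>(Basis :: 'a set). (v \<bullet> i) * F i x)) = (\<Sum>i\<in>Basis. (v \<bullet> i) * (LINT x|lebesgue. F i x))"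
      if "\<And>i. integrable lebesgue (F i)" for F :: "'a \<Rightarrow> 'a \<Rightarrow> real"
    proof -
      have "(LINT x|lebesgue. (\<Sum>i\<in>(Basis :: 'a set). (v \<bullet> i) * F i x)) = (\<Sum>i\<in>Basis. LINT x|lebesgue. (v \<bullet> i) * F i x)"
        by (rule Bochner_Integration.integral_sum) (rule integrable_mult_right[OF that])
      then show ?thesis by simp
    qed
    have "(LINT x|lebesgue. h x * \<phi> x) = (LINT x|lebesgue. quot_lim u v x * \<phi> x - (\<Sum>i\<in>Basis. (v \<bullet> i) * (quot_lim u i x * \<phi> x)))"
      by (rule Bochner_Integration.integral_cong[OF refl]) (simp add: h_def left_diff_distrib sum_distrib_right mult.assoc)
    also have "\<dots> = (LINT x|lebesgue. quot_lim u v x * \<phi> x) - (\<Sum>i\<in>Basis. (v \<bullet> i) * (LINT x|lebesgue. quot_lim u i x * \<phi> x))"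
      by (simp only: Bochner_Integration.integral_diff[OF I Bochner_Integration.integrable_sum[OF integrable_mult_right[OF I]]] sumE[OF I])
    also have "\<dots> = - (LINT x|lebesgue. u x * frechet_derivative \<phi> (at x) v) + (\<Sum>i\<in>Basis. (v \<bullet> i) * (LINT x|lebesgue. u x * frechet_derivative \<phi> (at x) i))"
      by (simp add: E sum_negf)
    also have "(LINT x|lebesgue. u x * frechet_derivative \<phi> (at x) v) = (LINT x|lebesgue. (\<Sum>i\<in>Basis. (v \<bullet> i) * (u x * frechet_derivative \<phi> (at x) i)))"
    proof (rule Bochner_Integration.integral_cong[OF refl])
      fix x
      have "frechet_derivative \<phi> (at x) v = frechet_derivative \<phi> (at x) (\<Sum>i\<in>Basis. (v \<bullet> i) *\<^sub>R i)" by (simp add: euclidean_representation)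
      also have "\<dots> = (\<Sum>i\<in>Basis. (v \<bullet> i) * frechet_derivative \<phi> (at x) i)" by (simp add: linear_sum[OF lin] linear_cmul[OF lin])
      finally show "u x * frechet_derivative \<phi> (at x) v = (\<Sum>i\<in>Basis. (v \<bullet> i) * (u x * frechet_derivative \<phi> (at x) i))"
        by (simp add: sum_distrib_left mult_ac)
    qed
    also have "\<dots> = (\<Sum>i\<in>Basis. (v \<bullet> i) * (LINT x|lebesgue. u x * frechet_derivative \<phi> (at x) i))"
      by (rule sumE[OF J])
    finally have "(LINT x|lebesgue. h x * \<phi> x) = 0" by simp
    then show "(LINT x:UNIV|lebesgue. h x * \<phi> x) = 0" by (simp add: set_lebesgue_integral_def)
  qed
  then show ?thesis by eventually_elim (simp add: h_def)
qed

definition lip_grad :: "('a::euclidean_space \<Rightarrow> real) \<Rightarrow> 'a \<Rightarrow> 'a" where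
  "lip_grad u x = (\<Sum>i\<in>Basis. quot_lim u i x *\<^sub>R i)"

text \<open>Outside a single null set the directional derivatives along a countable dense set of
  directions exist and are given by \<open>lip_grad\<close>. A finite net of the unit ball chosen
  from these directions, together with the Lipschitz bound, makes the approximation uniform over all
  directions.\<close>

lemma rademacher_real:
  fixes u :: "'a::euclidean_space \<Rightarrow> real"
  assumes u: "L-lipschitz_on UNIV u"
  shows "AE x in lebesgue. (u has_derivative (\<lambda>h. lip_grad u x \<bullet> h)) (at x)"
proof -
  have L: "L \<ge> 0" using u by (rule lipschitz_on_nonneg)
  obtain Q where Q: "countable Q" "\<And>X::'a set. open X \<Longrightarrow> X \<noteq> {} \<Longrightarrow> \<exists>d\<in>Q. d \<in> X" using countable_dense_setE by blast
  have "AE x in lebesgue. \<forall>v\<in>Q. ((\<lambda>t. u (x + t *\<^sub>R v)) has_real_derivative quot_lim u v x) (at 0)"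
    by (rule AE_ball_countable'[OF _ Q(1)]) (rule lipschitz_quot_lim_facts(2)[OF u])
  moreover have "AE x in lebesgue. \<forall>v\<in>Q. quot_lim u v x = (\<Sum>i\<in>Basis. (v \<bullet> i) * quot_lim u i x)"
    by (rule AE_ball_countable'[OF _ Q(1)]) (rule quot_lim_linear_AE[OF u])
  ultimately show ?thesis
  proof eventually_elim
    case (elim x)
    let ?g = "lip_grad u x"
    have dq: "((\<lambda>h. diff_quot u v h x) \<longlongrightarrow> ?g \<bullet> v) (at 0)" if "v \<in> Q" for v
    proof -
      have "?g \<bullet> v = (\<Sum>i\<in>Basis. quot_lim u i x * (i \<bullet> v))"
        by (simp only: lip_grad_def inner_sum_left inner_scaleR_left)
      also have "\<dots> = (\<Sum>i\<in>Basis. (v \<bullet> i) * quot_lim u i x)"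
        by (rule sum.cong) (simp_all add: inner_commute mult.commute)
      also have "\<dots> = quot_lim u v x" using elim(2) that by simp
      finally have "quot_lim u v x = ?g \<bullet> v" by (rule sym)
      moreover have "((\<lambda>t. u (x + t *\<^sub>R v)) has_real_derivative quot_lim u v x) (at 0)" using elim(1) that by (rule bspec)
      ultimately show ?thesis by (simp only: directional_derivative_iff)
    qed
    show ?case
      unfolding has_derivative_at_alt
    proof (intro conjI allI impI)
      show "bounded_linear ((\<bullet>) ?g)" by (rule bounded_linear_inner_right)
      fix e :: real assume e: "e > 0"
      \<comment> \<open>Three errors are to be absorbed, with t the distance to x: e' t along the
        net direction, L e' t from moving the argument of u, and \<open>norm ?g\<close> times e' t
        from moving the argument of the linear part.\<close>
      define e' where "e' = e / (L + norm ?g + 2)"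
      have s: "L + norm ?g + 2 > 0" using L norm_ge_zero[of ?g] by linarith
      have e': "e' > 0" using e s by (simp add: e'_def)
      have "cball 0 1 \<subseteq> (\<Union>q\<in>Q. ball q e')"
      proof
        fix w :: 'a
        obtain q where "q \<in> Q" "q \<in> ball w e'" using Q(2)[of "ball w e'"] e' by auto
        then show "w \<in> (\<Union>q\<in>Q. ball q e')" by (auto simp: dist_commute)
      qed
      then obtain F where F: "F \<subseteq> Q" "finite F" "cball 0 1 \<subseteq> (\<Union>q\<in>F. ball q e')"
        using compactE_image[of "cball (0::'a) 1" Q "\<lambda>q. ball q e'"] by auto
      have "\<forall>q\<in>F. \<forall>\<^sub>F h in at 0. \<bar>diff_quot u q h x - ?g \<bullet> q\<bar> < e'"
        using tendstoD[OF dq e'] F(1) by (auto simp: dist_real_def)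
      then have "\<forall>\<^sub>F h in at 0. \<forall>q\<in>F. \<bar>diff_quot u q h x - ?g \<bullet> q\<bar> < e'" using F(2) by (simp add: eventually_ball_finite)
      then obtain d where d: "d > 0" "\<And>h q. h \<noteq> 0 \<Longrightarrow> \<bar>h\<bar> < d \<Longrightarrow> q \<in> F \<Longrightarrow> \<bar>diff_quot u q h x - ?g \<bullet> q\<bar> < e'"
        unfolding eventually_at dist_real_def by auto
      have "norm (u y - u x - ?g \<bullet> (y - x)) \<le> e * norm (y - x)" if y: "norm (y - x) < d" for y
      proof (cases "y = x")
        case False
        define t where "t = norm (y - x)"
        have t: "t > 0" "t < d" using False y by (auto simp: t_def)
        define w where "w = (y - x) /\<^sub>R t"
        have w: "norm w = 1" "y = x + t *\<^sub>R w" using t False by (auto simp: w_def t_def)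
        have "w \<in> cball 0 1" using w(1) by simp
        then obtain q where q: "q \<in> F" "w \<in> ball q e'" using F(3) by blast
        then have q: "q \<in> F" "norm (w - q) < e'" by (simp_all add: dist_norm norm_minus_commute)
        have 1: "\<bar>u (x + t *\<^sub>R q) - u x - t * (?g \<bullet> q)\<bar> \<le> e' * t"
        proof -
          have "\<bar>diff_quot u q t x - ?g \<bullet> q\<bar> < e'" using d(2)[of t q] t q by simp
          then have "t * \<bar>diff_quot u q t x - ?g \<bullet> q\<bar> \<le> t * e'" using t by (intro mult_left_mono) auto
          moreover have "t * \<bar>diff_quot u q t x - ?g \<bullet> q\<bar> = \<bar>t * (diff_quot u q t x - ?g \<bullet> q)\<bar>" using t by (simp add: abs_mult)
          moreover have "t * diff_quot u q t x = u (x + t *\<^sub>R q) - u x" using t by (simp add: diff_quot_def)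
          then have "t * (diff_quot u q t x - ?g \<bullet> q) = u (x + t *\<^sub>R q) - u x - t * (?g \<bullet> q)"
            by (simp only: right_diff_distrib)
          ultimately show ?thesis by (simp add: mult.commute)
        qed
        have 2: "\<bar>u y - u (x + t *\<^sub>R q)\<bar> \<le> L * (e' * t)"
        proof -
          have "dist (u y) (u (x + t *\<^sub>R q)) \<le> L * dist y (x + t *\<^sub>R q)" using lipschitz_onD[OF u] by simp
          also have "dist y (x + t *\<^sub>R q) = t * norm (w - q)" using w(2) t by (simp add: dist_norm scaleR_diff_right[symmetric])
          also have "L * (t * norm (w - q)) \<le> L * (e' * t)" using q t L by (intro mult_left_mono) (auto simp: mult.commute)
          finally show ?thesis by (simp add: dist_real_def)
        qed
        have 3: "\<bar>t * (?g \<bullet> q) - ?g \<bullet> (y - x)\<bar> \<le> norm ?g * (e' * t)"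
        proof -
          have "t * (?g \<bullet> q) - ?g \<bullet> (y - x) = ?g \<bullet> (t *\<^sub>R (q - w))" using w(2) by (simp add: inner_diff_right algebra_simps)
          also have "\<bar>\<dots>\<bar> \<le> norm ?g * norm (t *\<^sub>R (q - w))" by (rule Cauchy_Schwarz_ineq2)
          also have "\<dots> \<le> norm ?g * (e' * t)" using q t by (intro mult_left_mono) (auto simp: norm_minus_commute mult.commute)
          finally show ?thesis .
        qed
        have "\<bar>u y - u x - ?g \<bullet> (y - x)\<bar> \<le> e' * t + L * (e' * t) + norm ?g * (e' * t)" using 1 2 3 by linarith
        also have "\<dots> \<le> (L + norm ?g + 2) * (e' * t)" using e' t by (simp add: algebra_simps)
        also have "\<dots> = e * t" using s by (simp add: e'_def)
        finally show ?thesis by (simp add: t_def)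
      qed simp
      then show "\<exists>d>0. \<forall>y. norm (y - x) < d \<longrightarrow> norm (u y - u x - ?g \<bullet> (y - x)) \<le> e * norm (y - x)" using d(1) by blast
    qed
  qed
qed

text \<open>The vector-valued form serves the Lipschitz maps that parametrise K, the real-valued one
  the energy.\<close>

theorem rademacher:
  fixes f :: "'a::euclidean_space \<Rightarrow> 'b::euclidean_space"
  assumes f: "L-lipschitz_on UNIV f"
  shows "negligible {x. \<not> f differentiable (at x)}"
proof -
  have fi: "L-lipschitz_on UNIV (\<lambda>x. f x \<bullet> i)" if "i \<in> Basis" for i
  proof (rule lipschitz_onI)
    fix x y
    have "dist (f x \<bullet> i) (f y \<bullet> i) \<le> dist (f x) (f y)"
      using Basis_le_norm[OF that, of "f x - f y"] by (simp add: dist_norm inner_diff_left)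
    also have "\<dots> \<le> L * dist x y" using lipschitz_onD[OF f] by simp
    finally show "dist (f x \<bullet> i) (f y \<bullet> i) \<le> L * dist x y" .
  qed (rule lipschitz_on_nonneg[OF f])
  have "AE x in lebesgue. \<forall>i\<in>Basis. (\<lambda>x. f x \<bullet> i) differentiable (at x)"
  proof (rule AE_ball_countable'[OF _ countable_finite[OF finite_Basis]])
    fix i :: 'b assume "i \<in> Basis"
    from rademacher_real[OF fi[OF this]] show "AE x in lebesgue. (\<lambda>x. f x \<bullet> i) differentiable (at x)"
      by eventually_elim (auto simp: differentiable_def)
  qed
  then have "AE x in lebesgue. f differentiable (at x)"
    by eventually_elim (rule differentiable_componentwise_within[THEN iffD2])
  from this[unfolded eventually_ae_filter_negligible]
  obtain N where "negligible N" "{x. \<not> f differentiable (at x)} \<subseteq> N" by (elim exE conjE)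
  then show ?thesis by (rule negligible_subset)
qed

section \<open>Existence and uniqueness of weak gradients\<close>

lemma weak_gradient_lipschitz:
  fixes u :: "'a::euclidean_space \<Rightarrow> real"
  assumes u: "L-lipschitz_on UNIV u"
  shows "weak_gradient U u (lip_grad u)"
proof -
  note F = lipschitz_quot_lim_facts[OF u]
  have c: "lip_grad u x \<bullet> i = quot_lim u i x" if "i \<in> Basis" for i x
    using that by (simp add: lip_grad_def)
  have "L2loc U (quot_lim u i)" for i
  proof -
    have m: "(\<lambda>x. (quot_lim u i x)\<^sup>2) \<in> borel_measurable lebesgue" by (rule borel_measurable_power[OF F(1)])
    have b: "AE x in lebesgue. \<bar>(quot_lim u i x)\<^sup>2\<bar> \<le> (L * norm i)\<^sup>2"
      using F(3)[of i] by eventually_elim (metis abs_ge_zero abs_power2 power2_abs power_mono)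
    show ?thesis unfolding L2loc_def using F(1) set_integrable_AE_bounded[OF m b] by blast
  qed
  moreover have "(LINT x:U|lebesgue. u x * frechet_derivative \<phi> (at x) i) = - (LINT x:U|lebesgue. quot_lim u i x * \<phi> x)"
    if "test_fun U \<phi>" for \<phi> i
    by (rule integration_by_parts_lipschitz(2)[OF u that F(1) F(2)])
  ultimately show ?thesis unfolding weak_gradient_def by (simp add: c cong: ball_cong)
qed

lemma L2loc_set_integrable:
  assumes g: "L2loc U g" and K: "compact K" "K \<subseteq> U"
  shows "set_integrable lebesgue K g"
proof -
  have gm: "g \<in> borel_measurable lebesgue" and gi: "set_integrable lebesgue K (\<lambda>x. (g x)\<^sup>2)"
    using g K unfolding L2loc_def by auto
  have Km: "K \<in> sets lebesgue" using lmeasurable_compact[OF K(1)] by (rule fmeasurableD)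
  have "set_integrable lebesgue K (\<lambda>x. 1 :: real)"
    by (rule set_integrable_AE_bounded[OF borel_measurable_const _ K(1), of 1 1]) simp
  from set_integral_add(1)[OF this gi] have I: "set_integrable lebesgue K (\<lambda>x. 1 + (g x)\<^sup>2)" .
  show ?thesis
  proof (rule set_integrable_bound[OF I])
    show "set_borel_measurable lebesgue K g"
      unfolding set_borel_measurable_def by (rule borel_measurable_scaleR[OF borel_measurable_indicator[OF Km] gm])
    have "\<bar>t\<bar> \<le> \<bar>1 + t\<^sup>2\<bar>" for t :: real
    proof -
      have "0 \<le> (\<bar>t\<bar> - 1)\<^sup>2" by simp
      then have "2 * \<bar>t\<bar> \<le> 1 + t\<^sup>2" by (simp add: power2_diff)
      then show ?thesis using abs_ge_zero[of t] by linarith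
    qed
    then show "AE x in lebesgue. x \<in> K \<longrightarrow> norm (g x) \<le> norm (1 + (g x)\<^sup>2)" by simp
  qed
qed

text \<open>Both gradients have the same pairing with every test function, so the fundamental lemma
  applies to each component of the difference. Square integrability on compact sets supplies the
  local integrability it asks for.\<close>

lemma weak_gradient_unique:
  fixes g h :: "'a::euclidean_space \<Rightarrow> 'a"
  assumes U: "open U" and g: "weak_gradient U u g" and h: "weak_gradient U u h"
  shows "AE x in lebesgue. x \<in> U \<longrightarrow> g x = h x"
proof -
  have "AE x in lebesgue. x \<in> U \<longrightarrow> g x \<bullet> i - h x \<bullet> i = 0" if i: "i \<in> Basis" for i
  proof (rule AE_zero_if_orthogonal_to_test_functions[OF U])
    have gL: "L2loc U (\<lambda>x. g x \<bullet> i)" and hL: "L2loc U (\<lambda>x. h x \<bullet> i)" using g h i unfolding weak_gradient_def by auto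
    have gm: "(\<lambda>x. g x \<bullet> i) \<in> borel_measurable lebesgue" and hm: "(\<lambda>x. h x \<bullet> i) \<in> borel_measurable lebesgue"
      using gL hL unfolding L2loc_def by auto
    show "(\<lambda>x. g x \<bullet> i - h x \<bullet> i) \<in> borel_measurable lebesgue" by (rule borel_measurable_diff[OF gm hm])
    show si: "set_integrable lebesgue K (\<lambda>x. g x \<bullet> i - h x \<bullet> i)" if "compact K" "K \<subseteq> U" for K
      by (rule set_integral_diff(1)[OF L2loc_set_integrable[OF gL that] L2loc_set_integrable[OF hL that]])
    fix \<phi> :: "'a \<Rightarrow> real" assume \<phi>: "test_fun U \<phi>"
    define C where "C = closure {x. \<phi> x \<noteq> 0}"
    have C: "compact C" "C \<subseteq> U" and sm: "smooth_on UNIV \<phi>" using \<phi> by (auto simp: test_fun_def C_def)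
    have \<phi>0: "\<phi> x = 0" if "x \<notin> C" for x using that closure_subset[of "{x. \<phi> x \<noteq> 0}"] by (auto simp: C_def)
    obtain B where B: "B \<ge> 0" "\<And>x. \<bar>\<phi> x\<bar> \<le> B" using continuous_vanishing_bounded[OF smooth_onD(2)[OF sm] C(1) \<phi>0] by blast
    have \<phi>m: "\<phi> \<in> borel_measurable lebesgue"
      by (rule measurable_completion) (simp add: borel_measurable_continuous_onI[OF smooth_onD(2)[OF sm]])
    have Cm: "C \<in> sets lebesgue" "U \<in> sets lebesgue" using lmeasurable_compact[OF C(1)] U by (auto intro: fmeasurableD)
    have int: "set_integrable lebesgue U (\<lambda>x. k x * \<phi> x)" if k: "L2loc U k" for k
    proof -
      have km: "k \<in> borel_measurable lebesgue" using k by (simp add: L2loc_def)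
      have I: "integrable lebesgue (\<lambda>x. B * (indicator C x *\<^sub>R k x))"
        using L2loc_set_integrable[OF k C] unfolding set_integrable_def by (rule integrable_mult_right)
      show ?thesis
        unfolding set_integrable_def
      proof (rule Bochner_Integration.integrable_bound[OF I])
        show "(\<lambda>x. indicator U x *\<^sub>R (k x * \<phi> x)) \<in> borel_measurable lebesgue"
          by (rule borel_measurable_scaleR[OF borel_measurable_indicator[OF Cm(2)] borel_measurable_times[OF km \<phi>m]])
        have "norm (indicator U x *\<^sub>R (k x * \<phi> x)) \<le> norm (B * (indicator C x *\<^sub>R k x))" for x
        proof (cases "x \<in> C")
          case True
          have "\<bar>k x\<bar> * \<bar>\<phi> x\<bar> \<le> \<bar>k x\<bar> * B" by (intro mult_left_mono B) simp
          then show ?thesis using True C(2) B(1) by (auto simp: abs_mult mult.commute subset_iff)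
        qed (simp add: \<phi>0)
        then show "AE x in lebesgue. norm (indicator U x *\<^sub>R (k x * \<phi> x)) \<le> norm (B * (indicator C x *\<^sub>R k x))" by simp
      qed
    qed
    have "(LINT x:U|lebesgue. (g x \<bullet> i - h x \<bullet> i) * \<phi> x) = (LINT x:U|lebesgue. (g x \<bullet> i) * \<phi> x - (h x \<bullet> i) * \<phi> x)"
      by (simp only: left_diff_distrib)
    also have "\<dots> = (LINT x:U|lebesgue. (g x \<bullet> i) * \<phi> x) - (LINT x:U|lebesgue. (h x \<bullet> i) * \<phi> x)"
      by (rule set_integral_diff(2)[OF int[OF gL] int[OF hL]])
    also have "\<dots> = 0"
    proof -
      have "(LINT x:U|lebesgue. u x * frechet_derivative \<phi> (at x) i) = - (LINT x:U|lebesgue. (k x \<bullet> i) * \<phi> x)"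
        if "weak_gradient U u k" for k using that i \<phi> unfolding weak_gradient_def by simp
      from this[OF g] this[OF h] show ?thesis by linarith
    qed
    finally show "(LINT x:U|lebesgue. (g x \<bullet> i - h x \<bullet> i) * \<phi> x) = 0" .
  qed
  then have "AE x in lebesgue. \<forall>i\<in>(Basis::'a set). x \<in> U \<longrightarrow> g x \<bullet> i - h x \<bullet> i = 0"
    by (intro AE_ball_countable'[OF _ countable_finite[OF finite_Basis]])
  then show ?thesis by eventually_elim (auto intro: euclidean_eqI)
qed

text \<open>Turns an energy estimate into a pointwise one: the bound is demanded only where u is
  classically differentiable, with g the derivative there, so later arguments never meet the weak
  gradient hidden in \<open>AC\<close>.\<close>

lemma AC_le_nn_integral:
  fixes u :: "'a::euclidean_space \<Rightarrow> real"
  assumes u: "L-lipschitz_on UNIV u" and U: "open U"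
    and B: "\<And>x g. x \<in> U \<Longrightarrow> (u has_derivative (\<lambda>h. g \<bullet> h)) (at x) \<Longrightarrow> ennreal (\<epsilon> * (norm g)\<^sup>2 + W (u x) / \<epsilon>) \<le> B x"
  shows "AC W \<epsilon> u U \<le> (\<integral>\<^sup>+x\<in>U. B x \<partial>lebesgue)"
proof -
  define g where "g = (SOME g. weak_gradient U u g)"
  have "weak_gradient U u g" unfolding g_def 
    by (rule someI[of "weak_gradient U u", OF weak_gradient_lipschitz[OF u]])
  from weak_gradient_unique[OF U this weak_gradient_lipschitz[OF u]] rademacher_real[OF u]
  have "AE x in lebesgue. ennreal (\<epsilon> * (norm (g x))\<^sup>2 + W (u x) / \<epsilon>) * indicator U x \<le> B x * indicator U x"
  proof eventually_elim
    case (elim x)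
    then show ?case using B[of x "lip_grad u x"] by (cases "x \<in> U") auto
  qed
  then show ?thesis unfolding AC_def g_def[symmetric] Let_def by (rule nn_integral_mono_AE)
qed

lemma W12loc_lipschitz:
  fixes u :: "'a::euclidean_space \<Rightarrow> real"
  assumes u: "L-lipschitz_on UNIV u" and b: "\<And>x. \<bar>u x\<bar> \<le> B"
  shows "W12loc U u"
proof -
  have m: "u \<in> borel_measurable lebesgue"
    by (rule measurable_completion) (simp add: borel_measurable_continuous_onI[OF lipschitz_on_continuous_on[OF u]])
  have b2: "AE x in lebesgue. \<bar>(u x)\<^sup>2\<bar> \<le> B\<^sup>2"
    by (rule AE_I2) (metis abs_ge_zero abs_power2 b power2_abs power_mono)
  have "L2loc U u" unfolding L2loc_def
    using m set_integrable_AE_bounded[OF borel_measurable_power[OF m] b2] by blast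
  then show ?thesis unfolding W12loc_def using weak_gradient_lipschitz[OF u] by blast
qed

section \<open>Hausdorff measure\<close>

lemma hausdorff_pre_mono: "A \<subseteq> B \<Longrightarrow> hausdorff_pre m d A \<le> hausdorff_pre m d B"
  unfolding hausdorff_pre_def by (rule INF_superset_mono) auto

lemma hausdorff_pre_antimono: "d \<le> d' \<Longrightarrow> hausdorff_pre m d' A \<le> hausdorff_pre m d A"
  unfolding hausdorff_pre_def by (rule INF_superset_mono) (auto intro: order_trans)

lemma hausdorff_mono: "A \<subseteq> B \<Longrightarrow> hausdorff m A \<le> hausdorff m B"
  unfolding hausdorff_def by (intro SUP_mono) (auto intro: hausdorff_pre_mono)

lemma hausdorff_pre_le_hausdorff: "d > 0 \<Longrightarrow> hausdorff_pre m d A \<le> hausdorff m A"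
  unfolding hausdorff_def by (intro SUP_upper) auto

lemma hausdorff_leI: "(\<And>d. d > 0 \<Longrightarrow> hausdorff_pre m d A \<le> c) \<Longrightarrow> hausdorff m A \<le> c"
  unfolding hausdorff_def by (intro SUP_least) auto

lemma hausdorff_pre_le_suminf:
  assumes "A \<subseteq> (\<Union>i. C i)" "\<And>i. bounded (C i)" "\<And>i. diameter (C i) \<le> d"
  shows "hausdorff_pre m d A \<le> (\<Sum>i. ennreal (unit_ball_vol (real m) * (diameter (C i) / 2) ^ m))"
  unfolding hausdorff_pre_def by (rule INF_lower) (use assms in auto)

lemma hausdorff_pre_lessE:
  fixes A :: "'a::metric_space set"
  assumes "hausdorff_pre m d A < c"
  obtains C :: "nat \<Rightarrow> 'a set" where "A \<subseteq> (\<Union>i. C i)" "\<And>i. bounded (C i)" "\<And>i. diameter (C i) \<le> d"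
    "(\<Sum>i. ennreal (unit_ball_vol (real m) * (diameter (C i) / 2) ^ m)) < c"
proof -
  from assms show ?thesis unfolding hausdorff_pre_def INF_less_iff by (blast intro: that)
qed

lemma hausdorff_pre_subadditive:
  "hausdorff_pre m d (\<Union>i. A i) \<le> (\<Sum>i. hausdorff_pre m d (A i))"
proof (rule ennreal_le_epsilon)
  fix e :: real assume fin: "(\<Sum>i. hausdorff_pre m d (A i)) < top" and e: "e > 0"
  have f: "hausdorff_pre m d (A i) < top" for i
    by (rule ennreal_suminf_lessD[OF fin])
  let ?t = "\<lambda>C. ennreal (unit_ball_vol (real m) * (diameter C / 2) ^ m)"
  have "\<exists>C::nat \<Rightarrow> 'a set. A i \<subseteq> (\<Union>k. C k) \<and> (\<forall>k. bounded (C k) \<and> diameter (C k) \<le> d) \<and>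
     (\<Sum>k. ?t (C k)) < hausdorff_pre m d (A i) + ennreal (e * (1 / 2) ^ Suc i)" for i
  proof -
    have "hausdorff_pre m d (A i) < hausdorff_pre m d (A i) + ennreal (e * (1 / 2) ^ Suc i)"
      using f[of i] e by (cases "hausdorff_pre m d (A i)" rule: ennreal_cases)
        (auto simp: ennreal_plus[symmetric] ennreal_less_iff simp del: ennreal_plus)
    then show ?thesis by (rule hausdorff_pre_lessE) blast
  qed
  then obtain C where C: "\<And>i. A i \<subseteq> (\<Union>k::nat. C i k)" "\<And>i k. bounded (C i k)" "\<And>i k. diameter (C i k) \<le> d"
    "\<And>i. (\<Sum>k. ?t (C i k)) < hausdorff_pre m d (A i) + ennreal (e * (1 / 2) ^ Suc i)" by metis
  define D where "D = (\<lambda>n. case prod_decode n of (i, k) \<Rightarrow> C i k)"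
  have "hausdorff_pre m d (\<Union>i. A i) \<le> (\<Sum>n. ?t (D n))"
  proof (rule hausdorff_pre_le_suminf)
    show "(\<Union>i. A i) \<subseteq> (\<Union>n. D n)"
    proof
      fix x assume "x \<in> (\<Union>i. A i)"
      then obtain i k where "x \<in> C i k" using C(1) by blast
      then have "x \<in> D (prod_encode (i, k))" by (simp add: D_def)
      then show "x \<in> (\<Union>n. D n)" by blast
    qed
  qed (auto simp: D_def C split: prod.split)
  also have "(\<Sum>n. ?t (D n)) = (\<Sum>n. (\<lambda>(i, k). ?t (C i k)) (prod_decode n))"
    by (simp add: D_def split_def)
  also have "\<dots> = (\<Sum>i. \<Sum>k. ?t (C i k))"
    by (rule suminf_ennreal_2dimen) simp
  also have "\<dots> \<le> (\<Sum>i. hausdorff_pre m d (A i) + ennreal (e * (1 / 2) ^ Suc i))"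
    by (intro suminf_le less_imp_le C) auto
  also have "\<dots> = (\<Sum>i. hausdorff_pre m d (A i)) + (\<Sum>i. ennreal (e * (1 / 2) ^ Suc i))"
    by (intro suminf_add[symmetric]) auto
  also have "(\<Sum>i. ennreal (e * (1 / 2) ^ Suc i)) = ennreal e"
  proof -
    have "(\<lambda>i. e * (1 / 2) ^ Suc i) sums (e * 1)" by (intro sums_mult power_half_series)
    then show ?thesis using e by (subst suminf_ennreal_eq) (auto simp: sums_iff)
  qed
  finally show "hausdorff_pre m d (\<Union>i. A i) \<le> (\<Sum>i. hausdorff_pre m d (A i)) + ennreal e" .
qed

lemma hausdorff_subadditive: "hausdorff m (\<Union>i. A i) \<le> (\<Sum>i. hausdorff m (A i))"
proof (rule hausdorff_leI)
  fix d :: real assume "d > 0"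
  have "hausdorff_pre m d (\<Union>i. A i) \<le> (\<Sum>i. hausdorff_pre m d (A i))"
    by (rule hausdorff_pre_subadditive)
  also have "\<dots> \<le> (\<Sum>i. hausdorff m (A i))"
    by (intro suminf_le hausdorff_pre_le_hausdorff \<open>d > 0\<close>) auto
  finally show "hausdorff_pre m d (\<Union>i. A i) \<le> (\<Sum>i. hausdorff m (A i))" .
qed

text \<open>For m = 0 each empty covering set would count as \<open>0 ^ 0 = 1\<close>; this is why m
  > 0 is carried through the following lemmas.\<close>

lemma hausdorff_pre_empty: assumes "m > 0" "d \<ge> 0" shows "hausdorff_pre m d {} = 0"
proof -
  have "hausdorff_pre m d ({}::'a set) \<le> (\<Sum>i::nat. ennreal (unit_ball_vol (real m) * (diameter ({}::'a set) / 2) ^ m))"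
    by (rule hausdorff_pre_le_suminf) (use assms in auto)
  moreover have "(0::real) ^ m = 0" using assms by (simp add: zero_power)
  ultimately show ?thesis by simp
qed

lemma hausdorff_empty [simp]: "m > 0 \<Longrightarrow> hausdorff m {} = 0"
  unfolding hausdorff_def by (simp add: hausdorff_pre_empty)

lemma suminf_two: "(\<Sum>i. if i = 0 then a else if i = Suc 0 then b else (0::ennreal)) = a + b"
proof -
  have "(\<Sum>i. if i = 0 then a else if i = Suc 0 then b else (0::ennreal)) = (\<Sum>i\<in>{0, Suc 0}. if i = 0 then a else if i = Suc 0 then b else 0)"
    by (rule suminf_finite) auto
  then show ?thesis by simp
qed

lemma hausdorff_pre_Un:
  assumes "m > 0" "d \<ge> 0" shows "hausdorff_pre m d (A \<union> B) \<le> hausdorff_pre m d A + hausdorff_pre m d B"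
proof -
  have "A \<union> B = (\<Union>i::nat. if i = 0 then A else if i = Suc 0 then B else {})" by (auto split: if_splits)
  also have "hausdorff_pre m d \<dots> \<le> (\<Sum>i::nat. hausdorff_pre m d (if i = 0 then A else if i = Suc 0 then B else {}))"
    by (rule hausdorff_pre_subadditive)
  also have "(\<lambda>i::nat. hausdorff_pre m d (if i = 0 then A else if i = Suc 0 then B else {})) =
      (\<lambda>i. if i = 0 then hausdorff_pre m d A else if i = Suc 0 then hausdorff_pre m d B else 0)"
    using assms by (auto simp: hausdorff_pre_empty)
  finally show ?thesis by (simp add: suminf_two)
qed

lemma hausdorff_Un: "m > 0 \<Longrightarrow> hausdorff m (A \<union> B) \<le> hausdorff m A + hausdorff m B"
  by (intro hausdorff_leI order_trans[OF hausdorff_pre_Un] add_mono hausdorff_pre_le_hausdorff) auto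

lemma hausdorff_null_UN:
  assumes "countable I" "m > 0" "\<And>i. i \<in> I \<Longrightarrow> hausdorff m (A i) = 0" shows "hausdorff m (\<Union>i\<in>I. A i) = 0"
proof (cases "I = {}")
  case False
  then have "(\<Union>i\<in>I. A i) = (\<Union>n. A (from_nat_into I n))"
    using assms(1) by (metis range_from_nat_into image_image)
  also have "hausdorff m \<dots> \<le> (\<Sum>n. hausdorff m (A (from_nat_into I n)))" by (rule hausdorff_subadditive)
  also have "\<dots> = 0" using assms False by (simp add: from_nat_into)
  finally show ?thesis by simp
qed (use assms in simp)

text \<open>A covering by an arbitrary countable family becomes a sequence padded with empty sets.
  The sum is written as an integral over \<open>count_space I\<close>, the form in which disjoint
  unions of balls are measured later.\<close>

lemma hausdorff_pre_cover:
  fixes S :: "'i \<Rightarrow> 'a::metric_space set"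
  assumes m: "m > 0" and d: "d \<ge> 0" and I: "countable I" and A: "A \<subseteq> (\<Union>i\<in>I. S i)"
    and S: "\<And>i. i \<in> I \<Longrightarrow> bounded (S i)" "\<And>i. i \<in> I \<Longrightarrow> diameter (S i) \<le> 2 * r i" "\<And>i. i \<in> I \<Longrightarrow> 2 * r i \<le> d"
  shows "hausdorff_pre m d A \<le> (\<integral>\<^sup>+i. ennreal (unit_ball_vol (real m) * r i ^ m) \<partial>count_space I)"
proof -
  define g where "g = to_nat_on I"
  have g: "inj_on g I" using I by (simp add: g_def inj_on_to_nat_on)
  define C where "C = (\<lambda>n. if n \<in> g ` I then S (inv_into I g n) else {})"
  have "hausdorff_pre m d A \<le> (\<Sum>n. ennreal (unit_ball_vol (real m) * (diameter (C n) / 2) ^ m))"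
  proof (rule hausdorff_pre_le_suminf)
    show "A \<subseteq> (\<Union>n. C n)"
    proof
      fix x assume "x \<in> A" then obtain i where "i \<in> I" "x \<in> S i" using A by auto
      then have "x \<in> C (g i)" using g by (simp add: C_def)
      then show "x \<in> (\<Union>n. C n)" by blast
    qed
    show "bounded (C i)" for i using S(1) g by (auto simp: C_def)
    show "diameter (C i) \<le> d" for i using order_trans[OF S(2) S(3)] g d by (auto simp: C_def)
  qed
  also have "\<dots> \<le> (\<Sum>n. ennreal (unit_ball_vol (real m) * r (inv_into I g n) ^ m) * indicator (g ` I) n)"
  proof (intro suminf_le)
    fix n
    show "ennreal (unit_ball_vol (real m) * (diameter (C n) / 2) ^ m)
      \<le> ennreal (unit_ball_vol (real m) * r (inv_into I g n) ^ m) * indicator (g ` I) n"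
    proof (cases "n \<in> g ` I")
      case True
      then have "diameter (C n) / 2 \<le> r (inv_into I g n)" "bounded (C n)"
        using S(1,2)[of "inv_into I g n"] by (auto simp: C_def inv_into_into)
      then show ?thesis using True
        by (auto intro!: ennreal_leI mult_left_mono power_mono simp: diameter_ge_0)
    next
      case False then show ?thesis using m by (simp add: C_def zero_power)
    qed
  qed auto
  also have "\<dots> = (\<integral>\<^sup>+n. ennreal (unit_ball_vol (real m) * r (inv_into I g n) ^ m) * indicator (g ` I) n \<partial>count_space UNIV)"
    by (simp add: nn_integral_count_space_nat)
  also have "\<dots> = (\<integral>\<^sup>+n. ennreal (unit_ball_vol (real m) * r (inv_into I g n) ^ m) \<partial>count_space (g ` I))"
    by (simp add: nn_integral_count_space_indicator)
  also have "\<dots> = (\<integral>\<^sup>+i. ennreal (unit_ball_vol (real m) * r (inv_into I g (g i)) ^ m) \<partial>count_space I)"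
    by (rule nn_integral_bij_count_space[symmetric]) (use g in \<open>simp add: bij_betw_def\<close>)
  also have "\<dots> = (\<integral>\<^sup>+i. ennreal (unit_ball_vol (real m) * r i ^ m) \<partial>count_space I)"
    using g by (intro nn_integral_cong) simp
  finally show ?thesis .
qed

text \<open>A covering set of diameter below e meets at most one of A and B, so every fine covering
  of the union splits into two coverings.\<close>

lemma hausdorff_metric_additive:
  assumes m: "m > 0" and e: "e > 0" and sep: "\<And>a b. a \<in> A \<Longrightarrow> b \<in> B \<Longrightarrow> e \<le> dist a b"
  shows "hausdorff m (A \<union> B) = hausdorff m A + hausdorff m B"
proof (rule antisym[OF hausdorff_Un[OF m]])
  have small: "hausdorff_pre m d A + hausdorff_pre m d B \<le> hausdorff_pre m d (A \<union> B)" if "0 < d" "d < e" for d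
    unfolding hausdorff_pre_def[of m d "A \<union> B"]
  proof (rule INF_greatest, safe)
    fix C :: "nat \<Rightarrow> 'a set" assume C: "A \<union> B \<subseteq> (\<Union>i. C i)" "\<forall>i. bounded (C i) \<and> diameter (C i) \<le> d"
    let ?t = "\<lambda>C. ennreal (unit_ball_vol (real m) * (diameter C / 2) ^ m)"
    have sub: "diameter (C i \<inter> X) \<le> diameter (C i)" for i X
      using C by (intro diameter_subset) auto
    have "hausdorff_pre m d X \<le> (\<Sum>i. ?t (C i \<inter> X))" if "X \<subseteq> A \<union> B" for X
    proof (rule hausdorff_pre_le_suminf)
      show "X \<subseteq> (\<Union>i. C i \<inter> X)" using that C(1) by blast
      show "bounded (C i \<inter> X)" for i using C(2) by (intro bounded_Int) simp
      show "diameter (C i \<inter> X) \<le> d" for i using sub[of i X] C(2) by (meson order_trans)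
    qed
    from this[of A] this[of B] have "hausdorff_pre m d A + hausdorff_pre m d B \<le> (\<Sum>i. ?t (C i \<inter> A)) + (\<Sum>i. ?t (C i \<inter> B))"
      by (intro add_mono) auto
    also have "\<dots> = (\<Sum>i. ?t (C i \<inter> A) + ?t (C i \<inter> B))" by (intro suminf_add) auto
    also have "\<dots> \<le> (\<Sum>i. ?t (C i))"
    proof (intro suminf_le)
      fix i
      have "C i \<inter> A = {} \<or> C i \<inter> B = {}"
      proof (rule ccontr)
        assume "\<not> ?thesis"
        then obtain a b where ab: "a \<in> C i" "a \<in> A" "b \<in> C i" "b \<in> B" by blast
        then have "dist a b \<le> d" using C(2) by (meson diameter_bounded_bound order_trans)
        then show False using sep[OF ab(2,4)] \<open>d < e\<close> by simp
      qed
      moreover have "?t (C i \<inter> X) \<le> ?t (C i)" for X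
        by (intro ennreal_leI mult_left_mono power_mono divide_right_mono sub)
          (use C in \<open>auto simp: diameter_ge_0 bounded_Int\<close>)
      ultimately show "?t (C i \<inter> A) + ?t (C i \<inter> B) \<le> ?t (C i)" using m by (auto simp: zero_power)
    qed auto
    finally show "hausdorff_pre m d A + hausdorff_pre m d B \<le> (\<Sum>i. ?t (C i))" .
  qed
  \<comment> \<open>The two scales are decoupled so that the suprema over d1 and d2 can be taken one
    after the other.\<close>
  have two: "hausdorff_pre m d1 A + hausdorff_pre m d2 B \<le> hausdorff m (A \<union> B)" if "0 < d1" "0 < d2" for d1 d2
  proof -
    define d where "d = min (min d1 d2) (e / 2)"
    have d: "0 < d" "d < e" "d \<le> d1" "d \<le> d2" using that e by (auto simp: d_def)
    have "hausdorff_pre m d1 A + hausdorff_pre m d2 B \<le> hausdorff_pre m d A + hausdorff_pre m d B"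
      by (intro add_mono hausdorff_pre_antimono d)
    also have "\<dots> \<le> hausdorff_pre m d (A \<union> B)" by (rule small[OF d(1,2)])
    also have "\<dots> \<le> hausdorff m (A \<union> B)" by (rule hausdorff_pre_le_hausdorff[OF d(1)])
    finally show ?thesis .
  qed
  have "hausdorff m A + hausdorff_pre m d2 B \<le> hausdorff m (A \<union> B)" if "0 < d2" for d2
  proof -
    have "hausdorff m A + hausdorff_pre m d2 B = (SUP d1\<in>{0<..}. hausdorff_pre m d1 A + hausdorff_pre m d2 B)"
      unfolding hausdorff_def by (rule ennreal_SUP_add_left[symmetric]) auto
    also have "\<dots> \<le> hausdorff m (A \<union> B)" using two that by (intro SUP_least) auto
    finally show ?thesis .
  qed
  then have "(SUP d2\<in>{0<..}. hausdorff m A + hausdorff_pre m d2 B) \<le> hausdorff m (A \<union> B)"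
    by (intro SUP_least) auto
  moreover have "hausdorff m A + hausdorff m B = (SUP d2\<in>{0<..}. hausdorff m A + hausdorff_pre m d2 B)"
    unfolding hausdorff_def[of m B] by (rule ennreal_SUP_add_right) simp
  ultimately show "hausdorff m A + hausdorff m B \<le> hausdorff m (A \<union> B)" by simp
qed

lemma diameter_leI: "(\<And>x y. x \<in> S \<Longrightarrow> y \<in> S \<Longrightarrow> dist x y \<le> D) \<Longrightarrow> 0 \<le> D \<Longrightarrow> diameter S \<le> D"
  unfolding diameter_def by (auto intro!: cSUP_least)

lemma hausdorff_lipschitz_image:
  assumes f: "L-lipschitz_on A f" and L: "L > 0"
  shows "hausdorff m (f ` A) \<le> ennreal (L ^ m) * hausdorff m A"
proof (rule hausdorff_leI)
  fix d :: real assume d: "d > 0"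
  let ?t = "\<lambda>D. unit_ball_vol (real m) * (D / 2) ^ m"
  let ?P = "hausdorff_pre m d (f ` A)"
  have inv: "ennreal (L ^ m) * (ennreal (inverse (L ^ m)) * x) = x" "ennreal (inverse (L ^ m)) * (ennreal (L ^ m) * x) = x" for x
    using L by (simp_all add: mult.assoc[symmetric] ennreal_mult[symmetric])
  \<comment> \<open>The factor is moved to the left as an inverse, so that the infimum on the right
    can be bounded from below covering by covering.\<close>
  have "ennreal (inverse (L ^ m)) * ?P \<le> hausdorff_pre m (d / L) A"
    unfolding hausdorff_pre_def[of m "d / L" A]
  proof (rule INF_greatest, safe)
    fix C :: "nat \<Rightarrow> 'a set" assume C: "A \<subseteq> (\<Union>i. C i)" "\<forall>i. bounded (C i) \<and> diameter (C i) \<le> d / L"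
    have D: "bounded (f ` (C i \<inter> A))" "diameter (f ` (C i \<inter> A)) \<le> L * diameter (C i)" for i
    proof -
      have *: "dist x y \<le> L * diameter (C i)" if xy: "x \<in> f ` (C i \<inter> A)" "y \<in> f ` (C i \<inter> A)" for x y
      proof -
        obtain a b where ab: "x = f a" "y = f b" "a \<in> C i" "b \<in> C i" "a \<in> A" "b \<in> A" using xy by auto
        then have "dist x y \<le> L * dist a b" using lipschitz_onD[OF f] by auto
        also have "\<dots> \<le> L * diameter (C i)" using L C ab by (intro mult_left_mono diameter_bounded_bound) auto
        finally show ?thesis .
      qed
      show "bounded (f ` (C i \<inter> A))" unfolding bounded_two_points using * by blast
      have "0 \<le> L * diameter (C i)" using L C(2) by (simp add: diameter_ge_0)
      then show "diameter (f ` (C i \<inter> A)) \<le> L * diameter (C i)"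
        using * by (intro diameter_leI)
    qed
    have "?P \<le> (\<Sum>i. ennreal (?t (diameter (f ` (C i \<inter> A)))))"
    proof (rule hausdorff_pre_le_suminf)
      show "f ` A \<subseteq> (\<Union>i. f ` (C i \<inter> A))" using C(1) by blast
      show "diameter (f ` (C i \<inter> A)) \<le> d" for i
      proof -
        have "L * diameter (C i) \<le> d" using C(2) L by (simp add: field_simps)
        then show ?thesis using D(2)[of i] by linarith
      qed
    qed (rule D)
    also have "\<dots> \<le> (\<Sum>i. ennreal (L ^ m) * ennreal (?t (diameter (C i))))"
    proof (intro suminf_le)
      fix i
      have "?t (diameter (f ` (C i \<inter> A))) \<le> ?t (L * diameter (C i))"
        by (intro mult_left_mono power_mono divide_right_mono D) (auto simp: diameter_ge_0 D)
      also have "\<dots> = L ^ m * ?t (diameter (C i))" by (simp add: power_mult_distrib power_divide)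
      finally show "ennreal (?t (diameter (f ` (C i \<inter> A)))) \<le> ennreal (L ^ m) * ennreal (?t (diameter (C i)))"
        using L C(2) by (subst ennreal_mult[symmetric]) (auto intro!: ennreal_leI mult_nonneg_nonneg simp: diameter_ge_0)
    qed auto
    also have "\<dots> = ennreal (L ^ m) * (\<Sum>i. ennreal (?t (diameter (C i))))" by simp
    finally have "ennreal (inverse (L ^ m)) * ?P \<le> ennreal (inverse (L ^ m)) * (ennreal (L ^ m) * (\<Sum>i. ennreal (?t (diameter (C i)))))"
      by (rule mult_left_mono) simp
    then show "ennreal (inverse (L ^ m)) * ?P \<le> (\<Sum>i. ennreal (?t (diameter (C i))))" by (simp only: inv)
  qed
  also have "\<dots> \<le> hausdorff m A" using d L by (intro hausdorff_pre_le_hausdorff) simp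
  finally have "ennreal (L ^ m) * (ennreal (inverse (L ^ m)) * ?P) \<le> ennreal (L ^ m) * hausdorff m A"
    by (rule mult_left_mono) simp
  then show "?P \<le> ennreal (L ^ m) * hausdorff m A" by (simp only: inv)
qed

text \<open>Caratheodory's argument for metric outer measures. X - F is exhausted by the sets
  \<open>A k\<close>, which have positive distance from F, and additivity is known for these. The
  shells \<open>R k\<close> between them have summable measure because shells of equal parity are
  separated, so the tail left out by \<open>A k\<close> tends to 0.\<close>

lemma hausdorff_closed_caratheodory:
  fixes F :: "'a::metric_space set"
  assumes m: "m > 0" and F: "closed F"
  shows "hausdorff m (X \<inter> F) + hausdorff m (X - F) \<le> hausdorff m X"
proof (cases "F = {} \<or> hausdorff m X = top")
  case True
  then show ?thesis using m by auto
next
  case False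
  then have Fne: "F \<noteq> {}" and fin: "hausdorff m X < top" by (auto simp: less_top)
  define A where "A = (\<lambda>k::nat. {x \<in> X. inverse (real (Suc k)) \<le> infdist x F})"
  define R where "R = (\<lambda>k. A (Suc k) - A k)"
  have Amono: "A j \<subseteq> A k" if "j \<le> k" for j k
    using that by (auto simp: A_def intro: order_trans[rotated] le_imp_inverse_le)
  have UA: "(\<Union>k. A k) = X - F"
  proof -
    have "x \<in> F \<longleftrightarrow> infdist x F = 0" for x using F Fne in_closed_iff_infdist_zero by blast
    moreover have "\<exists>k. inverse (real (Suc k)) \<le> infdist x F" if "infdist x F \<noteq> 0" for x
      using that reals_Archimedean[of "infdist x F"] infdist_nonneg[of x F] by (metis less_eq_real_def)
    moreover have "\<not> inverse (real (Suc k)) \<le> 0" for k by (simp add: not_le)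
    ultimately show ?thesis unfolding A_def by fastforce
  qed
  have inf: "infdist a F \<le> infdist b F + dist a b" for a b by (rule infdist_triangle)
  have step: "hausdorff m (X \<inter> F) + hausdorff m (A k) \<le> hausdorff m X" for k
  proof -
    have "hausdorff m (X \<inter> F \<union> A k) = hausdorff m (X \<inter> F) + hausdorff m (A k)"
    proof (rule hausdorff_metric_additive[OF m, where e="inverse (real (Suc k))"])
      fix a b assume "a \<in> X \<inter> F" "b \<in> A k"
      then show "inverse (real (Suc k)) \<le> dist a b"
        using infdist_le[of a F b] by (auto simp: A_def dist_commute)
    qed simp
    moreover have "hausdorff m (X \<inter> F \<union> A k) \<le> hausdorff m X" by (rule hausdorff_mono) (auto simp: A_def)
    ultimately show ?thesis by simp
  qed
  have odd_even: "(\<Sum>i<n. hausdorff m (R (2 * i + c))) \<le> hausdorff m X" for n c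
  proof -
    have "(\<Sum>i<n. hausdorff m (R (2 * i + c))) = hausdorff m (\<Union>i<n. R (2 * i + c))" for n
    proof (induction n)
      case (Suc n)
      have "hausdorff m ((\<Union>i<n. R (2 * i + c)) \<union> R (2 * n + c)) = hausdorff m (\<Union>i<n. R (2 * i + c)) + hausdorff m (R (2 * n + c))"
      proof (rule hausdorff_metric_additive[OF m])
        let ?e = "inverse (real (2 * n + c)) - inverse (real (Suc (2 * n + c)))"
        \<comment> \<open>For n = 0 and c = 0 the difference \<open>?e\<close> would be negative,
          since \<open>inverse 0 = 0\<close>; the union on the left is then empty and any positive
          separation serves.\<close>
        show "0 < (if n = 0 then 1 else ?e)" by (auto intro!: less_imp_inverse_less)
        fix a b assume a: "a \<in> (\<Union>i<n. R (2 * i + c))" and b: "b \<in> R (2 * n + c)"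
        then obtain i where i: "i < n" "a \<in> A (Suc (2 * i + c))" by (auto simp: R_def)
        then have "Suc (2 * i + c) \<le> 2 * n + c - 1" by linarith
        from Amono[OF this] have "a \<in> A (2 * n + c - 1)" using i(2) by blast
        then have "inverse (real (2 * n + c)) \<le> infdist a F" using i by (auto simp: A_def)
        moreover have "infdist b F < inverse (real (Suc (2 * n + c)))" using b by (auto simp: R_def A_def)
        ultimately have "?e \<le> dist a b" using inf[of a b] by linarith
        then show "(if n = 0 then 1 else ?e) \<le> dist a b" using i by simp
      qed
      moreover have "(\<Union>i<Suc n. R (2 * i + c)) = (\<Union>i<n. R (2 * i + c)) \<union> R (2 * n + c)" by (auto simp: less_Suc_eq)
      ultimately show ?case using Suc by simp
    qed (use m in simp)
    then show ?thesis using hausdorff_mono[of "\<Union>i<n. R (2 * i + c)" X m] by (auto simp: R_def A_def)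
  qed
  have Rsum: "(\<Sum>k. hausdorff m (R k)) \<noteq> top"
  proof -
    have "(\<Sum>k<n. hausdorff m (R k)) \<le> 2 * hausdorff m X" for n
    proof -
      have "(\<Sum>k<n. hausdorff m (R k)) \<le> (\<Sum>k<2 * n. hausdorff m (R k))" by (rule sum_mono2) auto
      also have "\<dots> = (\<Sum>i<n. hausdorff m (R (2 * i + 0))) + (\<Sum>i<n. hausdorff m (R (2 * i + 1)))"
        by (induction n) (auto simp: algebra_simps)
      also have "\<dots> \<le> hausdorff m X + hausdorff m X" by (intro add_mono odd_even)
      finally show ?thesis by (simp add: mult_2)
    qed
    then have "(\<Sum>k. hausdorff m (R k)) \<le> 2 * hausdorff m X" by (intro suminf_le_const) auto
    also have "\<dots> < top" using fin by (simp add: ennreal_mult_less_top)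
    finally show ?thesis by simp
  qed
  have "(\<lambda>k. \<Sum>j. hausdorff m (R (j + k))) \<longlonglongrightarrow> 0"
  proof -
    define r where "r = (\<lambda>k. enn2real (hausdorff m (R k)))"
    have r: "hausdorff m (R k) = ennreal (r k)" for k
      using Rsum ennreal_suminf_lessD[of "\<lambda>k. hausdorff m (R k)" top k] by (simp add: r_def less_top)
    have rs: "summable r"
      using Rsum unfolding r by (rule summable_suminf_not_top[rotated]) (simp add: r_def)
    have "(\<Sum>j. hausdorff m (R (j + k))) = ennreal (\<Sum>j. r (j + k))" for k
      unfolding r by (rule suminf_ennreal2) (use summable_ignore_initial_segment[OF rs] in \<open>auto simp: r_def\<close>)
    moreover have "(\<lambda>k. \<Sum>j. r (j + k)) \<longlonglongrightarrow> 0"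
      using rs by (rule suminf_exist_split2)
    ultimately show ?thesis by (simp flip: ennreal_0 add: tendsto_ennrealI)
  qed
  then have "(\<lambda>k. hausdorff m X + (\<Sum>j. hausdorff m (R (j + k)))) \<longlonglongrightarrow> hausdorff m X + 0"
    by (intro tendsto_add tendsto_const)
  moreover have "hausdorff m (X \<inter> F) + hausdorff m (X - F) \<le> hausdorff m X + (\<Sum>j. hausdorff m (R (j + k)))" for k
  proof -
    have "X - F \<subseteq> A k \<union> (\<Union>j. R (j + k))"
    proof
      fix x assume "x \<in> X - F"
      then obtain n where n: "x \<in> A n" using UA by blast
      show "x \<in> A k \<union> (\<Union>j. R (j + k))"
      proof (cases "x \<in> A k")
        case False
        define l where "l = (LEAST l. x \<in> A l)"
        have l: "x \<in> A l" "\<And>l'. l' < l \<Longrightarrow> x \<notin> A l'" unfolding l_def using n by (auto intro: LeastI dest: not_less_Least)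
        have "k < l" using l(1) False Amono[of l k] by (meson not_le subsetD)
        then have "x \<in> R ((l - 1 - k) + k)" using l by (simp add: R_def)
        then show ?thesis by blast
      qed simp
    qed
    then have "hausdorff m (X - F) \<le> hausdorff m (A k) + hausdorff m (\<Union>j. R (j + k))"
      by (intro order_trans[OF hausdorff_mono hausdorff_Un[OF m]])
    also have "\<dots> \<le> hausdorff m (A k) + (\<Sum>j. hausdorff m (R (j + k)))"
      by (intro add_mono hausdorff_subadditive) simp
    finally have "hausdorff m (X \<inter> F) + hausdorff m (X - F) \<le> hausdorff m (X \<inter> F) + (hausdorff m (A k) + (\<Sum>j. hausdorff m (R (j + k))))"
      by (intro add_mono) simp_all
    also have "\<dots> \<le> hausdorff m X + (\<Sum>j. hausdorff m (R (j + k)))"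
      unfolding add.assoc[symmetric] by (intro add_mono step) simp
    finally show ?thesis .
  qed
  ultimately show ?thesis by (intro LIMSEQ_le_const[of _ "hausdorff m X"]) auto
qed

definition hausdorff_measure :: "nat \<Rightarrow> 'a::metric_space measure" where
  "hausdorff_measure m = measure_of UNIV (sets borel) (hausdorff m)"

lemma sets_hausdorff_measure [simp, measurable_cong]: "sets (hausdorff_measure m) = sets borel"
  and space_hausdorff_measure [simp]: "space (hausdorff_measure m) = UNIV"
  unfolding hausdorff_measure_def using sets.sigma_sets_eq[of borel]
  by (simp_all add: sets_measure_of space_measure_of_conv)

text \<open>Closed sets split every set additively and hence lie in the Caratheodory sigma-algebra,
  which therefore contains all Borel sets.\<close>

lemma emeasure_hausdorff_measure:
  fixes A :: "'a::metric_space set"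
  assumes m: "m > 0" and A: "A \<in> sets borel"
  shows "emeasure (hausdorff_measure m) A = hausdorff m A"
proof -
  interpret P: sigma_algebra UNIV "UNIV :: 'a set set" using sigma_algebra_Pow[of "UNIV :: 'a set"] by simp
  let ?L = "lambda_system UNIV UNIV (hausdorff m :: 'a set \<Rightarrow> ennreal)"
  have "outer_measure_space UNIV (hausdorff m :: 'a set \<Rightarrow> ennreal)"
    unfolding outer_measure_space_def positive_def increasing_def countably_subadditive_def
    using m hausdorff_mono hausdorff_subadditive by auto
  from P.caratheodory_lemma[OF this] have ms: "measure_space UNIV ?L (hausdorff m)" by (simp add: Let_def)
  then interpret L: sigma_algebra UNIV ?L by (simp add: measure_space_def)
  have "F \<in> ?L" if "closed F" for F :: "'a set"
  proof -
    have "hausdorff m (F \<inter> X) + hausdorff m ((UNIV - F) \<inter> X) = hausdorff m X" for X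
    proof (rule antisym)
      show "hausdorff m (F \<inter> X) + hausdorff m ((UNIV - F) \<inter> X) \<le> hausdorff m X"
        using hausdorff_closed_caratheodory[OF m that, of X] by (simp add: Int_commute Diff_eq)
      have "X = (F \<inter> X) \<union> ((UNIV - F) \<inter> X)" by blast
      then show "hausdorff m X \<le> hausdorff m (F \<inter> X) + hausdorff m ((UNIV - F) \<inter> X)"
        using hausdorff_Un[OF m] by metis
    qed
    then show ?thesis by (simp add: lambda_system_def)
  qed
  then have "sigma_sets UNIV {F :: 'a set. closed F} \<subseteq> ?L" by (intro L.sigma_sets_subset) auto
  then have sub: "sets borel \<subseteq> ?L" by (simp add: borel_eq_closed)
  have "measure_space UNIV (sets borel) (hausdorff m :: 'a set \<Rightarrow> ennreal)"
    by (rule measure_down[OF ms _ sub]) (metis sets.sigma_algebra_axioms space_borel)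
  then show ?thesis unfolding hausdorff_measure_def
    by (intro emeasure_measure_of_sigma) (use A in \<open>auto simp: measure_space_def\<close>)
qed

text \<open>The set lies in an open set of small measure. Disjoint balls in that open set, enlarged
  five times, cover the set; the loss of \<open>5 ^ DIM('a)\<close> is harmless because the measure
  of the open set is arbitrary.\<close>

lemma hausdorff_negligible:
  fixes A :: "'a::euclidean_space set"
  assumes "negligible A" shows "hausdorff DIM('a) A = 0"
proof -
  let ?m = "DIM('a)"
  have "hausdorff_pre ?m d A \<le> ennreal e" if "d > 0" "e > 0" for d e :: real
  proof -
    have As: "A \<in> sets lebesgue" "emeasure lebesgue A = 0"
      using assms by (auto simp: negligible_iff_null_sets)
    have e5: "e / 5 ^ ?m > 0" using that by simp
    obtain U where U: "open U" "A \<subseteq> U" "U - A \<in> lmeasurable" "emeasure lebesgue (U - A) < ennreal (e / 5 ^ ?m)"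
      by (rule sets_lebesgue_outer_open[OF As(1) e5])
    have Us: "U \<in> sets lebesgue" using U(1) by simp
    have Ue: "emeasure lebesgue U \<le> ennreal (e / 5 ^ ?m)"
    proof -
      have "A \<union> (U - A) = U" using U(2) by blast
      with emeasure_subadditive[OF As(1) sets.Diff[OF Us As(1)]]
      have "emeasure lebesgue U \<le> emeasure lebesgue (U - A)" by (simp only: As(2) add_0)
      then show ?thesis by (rule order_trans[OF _ less_imp_le[OF U(4)]])
    qed
    \<comment> \<open>A radius of d / 10 leaves the fivefold enlarged balls with diameter at most
      d.\<close>
    have "\<exists>r. 0 < r \<and> r \<le> d / 10 \<and> ball x r \<subseteq> U" if x: "x \<in> A" for x
    proof -
      obtain r where "r > 0" "ball x r \<subseteq> U" using x U by (meson open_contains_ball subsetD)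
      then show ?thesis using \<open>d > 0\<close> by (intro exI[of _ "min r (d / 10)"]) auto
    qed
    then obtain r where r: "\<And>x. x \<in> A \<Longrightarrow> 0 < r x \<and> r x \<le> d / 10 \<and> ball x (r x) \<subseteq> U" by metis
    obtain C where C: "countable C" "C \<subseteq> A" "pairwise (\<lambda>i j. disjnt (ball i (r i)) (ball j (r j))) C"
      "A \<subseteq> (\<Union>i\<in>C. ball i (5 * r i))"
      by (rule Vitali_covering_lemma_balls[where S=A and K=A and a="\<lambda>x. x" and r=r and B="d / 10"]) (use r in \<open>auto intro: centre_in_ball[THEN iffD2]\<close>)
    have rC: "0 < r i \<and> r i \<le> d / 10" if "i \<in> C" for i using r C(2) that by blast
    have "hausdorff_pre ?m d A \<le> (\<integral>\<^sup>+i. ennreal (unit_ball_vol (real ?m) * (5 * r i) ^ ?m) \<partial>count_space C)"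
      by (rule hausdorff_pre_cover[OF _ _ C(1) C(4)]) (use rC \<open>d > 0\<close> in \<open>fastforce simp: diameter_ball\<close>)+
    also have "\<dots> = (\<integral>\<^sup>+i. ennreal (5 ^ ?m) * emeasure lebesgue (ball i (r i)) \<partial>count_space C)"
    proof (rule nn_integral_cong)
      fix i assume "i \<in> space (count_space C)"
      then have "r i > 0" using r C(2) by auto
      then show "ennreal (unit_ball_vol (real ?m) * (5 * r i) ^ ?m) = ennreal (5 ^ ?m) * emeasure lebesgue (ball i (r i))"
        by (simp add: emeasure_ball ennreal_mult[symmetric] power_mult_distrib mult_ac)
    qed
    also have "\<dots> = ennreal (5 ^ ?m) * emeasure lebesgue (\<Union>i\<in>C. ball i (r i))"
    proof -
      have "disjoint_family_on (\<lambda>i. ball i (r i)) C"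
        using C(3) by (auto simp: disjoint_family_on_def pairwise_def disjnt_def)
      then show ?thesis using C(1) by (subst emeasure_UN_countable) (auto simp: nn_integral_cmult)
    qed
    also have "\<dots> \<le> ennreal (5 ^ ?m) * ennreal (e / 5 ^ ?m)"
    proof (rule mult_left_mono[OF order_trans[OF emeasure_mono Ue]])
      show "(\<Union>i\<in>C. ball i (r i)) \<subseteq> U" using r C(2) by blast
    qed (use U in auto)
    also have "\<dots> = ennreal e" using that by (simp add: ennreal_mult[symmetric])
    finally show ?thesis .
  qed
  note small = this
  have "hausdorff_pre ?m d A \<le> 0" if "d > 0" for d
  proof (rule ennreal_le_epsilon)
    fix e :: real assume "e > 0"
    then show "hausdorff_pre ?m d A \<le> 0 + ennreal e" using small[OF that] by simp
  qed
  then show ?thesis using hausdorff_leI[of ?m A 0] by simp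
qed

text \<open>Here the constant must be sharp. Disjoint balls in an open superset exhaust A up to a
  null set; on balls the covering weight is exactly the volume, and the null set is handled by
  \<open>hausdorff_negligible\<close>.\<close>

lemma hausdorff_le_lebesgue:
  fixes A :: "'a::euclidean_space set"
  assumes A: "A \<in> sets lebesgue" shows "hausdorff DIM('a) A \<le> emeasure lebesgue A"
proof (rule hausdorff_leI)
  let ?m = "DIM('a)"
  fix d :: real assume d: "d > 0"
  show "hausdorff_pre ?m d A \<le> emeasure lebesgue A"
  proof (rule ennreal_le_epsilon)
    fix e :: real assume e: "e > 0"
    obtain U where U: "open U" "A \<subseteq> U" "U - A \<in> lmeasurable" "emeasure lebesgue (U - A) < ennreal e"
      by (rule sets_lebesgue_outer_open[OF A e])
    have Us: "U \<in> sets lebesgue" using U(1) by simp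
    have Ue: "emeasure lebesgue U \<le> emeasure lebesgue A + ennreal e"
    proof -
      have "A \<union> (U - A) = U" using U(2) by blast
      with emeasure_subadditive[OF A sets.Diff[OF Us A]]
      have "emeasure lebesgue U \<le> emeasure lebesgue A + emeasure lebesgue (U - A)" by (simp only:)
      then show ?thesis by (rule order_trans[OF _ add_left_mono[OF less_imp_le[OF U(4)]]])
    qed
    define I where "I = {(x, r). 0 < r \<and> r \<le> d / 2 \<and> ball x r \<subseteq> U}"
    have "\<exists>i. i \<in> I \<and> x \<in> ball (fst i) (snd i) \<and> snd i < t" if x: "x \<in> A" and t: "0 < t" for x t
    proof -
      obtain r where "r > 0" "ball x r \<subseteq> U" using x U by (meson open_contains_ball subsetD)
      then have "(x, min r (min (d / 2) (t / 2))) \<in> I" "min r (min (d / 2) (t / 2)) < t" "0 < min r (min (d / 2) (t / 2))"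
        using d t by (auto simp: I_def)
      then show ?thesis by (intro exI[of _ "(x, min r (min (d / 2) (t / 2)))"]) auto
    qed
    then obtain C where C: "countable C" "C \<subseteq> I" "pairwise (\<lambda>i j. disjnt (ball (fst i) (snd i)) (ball (fst j) (snd j))) C"
      "negligible (A - (\<Union>i\<in>C. ball (fst i) (snd i)))"
      by (rule Vitali_covering_theorem_balls[where S=A and K=I and a=fst and r=snd])
    let ?B = "\<Union>i\<in>C. ball (fst i) (snd i)"
    have "hausdorff_pre ?m d (A - ?B) \<le> hausdorff ?m (A - ?B)" by (rule hausdorff_pre_le_hausdorff[OF d])
    then have AB: "hausdorff_pre ?m d (A - ?B) = 0" by (simp only: hausdorff_negligible[OF C(4)] le_zero_eq)
    have "hausdorff_pre ?m d A \<le> hausdorff_pre ?m d (?B \<union> (A - ?B))" by (rule hausdorff_pre_mono) blast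
    also have "\<dots> \<le> hausdorff_pre ?m d ?B + hausdorff_pre ?m d (A - ?B)"
      by (rule hausdorff_pre_Un) (use d in simp_all)
    also have "\<dots> = hausdorff_pre ?m d ?B" unfolding AB by simp
    also have "\<dots> \<le> (\<integral>\<^sup>+i. ennreal (unit_ball_vol (real ?m) * snd i ^ ?m) \<partial>count_space C)"
      by (rule hausdorff_pre_cover[OF _ _ C(1) order_refl]) (use C(2) d in \<open>auto simp: diameter_ball I_def\<close>)
    also have "\<dots> = (\<integral>\<^sup>+i. emeasure lebesgue (ball (fst i) (snd i)) \<partial>count_space C)"
      by (rule nn_integral_cong) (use C(2) in \<open>auto simp: emeasure_ball I_def\<close>)
    also have "\<dots> = emeasure lebesgue ?B"
    proof (rule emeasure_UN_countable[symmetric])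
      show "disjoint_family_on (\<lambda>i. ball (fst i) (snd i)) C"
        using C(3) by (auto simp: disjoint_family_on_def pairwise_def disjnt_def)
    qed (use C(1) in simp_all)
    also have "\<dots> \<le> emeasure lebesgue U"
      by (rule emeasure_mono[OF _ Us]) (use C(2) in \<open>fastforce simp: I_def simp del: mem_ball\<close>)
    also note Ue
    finally show "hausdorff_pre ?m d A \<le> emeasure lebesgue A + ennreal e" .
  qed
qed

section \<open>The isodiametric inequality\<close>

definition mink_sum :: "'a::euclidean_space set \<Rightarrow> 'a set \<Rightarrow> 'a set" where
  "mink_sum A B = {x + y |x y. x \<in> A \<and> y \<in> B}"

text \<open>Empty members are excluded, so a nonempty family has positive volume and cutting with a
  half-space that misses one box strictly lowers the number of members.\<close>

definition box_family :: "'a::euclidean_space set set \<Rightarrow> bool" where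
  "box_family F \<longleftrightarrow> finite F \<and> (\<forall>X\<in>F. X \<noteq> {} \<and> (\<exists>a b. X = box a b)) \<and> disjoint F"

lemma mink_sum_commute: "mink_sum A B = mink_sum B A"
  unfolding mink_sum_def by (auto; metis add.commute)

lemma open_mink_sum: "open A \<Longrightarrow> open (mink_sum A B)"
proof -
  assume "open A"
  then have "open (\<Union>x\<in>A. \<Union>y\<in>B. {x + y})" by (intro open_sums) simp
  moreover have "(\<Union>x\<in>A. \<Union>y\<in>B. {x + y}) = mink_sum A B" by (auto simp: mink_sum_def)
  ultimately show ?thesis by simp
qed

lemma box_family_open: "box_family F \<Longrightarrow> open (\<Union>F)"
  by (auto simp: box_family_def intro!: open_Union)

lemma box_family_bounded: "box_family F \<Longrightarrow> bounded (\<Union>F)"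
  by (auto simp: box_family_def intro!: bounded_Union)

lemma bounded_mink_sum: "bounded A \<Longrightarrow> bounded B \<Longrightarrow> bounded (mink_sum A B)"
proof -
  assume "bounded A" "bounded B"
  then obtain a b where ab: "\<And>x. x \<in> A \<Longrightarrow> norm x \<le> a" "\<And>x. x \<in> B \<Longrightarrow> norm x \<le> b" by (auto simp: bounded_iff)
  have "norm (x + y) \<le> a + b" if "x \<in> A" "y \<in> B" for x y
    using norm_triangle_ineq[of x y] ab(1)[OF that(1)] ab(2)[OF that(2)] by linarith
  then show ?thesis by (auto simp: mink_sum_def bounded_iff)
qed

lemma bounded_open_measurable: "bounded A \<Longrightarrow> open A \<Longrightarrow> (A::'a::euclidean_space set) \<in> fmeasurable lborel"
  using emeasure_bounded_finite[of A] by (intro fmeasurableI) simp_all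

lemma open_measure_pos:
  fixes A :: "'a::euclidean_space set"
  assumes "open A" "bounded A" "A \<noteq> {}" shows "measure lborel A > 0"
proof -
  have "\<not> negligible A" using assms open_not_negligible by blast
  then have "emeasure lborel A \<noteq> 0"
    using assms(1) by (auto simp: negligible_iff_null_sets null_sets_def)
  moreover have "emeasure lborel A < top" using emeasure_bounded_finite[OF assms(2)] by simp
  ultimately show ?thesis by (simp add: measure_def enn2real_positive_iff zero_less_iff_neq_zero)
qed

text \<open>Side lengths add, and the arithmetic-geometric mean inequality is applied in each
  coordinate. The geometric mean form of Brunn-Minkowski is used because it involves no root of
  order \<open>DIM('a)\<close> and adds up under proportional cuts.\<close>

lemma measure_box_sum:
  fixes a b c d :: "'a::euclidean_space"
  assumes ne: "box a b \<noteq> {}" "box c d \<noteq> {}"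
  shows "2 ^ DIM('a) * sqrt (measure lborel (box a b) * measure lborel (box c d))
    \<le> measure lborel (mink_sum (box a b) (box c d))"
proof -
  have lt: "a \<bullet> i < b \<bullet> i" "c \<bullet> i < d \<bullet> i" if "i \<in> Basis" for i using ne that by (auto simp: box_ne_empty)
  have "box (a + c) (b + d) \<subseteq> mink_sum (box a b) (box c d)"
  proof
    fix z assume z: "z \<in> box (a + c) (b + d)"
    define t where "t i = (z \<bullet> i - a \<bullet> i - c \<bullet> i) / (b \<bullet> i - a \<bullet> i + (d \<bullet> i - c \<bullet> i))" for i
    define x where "x = (\<Sum>i\<in>Basis. (a \<bullet> i + t i * (b \<bullet> i - a \<bullet> i)) *\<^sub>R i)"
    have t: "0 < t i" "t i < 1" if i: "i \<in> Basis" for i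
      using z lt[OF i] i by (auto simp: t_def mem_box inner_add_left divide_less_eq)
    have xi: "x \<bullet> i = a \<bullet> i + t i * (b \<bullet> i - a \<bullet> i)" if "i \<in> Basis" for i using that by (simp add: x_def)
    have zi: "z \<bullet> i = x \<bullet> i + (c \<bullet> i + t i * (d \<bullet> i - c \<bullet> i))" if i: "i \<in> Basis" for i
    proof -
      have "t i * (b \<bullet> i - a \<bullet> i + (d \<bullet> i - c \<bullet> i)) = z \<bullet> i - a \<bullet> i - c \<bullet> i"
        using lt[OF i] by (simp add: t_def)
      then show ?thesis using xi[OF i] by (simp add: algebra_simps)
    qed
    have between: "p < p + s * (q - p) \<and> p + s * (q - p) < q" if "0 < s" "s < 1" "p < q" for p q s :: real
    proof -
      have "s * (q - p) < 1 * (q - p)" using that by (intro mult_strict_right_mono) auto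
      moreover have "0 < s * (q - p)" using that by simp
      ultimately show ?thesis by auto
    qed
    have "x \<in> box a b" using between t lt xi by (auto simp: mem_box)
    moreover have "z - x \<in> box c d" using between t lt zi by (auto simp: mem_box inner_diff_left)
    moreover have "z = x + (z - x)" by simp
    ultimately show "z \<in> mink_sum (box a b) (box c d)" unfolding mink_sum_def by blast
  qed
  moreover have "mink_sum (box a b) (box c d) \<in> fmeasurable lborel"
    by (intro bounded_open_measurable bounded_mink_sum open_mink_sum) auto
  ultimately have le: "measure lborel (box (a + c) (b + d)) \<le> measure lborel (mink_sum (box a b) (box c d))"
    by (intro measure_mono_fmeasurable) auto
  have le': "a \<bullet> i \<le> b \<bullet> i" "c \<bullet> i \<le> d \<bullet> i" if "i \<in> Basis" for i using lt[OF that] by auto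
  have mab: "measure lborel (box a b) = (\<Prod>i\<in>Basis. (b - a) \<bullet> i)" "measure lborel (box c d) = (\<Prod>i\<in>Basis. (d - c) \<bullet> i)"
    using le' by (auto simp: measure_lborel_box_eq)
  have sqrt_prod: "sqrt (prod f A) = (\<Prod>x\<in>A. sqrt (f x))" for f and A :: "'a set"
    by (induction A rule: infinite_finite_induct) (auto simp: real_sqrt_mult)
  have "sqrt (measure lborel (box a b) * measure lborel (box c d)) = sqrt (\<Prod>i\<in>Basis. ((b - a) \<bullet> i) * ((d - c) \<bullet> i))"
    by (simp add: mab prod.distrib)
  also have "\<dots> = (\<Prod>i\<in>Basis. sqrt (((b - a) \<bullet> i) * ((d - c) \<bullet> i)))"
    by (rule sqrt_prod)
  finally have "2 ^ DIM('a) * sqrt (measure lborel (box a b) * measure lborel (box c d))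
      = (\<Prod>i\<in>Basis. 2 * sqrt (((b - a) \<bullet> i) * ((d - c) \<bullet> i)))"
    by (simp add: prod.distrib)
  also have "\<dots> \<le> (\<Prod>i\<in>Basis. (b + d - (a + c)) \<bullet> i)"
  proof (rule prod_mono)
    fix i :: 'a assume i: "i \<in> Basis"
    have "sqrt (((b - a) \<bullet> i) * ((d - c) \<bullet> i)) \<le> ((b - a) \<bullet> i + (d - c) \<bullet> i) / 2"
      using lt[OF i] by (intro arith_geo_mean_sqrt) (auto simp: inner_diff_left)
    then show "0 \<le> 2 * sqrt (((b - a) \<bullet> i) * ((d - c) \<bullet> i)) \<and> 2 * sqrt (((b - a) \<bullet> i) * ((d - c) \<bullet> i)) \<le> (b + d - (a + c)) \<bullet> i"
      using lt[OF i] by (simp add: inner_diff_left inner_add_left)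
  qed
  also have "\<dots> = measure lborel (box (a + c) (b + d))"
    using le' by (auto simp: measure_lborel_box_eq inner_add_left add_mono)
  finally show ?thesis using le by simp
qed

section \<open>Cutting families of boxes by hyperplanes\<close>

lemma box_Int_halfspace:
  fixes a b :: "'a::euclidean_space"
  assumes "i \<in> Basis"
  shows "\<exists>b'. box a b \<inter> {x. x \<bullet> i < t} = box a b'" "\<exists>a'. box a b \<inter> {x. x \<bullet> i > t} = box a' b"
proof -
  let ?b = "b + (min (b \<bullet> i) t - b \<bullet> i) *\<^sub>R i" and ?a = "a + (max (a \<bullet> i) t - a \<bullet> i) *\<^sub>R i"
  have "?b \<bullet> j = (if j = i then min (b \<bullet> i) t else b \<bullet> j)" "?a \<bullet> j = (if j = i then max (a \<bullet> i) t else a \<bullet> j)"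
    if "j \<in> Basis" for j
    using assms that by (auto simp: inner_add_left inner_Basis)
  then have *: "x \<in> box a ?b \<longleftrightarrow> (\<forall>j\<in>Basis. a \<bullet> j < x \<bullet> j \<and> x \<bullet> j < (if j = i then min (b \<bullet> i) t else b \<bullet> j))"
    "x \<in> box ?a b \<longleftrightarrow> (\<forall>j\<in>Basis. (if j = i then max (a \<bullet> i) t else a \<bullet> j) < x \<bullet> j \<and> x \<bullet> j < b \<bullet> j)" for x
    unfolding mem_box by simp_all
  have "x \<in> box a b \<inter> {x. x \<bullet> i < t} \<longleftrightarrow> x \<in> box a ?b" "x \<in> box a b \<inter> {x. x \<bullet> i > t} \<longleftrightarrow> x \<in> box ?a b" for x
    unfolding * Int_iff mem_Collect_eq mem_box[of x a b] using assms by (auto split: if_splits)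
  then have "box a b \<inter> {x. x \<bullet> i < t} = box a ?b" "box a b \<inter> {x. x \<bullet> i > t} = box ?a b"
    by (auto simp only: set_eq_iff)
  then show "\<exists>b'. box a b \<inter> {x. x \<bullet> i < t} = box a b'" "\<exists>a'. box a b \<inter> {x. x \<bullet> i > t} = box a' b"
    by blast+
qed

lemma box_family_cut:
  assumes F: "box_family F" and i: "i \<in> Basis" and H: "H = {x. x \<bullet> i < t} \<or> H = {x. x \<bullet> i > t}"
  shows "box_family ((\<lambda>X. X \<inter> H) ` F - {{}})" "\<Union>((\<lambda>X. X \<inter> H) ` F - {{}}) = \<Union>F \<inter> H"
    "card ((\<lambda>X. X \<inter> H) ` F - {{}}) \<le> card F"
    "Y \<in> F \<Longrightarrow> Y \<inter> H = {} \<Longrightarrow> card ((\<lambda>X. X \<inter> H) ` F - {{}}) < card F"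
proof -
  have fin: "finite F" using F by (simp add: box_family_def)
  have "disjoint ((\<lambda>X. X \<inter> H) ` F - {{}})"
    using F unfolding box_family_def disjoint_def by blast
  moreover have "\<exists>a b. X \<inter> H = box a b" if "X \<in> F" for X
  proof -
    from F that have "\<exists>a b. X = box a b" unfolding box_family_def by simp
    then obtain a b where "X = box a b" by (elim exE)
    then show ?thesis using H box_Int_halfspace[OF i, of a b t] by auto
  qed
  ultimately show "box_family ((\<lambda>X. X \<inter> H) ` F - {{}})" using fin by (auto simp: box_family_def)
  show "\<Union>((\<lambda>X. X \<inter> H) ` F - {{}}) = \<Union>F \<inter> H" by auto
  have "card ((\<lambda>X. X \<inter> H) ` F - {{}}) \<le> card ((\<lambda>X. X \<inter> H) ` F)" using fin by (intro card_mono) auto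
  then show "card ((\<lambda>X. X \<inter> H) ` F - {{}}) \<le> card F" using card_image_le[OF fin, of "\<lambda>X. X \<inter> H"] by simp
  assume Y: "Y \<in> F" "Y \<inter> H = {}"
  have "card ((\<lambda>X. X \<inter> H) ` F - {{}}) \<le> card ((\<lambda>X. X \<inter> H) ` (F - {Y}))" using fin Y by (intro card_mono) auto
  also have "\<dots> \<le> card (F - {Y})" using fin by (intro card_image_le) auto
  also have "\<dots> < card F" using fin Y by (intro psubset_card_mono) auto
  finally show "card ((\<lambda>X. X \<inter> H) ` F - {{}}) < card F" .
qed

lemma box_separate:
  fixes a b c d :: "'a::euclidean_space"
  assumes ne: "box a b \<noteq> {}" "box c d \<noteq> {}" and dj: "box a b \<inter> box c d = {}"
  obtains i t where "i \<in> Basis" "(box a b \<subseteq> {x. x \<bullet> i < t} \<and> box c d \<subseteq> {x. x \<bullet> i > t}) \<or> (box c d \<subseteq> {x. x \<bullet> i < t} \<and> box a b \<subseteq> {x. x \<bullet> i > t})"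
proof -
  have lt: "a \<bullet> i < b \<bullet> i" "c \<bullet> i < d \<bullet> i" if "i \<in> Basis" for i using ne that by (auto simp: box_ne_empty)
  obtain i where i: "i \<in> Basis" "min (b \<bullet> i) (d \<bullet> i) \<le> max (a \<bullet> i) (c \<bullet> i)"
    using dj by (auto simp: box_Int_box box_eq_empty min_def max_def)
  then have "b \<bullet> i \<le> c \<bullet> i \<or> d \<bullet> i \<le> a \<bullet> i" using lt[OF i(1)] by (auto simp: min_def max_def split: if_splits)
  then show ?thesis
  proof
    assume "b \<bullet> i \<le> c \<bullet> i"
    then show ?thesis by (intro that[of i "b \<bullet> i"] i disjI1) (use i in \<open>force simp: mem_box\<close>)
  next
    assume "d \<bullet> i \<le> a \<bullet> i"
    then show ?thesis by (intro that[of i "d \<bullet> i"] i disjI2) (use i in \<open>force simp: mem_box\<close>)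
  qed
qed

lemma hyperplane_null: "i \<in> Basis \<Longrightarrow> {x::'a::euclidean_space. x \<bullet> i = t} \<in> null_sets lborel"
proof -
  assume i: "i \<in> Basis"
  have "negligible {x::'a. i \<bullet> x = t}" using i by (intro negligible_hyperplane) auto
  moreover have "closed {x::'a. i \<bullet> x = t}" by (rule closed_hyperplane)
  ultimately show ?thesis by (simp add: negligible_iff_null_sets null_sets_def inner_commute)
qed

lemma measure_split_halfspace:
  fixes U :: "'a::euclidean_space set"
  assumes U: "open U" "bounded U" and i: "i \<in> Basis"
  shows "measure lborel U = measure lborel (U \<inter> {x. x \<bullet> i < t}) + measure lborel (U \<inter> {x. x \<bullet> i > t})"
proof -
  have o: "open {x::'a. x \<bullet> i < t}" "open {x::'a. x \<bullet> i > t}"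
    using open_halfspace_lt[of i t] open_halfspace_gt[of t i] by (simp_all add: inner_commute)
  let ?V = "(U \<inter> {x. x \<bullet> i < t}) \<union> (U \<inter> {x. x \<bullet> i > t})"
  have "measure lborel U = measure lborel (?V \<union> (U \<inter> {x. x \<bullet> i = t}))"
    by (rule arg_cong[where f="measure lborel"]) auto
  also have "\<dots> = measure lborel ?V"
  proof (rule measure_Un_null_set)
    show "?V \<in> sets lborel" using U o by (simp add: open_Un open_Int)
    show "U \<inter> {x. x \<bullet> i = t} \<in> null_sets lborel"
      by (rule null_set_Int1[OF hyperplane_null[OF i]]) (use U in simp)
  qed
  also have "\<dots> = measure lborel (U \<inter> {x. x \<bullet> i < t}) + measure lborel (U \<inter> {x. x \<bullet> i > t})"
    using U o by (intro measure_Un_AE[OF _ bounded_open_measurable bounded_open_measurable]) (auto intro: bounded_Int open_Int)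
  finally show ?thesis .
qed

text \<open>The cut of the second family has to divide its volume in the ratio of the first cut;
  such a cut exists by continuity.\<close>

lemma measure_halfspace_IVT:
  fixes U :: "'a::euclidean_space set"
  assumes U: "open U" "bounded U" and i: "i \<in> Basis" and r: "0 \<le> r" "r \<le> measure lborel U"
  shows "\<exists>t. measure lborel (U \<inter> {x. x \<bullet> i < t}) = r"
proof -
  obtain B where B: "B > 0" "U \<subseteq> ball 0 B" using bounded_subset_ballD[OF U(2)] by blast
  have Bi: "\<bar>x \<bullet> i\<bar> < B" if "x \<in> U" for x
    using Basis_le_norm[OF i, of x] B that by (auto simp: subset_iff)
  define g where "g t = measure lborel (U \<inter> {x. x \<bullet> i < t})" for t
  have o: "open {x::'a. x \<bullet> i < t}" for t using open_halfspace_lt[of i t] by (simp add: inner_commute)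
  have Uf: "U \<inter> {x. x \<bullet> i < t} \<in> fmeasurable lborel" for t
    by (intro bounded_open_measurable open_Int o U bounded_Int) (use U in auto)
  have "continuous (at t) g" for t
  proof -
    have "isCont (\<lambda>t. LINT x|lborel. indicator (U \<inter> {x. x \<bullet> i < t}) x :: real) t"
      unfolding continuous_at_sequentially
    proof safe
      fix s :: "nat \<Rightarrow> real" assume s: "s \<longlonglongrightarrow> t"
      show "((\<lambda>t. LINT x|lborel. indicator (U \<inter> {x. x \<bullet> i < t}) x :: real) \<circ> s) \<longlonglongrightarrow> (LINT x|lborel. indicator (U \<inter> {x. x \<bullet> i < t}) x)"
        unfolding o_def
      proof (rule integral_dominated_convergence[where w="indicator U"])
        have "AE x::'a in lborel. x \<bullet> i \<noteq> t" using AE_not_in[OF hyperplane_null[OF i, of t]] by simp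
        then show "AE x in lborel. (\<lambda>n. indicator (U \<inter> {x. x \<bullet> i < s n}) x :: real) \<longlonglongrightarrow> indicator (U \<inter> {x. x \<bullet> i < t}) x"
        proof eventually_elim
          case (elim x)
          have "\<forall>\<^sub>F n in sequentially. (x \<bullet> i < s n) = (x \<bullet> i < t)"
          proof (cases "x \<bullet> i < t")
            case True then show ?thesis using order_tendstoD(1)[OF s] by simp
          next
            case False
            then have "t < x \<bullet> i" using elim by simp
            from order_tendstoD(2)[OF s this] show ?thesis using False by (auto elim: eventually_mono)
          qed
          then have "\<forall>\<^sub>F n in sequentially. indicator (U \<inter> {x. x \<bullet> i < t}) x = (indicator (U \<inter> {x. x \<bullet> i < s n}) x :: real)"
            by eventually_elim (simp add: indicator_def)
          then show ?case by (rule Lim_transform_eventually[OF tendsto_const])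
        qed
        show "integrable lborel (indicator U :: 'a \<Rightarrow> real)"
          using U emeasure_bounded_finite[OF U(2)] by (intro integrable_real_indicator) auto
        show "AE x in lborel. norm (indicator (U \<inter> {x. x \<bullet> i < s n}) x :: real) \<le> indicator U x" for n
          by (auto simp: indicator_def)
      qed (rule borel_measurable_indicator[OF fmeasurableD[OF Uf]])+
    qed
    then show ?thesis by (simp add: g_def[abs_def])
  qed
  moreover have "g (- B) = 0"
  proof -
    have "U \<inter> {x. x \<bullet> i < - B} = {}" using Bi by fastforce
    then show ?thesis by (simp add: g_def[abs_def])
  qed
  moreover have "g B = measure lborel U"
  proof -
    have "U \<inter> {x. x \<bullet> i < B} = U" using Bi by fastforce
    then show ?thesis by (simp add: g_def[abs_def])
  qed
  ultimately have "\<exists>t\<ge>- B. t \<le> B \<and> g t = r" using r B by (intro IVT) auto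
  then show ?thesis by (auto simp: g_def)
qed

text \<open>When both volumes are divided in the same ratio the geometric means add up exactly, so
  the two halves of the induction recombine without loss.\<close>

lemma sqrt_sum_proportional: "0 \<le> l \<Longrightarrow> l \<le> 1 \<Longrightarrow> 0 \<le> p \<Longrightarrow> 0 \<le> q \<Longrightarrow>
   sqrt ((l * p) * (l * q)) + sqrt (((1 - l) * p) * ((1 - l) * q)) = sqrt (p * q)"
proof -
  assume a: "0 \<le> l" "l \<le> 1" "0 \<le> p" "0 \<le> q"
  have "sqrt ((l * p) * (l * q)) = l * sqrt (p * q)" if "0 \<le> l" for l
    using that by (simp add: real_sqrt_mult)
  from this[of l] this[of "1 - l"] show ?thesis using a by (simp add: algebra_simps)
qed

text \<open>The argument of Hadwiger and Ohmann: cut one family by a hyperplane separating two of its boxes.\<close>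

lemma brunn_minkowski_boxes:
  fixes F G :: "'a::euclidean_space set set"
  assumes "box_family F" "box_family G" "F \<noteq> {}" "G \<noteq> {}"
  shows "2 ^ DIM('a) * sqrt (measure lborel (\<Union>F) * measure lborel (\<Union>G)) \<le> measure lborel (mink_sum (\<Union>F) (\<Union>G))"
  using assms
proof (induction "card F + card G" arbitrary: F G rule: less_induct)
  case less
  \<comment> \<open>Stated for arbitrary families with their own induction hypothesis, so that it
    also applies with the roles of F and G exchanged.\<close>
  have cut: "2 ^ DIM('a) * sqrt (measure lborel (\<Union>F) * measure lborel (\<Union>G)) \<le> measure lborel (mink_sum (\<Union>F) (\<Union>G))"
    if F: "box_family F" and G: "box_family G" "G \<noteq> {}" and c: "card F > 1"
      and IH: "\<And>F' G' :: 'a set set. card F' + card G' < card F + card G \<Longrightarrow> box_family F' \<Longrightarrow> box_family G' \<Longrightarrow> F' \<noteq> {} \<Longrightarrow> G' \<noteq> {} \<Longrightarrow>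
        2 ^ DIM('a) * sqrt (measure lborel (\<Union>F') * measure lborel (\<Union>G')) \<le> measure lborel (mink_sum (\<Union>F') (\<Union>G'))"
    for F G :: "'a set set"
  proof -
    obtain X Y where XY: "X \<in> F" "Y \<in> F" "X \<noteq> Y"
      using c by (metis One_nat_def card_le_Suc0_iff_eq card_eq_0_iff F box_family_def not_le)
    obtain a b c d where bx: "X = box a b" "Y = box c d" "box a b \<noteq> {}" "box c d \<noteq> {}" "box a b \<inter> box c d = {}"
      using F XY unfolding box_family_def disjoint_def by metis
    obtain i t where i: "i \<in> Basis" and sep: "(X \<subseteq> {x. x \<bullet> i < t} \<and> Y \<subseteq> {x. x \<bullet> i > t}) \<or> (Y \<subseteq> {x. x \<bullet> i < t} \<and> X \<subseteq> {x. x \<bullet> i > t})"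
      using box_separate[OF bx(3-5)] bx(1,2) by metis
    define H1 H2 where "H1 = {x::'a. x \<bullet> i < t}" "H2 = {x::'a. x \<bullet> i > t}"
    have sep': "\<exists>Z\<in>F. Z \<inter> H1 = {}" "\<exists>Z\<in>F. Z \<inter> H2 = {}" "\<Union>F \<inter> H1 \<noteq> {}" "\<Union>F \<inter> H2 \<noteq> {}"
    proof -
      have dj: "H1 \<inter> H2 = {}" by (auto simp: H1_H2_def)
      obtain A B where AB: "A \<in> F" "B \<in> F" "A \<subseteq> H1" "B \<subseteq> H2" "A \<noteq> {}" "B \<noteq> {}"
        using sep
      proof
        assume "X \<subseteq> {x. x \<bullet> i < t} \<and> Y \<subseteq> {x. x \<bullet> i > t}"
        then show ?thesis using that[of X Y] XY bx by (simp add: H1_H2_def)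
      next
        assume "Y \<subseteq> {x. x \<bullet> i < t} \<and> X \<subseteq> {x. x \<bullet> i > t}"
        then show ?thesis using that[of Y X] XY bx by (simp add: H1_H2_def)
      qed
      show "\<exists>Z\<in>F. Z \<inter> H1 = {}" by (rule bexI[OF _ AB(2)]) (use AB(4) dj in blast)
      show "\<exists>Z\<in>F. Z \<inter> H2 = {}" by (rule bexI[OF _ AB(1)]) (use AB(3) dj in blast)
      show "\<Union>F \<inter> H1 \<noteq> {}" using AB(1,3,5) by blast
      show "\<Union>F \<inter> H2 \<noteq> {}" using AB(2,4,6) by blast
    qed
    define F1 F2 where "F1 = (\<lambda>X. X \<inter> H1) ` F - {{}}" "F2 = (\<lambda>X. X \<inter> H2) ` F - {{}}"
    have H: "H1 = {x. x \<bullet> i < t} \<or> H1 = {x. x \<bullet> i > t}" "H2 = {x. x \<bullet> i < t} \<or> H2 = {x. x \<bullet> i > t}"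
      by (auto simp: H1_H2_def)
    note c1 = box_family_cut[OF F i H(1), folded F1_F2_def] and c2 = box_family_cut[OF F i H(2), folded F1_F2_def]
    let ?m = "measure lborel"
    have oF: "open (\<Union>F)" "bounded (\<Union>F)" "open (\<Union>G)" "bounded (\<Union>G)"
      using F G box_family_open box_family_bounded by blast+
    have mF: "?m (\<Union>F) = ?m (\<Union>F1) + ?m (\<Union>F2)"
      using measure_split_halfspace[OF oF(1,2) i, of t] c1(2) c2(2) by (simp add: H1_H2_def)
    have mF12: "?m (\<Union>F1) > 0" "?m (\<Union>F2) > 0"
      by (intro open_measure_pos box_family_open box_family_bounded c1 c2; use sep' c1(2) c2(2) in simp)+
    define l where "l = ?m (\<Union>F1) / ?m (\<Union>F)"
    have l: "0 < l" "l < 1" "?m (\<Union>F1) = l * ?m (\<Union>F)" "?m (\<Union>F2) = (1 - l) * ?m (\<Union>F)"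
      using mF mF12 by (auto simp: l_def field_simps)
    have mG: "?m (\<Union>G) > 0"
      using G by (intro open_measure_pos oF) (auto simp: box_family_def)
    obtain t' where t': "?m (\<Union>G \<inter> {x. x \<bullet> i < t'}) = l * ?m (\<Union>G)"
      using measure_halfspace_IVT[OF oF(3,4) i, of "l * ?m (\<Union>G)"] l mG by auto
    define J1 J2 where "J1 = {x::'a. x \<bullet> i < t'}" "J2 = {x::'a. x \<bullet> i > t'}"
    define G1 G2 where "G1 = (\<lambda>X. X \<inter> J1) ` G - {{}}" "G2 = (\<lambda>X. X \<inter> J2) ` G - {{}}"
    have J: "J1 = {x. x \<bullet> i < t'} \<or> J1 = {x. x \<bullet> i > t'}" "J2 = {x. x \<bullet> i < t'} \<or> J2 = {x. x \<bullet> i > t'}"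
      by (auto simp: J1_J2_def)
    note d1 = box_family_cut[OF G(1) i J(1), folded G1_G2_def] and d2 = box_family_cut[OF G(1) i J(2), folded G1_G2_def]
    have mG1: "?m (\<Union>G1) = l * ?m (\<Union>G)" using t' d1(2) by (simp add: J1_J2_def)
    have mG2: "?m (\<Union>G2) = (1 - l) * ?m (\<Union>G)"
      using measure_split_halfspace[OF oF(3,4) i, of t'] d1(2) d2(2) mG1 by (simp add: J1_J2_def algebra_simps)
    have ne: "F1 \<noteq> {}" "F2 \<noteq> {}" "G1 \<noteq> {}" "G2 \<noteq> {}"
      using mF12 mG1 mG2 mG l by auto
    \<comment> \<open>The cut of G need not separate any boxes; it suffices that it does not raise
      their number, since the number for F strictly drops.\<close>
    have less1: "card F1 + card G1 < card F + card G" using sep'(1) c1(4) d1(3) by (metis add_less_le_mono)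
    have less2: "card F2 + card G2 < card F + card G" using sep'(2) c2(4) d2(3) by (metis add_less_le_mono)
    have I1: "2 ^ DIM('a) * sqrt (?m (\<Union>F1) * ?m (\<Union>G1)) \<le> ?m (mink_sum (\<Union>F1) (\<Union>G1))"
      by (rule IH[OF less1 c1(1) d1(1) ne(1,3)])
    have I2: "2 ^ DIM('a) * sqrt (?m (\<Union>F2) * ?m (\<Union>G2)) \<le> ?m (mink_sum (\<Union>F2) (\<Union>G2))"
      by (rule IH[OF less2 c2(1) d2(1) ne(2,4)])
    have meas: "mink_sum (\<Union>F) (\<Union>G) \<in> fmeasurable lborel" "mink_sum (\<Union>F1) (\<Union>G1) \<in> fmeasurable lborel" "mink_sum (\<Union>F2) (\<Union>G2) \<in> fmeasurable lborel"
      by (intro bounded_open_measurable bounded_mink_sum open_mink_sum box_family_open box_family_bounded c1 c2 d1 d2 F G)+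
    have "2 ^ DIM('a) * sqrt (?m (\<Union>F) * ?m (\<Union>G))
        = 2 ^ DIM('a) * (sqrt (?m (\<Union>F1) * ?m (\<Union>G1)) + sqrt (?m (\<Union>F2) * ?m (\<Union>G2)))"
      using sqrt_sum_proportional[of l "?m (\<Union>F)" "?m (\<Union>G)"] l mG1 mG2 mG by (simp add: mult_ac)
    also have "\<dots> \<le> ?m (mink_sum (\<Union>F1) (\<Union>G1)) + ?m (mink_sum (\<Union>F2) (\<Union>G2))"
      using I1 I2 by (simp add: distrib_left)
    \<comment> \<open>The two sums lie strictly on opposite sides of the hyperplane at height t +
      t', so their volumes add.\<close>
    also have "\<dots> = ?m (mink_sum (\<Union>F1) (\<Union>G1) \<union> mink_sum (\<Union>F2) (\<Union>G2))"
    proof (rule measure_Un_AE[symmetric])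
      have "mink_sum (\<Union>F1) (\<Union>G1) \<subseteq> {x. x \<bullet> i < t + t'}" "mink_sum (\<Union>F2) (\<Union>G2) \<subseteq> {x. x \<bullet> i > t + t'}"
        unfolding mink_sum_def c1(2) c2(2) d1(2) d2(2) by (auto simp: H1_H2_def J1_J2_def inner_add_left)
      then show "AE x in lborel. x \<notin> mink_sum (\<Union>F1) (\<Union>G1) \<or> x \<notin> mink_sum (\<Union>F2) (\<Union>G2)"
        by (intro AE_I2) force
    qed (use meas[THEN fmeasurableD] meas in auto)
    also have "\<dots> \<le> ?m (mink_sum (\<Union>F) (\<Union>G))"
    proof (rule measure_mono_fmeasurable[OF _ _ meas(1)])
      show "mink_sum (\<Union>F1) (\<Union>G1) \<union> mink_sum (\<Union>F2) (\<Union>G2) \<subseteq> mink_sum (\<Union>F) (\<Union>G)"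
        unfolding mink_sum_def c1(2) c2(2) d1(2) d2(2) by blast
    qed (use meas[THEN fmeasurableD] in auto)
    finally show ?thesis .
  qed
  have fin: "finite F" "finite G" using less.prems(1,2) unfolding box_family_def by simp_all
  then have pos: "card F > 0" "card G > 0" using less.prems(3,4) by (simp_all add: card_gt_0_iff)
  consider "card F > 1" | "card G > 1" | "card F = 1" "card G = 1" using pos by linarith
  then show ?case
  proof cases
    case 1
    show ?thesis by (rule cut[OF less.prems(1,2,4) 1 less.hyps])
  next
    case 2
    have "2 ^ DIM('a) * sqrt (measure lborel (\<Union>G) * measure lborel (\<Union>F)) \<le> measure lborel (mink_sum (\<Union>G) (\<Union>F))"
      by (rule cut[OF less.prems(2,1,3) 2 less.hyps]) (auto simp: add.commute)
    then show ?thesis by (simp add: mink_sum_commute mult.commute)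
  next
    case 3
    then obtain X Y where XY: "F = {X}" "G = {Y}" by (auto simp: card_1_singleton_iff)
    have "X \<noteq> {} \<and> (\<exists>a b. X = box a b)" "Y \<noteq> {} \<and> (\<exists>a b. Y = box a b)"
      using less.prems(1,2) unfolding box_family_def XY by simp_all
    then obtain a b c d where "X = box a b" "Y = box c d" "box a b \<noteq> {}" "box c d \<noteq> {}" by metis
    then show ?thesis using XY measure_box_sum[of a b c d] by simp
  qed
qed

text \<open>Brunn-Minkowski is applied to the set and its reflection: the sum of E and -E is the set
  of differences, which lies in a ball of radius \<open>diameter E\<close>. This avoids
  symmetrisation. E is first replaced by a union of boxes of mesh h, and h tends to 0 at the
  end.\<close>

theorem isodiametric:
  fixes E :: "'a::euclidean_space set"
  assumes E: "bounded E" "E \<in> sets lebesgue"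
  shows "emeasure lebesgue E \<le> ennreal (unit_ball_vol (real DIM('a)) * (diameter E / 2) ^ DIM('a))"
proof (cases "E = {}")
  case False
  let ?n = "DIM('a)"
  have bound: "measure lebesgue E \<le> unit_ball_vol (real ?n) * ((diameter E + 3 * h) / 2) ^ ?n" if h: "h > 0" for h
  proof -
    obtain a where a: "E \<subseteq> cbox (- a) a" using bounded_subset_cbox_symmetric[OF E(1)] by blast
    \<comment> \<open>A tagged division that is fine for this gauge has cells of diameter below
      h.\<close>
    have "gauge (\<lambda>x::'a. ball x (h / 2))" using h by auto
    from fine_division_exists[OF this, of "- a" a] obtain p where
      p: "p tagged_division_of cbox (- a) a" "(\<lambda>x. ball x (h / 2)) fine p" by blast
    define F where "F = {interior k |x k. (x, k) \<in> p \<and> k \<inter> E \<noteq> {} \<and> interior k \<noteq> {}}"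
    have finp: "finite p" using p(1) by blast
    have bf: "box_family F"
      unfolding box_family_def
    proof (intro conjI ballI)
      have "F \<subseteq> (\<lambda>(x, k). interior k) ` p" by (force simp: F_def)
      then show "finite F" using finp finite_surj by blast
      fix X assume "X \<in> F"
      then obtain x k where k: "X = interior k" "(x, k) \<in> p" "interior k \<noteq> {}" by (auto simp: F_def)
      then show "X \<noteq> {}" by simp
      from tagged_division_ofD(4)[OF p(1) k(2)] obtain u v where "k = cbox u v" by blast
      then have "X = box u v" using k(1) by (simp only: interior_cbox)
      then show "\<exists>a b. X = box a b" by (intro exI)
    next
      show "disjoint F"
        unfolding disjoint_def
      proof (intro ballI impI)
        fix X Y assume "X \<in> F" "Y \<in> F" "X \<noteq> Y"
        then obtain x k y l where "X = interior k" "(x, k) \<in> p" "Y = interior l" "(y, l) \<in> p" by (auto simp: F_def)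
        with \<open>X \<noteq> Y\<close> tagged_division_ofD(5)[OF p(1)] show "X \<inter> Y = {}" by fastforce
      qed
    qed
    define G where "G = (`) uminus ` F"
    have um: "x \<in> uminus ` S \<longleftrightarrow> - x \<in> S" for x :: 'a and S
      by (auto intro: image_eqI[of _ _ "- x"])
    have bg: "box_family G"
      unfolding box_family_def
    proof (intro conjI ballI)
      show "finite G" using bf by (simp add: G_def box_family_def)
      fix X assume "X \<in> G"
      then obtain Y where Y: "X = uminus ` Y" "Y \<in> F" by (auto simp: G_def)
      then show "X \<noteq> {}" using bf by (auto simp: box_family_def)
      from bf Y(2) have "\<exists>a b. Y = box a b" unfolding box_family_def by simp
      then obtain a b where "Y = box a b" by (elim exE)
      then have "X = box (- b) (- a)"
        using Y(1) by (auto simp: set_eq_iff um mem_box)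
      then show "\<exists>a b. X = box a b" by blast
    next
      show "disjoint G"
        unfolding disjoint_def
      proof (intro ballI impI)
        fix X Y assume "X \<in> G" "Y \<in> G" "X \<noteq> Y"
        then obtain X' Y' where XY: "X = uminus ` X'" "Y = uminus ` Y'" "X' \<in> F" "Y' \<in> F" "X' \<noteq> Y'"
          unfolding G_def by blast
        then have "X' \<inter> Y' = {}" using bf unfolding box_family_def disjoint_def by blast
        then show "X \<inter> Y = {}" unfolding XY by (simp add: image_Int[OF inj_uminus, symmetric])
      qed
    qed
    have UG: "\<Union>G = uminus ` \<Union>F" by (auto simp: G_def)
    have diamk: "dist x y < h" if "(z, k) \<in> p" "x \<in> k" "y \<in> k" for x y z k
    proof -
      have "k \<subseteq> ball z (h / 2)" using p(2) that(1) unfolding fine_def by blast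
      then have "dist z x < h / 2" "dist z y < h / 2" using that by (auto simp: subset_iff)
      then show ?thesis using dist_triangle_less_add[of x z "h/2" y "h/2"] by (simp add: dist_commute)
    qed
    have near: "\<exists>e\<in>E. dist x e < h" if xF: "x \<in> \<Union>F" for x
    proof -
      obtain z k e where "(z, k) \<in> p" "x \<in> interior k" "e \<in> k" "e \<in> E" using xF unfolding F_def by blast
      then show ?thesis using diamk[of z k x e] interior_subset by blast
    qed
    have sum_sub: "mink_sum (\<Union>F) (\<Union>G) \<subseteq> ball 0 (diameter E + 3 * h)"
    proof
      fix z assume "z \<in> mink_sum (\<Union>F) (\<Union>G)"
      then obtain x v where "z = x + v" "x \<in> \<Union>F" "v \<in> uminus ` \<Union>F" unfolding mink_sum_def UG by blast
      then obtain y where xy: "z = x - y" "x \<in> \<Union>F" "y \<in> \<Union>F" using um[of v "\<Union>F"] by (metis diff_minus_eq_add)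
      obtain e f where ef: "e \<in> E" "dist x e < h" "f \<in> E" "dist y f < h" using near xy by blast
      have "dist x y \<le> dist x e + dist e f + dist f y" by metric
      moreover have "dist e f \<le> diameter E" by (rule diameter_bounded_bound[OF E(1) ef(1,3)])
      ultimately have "dist x y < diameter E + 3 * h" using ef h by (simp add: dist_commute)
      then show "z \<in> ball 0 (diameter E + 3 * h)" using xy(1) by (simp add: dist_norm norm_minus_commute)
    qed
    have cover: "emeasure lebesgue E \<le> emeasure lebesgue (\<Union>F)"
    proof -
      \<comment> \<open>F consists of the interiors of cells, to be disjoint and open; the points of
        E that this loses lie on cell boundaries, a null set.\<close>
      define N where "N = (\<Union>(x, k)\<in>p. frontier k)"
      have N: "N \<in> null_sets lebesgue"
        unfolding N_def
      proof (rule null_sets_UN')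
        fix q assume "q \<in> p"
        then obtain x k where q: "q = (x, k)" "(x, k) \<in> p" by (cases q) auto
        then obtain u v where "k = cbox u v" using tagged_division_ofD(4)[OF p(1)] by blast
        then have "negligible (frontier k)" by (intro negligible_convex_frontier) auto
        then show "(case q of (x, k) \<Rightarrow> frontier k) \<in> null_sets lebesgue" using q by (simp add: negligible_iff_null_sets)
      qed (use finp countable_finite in blast)
      have "E \<subseteq> \<Union>F \<union> N"
      proof
        fix e assume e: "e \<in> E"
        then have "e \<in> \<Union>{k. \<exists>x. (x, k) \<in> p}" using a tagged_division_ofD(6)[OF p(1)] by blast
        then obtain x k where k: "(x, k) \<in> p" "e \<in> k" by blast
        have cl: "closed k" using tagged_division_ofD(4)[OF p(1) k(1)] by auto
        show "e \<in> \<Union>F \<union> N"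
        proof (cases "e \<in> interior k")
          case True
          then show ?thesis using k e by (auto simp: F_def)
        next
          case False
          then have "e \<in> frontier k" using k cl by (simp add: frontier_def)
          then show ?thesis using k by (auto simp: N_def)
        qed
      qed
      then have "emeasure lebesgue E \<le> emeasure lebesgue (\<Union>F \<union> N)"
        using N box_family_open[OF bf] by (intro emeasure_mono) auto
      also have "\<dots> = emeasure lebesgue (\<Union>F)"
        using N box_family_open[OF bf] by (intro emeasure_Un_null_set) auto
      finally show ?thesis .
    qed
    have "measure lebesgue E \<le> measure lborel (\<Union>F)"
    proof -
      have "emeasure lborel (\<Union>F) < top" using emeasure_bounded_finite[OF box_family_bounded[OF bf]] by simp
      then show ?thesis using cover box_family_open[OF bf] unfolding measure_def by (intro enn2real_mono) auto
    qed
    also have "\<dots> \<le> unit_ball_vol (real ?n) * ((diameter E + 3 * h) / 2) ^ ?n"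
    proof (cases "F = {}")
      case True
      then show ?thesis using diameter_ge_0[OF E(1)] h by simp
    next
      case Fne: False
      \<comment> \<open>Reflection preserves volume, so the geometric mean is the volume of
        \<open>\<Union>F\<close> itself.\<close>
      have "measure lborel (\<Union>G) = measure lborel (\<Union>F)"
      proof -
        have "emeasure lebesgue (uminus ` \<Union>F) = emeasure lebesgue (\<Union>F)"
          using emeasure_lebesgue_affine[of "-1" 0 "\<Union>F"] box_family_open[OF bf] by (simp add: image_def)
        then show ?thesis unfolding UG[symmetric] measure_def using box_family_open[OF bf] box_family_open[OF bg] by simp
      qed
      then have "2 ^ ?n * measure lborel (\<Union>F) \<le> measure lborel (mink_sum (\<Union>F) (\<Union>G))"
        using brunn_minkowski_boxes[OF bf bg] Fne by (simp add: G_def)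
      also have "\<dots> \<le> measure lborel (ball (0::'a) (diameter E + 3 * h))"
        by (intro measure_mono_fmeasurable sum_sub)
          (use open_mink_sum[OF box_family_open[OF bf]] bounded_open_measurable[OF bounded_ball open_ball] in auto)
      also have "\<dots> = unit_ball_vol (real ?n) * (diameter E + 3 * h) ^ ?n"
        using diameter_ge_0[OF E(1)] h by (simp add: measure_def emeasure_ball)
      finally have "measure lborel (\<Union>F) \<le> unit_ball_vol (real ?n) * (diameter E + 3 * h) ^ ?n / 2 ^ ?n"
        by (simp add: pos_le_divide_eq mult.commute)
      then show ?thesis by (simp add: power_divide)
    qed
    finally show ?thesis .
  qed
  have "((\<lambda>h. unit_ball_vol (real ?n) * ((diameter E + 3 * h) / 2) ^ ?n) \<longlongrightarrow> unit_ball_vol (real ?n) * ((diameter E + 3 * 0) / 2) ^ ?n) (at_right 0)"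
    by (intro tendsto_intros) simp
  then have "measure lebesgue E \<le> unit_ball_vol (real ?n) * ((diameter E + 3 * 0) / 2) ^ ?n"
    by (rule tendsto_lowerbound) (auto simp: eventually_at_right_less intro!: eventually_mono[OF eventually_at_right_less[of 0]] bound)
  moreover have "E \<in> lmeasurable" using bounded_set_imp_lmeasurable[OF E] .
  ultimately show ?thesis by (simp add: emeasure_eq_measure2 ennreal_leI)
qed simp

section \<open>Flat pieces of rectifiable sets\<close>

text \<open>The isodiametric inequality bounds the volume of each member of an arbitrary covering by
  its Hausdorff weight. Closures are measurable and have the same diameter.\<close>

lemma lebesgue_le_hausdorff:
  fixes A :: "'a::euclidean_space set"
  assumes A: "A \<in> sets lebesgue" shows "emeasure lebesgue A \<le> hausdorff DIM('a) A"
proof -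
  have "emeasure lebesgue A \<le> hausdorff_pre DIM('a) 1 A"
    unfolding hausdorff_pre_def
  proof (rule INF_greatest, safe)
    fix C :: "nat \<Rightarrow> 'a set" assume C: "A \<subseteq> (\<Union>i. C i)" "\<forall>i. bounded (C i) \<and> diameter (C i) \<le> 1"
    have cl: "closure (C i) \<in> sets lebesgue" for i by simp
    have "emeasure lebesgue A \<le> emeasure lebesgue (\<Union>i. closure (C i))"
    proof (rule emeasure_mono)
      show "A \<subseteq> (\<Union>i. closure (C i))"
        by (rule subset_trans[OF C(1)]) (intro UN_mono subset_UNIV closure_subset order_refl)
      show "(\<Union>i. closure (C i)) \<in> sets lebesgue" by (rule sets.countable_UN) (use cl in blast)
    qed
    also have "\<dots> \<le> (\<Sum>i. emeasure lebesgue (closure (C i)))"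
      by (rule emeasure_subadditive_countably) (use cl in blast)
    also have "\<dots> \<le> (\<Sum>i. ennreal (unit_ball_vol (real DIM('a)) * (diameter (C i) / 2) ^ DIM('a)))"
    proof (intro suminf_le)
      fix i
      have "bounded (closure (C i))" "diameter (closure (C i)) = diameter (C i)"
        using C(2) by (auto simp: diameter_closure)
      then show "emeasure lebesgue (closure (C i)) \<le> ennreal (unit_ball_vol (real DIM('a)) * (diameter (C i) / 2) ^ DIM('a))"
        using isodiametric[OF _ cl] by metis
    qed auto
    finally show "emeasure lebesgue A \<le> (\<Sum>i. ennreal (unit_ball_vol (real DIM('a)) * (diameter (C i) / 2) ^ DIM('a)))" .
  qed
  also have "\<dots> \<le> hausdorff DIM('a) A" by (rule hausdorff_pre_le_hausdorff) simp
  finally show ?thesis .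
qed

lemma hausdorff_pre_UN_count_space:
  assumes I: "countable I" and m: "m > 0" "d \<ge> 0"
  shows "hausdorff_pre m d (\<Union>i\<in>I. A i) \<le> (\<integral>\<^sup>+i. hausdorff_pre m d (A i) \<partial>count_space I)"
proof -
  define g where "g = to_nat_on I"
  have g: "inj_on g I" using I by (simp add: g_def inj_on_to_nat_on)
  define C where "C = (\<lambda>n. if n \<in> g ` I then A (inv_into I g n) else {})"
  have "(\<Union>i\<in>I. A i) \<subseteq> (\<Union>n. C n)"
  proof
    fix x assume "x \<in> (\<Union>i\<in>I. A i)" then obtain i where "i \<in> I" "x \<in> A i" by auto
    then have "x \<in> C (g i)" using g by (simp add: C_def)
    then show "x \<in> (\<Union>n. C n)" by blast
  qed
  then have "hausdorff_pre m d (\<Union>i\<in>I. A i) \<le> hausdorff_pre m d (\<Union>n. C n)" by (rule hausdorff_pre_mono)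
  also have "\<dots> \<le> (\<Sum>n. hausdorff_pre m d (C n))" by (rule hausdorff_pre_subadditive)
  also have "\<dots> = (\<Sum>n. hausdorff_pre m d (A (inv_into I g n)) * indicator (g ` I) n)"
    by (rule suminf_cong) (use m in \<open>auto simp: C_def hausdorff_pre_empty\<close>)
  also have "\<dots> = (\<integral>\<^sup>+n. hausdorff_pre m d (A (inv_into I g n)) * indicator (g ` I) n \<partial>count_space UNIV)"
    by (simp add: nn_integral_count_space_nat)
  also have "\<dots> = (\<integral>\<^sup>+n. hausdorff_pre m d (A (inv_into I g n)) \<partial>count_space (g ` I))"
    by (simp add: nn_integral_count_space_indicator)
  also have "\<dots> = (\<integral>\<^sup>+i. hausdorff_pre m d (A (inv_into I g (g i))) \<partial>count_space I)"
    by (rule nn_integral_bij_count_space[symmetric]) (use g in \<open>simp add: bij_betw_def\<close>)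
  also have "\<dots> = (\<integral>\<^sup>+i. hausdorff_pre m d (A i) \<partial>count_space I)"
    using g by (intro nn_integral_cong) simp
  finally show ?thesis .
qed

text \<open>The uniform bound on the size of separated sets yields one of maximal cardinality; a
  point missed by its balls could be added.\<close>

lemma maximal_separated_subset:
  fixes S :: "'a::metric_space set"
  assumes M: "\<And>T. finite T \<Longrightarrow> T \<subseteq> S \<Longrightarrow> (\<And>s t. s \<in> T \<Longrightarrow> t \<in> T \<Longrightarrow> s \<noteq> t \<Longrightarrow> a < dist s t) \<Longrightarrow> real (card T) \<le> M"
    and a: "a \<ge> 0"
  obtains T where "finite T" "T \<subseteq> S" "real (card T) \<le> M" "S \<subseteq> (\<Union>t\<in>T. cball t a)"
proof -
  let ?P = "\<lambda>T. finite T \<and> T \<subseteq> S \<and> (\<forall>s\<in>T. \<forall>t\<in>T. s \<noteq> t \<longrightarrow> a < dist s t)"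
  have "?P {}" by simp
  moreover have "\<forall>T. ?P T \<longrightarrow> card T < Suc (nat \<lfloor>M\<rfloor>)"
  proof (intro allI impI)
    fix T assume "?P T"
    then have "real (card T) \<le> M" by (intro M) simp_all
    then show "card T < Suc (nat \<lfloor>M\<rfloor>)" by (intro le_imp_less_Suc le_nat_floor)
  qed
  ultimately have "\<exists>T. ?P T \<and> (\<forall>T'. ?P T' \<longrightarrow> card T' \<le> card T)"
    by (rule ex_has_greatest_nat)
  then obtain T where T0: "?P T \<and> (\<forall>T'. ?P T' \<longrightarrow> card T' \<le> card T)" by (rule exE)
  have T: "?P T" "\<forall>T'. ?P T' \<longrightarrow> card T' \<le> card T" by (rule conjunct1[OF T0], rule conjunct2[OF T0])
  show ?thesis
  proof (rule that)
    show "S \<subseteq> (\<Union>t\<in>T. cball t a)"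
    proof (rule ccontr)
      assume "\<not> ?thesis"
      then obtain s where "s \<in> S" "s \<notin> (\<Union>t\<in>T. cball t a)" by blast
      then have s: "s \<in> S" "\<And>t. t \<in> T \<Longrightarrow> a < dist t s" by (auto simp: not_le)
      then have "s \<notin> T" using a by force
      have "?P (insert s T)" using T(1) s by (auto simp: dist_commute)
      then have "card (insert s T) \<le> card T" using T(2) by blast
      then show False using T(1) \<open>s \<notin> T\<close> by simp
    qed
  qed (use T(1) M in auto)
qed

text \<open>A linear map with a kernel maps a ball into a thin set: translating a separated family of
  points along a kernel direction produces many disjoint balls, so the family is small.\<close>

lemma separated_degenerate_card:
  fixes f D :: "'b::euclidean_space \<Rightarrow> 'a::euclidean_space"
  assumes L: "L \<ge> 1" and \<eta>: "0 < \<eta>" "\<eta> \<le> 1" and r: "r > 0"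
    and D: "linear D" "\<And>v. norm (D v) \<le> L * norm v" and k: "D k = 0" "norm k = 1"
    and P: "P \<subseteq> ball x (5 * r)" "\<And>y. y \<in> P \<Longrightarrow> norm (f y - f x - D (y - x)) \<le> \<eta> * r"
    and T: "finite T" "T \<subseteq> f ` P" "\<And>s t. s \<in> T \<Longrightarrow> t \<in> T \<Longrightarrow> s \<noteq> t \<Longrightarrow> 4 * \<eta> * r < dist s t"
  shows "real (card T) \<le> 2 * 9 ^ DIM('b) * L ^ DIM('b) * \<eta> / \<eta> ^ DIM('b)"
proof -
  let ?n = "DIM('b)"
  have "\<forall>t\<in>T. \<exists>y\<in>P. f y = t" using T(2) by blast
  then obtain y where y: "\<And>t. t \<in> T \<Longrightarrow> y t \<in> P" "\<And>t. t \<in> T \<Longrightarrow> f (y t) = t" by metis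
  \<comment> \<open>Points of T are 4 \<eta> r apart and each linearisation error is at most \<eta>
    r, so their images under D still differ by 2 \<eta> r and the arguments of D by 2 \<eta> r / L =
    2 \<mu>.\<close>
  define \<mu> where "\<mu> = \<eta> * r / L"
  have \<mu>: "\<mu> > 0" "\<mu> \<le> r"
  proof -
    show "\<mu> > 0" using L \<eta> r by (simp add: \<mu>_def)
    have "\<eta> * r \<le> 1 * r" using \<eta> r by (intro mult_right_mono) auto
    also have "\<dots> \<le> r * L" using r L by simp
    finally show "\<mu> \<le> r" using L by (simp add: \<mu>_def pos_divide_le_eq)
  qed
  \<comment> \<open>The number of steps of length 2 \<mu> that fit into a segment of length about r
    along k; it gains the factor L / (2 \<eta>).\<close>
  define J where "J = nat \<lceil>L / (2 * \<eta>)\<rceil>"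
  have J: "L / (2 * \<eta>) \<le> real J" "real J \<le> L / (2 * \<eta>) + 1"
    using L \<eta> by (auto simp: J_def of_nat_nat)
  \<comment> \<open>Removing the component along k does not change the value of D, so the projected
    points remain separated within the orthogonal complement of k.\<close>
  define v where "v t = (y t - x) - ((y t - x) \<bullet> k) *\<^sub>R k" for t
  have kk: "k \<bullet> k = 1" using k(2) by (simp add: dot_square_norm)
  have vk: "v t \<bullet> k = 0" for t by (simp add: v_def inner_diff_left kk)
  have Dv: "D (v t) = D (y t - x)" for t
    using k by (simp add: v_def linear_diff[OF D(1)] linear_cmul[OF D(1)])
  have vn: "norm (v t) \<le> 5 * r" if "t \<in> T" for t
  proof -
    define a where "a = y t - x"
    have "(norm (v t))\<^sup>2 = (norm a)\<^sup>2 - (a \<bullet> k)\<^sup>2"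
      unfolding power2_norm_eq_inner v_def a_def[symmetric]
      by (simp add: inner_diff_left inner_diff_right kk inner_commute[of k a] power2_eq_square)
    then have "(norm (v t))\<^sup>2 \<le> (norm a)\<^sup>2" by simp
    then have "norm (v t) \<le> norm (y t - x)" unfolding a_def by (rule power2_le_imp_le[OF _ norm_ge_zero])
    also have "\<dots> \<le> 5 * r" using P(1) y(1)[OF that] by (auto simp: dist_norm norm_minus_commute subset_iff less_imp_le)
    finally show ?thesis .
  qed
  have sep: "2 * \<mu> < norm (v s - v t)" if "s \<in> T" "t \<in> T" "s \<noteq> t" for s t
  proof -
    have "s - t = (f (y s) - f x - D (y s - x)) - (f (y t) - f x - D (y t - x)) + D (v s - v t)"
      using y(2) that by (simp add: linear_diff[OF D(1)] Dv)
    also have "norm \<dots> \<le> norm (f (y s) - f x - D (y s - x)) + norm (f (y t) - f x - D (y t - x)) + norm (D (v s - v t))"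
      by (meson add_right_mono norm_triangle_ineq norm_triangle_ineq4 order_trans)
    also have "\<dots> \<le> \<eta> * r + \<eta> * r + L * norm (v s - v t)"
      using P(2)[OF y(1)] that D(2) by (intro add_mono) auto
    finally have "2 * \<eta> * r < L * norm (v s - v t)" using T(3)[OF that] by (simp add: dist_norm)
    then show ?thesis using L by (simp add: \<mu>_def pos_divide_less_eq mult_ac)
  qed
  \<comment> \<open>Each projected point is stacked J times along k. The balls of radius \<mu>
    around these points are disjoint and stay in a ball of radius 9 r, and comparing volumes bounds
    the size of T.\<close>
  define w where "w = (\<lambda>(t, j). v t + (2 * \<mu> * real j) *\<^sub>R k)"
  have inner_w: "w p - w q = (v (fst p) - v (fst q)) + (2 * \<mu> * (real (snd p) - real (snd q))) *\<^sub>R k" for p q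
    by (simp add: w_def split_def algebra_simps)
  have wd: "2 * \<mu> \<le> norm (w p - w q)" if "p \<in> T \<times> {..<J}" "q \<in> T \<times> {..<J}" "p \<noteq> q" for p q
  proof -
    define a b where "a = v (fst p) - v (fst q)" "b = 2 * \<mu> * (real (snd p) - real (snd q))"
    let ?a = "v (fst p) - v (fst q)" and ?c = "2 * \<mu> * (real (snd p) - real (snd q))"
    have ak: "a \<bullet> k = 0" by (simp add: a_b_def inner_diff_left vk)
    have "(norm (w p - w q))\<^sup>2 = (norm ?a)\<^sup>2 + ?c\<^sup>2"
      unfolding inner_w a_b_def[symmetric] power2_norm_eq_inner
      by (simp add: inner_add_left inner_add_right ak kk inner_commute[of k a] power2_eq_square)
    moreover have "(2 * \<mu>)\<^sup>2 \<le> (norm ?a)\<^sup>2 + ?c\<^sup>2"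
    proof (cases "fst p = fst q")
      case False
      then have "2 * \<mu> < norm ?a" using sep that by auto
      then have "(2 * \<mu>)\<^sup>2 \<le> (norm ?a)\<^sup>2" using \<mu> by (intro power_mono) auto
      then show ?thesis by (simp add: add_increasing2)
    next
      case True
      then have "snd p \<noteq> snd q" using that(3) by (simp add: prod_eq_iff)
      then have "1 \<le> \<bar>real (snd p) - real (snd q)\<bar>" by linarith
      then have "2 * \<mu> \<le> \<bar>?c\<bar>" using \<mu> by (simp add: abs_mult)
      then have "(2 * \<mu>)\<^sup>2 \<le> ?c\<^sup>2" using \<mu> by (metis abs_le_square_iff abs_of_nonneg less_imp_le mult_nonneg_nonneg zero_le_numeral)
      then show ?thesis by (simp add: add_increasing)
    qed
    ultimately show ?thesis by (metis norm_ge_zero power2_le_imp_le)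
  qed
  have dj: "disjoint_family_on (\<lambda>p. ball (w p) \<mu>) (T \<times> {..<J})"
    unfolding disjoint_family_on_def
  proof (intro ballI impI)
    fix p q assume pq: "p \<in> T \<times> {..<J}" "q \<in> T \<times> {..<J}" "p \<noteq> q"
    then have "\<mu> + \<mu> \<le> dist (w p) (w q)" using wd by (simp add: dist_norm)
    then show "ball (w p) \<mu> \<inter> ball (w q) \<mu> = {}" using \<mu> by (auto simp: disjoint_ballI)
  qed
  have sub: "(\<Union>p\<in>T \<times> {..<J}. ball (w p) \<mu>) \<subseteq> ball 0 (9 * r)"
  proof
    fix z assume "z \<in> (\<Union>p\<in>T \<times> {..<J}. ball (w p) \<mu>)"
    then obtain t j where tj: "t \<in> T" "j < J" "norm (w (t, j) - z) < \<mu>" by (auto simp: dist_norm)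
    have "2 * \<mu> * real j \<le> 2 * \<mu> * (L / (2 * \<eta>))" using \<mu> tj(2) J by (intro mult_left_mono) linarith+
    also have "\<dots> = r" using L \<eta> by (simp add: \<mu>_def)
    finally have "norm ((2 * \<mu> * real j) *\<^sub>R k) \<le> r" using k(2) \<mu> by (simp add: abs_mult)
    then have "norm (w (t, j)) \<le> 5 * r + r" using vn[OF tj(1)] norm_triangle_ineq[of "v t" "(2 * \<mu> * real j) *\<^sub>R k"] by (simp add: w_def)
    moreover have "norm z \<le> norm (w (t, j)) + norm (w (t, j) - z)" by norm
    ultimately show "z \<in> ball 0 (9 * r)" using tj(3) \<mu> r by simp
  qed
  let ?\<omega> = "unit_ball_vol (real ?n)"
  have "ennreal (real (card T * J)) * ennreal (?\<omega> * \<mu> ^ ?n) = (\<Sum>p\<in>T \<times> {..<J}. emeasure lborel (ball (w p) \<mu>))"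
    using \<mu> by (simp add: emeasure_ball ennreal_of_nat_eq_real_of_nat card_cartesian_product)
  also have "\<dots> = emeasure lborel (\<Union>p\<in>T \<times> {..<J}. ball (w p) \<mu>)"
    using T(1) dj by (intro sum_emeasure) auto
  also have "\<dots> \<le> emeasure lborel (ball (0::'b) (9 * r))"
    by (rule emeasure_mono[OF sub]) simp
  also have "\<dots> = ennreal (?\<omega> * (9 * r) ^ ?n)" using r by (simp add: emeasure_ball)
  finally have "real (card T * J) * (?\<omega> * \<mu> ^ ?n) \<le> ?\<omega> * (9 * r) ^ ?n"
    using \<mu> r by (subst (asm) ennreal_mult[symmetric]) (auto simp: ennreal_le_iff)
  then have "?\<omega> * (real (card T) * real J * \<mu> ^ ?n) \<le> ?\<omega> * (9 * r) ^ ?n" by (simp add: mult_ac)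
  then have "real (card T) * real J * \<mu> ^ ?n \<le> (9 * r) ^ ?n" by simp
  moreover have "real (card T) * (L / (2 * \<eta>)) * \<mu> ^ ?n \<le> real (card T) * real J * \<mu> ^ ?n"
    using J \<mu> by (intro mult_right_mono mult_left_mono) auto
  ultimately have "real (card T) * (L / (2 * \<eta>)) * (\<eta> * r / L) ^ ?n \<le> (9 * r) ^ ?n" by (simp add: \<mu>_def)
  then have "r ^ ?n * (real (card T) * (L / (2 * \<eta>)) * (\<eta> / L) ^ ?n) \<le> r ^ ?n * 9 ^ ?n"
    by (simp add: power_mult_distrib power_divide mult_ac)
  then have "real (card T) * (L / (2 * \<eta>)) * (\<eta> / L) ^ ?n \<le> 9 ^ ?n" by (rule mult_left_le_imp_le[OF _ zero_less_power[OF r]])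
  then have "real (card T) * L * \<eta> ^ ?n \<le> 2 * 9 ^ ?n * L ^ ?n * \<eta>"
    using L \<eta> by (simp add: power_divide field_simps)
  moreover have "real (card T) * 1 * \<eta> ^ ?n \<le> real (card T) * L * \<eta> ^ ?n"
    using L \<eta> by (intro mult_right_mono mult_left_mono) auto
  ultimately have "real (card T) * \<eta> ^ ?n \<le> 2 * 9 ^ ?n * L ^ ?n * \<eta>" by simp
  then show ?thesis using \<eta> by (simp add: pos_le_divide_eq)
qed

lemma lipschitz_derivative_bound:
  fixes f :: "'b::real_normed_vector \<Rightarrow> 'a::real_normed_vector"
  assumes f: "L-lipschitz_on UNIV f" and D: "(f has_derivative D) (at x)"
  shows "norm (D v) \<le> L * norm v"
proof (cases "v = 0")
  case True
  then show ?thesis using has_derivative_linear[OF D] by (simp add: linear_0)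
next
  case False
  have "norm (D v) \<le> L * norm v + e" if e: "e > 0" for e
  proof -
    have "e / norm v > 0" using e False by simp
    then obtain d where d: "d > 0" "\<And>y. norm (y - x) < d \<Longrightarrow> norm (f y - f x - D (y - x)) \<le> e / norm v * norm (y - x)"
      using D unfolding has_derivative_at_alt by metis
    define t where "t = d / (2 * norm v)"
    have t: "t > 0" "t * norm v < d" using d False by (simp_all add: t_def)
    let ?r = "f (x + t *\<^sub>R v) - f x - D (t *\<^sub>R v)"
    have "norm ?r \<le> e / norm v * norm (t *\<^sub>R v)" using d(2)[of "x + t *\<^sub>R v"] t by simp
    also have "\<dots> = t * e" using t False by simp
    finally have r: "norm ?r \<le> t * e" .
    have "norm (f (x + t *\<^sub>R v) - f x) \<le> L * norm (t *\<^sub>R v)"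
      using lipschitz_onD[OF f, of "x + t *\<^sub>R v" x] by (simp add: dist_norm)
    moreover have "norm (D (t *\<^sub>R v)) \<le> norm (f (x + t *\<^sub>R v) - f x) + norm ?r"
      by (metis add.commute diff_add_cancel norm_minus_commute norm_triangle_sub)
    ultimately have "t * norm (D v) \<le> t * (L * norm v + e)"
      using r t by (simp add: linear_cmul[OF has_derivative_linear[OF D]] algebra_simps)
    then show ?thesis using t by simp
  qed
  then show ?thesis by (rule field_le_epsilon)
qed

text \<open>A Sard type statement: where the derivative has a kernel, the image of a small ball has
  covering weight at most a multiple of \<eta> times the volume of the ball. A Vitali selection sums
  this over disjoint balls, and \<eta> is arbitrary.\<close>

lemma hausdorff_degenerate_image:
  fixes f :: "'b::euclidean_space \<Rightarrow> 'a::euclidean_space"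
  assumes f: "L-lipschitz_on UNIV f" and L: "L \<ge> 1"
    and Z: "Z \<subseteq> ball 0 R" "\<And>x. x \<in> Z \<Longrightarrow> \<exists>D k. (f has_derivative D) (at x) \<and> D k = 0 \<and> norm k = 1"
  shows "hausdorff DIM('b) (f ` Z) = 0"
proof -
  let ?n = "DIM('b)" let ?\<omega> = "unit_ball_vol (real ?n)"
  define c where "c = 8 ^ ?n * 9 ^ ?n * 2 * L ^ ?n"
  have c0: "c \<ge> 0" using L by (simp add: c_def)
  have small: "hausdorff_pre ?n d (f ` Z) \<le> ennreal (c * \<eta>) * emeasure lebesgue (ball (0::'b) (R + 1))"
    if d: "d > 0" and \<eta>: "0 < \<eta>" "\<eta> \<le> 1" for d \<eta>
  proof -
    have "\<exists>r. 0 < r \<and> r \<le> min 1 (d / 8) \<and> hausdorff_pre ?n d (f ` ball x (5 * r)) \<le> ennreal (c * \<eta>) * emeasure lebesgue (ball x r)"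
      if x: "x \<in> Z" for x
    proof -
      obtain D k where D: "(f has_derivative D) (at x)" "D k = 0" "norm k = 1" using Z(2)[OF x] by blast
      have lin: "linear D" using D(1) has_derivative_linear by blast
      have Db: "norm (D v) \<le> L * norm v" for v
        by (rule lipschitz_derivative_bound[OF f D(1)])
      obtain s where s: "s > 0" "\<And>y. norm (y - x) < s \<Longrightarrow> norm (f y - f x - D (y - x)) \<le> \<eta> / 5 * norm (y - x)"
        using D(1) \<eta> unfolding has_derivative_at_alt by (metis divide_pos_pos zero_less_numeral)
      \<comment> \<open>The estimate is needed on the fivefold ball that the covering lemma uses,
        hence s / 5; the bound 1 keeps all balls in \<open>ball 0 (R + 1)\<close>.\<close>
      define r where "r = min (min 1 (d / 8)) (s / 5)"
      have r: "0 < r" "r \<le> min 1 (d / 8)" "5 * r \<le> s" using d s by (auto simp: r_def)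
      define P where "P = ball x (5 * r)"
      have P: "P \<subseteq> ball x (5 * r)" "\<And>y. y \<in> P \<Longrightarrow> norm (f y - f x - D (y - x)) \<le> \<eta> * r"
      proof -
        fix y assume "y \<in> P"
        then have y: "norm (y - x) < 5 * r" by (simp add: P_def dist_norm norm_minus_commute)
        then have "norm (f y - f x - D (y - x)) \<le> \<eta> / 5 * norm (y - x)" using s(2) r(3) by simp
        also have "\<dots> \<le> \<eta> / 5 * (5 * r)" using y \<eta> by (intro mult_left_mono) auto
        finally show "norm (f y - f x - D (y - x)) \<le> \<eta> * r" by simp
      qed (simp add: P_def)
      let ?M = "2 * 9 ^ ?n * L ^ ?n * \<eta> / \<eta> ^ ?n"
      obtain T where T: "finite T" "T \<subseteq> f ` P" "real (card T) \<le> ?M" "f ` P \<subseteq> (\<Union>t\<in>T. cball t (4 * \<eta> * r))"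
        by (rule maximal_separated_subset[where S="f ` P" and a="4 * \<eta> * r" and M="?M"])
          (use separated_degenerate_card[OF L \<eta> r(1) lin Db D(2,3) P] \<eta> r in auto)
      have "2 * (4 * \<eta> * r) \<le> d"
      proof -
        have "\<eta> * r \<le> 1 * r" using \<eta> r by (intro mult_right_mono) auto
        then show ?thesis using r(2) by simp
      qed
      then have "hausdorff_pre ?n d (f ` P) \<le> (\<integral>\<^sup>+t. ennreal (?\<omega> * (4 * \<eta> * r) ^ ?n) \<partial>count_space T)"
        using T(1,4) d \<eta> r
        by (intro hausdorff_pre_cover[where S="\<lambda>t. cball t (4 * \<eta> * r)"]) (auto simp: countable_finite diameter_cball)
      also have "\<dots> = ennreal (real (card T)) * ennreal (?\<omega> * (4 * \<eta> * r) ^ ?n)"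
        using T(1) by (simp add: nn_integral_count_space_finite ennreal_of_nat_eq_real_of_nat mult.commute)
      also have "\<dots> = ennreal (real (card T) * (?\<omega> * (4 * \<eta> * r) ^ ?n))"
        using \<eta> r by (intro ennreal_mult[symmetric]) auto
      \<comment> \<open>T has at most a multiple of \<eta> / \<eta>^n points, each with a ball of
        weight of order (\<eta> r)^n: the powers \<eta>^n cancel and one factor \<eta>
        remains.\<close>
      also have "\<dots> \<le> ennreal (c * \<eta> * (?\<omega> * r ^ ?n))"
      proof (rule ennreal_leI)
        have "real (card T) * (?\<omega> * (4 * \<eta> * r) ^ ?n) \<le> ?M * (?\<omega> * (4 * \<eta> * r) ^ ?n)"
          using T(3) \<eta> r by (intro mult_right_mono) auto
        also have "\<dots> = (4 ^ ?n * 9 ^ ?n * 2 * L ^ ?n) * \<eta> * (?\<omega> * r ^ ?n)"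
          using \<eta> by (simp add: power_mult_distrib field_simps)
        also have "\<dots> \<le> c * \<eta> * (?\<omega> * r ^ ?n)"
          unfolding c_def using \<eta> r L by (intro mult_right_mono power_mono) auto
        finally show "real (card T) * (?\<omega> * (4 * \<eta> * r) ^ ?n) \<le> c * \<eta> * (?\<omega> * r ^ ?n)" .
      qed
      also have "\<dots> = ennreal (c * \<eta>) * emeasure lebesgue (ball x r)"
        using c0 \<eta> r by (simp add: emeasure_ball ennreal_mult)
      finally show ?thesis using r by (auto simp: P_def)
    qed
    then obtain r where r: "\<And>x. x \<in> Z \<Longrightarrow> 0 < r x \<and> r x \<le> min 1 (d / 8)"
      "\<And>x. x \<in> Z \<Longrightarrow> hausdorff_pre ?n d (f ` ball x (5 * r x)) \<le> ennreal (c * \<eta>) * emeasure lebesgue (ball x (r x))" by metis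
    obtain C where C: "countable C" "C \<subseteq> Z" "pairwise (\<lambda>i j. disjnt (ball i (r i)) (ball j (r j))) C"
      "Z \<subseteq> (\<Union>i\<in>C. ball i (5 * r i))"
      by (rule Vitali_covering_lemma_balls[where S=Z and K=Z and a="\<lambda>x. x" and r=r and B=1])
        (use r in \<open>auto intro: centre_in_ball[THEN iffD2]\<close>)
    have "hausdorff_pre ?n d (f ` Z) \<le> hausdorff_pre ?n d (\<Union>i\<in>C. f ` ball i (5 * r i))"
      by (rule hausdorff_pre_mono) (use C(4) in blast)
    also have "\<dots> \<le> (\<integral>\<^sup>+i. hausdorff_pre ?n d (f ` ball i (5 * r i)) \<partial>count_space C)"
      by (rule hausdorff_pre_UN_count_space) (use C d in auto)
    also have "\<dots> \<le> (\<integral>\<^sup>+i. ennreal (c * \<eta>) * emeasure lebesgue (ball i (r i)) \<partial>count_space C)"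
      by (rule nn_integral_mono) (use r(2) C(2) in \<open>simp add: subset_iff\<close>)
    also have "\<dots> = ennreal (c * \<eta>) * (\<integral>\<^sup>+i. emeasure lebesgue (ball i (r i)) \<partial>count_space C)"
      by (rule nn_integral_cmult) simp
    also have "(\<integral>\<^sup>+i. emeasure lebesgue (ball i (r i)) \<partial>count_space C) = emeasure lebesgue (\<Union>i\<in>C. ball i (r i))"
    proof (rule emeasure_UN_countable[symmetric])
      show "disjoint_family_on (\<lambda>i. ball i (r i)) C"
        using C(3) by (auto simp: disjoint_family_on_def pairwise_def disjnt_def)
    qed (use C(1) in simp_all)
    also have "ennreal (c * \<eta>) * emeasure lebesgue (\<Union>i\<in>C. ball i (r i)) \<le> ennreal (c * \<eta>) * emeasure lebesgue (ball (0::'b) (R + 1))"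
    proof (rule mult_left_mono[OF emeasure_mono])
      show "(\<Union>i\<in>C. ball i (r i)) \<subseteq> ball 0 (R + 1)"
      proof
        fix z assume "z \<in> (\<Union>i\<in>C. ball i (r i))"
        then obtain i where i: "i \<in> C" "dist i z < r i" by auto
        then have "norm i < R" "r i \<le> 1" using C(2) Z(1) r(1)[of i] by (auto simp: subset_iff)
        moreover have "norm z \<le> norm i + dist i z" unfolding dist_norm by norm
        ultimately show "z \<in> ball 0 (R + 1)" using i by simp
      qed
    qed auto
    finally show ?thesis .
  qed
  define V where "V = measure lebesgue (ball (0::'b) (R + 1))"
  have V: "emeasure lebesgue (ball (0::'b) (R + 1)) = ennreal V"
    unfolding V_def by (rule emeasure_eq_measure2) simp
  have "hausdorff_pre ?n d (f ` Z) = 0" if d: "d > 0" for d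
  proof -
    have "hausdorff_pre ?n d (f ` Z) \<le> ennreal e" if e: "e > 0" for e
    proof -
      define \<eta> where "\<eta> = min 1 (e / (c * V + 1))"
      have cV: "c * V \<ge> 0" using c0 by (simp add: V_def)
      have \<eta>: "0 < \<eta>" "\<eta> \<le> 1" using e cV by (auto simp: \<eta>_def add_nonneg_pos)
      have "c * \<eta> * V \<le> e"
      proof -
        have "\<eta> * (c * V) \<le> e / (c * V + 1) * (c * V)" using cV by (intro mult_right_mono) (auto simp: \<eta>_def)
        also have "\<dots> \<le> e" using cV e by (simp add: field_simps)
        finally show ?thesis by (simp add: mult_ac)
      qed
      moreover have "hausdorff_pre ?n d (f ` Z) \<le> ennreal (c * \<eta>) * ennreal V" using small[OF d \<eta>] V by simp
      ultimately show ?thesis using c0 \<eta> by (simp add: ennreal_mult[symmetric] V_def order_trans[OF _ ennreal_leI])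
    qed
    note le = this
    have "hausdorff_pre ?n d (f ` Z) \<le> 0"
    proof (rule ennreal_le_epsilon)
      fix e :: real assume "e > 0"
      then show "hausdorff_pre ?n d (f ` Z) \<le> 0 + ennreal e" using le by simp
    qed
    then show ?thesis by simp
  qed
  then show ?thesis using hausdorff_leI[of ?n "f ` Z" 0] by simp
qed

text \<open>A cone condition between all pairs of points: for l < 1 the set is a Lipschitz graph
  over the hyperplane orthogonal to e. Being uniform, the condition passes to subsets and
  closures.\<close>

definition flat_set :: "'a::euclidean_space \<Rightarrow> real \<Rightarrow> 'a set \<Rightarrow> bool" where
  "flat_set e l E \<longleftrightarrow> norm e = 1 \<and> (\<forall>x\<in>E. \<forall>y\<in>E. \<bar>(x - y) \<bullet> e\<bar> \<le> l * norm (x - y))"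

lemma flat_set_subset: "flat_set e l E \<Longrightarrow> F \<subseteq> E \<Longrightarrow> flat_set e l F"
  unfolding flat_set_def by blast

lemma flat_set_closure: "flat_set e l E \<Longrightarrow> flat_set e l (closure E)"
  unfolding flat_set_def
proof (intro conjI ballI)
  fix x y assume E: "norm e = 1 \<and> (\<forall>x\<in>E. \<forall>y\<in>E. \<bar>(x - y) \<bullet> e\<bar> \<le> l * norm (x - y))" and xy: "x \<in> closure E" "y \<in> closure E"
  obtain a where a: "\<And>n::nat. a n \<in> E" "a \<longlonglongrightarrow> x" using xy(1) by (auto simp: closure_sequential)
  obtain b where b: "\<And>n::nat. b n \<in> E" "b \<longlonglongrightarrow> y" using xy(2) by (auto simp: closure_sequential)
  have "(\<lambda>n. \<bar>(a n - b n) \<bullet> e\<bar>) \<longlonglongrightarrow> \<bar>(x - y) \<bullet> e\<bar>" "(\<lambda>n. l * norm (a n - b n)) \<longlonglongrightarrow> l * norm (x - y)"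
    by (intro tendsto_intros a b)+
  then show "\<bar>(x - y) \<bullet> e\<bar> \<le> l * norm (x - y)" by (rule LIMSEQ_le) (use E a b in blast)
qed simp

text \<open>Points without derivative or with a degenerate one have negligible image. At the others
  the range of the derivative has dimension below \<open>DIM('a)\<close>, hence a unit normal e, and
  f moves almost orthogonally to e near the point. The normal, the scale and the location are
  rounded to countable sets, which sorts these points into countably many flat pieces.\<close>

lemma lipschitz_range_flat_cover:
  fixes f :: "'b::euclidean_space \<Rightarrow> 'a::euclidean_space"
  assumes f: "L-lipschitz_on UNIV f" and dim: "DIM('a) = Suc DIM('b)" and l: "l > 0"
  shows "\<exists>\<F>. countable \<F> \<and> (\<forall>F\<in>\<F>. closed F \<and> (\<exists>e. flat_set e l F)) \<and> hausdorff DIM('b) (range f - \<Union>\<F>) = 0"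
proof -
  let ?n = "DIM('b)"
  define L' where "L' = max L 1"
  have f': "L'-lipschitz_on UNIV f" and L': "L' \<ge> 1" using f by (auto simp: L'_def intro: lipschitz_on_mono)
  define N where "N = {x. \<not> f differentiable (at x)}"
  have N: "hausdorff ?n (f ` N) = 0"
  proof -
    have "hausdorff ?n (f ` N) \<le> ennreal (L' ^ ?n) * hausdorff ?n N"
      using L' by (intro hausdorff_lipschitz_image lipschitz_on_subset[OF f']) auto
    also have "hausdorff ?n N = 0" unfolding N_def by (rule hausdorff_negligible[OF rademacher[OF f]])
    finally show ?thesis by simp
  qed
  define Z where "Z = {x. \<exists>D k. (f has_derivative D) (at x) \<and> D k = 0 \<and> norm k = 1}"
  have Z: "hausdorff ?n (f ` Z) = 0"
  proof -
    have "hausdorff ?n (f ` (Z \<inter> ball 0 (real R))) = 0" for R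
      by (rule hausdorff_degenerate_image[OF f' L', of _ "real R"]) (auto simp: Z_def)
    then have "hausdorff ?n (\<Union>R\<in>UNIV. f ` (Z \<inter> ball 0 (real R))) = 0"
      by (intro hausdorff_null_UN) auto
    moreover have "f ` Z \<subseteq> (\<Union>R\<in>UNIV. f ` (Z \<inter> ball 0 (real R)))"
    proof
      fix z assume "z \<in> f ` Z"
      then obtain x where x: "x \<in> Z" "z = f x" by auto
      obtain R where "norm x < real R" using reals_Archimedean2 by blast
      then have "x \<in> Z \<inter> ball 0 (real R)" using x(1) by simp
      then show "z \<in> (\<Union>R\<in>UNIV. f ` (Z \<inter> ball 0 (real R)))" unfolding x(2) by blast
    qed
    ultimately show ?thesis using hausdorff_mono by (metis le_zero_eq)
  qed
  obtain Q where Q: "countable Q" "\<And>X::'a set. open X \<Longrightarrow> X \<noteq> {} \<Longrightarrow> \<exists>d\<in>Q. d \<in> X" using countable_dense_setE by blast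
  obtain S where S: "countable S" "\<And>X::'b set. open X \<Longrightarrow> X \<noteq> {} \<Longrightarrow> \<exists>d\<in>S. d \<in> X" using countable_dense_setE by blast
  \<comment> \<open>The ball has half the radius of the scale, so that any two points of a piece lie
    within the scale of each other.\<close>
  define P where "P = (\<lambda>(q, m, p). {x \<in> ball p (inverse (2 * real (Suc m))). \<forall>y. norm (y - x) < inverse (real (Suc m)) \<longrightarrow>
      \<bar>(f y - f x) \<bullet> (q /\<^sub>R norm q)\<bar> \<le> l * norm (f y - f x)})"
  define I where "I = (Q - {0}) \<times> (UNIV :: nat set) \<times> S"
  define \<F> where "\<F> = (\<lambda>i. closure (f ` P i)) ` I"
  have cov: "x \<in> (\<Union>i\<in>I. P i)" if x: "x \<notin> N" "x \<notin> Z" for x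
  proof -
    obtain D where D: "(f has_derivative D) (at x)" using x(1) by (auto simp: N_def differentiable_def)
    have lin: "linear D" using D has_derivative_linear by blast
    have inj: "inj D"
    proof (rule linear_injective_0[OF lin, THEN iffD2], intro allI impI)
      fix v assume v: "D v = 0"
      show "v = 0"
      proof (rule ccontr)
        assume "v \<noteq> 0"
        then have "D (v /\<^sub>R norm v) = 0" "norm (v /\<^sub>R norm v) = 1" using v by (simp_all add: linear_cmul[OF lin])
        then show False using x(2) D unfolding Z_def by blast
      qed
    qed
    obtain B where B: "B > 0" "\<And>v. B * norm v \<le> norm (D v)" using linear_inj_bounded_below_pos[OF lin inj] by blast
    have "dim (range D) < DIM('a)" using dim_image_le[OF lin, of UNIV] dim by simp
    then obtain e0 where e0: "e0 \<noteq> 0" "\<And>y. y \<in> span (range D) \<Longrightarrow> orthogonal e0 y"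
      using orthogonal_to_subspace_exists by blast
    define e where "e = e0 /\<^sub>R norm e0"
    have e: "norm e = 1" "\<And>v. D v \<bullet> e = 0"
    proof -
      show "norm e = 1" using e0(1) by (simp add: e_def)
      show "D v \<bullet> e = 0" for v
        using e0(2)[OF span_base[of "D v" "range D"]] by (simp add: e_def orthogonal_def inner_commute)
    qed
    \<comment> \<open>Normalising q doubles its distance to e, so \<tau> <= l / 8 makes the change
      of normal cost at most l / 4.\<close>
    define \<tau> where "\<tau> = min (1/2) (l / 8)"
    have \<tau>: "\<tau> > 0" "\<tau> \<le> 1/2" "\<tau> \<le> l / 8" using l by (auto simp: \<tau>_def)
    obtain q where q: "q \<in> Q" "q \<in> ball e \<tau>" using Q(2)[of "ball e \<tau>"] \<tau> by auto
    have qe: "norm (q - e) < \<tau>" using q by (simp add: dist_norm norm_minus_commute)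
    have q0: "q \<noteq> 0" using qe e \<tau> by auto
    have qn: "norm (q /\<^sub>R norm q - e) \<le> 2 * \<tau>"
    proof -
      have "\<bar>norm q - norm e\<bar> \<le> norm (q - e)" by (rule norm_triangle_ineq3)
      then have "\<bar>1 - norm q\<bar> < \<tau>" using qe e by simp
      moreover define qq where "qq = q /\<^sub>R norm q"
      have nqq: "norm qq = 1" "norm q *\<^sub>R qq = q" using q0 by (simp_all add: qq_def)
      have "qq - q = (1 - norm q) *\<^sub>R qq" by (simp add: scaleR_left_diff_distrib nqq(2))
      then have "norm (qq - q) = \<bar>1 - norm q\<bar>" by (simp add: nqq(1))
      moreover have "norm (qq - e) \<le> norm (qq - q) + norm (q - e)" by norm
      ultimately show ?thesis using qe unfolding qq_def[symmetric] by linarith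
    qed
    \<comment> \<open>The first bound gives \<open>B / 2 * norm (y - x) <= norm (f y - f x)\<close>;
      by the second, the linearisation error is then at most l / 2 times
      \<open>norm (f y - f x)\<close>. Together with l / 4 this stays below l.\<close>
    define \<kappa> where "\<kappa> = min (B / 2) (l * B / 4)"
    have \<kappa>: "\<kappa> > 0" "\<kappa> \<le> B / 2" "\<kappa> \<le> l * B / 4" using B l by (auto simp: \<kappa>_def)
    obtain s where s: "s > 0" "\<And>y. norm (y - x) < s \<Longrightarrow> norm (f y - f x - D (y - x)) \<le> \<kappa> * norm (y - x)"
      using D \<kappa>(1) unfolding has_derivative_at_alt by metis
    obtain m where m: "inverse (real (Suc m)) < s" using reals_Archimedean[OF s(1)] by blast
    obtain p where p: "p \<in> S" "p \<in> ball x (inverse (2 * real (Suc m)))" using S(2)[of "ball x (inverse (2 * real (Suc m)))"] by auto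
    have "\<bar>(f y - f x) \<bullet> (q /\<^sub>R norm q)\<bar> \<le> l * norm (f y - f x)" if y: "norm (y - x) < inverse (real (Suc m))" for y
    proof -
      let ?d = "f y - f x" and ?r = "f y - f x - D (y - x)"
      have r: "norm ?r \<le> \<kappa> * norm (y - x)" using s(2) y m by simp
      have "B * norm (y - x) \<le> norm (D (y - x))" by (rule B)
      also have "\<dots> \<le> norm ?d + norm ?r" by norm
      finally have "B * norm (y - x) \<le> norm ?d + \<kappa> * norm (y - x)" using r by simp
      moreover have "\<kappa> * norm (y - x) \<le> B / 2 * norm (y - x)" using \<kappa> by (intro mult_right_mono) auto
      ultimately have low: "B / 2 * norm (y - x) \<le> norm ?d" by simp
      have "?d \<bullet> (q /\<^sub>R norm q) = ?r \<bullet> e + ?d \<bullet> (q /\<^sub>R norm q - e)"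
        using e(2)[of "y - x"] by (simp add: inner_diff_left inner_diff_right)
      also have "\<bar>\<dots>\<bar> \<le> \<bar>?r \<bullet> e\<bar> + \<bar>?d \<bullet> (q /\<^sub>R norm q - e)\<bar>" by (rule abs_triangle_ineq)
      also have "\<dots> \<le> norm ?r * norm e + norm ?d * norm (q /\<^sub>R norm q - e)"
        by (intro add_mono Cauchy_Schwarz_ineq2)
      also have "\<dots> \<le> \<kappa> * norm (y - x) + norm ?d * (l / 4)"
        using r e(1) qn \<tau>(3) by (intro add_mono mult_left_mono) auto
      also have "\<kappa> * norm (y - x) \<le> l * B / 4 * norm (y - x)" using \<kappa> by (intro mult_right_mono) auto
      also have "l * B / 4 * norm (y - x) = l / 2 * (B / 2 * norm (y - x))" by simp
      also have "l / 2 * (B / 2 * norm (y - x)) \<le> l / 2 * norm ?d" using low l by (intro mult_left_mono) auto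
      also have "l / 2 * norm ?d + norm ?d * (l / 4) \<le> l * norm ?d" using l by (simp add: algebra_simps)
      finally show ?thesis by simp
    qed
    then have "x \<in> P (q, m, p)" using p by (simp add: P_def dist_commute)
    moreover have "(q, m, p) \<in> I" using q p q0 by (simp add: I_def)
    ultimately show ?thesis by blast
  qed
  show ?thesis
  proof (intro exI[of _ \<F>] conjI ballI)
    show "countable \<F>" unfolding \<F>_def I_def using Q(1) S(1) by auto
    fix F assume "F \<in> \<F>"
    then obtain q m p where i: "F = closure (f ` P (q, m, p))" "q \<noteq> 0" by (auto simp: \<F>_def I_def)
    show "closed F" using i by simp
    have "flat_set (q /\<^sub>R norm q) l (f ` P (q, m, p))"
      unfolding flat_set_def
    proof (intro conjI ballI)
      fix u v assume "u \<in> f ` P (q, m, p)" "v \<in> f ` P (q, m, p)"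
      then obtain x y where xy: "u = f y" "v = f x" "y \<in> P (q, m, p)" "x \<in> P (q, m, p)" by auto
      have "dist p y < inverse (2 * real (Suc m))" "dist p x < inverse (2 * real (Suc m))" using xy by (auto simp: P_def)
      then have "dist y x < inverse (2 * real (Suc m)) + inverse (2 * real (Suc m))"
        using dist_triangle3[of y x p] by linarith
      also have "\<dots> = inverse (real (Suc m))" by (simp add: field_simps)
      finally have "norm (y - x) < inverse (real (Suc m))" by (simp only: dist_norm)
      then show "\<bar>(u - v) \<bullet> (q /\<^sub>R norm q)\<bar> \<le> l * norm (u - v)" using xy by (simp add: P_def)
    qed (use i in simp)
    then show "\<exists>e. flat_set e l F" using flat_set_closure i(1) by blast
  next
    have "range f - \<Union>\<F> \<subseteq> f ` N \<union> f ` Z"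
    proof
      fix z assume z: "z \<in> range f - \<Union>\<F>"
      then obtain x where x: "z = f x" by auto
      have "x \<notin> (\<Union>i\<in>I. P i)" using z x closure_subset[of "f ` P _"] unfolding \<F>_def by fastforce
      then show "z \<in> f ` N \<union> f ` Z" using cov x by blast
    qed
    then have "hausdorff ?n (range f - \<Union>\<F>) \<le> hausdorff ?n (f ` N) + hausdorff ?n (f ` Z)"
      by (intro order_trans[OF hausdorff_mono hausdorff_Un]) auto
    then show "hausdorff ?n (range f - \<Union>\<F>) = 0" using N Z by simp
  qed
qed

text \<open>The flat sets of all parametrisations are enumerated, made disjoint within K, and
  replaced by compact subsets through inner regularity; finiteness of the measure of K allows
  stopping after finitely many.\<close>

lemma rectifiable_flat_pieces:
  fixes K :: "'a::euclidean_space set"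
  assumes K: "K \<in> sets borel" "H_rectifiable TYPE('b::euclidean_space) K" and dim: "DIM('a) = Suc DIM('b)"
    and l: "l > 0" and \<eta>: "\<eta> > 0"
  obtains m :: nat and C :: "nat \<Rightarrow> 'a set"
  where "\<And>k. k < m \<Longrightarrow> compact (C k) \<and> C k \<subseteq> K \<and> (\<exists>e. flat_set e l (C k))"
    "disjoint_family_on C {..<m}" "hausdorff DIM('b) (K - (\<Union>k<m. C k)) \<le> ennreal \<eta>"
proof -
  let ?n = "DIM('b)"
  obtain f :: "nat \<Rightarrow> 'b \<Rightarrow> 'a" where f: "\<And>i. \<exists>L. L-lipschitz_on UNIV (f i)"
    "hausdorff ?n (K - (\<Union>i. range (f i))) = 0" and fin: "hausdorff ?n K < \<infinity>"
    using K(2) unfolding H_rectifiable_def by blast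
  have "\<exists>\<F>. countable \<F> \<and> (\<forall>F\<in>\<F>. closed F \<and> (\<exists>e. flat_set e l F)) \<and> hausdorff ?n (range (f i) - \<Union>\<F>) = 0" for i
    using f(1)[of i] lipschitz_range_flat_cover[OF _ dim l] by blast
  then obtain \<F> where \<F>: "\<And>i. countable (\<F> i)" "\<And>i F. F \<in> \<F> i \<Longrightarrow> closed F \<and> (\<exists>e. flat_set e l F)"
    "\<And>i. hausdorff ?n (range (f i) - \<Union>(\<F> i)) = 0" by metis
  \<comment> \<open>The empty set is added to the flat sets so that the enumeration is total; its
    flatness still requires some unit vector.\<close>
  obtain e0 :: 'a where e0: "norm e0 = 1" using vector_choose_size[of 1] by auto
  define \<G> where "\<G> = insert {} (\<Union>i. \<F> i)"
  have \<G>: "countable \<G>" "\<G> \<noteq> {}" using \<F>(1) by (auto simp: \<G>_def)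
  have \<G>f: "closed F \<and> (\<exists>e. flat_set e l F)" if "F \<in> \<G>" for F
    using that \<F>(2) e0 by (auto simp: \<G>_def flat_set_def)
  define F where "F = from_nat_into \<G>"
  have F: "closed (F k)" "\<exists>e. flat_set e l (F k)" for k
    using \<G>f from_nat_into[OF \<G>(2)] by (auto simp: F_def)
  have UF: "(\<Union>k. F k) = \<Union>\<G>" unfolding F_def using range_from_nat_into[OF \<G>(2,1)] by simp
  have null: "hausdorff ?n (K - (\<Union>k. F k)) = 0"
  proof -
    have "K - (\<Union>k. F k) \<subseteq> (K - (\<Union>i. range (f i))) \<union> (\<Union>i\<in>UNIV. range (f i) - \<Union>(\<F> i))"
      unfolding UF \<G>_def by blast
    then have "hausdorff ?n (K - (\<Union>k. F k)) \<le> hausdorff ?n (K - (\<Union>i. range (f i))) + hausdorff ?n (\<Union>i\<in>UNIV. range (f i) - \<Union>(\<F> i))"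
      by (intro order_trans[OF hausdorff_mono hausdorff_Un]) auto
    also have "hausdorff ?n (\<Union>i\<in>UNIV. range (f i) - \<Union>(\<F> i)) = 0"
      by (rule hausdorff_null_UN) (use \<F>(3) in auto)
    finally show ?thesis using f(2) by simp
  qed
  let ?H = "hausdorff_measure ?n :: 'a measure"
  \<comment> \<open>Restricted to K, the Hausdorff measure is a finite Borel measure, for which
    inner regularity by compact sets is available.\<close>
  define M where "M = density ?H (indicator K)"
  have M: "emeasure M A = hausdorff ?n (A \<inter> K)" if A: "A \<in> sets borel" for A
  proof -
    have "emeasure M A = (\<integral>\<^sup>+x. indicator K x * indicator A x \<partial>?H)"
      unfolding M_def by (rule emeasure_density) (use A K(1) in simp_all)
    also have "\<dots> = (\<integral>\<^sup>+x. indicator (A \<inter> K) x \<partial>?H)"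
      by (rule nn_integral_cong) (auto simp: indicator_def)
    also have "\<dots> = emeasure ?H (A \<inter> K)" by (rule nn_integral_indicator) (use A K(1) in simp)
    also have "\<dots> = hausdorff ?n (A \<inter> K)" by (rule emeasure_hausdorff_measure) (use A K(1) in simp_all)
    finally show ?thesis .
  qed
  have setsM: "sets M = sets borel" and spM: "space M = UNIV" by (simp_all add: M_def)
  have finM: "emeasure M (space M) \<noteq> \<infinity>" using M[of UNIV] fin spM by simp
  interpret finite_measure M by (rule finite_measureI[OF finM])
  define D where "D k = K \<inter> disjointed F k" for k
  have Db: "D k \<in> sets borel" for k
    unfolding D_def using K(1) F(1) sets.range_disjointed_sets[of F borel] by (intro sets.Int) (auto simp: image_subset_iff)
  have Dd: "disjoint_family D" using disjoint_family_disjointed[of F] by (auto simp: D_def disjoint_family_on_def)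
  have UD: "(\<Union>k. D k) = K \<inter> (\<Union>k. F k)" unfolding D_def by (simp add: UN_disjointed_eq flip: Int_UN_distrib)
  \<comment> \<open>The errors of the compact approximations sum to at most \<eta> / 2; the other
    half is kept for the pieces beyond index m.\<close>
  have "\<exists>C. C \<subseteq> D k \<and> compact C \<and> emeasure M (D k) < emeasure M C + ennreal (\<eta> / 2 * (1 / 2) ^ Suc k)" for k
  proof -
    let ?S = "{C. C \<subseteq> D k \<and> compact C}" and ?e = "\<eta> / 2 * (1 / 2) ^ Suc k"
    have "emeasure M (D k) = (SUP C \<in> ?S. emeasure M C)"
      by (rule inner_regular[OF setsM finM Db])
    then have sup: "emeasure M (D k) = (SUP C \<in> ?S. emeasure M C)" .
    show ?thesis
    proof (rule ccontr)
      assume "\<not> ?thesis"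
      then have "\<And>C. C \<in> ?S \<Longrightarrow> emeasure M C + ennreal ?e \<le> emeasure M (D k)" by (auto simp: not_less)
      then have "(SUP C \<in> ?S. emeasure M C + ennreal ?e) \<le> emeasure M (D k)" by (rule SUP_least)
      moreover have "?S \<noteq> {}" by auto
      then have "(SUP C \<in> ?S. emeasure M C + ennreal ?e) = (SUP C \<in> ?S. emeasure M C) + ennreal ?e"
        by (rule ennreal_SUP_add_left)
      ultimately have "emeasure M (D k) + ennreal ?e \<le> emeasure M (D k)"
        unfolding sup[symmetric] by (simp only:)
      then have "measure M (D k) + ?e \<le> measure M (D k)"
        using \<eta> unfolding emeasure_eq_measure by (subst (asm) ennreal_plus[symmetric]) (auto simp: ennreal_le_iff)
      moreover have "?e > 0" using \<eta> by simp
      ultimately show False by linarith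
    qed
  qed
  then obtain C where C: "\<And>k. C k \<subseteq> D k" "\<And>k. compact (C k)" "\<And>k. emeasure M (D k) < emeasure M (C k) + ennreal (\<eta> / 2 * (1 / 2) ^ Suc k)" by metis
  have Cb: "C k \<in> sets M" for k using C(2) setsM by (simp add: borel_compact)
  have DC: "emeasure M (D k - C k) \<le> ennreal (\<eta> / 2 * (1 / 2) ^ Suc k)" for k
  proof -
    have "measure M (D k) \<le> measure M (C k) + \<eta> / 2 * (1 / 2) ^ Suc k"
      using C(3)[of k] \<eta> unfolding emeasure_eq_measure
      by (simp add: ennreal_plus[symmetric] ennreal_less_iff less_imp_le del: ennreal_plus)
    moreover have "measure M (D k - C k) = measure M (D k) - measure M (C k)"
      using Cb C(1) Db setsM by (intro finite_measure_Diff) auto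
    ultimately show ?thesis unfolding emeasure_eq_measure by (intro ennreal_leI) simp
  qed
  have "(\<lambda>m. emeasure M (K - (\<Union>k<m. D k))) \<longlonglongrightarrow> emeasure M (\<Inter>m. K - (\<Union>k<m. D k))"
    using K(1) Db setsM emeasure_finite
    by (intro Lim_emeasure_decseq) (auto simp: decseq_def intro!: sets.Diff sets.finite_UN)
  also have "(\<Inter>m. K - (\<Union>k<m. D k)) = K - (\<Union>k. F k)" using UD by auto
  also have "emeasure M (K - (\<Union>k. F k)) = 0"
  proof -
    have "K - (\<Union>k. F k) \<in> sets borel" using K(1) F(1) by (intro sets.Diff sets.countable_UN) auto
    from M[OF this] have "emeasure M (K - (\<Union>k. F k)) = hausdorff ?n ((K - (\<Union>k. F k)) \<inter> K)" .
    also have "(K - (\<Union>k. F k)) \<inter> K = K - (\<Union>k. F k)" by blast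
    finally show ?thesis using null by simp
  qed
  finally have "eventually (\<lambda>m. emeasure M (K - (\<Union>k<m. D k)) < ennreal (\<eta> / 2)) sequentially"
    using \<eta> by (intro order_tendstoD(2)) auto
  then obtain m where m: "emeasure M (K - (\<Union>k<m. D k)) < ennreal (\<eta> / 2)" by (auto simp: eventually_sequentially)
  show ?thesis
  proof (rule that[of m C])
    fix k assume "k < m"
    have "C k \<subseteq> F k" using C(1)[of k] disjointed_subset[of F k] by (auto simp: D_def)
    then have "\<exists>e. flat_set e l (C k)" using F(2)[of k] flat_set_subset by blast
    moreover have "C k \<subseteq> K" using C(1)[of k] by (auto simp: D_def)
    ultimately show "compact (C k) \<and> C k \<subseteq> K \<and> (\<exists>e. flat_set e l (C k))" using C(2) by blast
  next
    show "disjoint_family_on C {..<m}" using Dd C(1) unfolding disjoint_family_on_def by blast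
    have "K - (\<Union>k<m. C k) \<subseteq> (K - (\<Union>k<m. D k)) \<union> (\<Union>k<m. D k - C k)" by blast
    then have "emeasure M (K - (\<Union>k<m. C k)) \<le> emeasure M ((K - (\<Union>k<m. D k)) \<union> (\<Union>k<m. D k - C k))"
      using K(1) Db Cb setsM by (intro emeasure_mono) (auto intro!: sets.Diff sets.Un sets.finite_UN)
    also have "\<dots> \<le> emeasure M (K - (\<Union>k<m. D k)) + emeasure M (\<Union>k<m. D k - C k)"
      using K(1) Db Cb setsM by (intro emeasure_subadditive) (auto intro!: sets.Diff sets.finite_UN)
    also have "\<dots> \<le> ennreal (\<eta> / 2) + (\<Sum>k<m. emeasure M (D k - C k))"
      using m Db Cb setsM by (intro add_mono emeasure_subadditive_finite) (auto intro!: sets.Diff)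
    also have "\<dots> \<le> ennreal (\<eta> / 2) + (\<Sum>k<m. ennreal (\<eta> / 2 * (1 / 2) ^ Suc k))"
      by (intro add_mono sum_mono DC) simp
    also have "(\<Sum>k<m. ennreal (\<eta> / 2 * (1 / 2) ^ Suc k)) = ennreal (\<Sum>k<m. \<eta> / 2 * (1 / 2) ^ Suc k)"
      using \<eta> by (intro sum_ennreal) auto
    also have "(\<Sum>k<m. \<eta> / 2 * (1 / 2) ^ Suc k) \<le> \<eta> / 2"
    proof -
      have "(\<Sum>k<m. (1 / 2 :: real) ^ Suc k) = 1 - (1 / 2) ^ m" by (induction m) (auto simp: field_simps)
      then have "(\<Sum>k<m. (1 / 2 :: real) ^ Suc k) \<le> 1" by simp
      then have "\<eta> / 2 * (\<Sum>k<m. (1 / 2 :: real) ^ Suc k) \<le> \<eta> / 2 * 1" using \<eta> by (intro mult_left_mono) auto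
      then show ?thesis by (simp add: sum_distrib_left)
    qed
    also have "ennreal (\<eta> / 2) + ennreal (\<eta> / 2) = ennreal \<eta>" using \<eta> by (simp add: ennreal_plus[symmetric] del: ennreal_plus)
    finally have "emeasure M (K - (\<Union>k<m. C k)) \<le> ennreal \<eta>" by (simp add: ennreal_leI)
    moreover have "emeasure M (K - (\<Union>k<m. C k)) = hausdorff ?n (K - (\<Union>k<m. C k))"
      using M[of "K - (\<Union>k<m. C k)"] K(1) Cb setsM by (simp add: Int_absorb2 Diff_subset sets.Diff sets.finite_UN)
    ultimately show "hausdorff ?n (K - (\<Union>k<m. C k)) \<le> ennreal \<eta>" by simp
  qed
qed

section \<open>Minkowski content of rectifiable sets\<close>

lemma lebesgue_eq_hausdorff:
  "A \<in> sets lebesgue \<Longrightarrow> emeasure lebesgue A = hausdorff DIM('a) (A :: 'a::euclidean_space set)"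
  by (intro antisym lebesgue_le_hausdorff hausdorff_le_lebesgue)

lemma hausdorff_isometry_image:
  assumes "\<And>x y. x \<in> A \<Longrightarrow> y \<in> A \<Longrightarrow> dist (T x) (T y) = dist x y"
  shows "hausdorff m (T ` A) = hausdorff m A"
proof (rule antisym)
  have "1-lipschitz_on A T" by (rule lipschitz_onI) (use assms in auto)
  from hausdorff_lipschitz_image[OF this] show "hausdorff m (T ` A) \<le> hausdorff m A" by simp
  have inj: "inj_on T A" using assms by (intro inj_onI) (metis dist_eq_0_iff)
  have "1-lipschitz_on (T ` A) (inv_into A T)"
    by (rule lipschitz_onI) (use assms inj in auto)
  from hausdorff_lipschitz_image[OF this] have "hausdorff m (inv_into A T ` T ` A) \<le> hausdorff m (T ` A)" by simp
  moreover have "inv_into A T ` T ` A = A" by (rule inv_into_image_cancel[OF inj order_refl])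
  ultimately show "hausdorff m A \<le> hausdorff m (T ` A)" by simp
qed

section \<open>Open neighbourhoods and their volume\<close>

definition nbhd :: "real \<Rightarrow> 'a::metric_space set \<Rightarrow> 'a set" where
  "nbhd s C = (\<Union>c\<in>C. ball c s)"

lemma open_nbhd [simp]: "open (nbhd s C)"
  by (auto simp: nbhd_def)

lemma nbhd_lebesgue [simp]: "nbhd s (C :: 'a::euclidean_space set) \<in> sets lebesgue"
  by simp

lemma bounded_nbhd: "bounded C \<Longrightarrow> bounded (nbhd s (C :: 'a::euclidean_space set))"
proof -
  assume "bounded C"
  then obtain B where B: "\<And>c. c \<in> C \<Longrightarrow> norm c \<le> B" by (auto simp: bounded_iff)
  have "norm x \<le> B + s" if "x \<in> nbhd s C" for x
  proof -
    obtain c where c: "c \<in> C" "dist c x < s" using \<open>x \<in> nbhd s C\<close> by (auto simp: nbhd_def)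
    have "norm x \<le> norm c + dist c x" unfolding dist_norm by norm
    then show ?thesis using B[OF c(1)] c(2) by linarith
  qed
  then show ?thesis by (auto simp: bounded_iff)
qed

lemma lmeasurable_nbhd: "bounded C \<Longrightarrow> nbhd s (C :: 'a::euclidean_space set) \<in> lmeasurable"
  by (intro lmeasurable_open bounded_nbhd open_nbhd)

lemma nbhd_isometry:
  assumes "\<And>x y. dist (T x) (T y) = dist x y" "surj T"
  shows "nbhd s (T ` C) = T ` nbhd s C"
proof (intro set_eqI iffI)
  fix y assume "y \<in> nbhd s (T ` C)"
  then obtain c where c: "c \<in> C" "dist (T c) y < s" by (auto simp: nbhd_def)
  obtain x where x: "y = T x" using assms(2) by (rule surjE)
  then have "x \<in> nbhd s C" using c assms(1) by (auto simp: nbhd_def)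
  then show "y \<in> T ` nbhd s C" using x by blast
qed (use assms(1) in \<open>auto simp: nbhd_def\<close>)

text \<open>The neighbourhoods decrease to P because P is closed, and measures are continuous from
  above along sets of finite measure.\<close>

lemma measure_nbhd_compact_tendsto:
  fixes P :: "'a::euclidean_space set"
  assumes P: "compact P" and e: "e > 0"
  shows "\<exists>s0>0. \<forall>s. 0 < s \<longrightarrow> s < s0 \<longrightarrow> emeasure lborel (nbhd s P) \<le> ennreal (measure lborel P + e)"
proof -
  define N where "N n = nbhd (inverse (real (Suc n))) P" for n
  have dec: "decseq N"
  proof (rule decseq_SucI)
    fix n
    have "inverse (real (Suc (Suc n))) \<le> inverse (real (Suc n))" by (intro le_imp_inverse_le) auto
    then have "ball c (inverse (real (Suc (Suc n)))) \<subseteq> ball c (inverse (real (Suc n)))" for c :: 'a by (rule subset_ball)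
    then show "N (Suc n) \<subseteq> N n" unfolding N_def nbhd_def by (intro UN_mono) auto
  qed
  have "(\<lambda>n. emeasure lborel (N n)) \<longlonglongrightarrow> emeasure lborel (\<Inter>n. N n)"
  proof (rule Lim_emeasure_decseq[OF _ dec])
    show "range N \<subseteq> sets lborel" by (auto simp: N_def)
    show "emeasure lborel (N i) \<noteq> \<infinity>" for i
      using emeasure_bounded_finite[OF bounded_nbhd[OF compact_imp_bounded[OF P]]] unfolding N_def by (simp add: less_top)
  qed
  also have "(\<Inter>n. N n) = P"
  proof (intro set_eqI iffI)
    fix x assume x: "x \<in> (\<Inter>n. N n)"
    have "\<exists>y\<in>P. dist y x < e" if e0: "e > 0" for e
    proof -
      obtain n where n: "inverse (real (Suc n)) < e" using reals_Archimedean[OF e0] by blast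
      have "x \<in> N n" using x by blast
      then obtain y where "y \<in> P" "dist y x < inverse (real (Suc n))" by (auto simp: N_def nbhd_def)
      then show ?thesis using n by (intro bexI[of _ y]) auto
    qed
    then show "x \<in> P" using closed_approachable[OF compact_imp_closed[OF P]] by blast
  next
    fix x assume "x \<in> P"
    then have "x \<in> N n" for n unfolding N_def nbhd_def by (rule UN_I) simp
    then show "x \<in> (\<Inter>n. N n)" by (rule INT_I)
  qed
  finally have lim: "(\<lambda>n. emeasure lborel (N n)) \<longlonglongrightarrow> emeasure lborel P" .
  have Pe: "emeasure lborel P = ennreal (measure lborel P)"
    using emeasure_compact_finite[OF P] by (intro emeasure_eq_ennreal_measure) simp
  have "emeasure lborel P < ennreal (measure lborel P + e)"
    unfolding Pe using e by (simp add: ennreal_less_iff)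
  from order_tendstoD(2)[OF lim this] obtain n where n: "emeasure lborel (N n) < ennreal (measure lborel P + e)"
    by (auto simp: eventually_sequentially)
  show ?thesis
  proof (intro exI[of _ "inverse (real (Suc n))"] conjI allI impI)
    fix s :: real assume "0 < s" "s < inverse (real (Suc n))"
    then have "nbhd s P \<subseteq> N n" unfolding N_def nbhd_def by (intro UN_mono subset_ball) auto
    then have "emeasure lborel (nbhd s P) \<le> emeasure lborel (N n)" by (rule emeasure_mono) (simp add: N_def)
    then show "emeasure lborel (nbhd s P) \<le> ennreal (measure lborel P + e)" using n by (meson less_imp_le order_trans)
  qed simp
qed

text \<open>The isodiametric inequality in dimension one, where the unit ball has volume 2.\<close>

lemma emeasure_real_le_diameter:
  fixes A :: "real set"
  assumes A: "A \<in> sets borel" and D: "\<And>s t. s \<in> A \<Longrightarrow> t \<in> A \<Longrightarrow> \<bar>s - t\<bar> \<le> D" "D \<ge> 0"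
  shows "emeasure lborel A \<le> ennreal D"
proof -
  have b: "bounded A" unfolding bounded_two_points using D(1) by (auto simp: dist_real_def)
  have d: "diameter A \<le> D" by (rule diameter_leI) (use D in \<open>auto simp: dist_real_def\<close>)
  have "emeasure lebesgue A \<le> ennreal (unit_ball_vol (real DIM(real)) * (diameter A / 2) ^ DIM(real))"
    by (rule isodiametric[OF b]) (use A in simp)
  also have "\<dots> \<le> ennreal D" using d diameter_ge_0[OF b] by (intro ennreal_leI) (simp add: unit_ball_vol_1)
  finally show ?thesis using A by simp
qed

lemma emeasure_UN_le_count_space:
  assumes "countable I" "\<And>i. i \<in> I \<Longrightarrow> X i \<in> sets M"
  shows "emeasure M (\<Union>i\<in>I. X i) \<le> (\<integral>\<^sup>+i. emeasure M (X i) \<partial>count_space I)"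
proof -
  have "emeasure M (\<Union>i\<in>I. X i) = (\<integral>\<^sup>+x. indicator (\<Union>i\<in>I. X i) x \<partial>M)"
    using assms by (intro nn_integral_indicator[symmetric] sets.countable_UN'') auto
  also have "\<dots> \<le> (\<integral>\<^sup>+x. (\<integral>\<^sup>+i. indicator (X i) x \<partial>count_space I) \<partial>M)"
  proof (rule nn_integral_mono)
    fix x
    show "indicator (\<Union>i\<in>I. X i) x \<le> (\<integral>\<^sup>+i. indicator (X i) x \<partial>count_space I)"
    proof (cases "x \<in> (\<Union>i\<in>I. X i)")
      case True
      then obtain i where i: "i \<in> I" "x \<in> X i" by (rule UN_E)
      have "(indicator (X i) x :: ennreal) \<le> (\<integral>\<^sup>+i. indicator (X i) x \<partial>count_space I)"
        by (rule nn_integral_ge_point[OF i(1)])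
      then show ?thesis using True i by simp
    qed simp
  qed
  also have "\<dots> = (\<integral>\<^sup>+i. (\<integral>\<^sup>+x. indicator (X i) x \<partial>M) \<partial>count_space I)"
    using assms by (intro nn_integral_count_space_nn_integral) auto
  also have "\<dots> = (\<integral>\<^sup>+i. emeasure M (X i) \<partial>count_space I)"
    using assms by (intro nn_integral_cong nn_integral_indicator) auto
  finally show ?thesis .
qed

text \<open>Coordinates adapted to e: the product type splits off the direction of e, so that Fubini
  can be used along it.\<close>

lemma hyperplane_isometry:
  fixes e :: "'a::euclidean_space"
  assumes e: "norm e = 1" and dim: "DIM('a) = Suc DIM('b::euclidean_space)"
  obtains T :: "'b::euclidean_space \<times> real \<Rightarrow> 'a" where "linear T" "\<And>z. norm (T z) = norm z" "surj T" "\<And>z. T z \<bullet> e = snd z"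
proof -
  have ee: "e \<bullet> e = 1" using e by (simp add: dot_square_norm)
  have "e \<noteq> 0" using e by auto
  then have "dim (UNIV :: 'b set) = dim {x. e \<bullet> x = 0}" using dim by (simp add: dim_hyperplane)
  then obtain f :: "'b \<Rightarrow> 'a" where f: "linear f" "f ` UNIV = {x. e \<bullet> x = 0}" "\<And>x. x \<in> UNIV \<Longrightarrow> norm (f x) = norm x"
    by (rule isometries_subspaces[OF subspace_UNIV subspace_hyperplane[of e]]) blast
  define T where "T z = f (fst z) + snd z *\<^sub>R e" for z
  have ef: "e \<bullet> f y = 0" for y using f(2) by auto
  then have fe: "f y \<bullet> e = 0" for y by (simp add: inner_commute)
  show ?thesis
  proof (rule that[of T])
    show "linear T" unfolding T_def
      by (intro linearI) (auto simp: linear_add[OF f(1)] linear_cmul[OF f(1)] algebra_simps)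
    show "norm (T z) = norm z" for z
    proof -
      have "(norm (T z))\<^sup>2 = (norm (f (fst z)))\<^sup>2 + (snd z)\<^sup>2"
        unfolding power2_norm_eq_inner T_def
        by (simp add: inner_add_left inner_add_right fe ef ee power2_eq_square)
      also have "\<dots> = (norm z)\<^sup>2" using f(3) by (simp add: norm_prod_def)
      finally show ?thesis by (simp add: power2_eq_iff_nonneg)
    qed
    show "T z \<bullet> e = snd z" for z by (simp add: T_def inner_add_left fe ee)
    show "surj T" unfolding surj_def
    proof
      fix x
      have "x - (x \<bullet> e) *\<^sub>R e \<in> {x. e \<bullet> x = 0}" by (simp add: inner_diff_right ee inner_commute)
      then obtain y where "x - (x \<bullet> e) *\<^sub>R e = f y" using f(2) by blast
      then have "x = T (y, x \<bullet> e)" by (simp add: T_def algebra_simps)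
      then show "\<exists>z. x = T z" by blast
    qed
  qed
qed

text \<open>C is a graph over its projection, which gives the Hausdorff bounds by Lipschitz maps in
  both directions. For the neighbourhood, Fubini slices along the last coordinate: over the
  projection each slice contains an interval of length 2 s, and any slice has diameter at most 2 s
  (1 + l) and is empty unless its base point is within s of the projection.\<close>

lemma graph_minkowski:
  fixes C :: "('b::euclidean_space \<times> real) set"
  assumes C: "compact C" and l: "l \<ge> 0" and g: "\<And>z w. z \<in> C \<Longrightarrow> w \<in> C \<Longrightarrow> \<bar>snd z - snd w\<bar> \<le> l * norm (fst z - fst w)"
  shows "ennreal (measure lborel (fst ` C)) \<le> hausdorff DIM('b) C"
    and "hausdorff DIM('b) C \<le> ennreal ((1 + l) ^ DIM('b) * measure lborel (fst ` C))"
    and "s > 0 \<Longrightarrow> ennreal (2 * s * measure lborel (fst ` C)) \<le> emeasure lborel (nbhd s C)"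
    and "s > 0 \<Longrightarrow> emeasure lborel (nbhd s C) \<le> ennreal (2 * s * (1 + l)) * emeasure lborel (nbhd s (fst ` C))"
proof -
  let ?P = "fst ` C" let ?n = "DIM('b)"
  have P: "compact ?P" by (intro compact_continuous_image C continuous_on_fst continuous_on_id)
  have Pe: "emeasure lebesgue ?P = ennreal (measure lborel ?P)"
    using emeasure_compact_finite[OF P] compact_imp_closed[OF P]
    by (subst emeasure_eq_ennreal_measure[symmetric]) (auto simp: borel_closed)
  have Pm: "?P \<in> sets lebesgue" using compact_imp_closed[OF P] by simp
  have PH: "hausdorff ?n ?P = ennreal (measure lborel ?P)" using lebesgue_eq_hausdorff[OF Pm] Pe by simp
  have "1-lipschitz_on C fst" by (rule lipschitz_onI) (auto simp: dist_fst_le)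
  from hausdorff_lipschitz_image[OF this, of ?n] show "ennreal (measure lborel ?P) \<le> hausdorff ?n C" using PH by simp
  have inj: "inj_on fst C"
  proof (rule inj_onI)
    fix z w assume zw: "z \<in> C" "w \<in> C" "fst z = fst w"
    then have "\<bar>snd z - snd w\<bar> \<le> 0" using g[OF zw(1,2)] by simp
    then show "z = w" using zw by (simp add: prod_eq_iff)
  qed
  have "(1 + l)-lipschitz_on ?P (inv_into C fst)"
  proof (rule lipschitz_onI)
    fix x y assume xy: "x \<in> ?P" "y \<in> ?P"
    define z w where "z = inv_into C fst x" "w = inv_into C fst y"
    have zw: "z \<in> C" "w \<in> C" "fst z = x" "fst w = y" using xy by (auto simp: z_w_def inv_into_into f_inv_into_f)
    have "dist z w \<le> dist (fst z) (fst w) + dist (snd z) (snd w)"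
      unfolding dist_prod_def by (rule order_trans[OF sqrt_add_le_add_sqrt]) auto
    also have "dist (snd z) (snd w) \<le> l * dist (fst z) (fst w)" using g[OF zw(1,2)] by (simp add: dist_real_def dist_norm)
    finally show "dist (inv_into C fst x) (inv_into C fst y) \<le> (1 + l) * dist x y" using zw by (simp add: z_w_def algebra_simps)
  qed (use l in simp)
  from hausdorff_lipschitz_image[OF this, of ?n] l
  have "hausdorff ?n (inv_into C fst ` ?P) \<le> ennreal ((1 + l) ^ ?n) * ennreal (measure lborel ?P)" using PH by simp
  also have "inv_into C fst ` ?P = C" by (rule inv_into_image_cancel[OF inj order_refl])
  finally show "hausdorff ?n C \<le> ennreal ((1 + l) ^ ?n * measure lborel ?P)" using l by (simp add: ennreal_mult)
  assume s: "s > 0"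
  have slice: "emeasure lborel (nbhd s C) = (\<integral>\<^sup>+y. emeasure lborel (Pair y -` nbhd s C) \<partial>lborel)"
  proof -
    have "nbhd s C \<in> sets (lborel \<Otimes>\<^sub>M lborel)" unfolding lborel_prod by simp
    from lborel.emeasure_pair_measure_alt[OF this] show ?thesis unfolding lborel_prod .
  qed
  have sm: "Pair y -` nbhd s C \<in> sets borel" for y
  proof -
    have "open (Pair y -` nbhd s C)" by (intro open_vimage open_nbhd continuous_on_Pair continuous_on_const continuous_on_id)
    then show ?thesis by simp
  qed
  have "ennreal (2 * s * measure lborel ?P) = (\<integral>\<^sup>+y. ennreal (2 * s) * indicator ?P y \<partial>lborel)"
    using s Pe Pm compact_imp_closed[OF P] by (simp add: nn_integral_cmult ennreal_mult)
  also have "\<dots> \<le> (\<integral>\<^sup>+y. emeasure lborel (Pair y -` nbhd s C) \<partial>lborel)"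
  proof (rule nn_integral_mono)
    fix y
    show "ennreal (2 * s) * indicator ?P y \<le> emeasure lborel (Pair y -` nbhd s C)"
    proof (cases "y \<in> ?P")
      case True
      then obtain t where t: "(y, t) \<in> C" by auto
      have "{t - s<..<t + s} \<subseteq> Pair y -` nbhd s C"
      proof
        fix t' assume "t' \<in> {t - s<..<t + s}"
        then have "dist (y, t) (y, t') < s" by (auto simp: dist_prod_def dist_real_def)
        then show "t' \<in> Pair y -` nbhd s C" using t by (auto simp: nbhd_def)
      qed
      then have "emeasure lborel {t - s<..<t + s} \<le> emeasure lborel (Pair y -` nbhd s C)"
        by (rule emeasure_mono) (use sm in simp)
      then show ?thesis using True s by simp
    qed simp
  qed
  finally show "ennreal (2 * s * measure lborel ?P) \<le> emeasure lborel (nbhd s C)" using slice by simp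
  have "(\<integral>\<^sup>+y. emeasure lborel (Pair y -` nbhd s C) \<partial>lborel) \<le> (\<integral>\<^sup>+y. ennreal (2 * s * (1 + l)) * indicator (nbhd s ?P) y \<partial>lborel)"
  proof (rule nn_integral_mono)
    fix y
    show "emeasure lborel (Pair y -` nbhd s C) \<le> ennreal (2 * s * (1 + l)) * indicator (nbhd s ?P) y"
    proof (cases "y \<in> nbhd s ?P")
      case False
      have "Pair y -` nbhd s C = {}"
      proof (rule ccontr)
        assume "Pair y -` nbhd s C \<noteq> {}"
        then obtain t z where "z \<in> C" "dist z (y, t) < s" by (auto simp: nbhd_def)
        then have "dist (fst z) y < s" using dist_fst_le[of z "(y, t)"] by simp
        then show False using False \<open>z \<in> C\<close> by (auto simp: nbhd_def)
      qed
      then show ?thesis by simp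
    next
      case True
      have "\<bar>t1 - t2\<bar> \<le> 2 * s * (1 + l)" if "t1 \<in> Pair y -` nbhd s C" "t2 \<in> Pair y -` nbhd s C" for t1 t2
      proof -
        have "(y, t1) \<in> (\<Union>c\<in>C. ball c s)" "(y, t2) \<in> (\<Union>c\<in>C. ball c s)" using that by (simp_all add: nbhd_def)
        then obtain z w where "z \<in> C" "(y, t1) \<in> ball z s" "w \<in> C" "(y, t2) \<in> ball w s" by (elim UN_E)
        then have z: "z \<in> C" "dist z (y, t1) < s" and w: "w \<in> C" "dist w (y, t2) < s" by simp_all
        have "dist (fst z) y < s" "dist (fst w) y < s" "\<bar>snd z - t1\<bar> < s" "\<bar>snd w - t2\<bar> < s"
          using z w dist_fst_le[of z "(y, t1)"] dist_fst_le[of w "(y, t2)"] dist_snd_le[of z "(y, t1)"] dist_snd_le[of w "(y, t2)"]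
          by (auto simp: dist_real_def)
        moreover have "norm (fst z - fst w) \<le> 2 * s"
          using \<open>dist (fst z) y < s\<close> \<open>dist (fst w) y < s\<close> dist_triangle2[of "fst z" "fst w" y] by (simp add: dist_norm)
        then have "l * norm (fst z - fst w) \<le> l * (2 * s)" using l by (rule mult_left_mono)
        ultimately show ?thesis using g[OF z(1) w(1)] by (simp add: algebra_simps)
      qed
      then have "emeasure lborel (Pair y -` nbhd s C) \<le> ennreal (2 * s * (1 + l))"
        by (intro emeasure_real_le_diameter sm) (use s l in auto)
      then show ?thesis using True by simp
    qed
  qed
  also have "\<dots> = ennreal (2 * s * (1 + l)) * emeasure lborel (nbhd s ?P)" by (simp add: nn_integral_cmult)
  finally show "emeasure lborel (nbhd s C) \<le> ennreal (2 * s * (1 + l)) * emeasure lborel (nbhd s ?P)" using slice by simp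
qed

text \<open>p is the volume of the projection to the hyperplane. It controls both the Hausdorff
  measure of C and the volume of thin neighbourhoods, up to factors that tend to 1 with l.\<close>

lemma flat_minkowski:
  fixes C :: "'a::euclidean_space set"
  assumes C: "compact C" "flat_set e l C" and l: "0 < l" "l \<le> 1/2" and dim: "DIM('a) = Suc DIM('b::euclidean_space)"
  shows "\<exists>p\<ge>0. ennreal p \<le> hausdorff DIM('b) C \<and> hausdorff DIM('b) C \<le> ennreal ((1 + 2 * l) ^ DIM('b) * p) \<and>
    (\<forall>s>0. 2 * s * p \<le> measure lebesgue (nbhd s C)) \<and>
    (\<forall>\<eta>>0. \<exists>s0>0. \<forall>s. 0 < s \<longrightarrow> s < s0 \<longrightarrow> measure lebesgue (nbhd s C) \<le> 2 * s * (1 + 2 * l) * (p + \<eta>))"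
proof -
  have e: "norm e = 1" and fl: "\<And>x y. x \<in> C \<Longrightarrow> y \<in> C \<Longrightarrow> \<bar>(x - y) \<bullet> e\<bar> \<le> l * norm (x - y)" using C(2) by (auto simp: flat_set_def)
  obtain T :: "'b \<times> real \<Rightarrow> 'a" where T: "linear T" "\<And>z. norm (T z) = norm z" "surj T" "\<And>z. T z \<bullet> e = snd z"
    using hyperplane_isometry[OF e dim] by metis
  have Td: "dist (T x) (T y) = dist x y" for x y unfolding dist_norm by (metis T(1,2) linear_diff)
  define C' where "C' = T -` C"
  have CC: "C = T ` C'" unfolding C'_def using T(3) by (simp add: surj_image_vimage_eq)
  have cT: "continuous_on UNIV T" using T(1) by (simp add: linear_continuous_on linear_conv_bounded_linear)
  have C': "compact C'"
  proof -
    have "closed C'" unfolding C'_def by (intro closed_vimage compact_imp_closed C cT)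
    moreover obtain B where "\<And>x. x \<in> C \<Longrightarrow> norm x \<le> B" using compact_imp_bounded[OF C(1)] by (auto simp: bounded_iff)
    then have "bounded C'" unfolding C'_def bounded_iff using T(2) by (metis vimage_eq)
    ultimately show ?thesis by (simp add: compact_eq_bounded_closed)
  qed
  \<comment> \<open>The vertical difference appears on both sides of the cone condition; l <= 1/2
    absorbs it and turns the tilt l into the slope 2 l.\<close>
  have g: "\<bar>snd z - snd w\<bar> \<le> (2 * l) * norm (fst z - fst w)" if zw: "z \<in> C'" "w \<in> C'" for z w
  proof -
    have "\<bar>(T z - T w) \<bullet> e\<bar> \<le> l * norm (T z - T w)" using zw by (intro fl) (auto simp: C'_def)
    then have "\<bar>snd z - snd w\<bar> \<le> l * norm (z - w)" using Td[of z w] by (simp add: inner_diff_left T(4) dist_norm)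
    also have "norm (z - w) \<le> norm (fst z - fst w) + \<bar>snd z - snd w\<bar>"
      unfolding norm_prod_def by (rule order_trans[OF sqrt_add_le_add_sqrt]) auto
    finally have 1: "\<bar>snd z - snd w\<bar> \<le> l * norm (fst z - fst w) + l * \<bar>snd z - snd w\<bar>" using l by (simp add: distrib_left)
    have "l * \<bar>snd z - snd w\<bar> \<le> 1/2 * \<bar>snd z - snd w\<bar>" using l by (intro mult_right_mono) auto
    then show ?thesis using 1 by simp
  qed
  have l2: "2 * l \<ge> 0" using l by simp
  let ?P = "fst ` C'"
  have G1: "ennreal (measure lborel ?P) \<le> hausdorff DIM('b) C'" by (rule graph_minkowski(1)[OF C' l2]) (rule g)
  have G2: "hausdorff DIM('b) C' \<le> ennreal ((1 + 2 * l) ^ DIM('b) * measure lborel ?P)"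
    by (rule graph_minkowski(2)[OF C' l2]) (rule g)
  have G3: "ennreal (2 * s * measure lborel ?P) \<le> emeasure lborel (nbhd s C')" if "s > 0" for s
    by (rule graph_minkowski(3)[OF C' l2 _ that]) (rule g)
  have G4: "emeasure lborel (nbhd s C') \<le> ennreal (2 * s * (1 + 2 * l)) * emeasure lborel (nbhd s ?P)" if "s > 0" for s
    by (rule graph_minkowski(4)[OF C' l2 _ that]) (rule g)
  have H: "hausdorff DIM('b) C = hausdorff DIM('b) C'" unfolding CC by (rule hausdorff_isometry_image) (rule Td)
  \<comment> \<open>The two spaces are different types, so their Lebesgue measures are compared
    through the Hausdorff measure of full dimension, which isometries preserve.\<close>
  have m: "emeasure lebesgue (nbhd s C) = emeasure lborel (nbhd s C')" for s
  proof -
    have "nbhd s C = T ` nbhd s C'" unfolding CC by (rule nbhd_isometry[OF Td T(3)])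
    then have "emeasure lebesgue (nbhd s C) = hausdorff DIM('a) (T ` nbhd s C')"
      using lebesgue_eq_hausdorff[OF nbhd_lebesgue[of s C]] by simp
    also have "\<dots> = hausdorff DIM('b \<times> real) (nbhd s C')"
      using hausdorff_isometry_image[of "nbhd s C'" T "DIM('a)"] Td dim by simp
    also have "\<dots> = emeasure lebesgue (nbhd s C')" by (rule lebesgue_eq_hausdorff[symmetric]) simp
    finally show ?thesis by simp
  qed
  have fin: "emeasure lebesgue (nbhd s C) = ennreal (measure lebesgue (nbhd s C))" for s
    by (rule emeasure_eq_measure2[OF lmeasurable_nbhd[OF compact_imp_bounded[OF C(1)]]])
  have P: "compact ?P" by (intro compact_continuous_image C' continuous_on_fst continuous_on_id)
  show ?thesis
  proof (rule exI[of _ "measure lborel ?P"], intro conjI allI impI)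
    show "ennreal (measure lborel ?P) \<le> hausdorff DIM('b) C" using G1 H by simp
    show "hausdorff DIM('b) C \<le> ennreal ((1 + 2 * l) ^ DIM('b) * measure lborel ?P)" using G2 H by simp
    show "2 * s * measure lborel ?P \<le> measure lebesgue (nbhd s C)" if "s > 0" for s
      using G3[OF that] unfolding m[symmetric] fin by (simp add: ennreal_le_iff)
    fix \<eta> :: real assume "\<eta> > 0"
    obtain s0 where s0: "s0 > 0" "\<And>s. 0 < s \<Longrightarrow> s < s0 \<Longrightarrow> emeasure lborel (nbhd s ?P) \<le> ennreal (measure lborel ?P + \<eta>)"
      using measure_nbhd_compact_tendsto[OF P \<open>\<eta> > 0\<close>] by blast
    have "measure lebesgue (nbhd s C) \<le> 2 * s * (1 + 2 * l) * (measure lborel ?P + \<eta>)" if s: "0 < s" "s < s0" for s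
    proof -
      have "ennreal (measure lebesgue (nbhd s C)) \<le> ennreal (2 * s * (1 + 2 * l)) * emeasure lborel (nbhd s ?P)"
        using G4[OF s(1)] unfolding m[symmetric] fin .
      also have "\<dots> \<le> ennreal (2 * s * (1 + 2 * l)) * ennreal (measure lborel ?P + \<eta>)"
        by (rule mult_left_mono[OF s0(2)[OF s]]) simp
      also have "\<dots> = ennreal (2 * s * (1 + 2 * l) * (measure lborel ?P + \<eta>))"
        using s l \<open>\<eta> > 0\<close> by (intro ennreal_mult[symmetric]) auto
      finally show ?thesis using s l \<open>\<eta> > 0\<close> by (subst (asm) ennreal_le_iff) auto
    qed
    then show "\<exists>s0>0. \<forall>s. 0 < s \<longrightarrow> s < s0 \<longrightarrow> measure lebesgue (nbhd s C) \<le> 2 * s * (1 + 2 * l) * (measure lborel ?P + \<eta>)"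
      using s0(1) by blast
  qed simp
qed

text \<open>The part of the set far from a good compact subset is covered by few balls, by the lower density bound.\<close>

lemma nbhd_far_part:
  fixes K :: "'a::euclidean_space set"
  assumes K: "K \<in> sets borel" and n: "n > 0" and c: "c > 0" and D: "D \<in> sets borel"
    and dens: "\<And>x. x \<in> K \<Longrightarrow> ennreal (c * (t * s) ^ n) \<le> hausdorff n (K \<inter> ball x (t * s))"
    and s: "s > 0" and t: "0 < t" "t \<le> 1" and dim: "DIM('a) = Suc n"
    and rest: "hausdorff n (K - D) \<le> ennreal \<eta>" and \<eta>: "\<eta> \<ge> 0"
    and R: "R \<subseteq> K" "\<And>z d. z \<in> R \<Longrightarrow> d \<in> D \<Longrightarrow> t * s \<le> dist z d"
  shows "emeasure lebesgue (nbhd s R) \<le> ennreal (unit_ball_vol (real (Suc n)) * 6 ^ Suc n / (c * t ^ n) * \<eta> * s)"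
proof -
  have ts: "t * s > 0" using s t by simp
  obtain I where I: "countable I" "I \<subseteq> R" "pairwise (\<lambda>i j. disjnt (ball i (t * s)) (ball j (t * s))) I"
    "R \<subseteq> (\<Union>i\<in>I. ball i (5 * (t * s)))"
    by (rule Vitali_covering_lemma_balls[where S=R and K=R and a="\<lambda>x. x" and r="\<lambda>_. t * s" and B="t * s"])
      (use ts in auto)
  have dj: "disjoint_family_on (\<lambda>i. K \<inter> ball i (t * s)) I"
    using I(3) by (auto simp: disjoint_family_on_def pairwise_def disjnt_def)
  let ?\<omega> = "unit_ball_vol (real (Suc n))"
  define Y where "Y = c * (t * s) ^ n"
  have Y: "Y > 0" using c zero_less_power[OF ts] by (simp add: Y_def)
  \<comment> \<open>The volume of a ball of radius 6 s per unit of Hausdorff measure that the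
    density bound guarantees inside a ball of radius t s.\<close>
  define A where "A = ?\<omega> * (6 * s) ^ Suc n / Y"
  have A0: "A \<ge> 0" using s Y by (simp add: A_def)
  \<comment> \<open>Five times t s from the covering lemma plus s for the neighbourhood is at most 6
    s, as t <= 1.\<close>
  have sub: "nbhd s R \<subseteq> (\<Union>i\<in>I. ball i (6 * s))"
  proof
    fix x assume "x \<in> nbhd s R"
    then obtain z where z: "z \<in> R" "dist z x < s" by (auto simp: nbhd_def)
    then obtain i where i: "i \<in> I" "dist i z < 5 * (t * s)" using I(4) by auto
    have "t * s \<le> 1 * s" using t s by (intro mult_right_mono) auto
    then have "dist i x < 6 * s" using dist_triangle[of i x z] i z by linarith
    then show "x \<in> (\<Union>i\<in>I. ball i (6 * s))" using i by auto
  qed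
  have "emeasure lebesgue (nbhd s R) \<le> emeasure lebesgue (\<Union>i\<in>I. ball i (6 * s))"
    by (rule emeasure_mono[OF sub]) (use I(1) in \<open>simp add: open_UN\<close>)
  also have "\<dots> \<le> (\<integral>\<^sup>+i. emeasure lebesgue (ball i (6 * s)) \<partial>count_space I)"
    by (rule emeasure_UN_le_count_space[OF I(1)]) simp
  also have "\<dots> \<le> (\<integral>\<^sup>+i. ennreal A * hausdorff n (K \<inter> ball i (t * s)) \<partial>count_space I)"
  proof (rule nn_integral_mono)
    fix i assume "i \<in> space (count_space I)"
    then have "i \<in> K" using I(2) R(1) by auto
    have "emeasure lebesgue (ball i (6 * s)) = ennreal (?\<omega> * (6 * s) ^ Suc n)"
      using s dim by (simp add: emeasure_ball)
    also have "?\<omega> * (6 * s) ^ Suc n = A * Y" using Y by (simp add: A_def)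
    also have "ennreal (A * Y) = ennreal A * ennreal (c * (t * s) ^ n)"
      unfolding Y_def[symmetric] using A0 Y by (intro ennreal_mult) auto
    also have "\<dots> \<le> ennreal A * hausdorff n (K \<inter> ball i (t * s))" by (intro mult_left_mono dens \<open>i \<in> K\<close>) simp
    finally show "emeasure lebesgue (ball i (6 * s)) \<le> ennreal A * hausdorff n (K \<inter> ball i (t * s))" .
  qed
  also have "\<dots> = ennreal A * (\<integral>\<^sup>+i. emeasure (hausdorff_measure n) (K \<inter> ball i (t * s)) \<partial>count_space I)"
    using K n by (simp add: nn_integral_cmult emeasure_hausdorff_measure)
  also have "(\<integral>\<^sup>+i. emeasure (hausdorff_measure n) (K \<inter> ball i (t * s)) \<partial>count_space I) = emeasure (hausdorff_measure n) (\<Union>i\<in>I. K \<inter> ball i (t * s))"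
    by (rule emeasure_UN_countable[symmetric, OF _ I(1) dj]) (use K in simp)
  also have "\<dots> \<le> emeasure (hausdorff_measure n) (K - D)"
  proof (rule emeasure_mono)
    \<comment> \<open>Centres in R have distance at least t s from D, so the disjoint small balls
      only use up measure of K - D, which is at most \<eta>.\<close>
    show "(\<Union>i\<in>I. K \<inter> ball i (t * s)) \<subseteq> K - D"
    proof
      fix x assume "x \<in> (\<Union>i\<in>I. K \<inter> ball i (t * s))"
      then obtain i where i: "i \<in> I" "x \<in> K" "dist i x < t * s" by auto
      then show "x \<in> K - D" using R(2)[of i x] I(2) by (auto simp: not_le[symmetric])
    qed
  qed (use K D in simp)
  also have "\<dots> = hausdorff n (K - D)" using K D n by (intro emeasure_hausdorff_measure) auto
  also have "\<dots> \<le> ennreal \<eta>" by (rule rest)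
  finally have "emeasure lebesgue (nbhd s R) \<le> ennreal A * ennreal \<eta>" by (simp add: mult_left_mono)
  also have "\<dots> = ennreal (A * \<eta>)" using A0 \<eta> by (simp add: ennreal_mult)
  also have "A * \<eta> = ?\<omega> * 6 ^ Suc n / (c * t ^ n) * \<eta> * s"
    using s t c by (simp add: A_def Y_def power_mult_distrib field_simps)
  finally show ?thesis .
qed

lemma compact_disjoint_family_separated:
  fixes C :: "nat \<Rightarrow> 'a::euclidean_space set"
  assumes "\<And>k. k < m \<Longrightarrow> compact (C k)" "disjoint_family_on C {..<m}"
  shows "\<exists>d>0. \<forall>j<m. \<forall>k<m. j \<noteq> k \<longrightarrow> (\<forall>x\<in>C j. \<forall>y\<in>C k. d \<le> dist x y)"
proof -
  have "\<exists>d>0. \<forall>x\<in>C j. \<forall>y\<in>C k. d \<le> dist x y" if "j < m" "k < m" "j \<noteq> k" for j k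
    using that assms by (intro separate_compact_closed) (auto intro: compact_imp_closed simp: disjoint_family_on_def)
  then obtain d where d: "\<And>j k. j < m \<Longrightarrow> k < m \<Longrightarrow> j \<noteq> k \<Longrightarrow> d j k > 0 \<and> (\<forall>x\<in>C j. \<forall>y\<in>C k. d j k \<le> dist x y)" by metis
  define S where "S = insert 1 ((\<lambda>(j, k). d j k) ` {(j, k). j < m \<and> k < m \<and> j \<noteq> k})"
  have fin: "finite S"
  proof -
    have "{(j, k). j < m \<and> k < m \<and> j \<noteq> k} \<subseteq> {..<m} \<times> {..<m}" by auto
    then have "finite {(j, k). j < m \<and> k < m \<and> j \<noteq> k}" by (rule finite_subset) simp
    then show ?thesis by (simp add: S_def)
  qed
  have "Min S > 0" using fin d by (subst Min_gr_iff) (auto simp: S_def)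
  moreover have "Min S \<le> d j k" if "j < m" "k < m" "j \<noteq> k" for j k
    using fin that by (intro Min_le) (auto simp: S_def)
  ultimately show ?thesis using d by (meson order_trans)
qed

text \<open>Lower bound: the disjoint compact flat pieces have disjoint neighbourhoods for small s.
  Upper bound: a point of K is either within l s of a piece, so that its s-ball lies in a slightly
  larger neighbourhood of that piece, or belongs to the far part, whose neighbourhood has volume at
  most a multiple of \<eta> s by the density bound.\<close>

theorem minkowski_content_rectifiable:
  fixes K :: "'a::euclidean_space set"
  assumes K: "K \<in> sets borel" "bounded K" "H_rectifiable TYPE('b::euclidean_space) K" and dim: "DIM('a) = Suc DIM('b)"
    and c: "c > 0" "r0 > 0"
    and dens: "\<And>x r. x \<in> K \<Longrightarrow> 0 < r \<Longrightarrow> r < r0 \<Longrightarrow> ennreal (c * r ^ DIM('b)) \<le> hausdorff DIM('b) (K \<inter> ball x r)"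
  shows "((\<lambda>s. measure lebesgue (nbhd s K) / (2 * s)) \<longlongrightarrow> enn2real (hausdorff DIM('b) K)) (at_right 0)"
proof (rule tendstoI)
  let ?n = "DIM('b)"
  define M where "M = enn2real (hausdorff ?n K)"
  have HK: "hausdorff ?n K = ennreal M" using K(3) by (simp add: M_def H_rectifiable_def)
  have M0: "M \<ge> 0" by (simp add: M_def)
  fix z :: real assume z: "z > 0"
  define \<zeta> where "\<zeta> = z / 2"
  have \<zeta>: "\<zeta> > 0" "\<zeta> < z" using z by (auto simp: \<zeta>_def)
  have "((\<lambda>l::real. (1 + 2 * l) ^ ?n) \<longlongrightarrow> (1 + 2 * 0) ^ ?n) (at_right 0)" by (intro tendsto_intros)
  then have "\<forall>\<^sub>F l in at_right 0. (1 + 2 * l) ^ ?n < 1 + \<zeta> / (2 * (M + 1))"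
    using \<zeta> M0 by (intro order_tendstoD(2)) auto
  then obtain l1 where l1: "l1 > 0" "\<And>l. 0 < l \<Longrightarrow> l < l1 \<Longrightarrow> (1 + 2 * l) ^ ?n < 1 + \<zeta> / (2 * (M + 1))"
    unfolding eventually_at_right_field by auto
  \<comment> \<open>l < l1 serves the lower bound, where Hausdorff measures are distorted by
    \<open>(1 + 2 * l) ^ ?n\<close>; the bound by \<zeta> / (8 (M + 1)) serves the upper one, where
    neighbourhoods are distorted by 1 + 4 l.\<close>
  define l where "l = min (min (1/2) (l1 / 2)) (\<zeta> / (8 * (M + 1)))"
  have l: "0 < l" "l \<le> 1/2" "l < l1" "l \<le> \<zeta> / (8 * (M + 1))" 
  proof -
    have "l \<le> l1 / 2" unfolding l_def by (intro min.coboundedI1 min.coboundedI2 order_refl)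
    then show "l < l1" using l1(1) by simp
    show "l \<le> 1/2" unfolding l_def by (intro min.coboundedI1 order_refl)
    show "l \<le> \<zeta> / (8 * (M + 1))" unfolding l_def by (rule min.cobounded2)
    show "0 < l" using l1(1) \<zeta> M0 unfolding l_def by (intro min_less_iff_conj[THEN iffD2] conjI divide_pos_pos) auto
  qed
  define B where "B = unit_ball_vol (real (Suc ?n)) * 6 ^ Suc ?n / (c * l ^ ?n)"
  have B0: "B \<ge> 0" using c l by (simp add: B_def)
  \<comment> \<open>Chosen after l, because the constant B of the far part grows like
    l^(-n).\<close>
  define \<eta> where "\<eta> = \<zeta> / (2 * (3 + B / 2))"
  have \<eta>: "\<eta> > 0" "\<eta> * (3 + B / 2) = \<zeta> / 2" "\<eta> \<le> \<zeta> / 2"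
  proof -
    show "\<eta> > 0" using \<zeta> B0 by (simp add: \<eta>_def)
    then show "\<eta> * (3 + B / 2) = \<zeta> / 2" using B0 by (simp add: \<eta>_def field_simps)
    moreover have "\<eta> * 1 \<le> \<eta> * (3 + B / 2)" using \<open>\<eta> > 0\<close> B0 by (intro mult_left_mono) auto
    ultimately show "\<eta> \<le> \<zeta> / 2" by simp
  qed
  obtain m :: nat and C where C: "\<And>k. k < m \<Longrightarrow> compact (C k) \<and> C k \<subseteq> K \<and> (\<exists>e. flat_set e l (C k))"
    "disjoint_family_on C {..<m}" "hausdorff ?n (K - (\<Union>k<m. C k)) \<le> ennreal \<eta>"
    using rectifiable_flat_pieces[OF K(1,3) dim l(1) \<eta>(1)] by metis
  let ?Q = "\<lambda>k p. p \<ge> 0 \<and> ennreal p \<le> hausdorff ?n (C k) \<and> hausdorff ?n (C k) \<le> ennreal ((1 + 2 * l) ^ ?n * p) \<and>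
    (\<forall>s>0. 2 * s * p \<le> measure lebesgue (nbhd s (C k))) \<and>
    (\<forall>\<eta>>0. \<exists>s0>0. \<forall>s. 0 < s \<longrightarrow> s < s0 \<longrightarrow> measure lebesgue (nbhd s (C k)) \<le> 2 * s * (1 + 2 * l) * (p + \<eta>))"
  have "\<forall>k\<in>{..<m}. \<exists>p. ?Q k p"
  proof
    fix k assume "k \<in> {..<m}"
    then obtain e where "compact (C k)" "flat_set e l (C k)" using C(1)[of k] by auto
    then show "\<exists>p. ?Q k p" by (rule flat_minkowski[OF _ _ l(1,2) dim])
  qed
  from bchoice[OF this] obtain p where p0: "\<forall>k\<in>{..<m}. ?Q k (p k)" by (rule exE)
  have p: "?Q k (p k)" if "k < m" for k by (rule bspec[OF p0]) (use that in simp)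
  have p1: "0 \<le> p k" and p2: "ennreal (p k) \<le> hausdorff ?n (C k)"
    and p3: "hausdorff ?n (C k) \<le> ennreal ((1 + 2 * l) ^ ?n * p k)" if "k < m" for k
    using p[OF that] by simp_all
  have p4: "2 * s * p k \<le> measure lebesgue (nbhd s (C k))" if "k < m" "s > 0" for k s
    using p[OF that(1)] that(2) by simp
  have p5: "\<exists>s0>0. \<forall>s. 0 < s \<longrightarrow> s < s0 \<longrightarrow> measure lebesgue (nbhd s (C k)) \<le> 2 * s * (1 + 2 * l) * (p k + \<eta>)"
    if "k < m" "\<eta> > 0" for k \<eta>
    using p[OF that(1)] that(2) by simp
  let ?H = "hausdorff_measure ?n :: 'a measure" and ?U = "\<Union>k<m. C k"
  have Cb: "C k \<in> sets borel" if "k < m" for k using C(1)[OF that] by (simp add: borel_compact)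
  have Ub: "?U \<in> sets borel" using Cb by (intro sets.finite_UN) auto
  have sumH: "(\<Sum>k<m. hausdorff ?n (C k)) = hausdorff ?n ?U"
  proof -
    have "(\<Sum>k<m. emeasure ?H (C k)) = emeasure ?H ?U" using Cb C(2) by (intro sum_emeasure) auto
    then show ?thesis using Cb Ub by (simp add: emeasure_hausdorff_measure)
  qed
  have HU: "hausdorff ?n ?U \<le> hausdorff ?n K" using C(1) by (intro hausdorff_mono) auto
  have sp: "(\<Sum>k<m. p k) \<le> M"
  proof -
    have "ennreal (\<Sum>k<m. p k) = (\<Sum>k<m. ennreal (p k))" using p1 by (intro sum_ennreal[symmetric]) simp
    also have "\<dots> \<le> (\<Sum>k<m. hausdorff ?n (C k))" using p2 by (intro sum_mono) simp
    also have "\<dots> \<le> ennreal M" using sumH HU HK by simp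
    finally show ?thesis using M0 by (simp add: ennreal_le_iff)
  qed
  have sp0: "0 \<le> (\<Sum>k<m. p k)" using p1 by (intro sum_nonneg) simp
  have low: "M - \<zeta> \<le> (\<Sum>k<m. p k)"
  proof -
    have "ennreal M \<le> hausdorff ?n ?U + hausdorff ?n (K - ?U)"
      unfolding HK[symmetric] by (rule order_trans[OF hausdorff_mono hausdorff_Un]) auto
    also have "\<dots> \<le> (\<Sum>k<m. ennreal ((1 + 2 * l) ^ ?n * p k)) + ennreal \<eta>"
      unfolding sumH[symmetric] using p3 C(3) by (intro add_mono sum_mono) simp_all
    also have "(\<Sum>k<m. ennreal ((1 + 2 * l) ^ ?n * p k)) = ennreal ((1 + 2 * l) ^ ?n * (\<Sum>k<m. p k))"
      using p1 l by (subst sum_ennreal) (simp_all add: sum_distrib_left)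
    also have "\<dots> + ennreal \<eta> = ennreal ((1 + 2 * l) ^ ?n * (\<Sum>k<m. p k) + \<eta>)"
      using sp0 l \<eta> by (intro ennreal_plus[symmetric]) auto
    finally have "M \<le> (1 + 2 * l) ^ ?n * (\<Sum>k<m. p k) + \<eta>"
      using sp0 l \<eta> by (subst (asm) ennreal_le_iff) auto
    also have "(1 + 2 * l) ^ ?n * (\<Sum>k<m. p k) \<le> (1 + \<zeta> / (2 * (M + 1))) * (\<Sum>k<m. p k)"
      using l1(2)[OF l(1,3)] sp0 by (intro mult_right_mono) auto
    also have "\<dots> = (\<Sum>k<m. p k) + \<zeta> / (2 * (M + 1)) * (\<Sum>k<m. p k)" by (simp add: distrib_right)
    also have "\<zeta> / (2 * (M + 1)) * (\<Sum>k<m. p k) \<le> \<zeta> / (2 * (M + 1)) * (M + 1)" using sp \<zeta> M0 by (intro mult_left_mono) auto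
    also have "\<dots> = \<zeta> / 2" using M0 by (simp add: field_simps)
    finally show ?thesis using \<eta> by simp
  qed
  have "\<exists>d>0. \<forall>j<m. \<forall>k<m. j \<noteq> k \<longrightarrow> (\<forall>x\<in>C j. \<forall>y\<in>C k. d \<le> dist x y)"
    by (rule compact_disjoint_family_separated) (use C(1,2) in simp_all)
  then obtain d where d0: "d > 0" "\<forall>j<m. \<forall>k<m. j \<noteq> k \<longrightarrow> (\<forall>x\<in>C j. \<forall>y\<in>C k. d \<le> dist x y)"
    by (elim exE conjE)
  have d: "d > 0" "\<And>j k x y. j < m \<Longrightarrow> k < m \<Longrightarrow> j \<noteq> k \<Longrightarrow> x \<in> C j \<Longrightarrow> y \<in> C k \<Longrightarrow> d \<le> dist x y"
    using d0 by simp_all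
  have fm: "nbhd s X \<in> lmeasurable" if "X \<subseteq> K" for s X using lmeasurable_nbhd[OF bounded_subset[OF K(2) that]] .
  have lower: "M - \<zeta> \<le> measure lebesgue (nbhd s K) / (2 * s)" if s: "0 < s" "s < d / 2" for s
  proof -
    have "2 * s * (M - \<zeta>) \<le> (\<Sum>k<m. 2 * s * p k)" using low s by (simp add: sum_distrib_left[symmetric])
    also have "\<dots> \<le> (\<Sum>k<m. measure lebesgue (nbhd s (C k)))" using p4 s by (intro sum_mono) simp
    also have "\<dots> = measure lebesgue (\<Union>k<m. nbhd s (C k))"
    proof (rule measure_finite_Union[symmetric])
      show "disjoint_family_on (\<lambda>k. nbhd s (C k)) {..<m}"
        unfolding disjoint_family_on_def
      proof (intro ballI impI)
        fix j k assume jk: "j \<in> {..<m}" "k \<in> {..<m}" "j \<noteq> k"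
        show "nbhd s (C j) \<inter> nbhd s (C k) = {}"
        proof (rule ccontr)
          assume "nbhd s (C j) \<inter> nbhd s (C k) \<noteq> {}"
          then obtain x y w where "x \<in> C j" "y \<in> C k" "dist x w < s" "dist y w < s" by (auto simp: nbhd_def)
          then show False using d(2)[of j k x y] jk dist_triangle2[of x y w] s by auto
        qed
      qed
      show "emeasure lebesgue (nbhd s (C k)) \<noteq> \<infinity>" if "k \<in> {..<m}" for k
        using fm[of "C k" s] C(1) that by (auto simp: fmeasurable_def)
    qed auto
    also have "\<dots> \<le> measure lebesgue (nbhd s K)"
    proof (rule measure_mono_fmeasurable[OF _ _ fm[OF order_refl]])
      show "(\<Union>k<m. nbhd s (C k)) \<subseteq> nbhd s K" unfolding nbhd_def using C(1) by (intro UN_least UN_mono) auto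
      show "(\<Union>k<m. nbhd s (C k)) \<in> sets lebesgue" by (intro sets.finite_UN) auto
    qed
    finally show ?thesis using s by (simp add: pos_le_divide_eq mult.commute)
  qed
  \<comment> \<open>The error is shared among the m pieces; \<open>Suc m\<close> avoids division by
    0 when there are none.\<close>
  define \<eta>' where "\<eta>' = \<eta> / real (Suc m)"
  have \<eta>': "\<eta>' > 0" "real m * \<eta>' \<le> \<eta>" using \<eta>(1) by (auto simp: \<eta>'_def field_simps)
  have "\<forall>k\<in>{..<m}. \<exists>s0>0. \<forall>s. 0 < s \<longrightarrow> s < s0 \<longrightarrow> measure lebesgue (nbhd s (C k)) \<le> 2 * s * (1 + 2 * l) * (p k + \<eta>')"
    using p5[OF _ \<eta>'(1)] by simp
  from bchoice[OF this] obtain s0 where s0: "\<And>k. k < m \<Longrightarrow> s0 k > 0"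
    "\<And>k s. k < m \<Longrightarrow> 0 < s \<Longrightarrow> s < s0 k \<Longrightarrow> measure lebesgue (nbhd s (C k)) \<le> 2 * s * (1 + 2 * l) * (p k + \<eta>')" by auto
  define s1 where "s1 = Min (insert 1 (s0 ` {..<m}))"
  have s1: "s1 > 0" "\<And>k. k < m \<Longrightarrow> s1 \<le> s0 k"
    using s0(1) by (auto simp: s1_def)
  have upper: "measure lebesgue (nbhd s K) / (2 * s) \<le> M + \<zeta>" if s: "0 < s" "s < s1 / 2" "s < r0" for s
  proof -
    define R where "R = {x \<in> K. \<forall>y\<in>?U. l * s \<le> dist x y}"
    have ls: "0 < l * s" "l * s < r0"
    proof -
      show "0 < l * s" using l s by simp
      have "l * s \<le> 1 * s" using l s by (intro mult_right_mono) auto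
      then show "l * s < r0" using s by linarith
    qed
    have bad: "emeasure lebesgue (nbhd s R) \<le> ennreal (B * \<eta> * s)"
      unfolding B_def
      by (rule nbhd_far_part[OF K(1) _ c(1) Ub dens[OF _ ls] s(1) l(1) _ dim C(3)]) (use l \<eta> in \<open>auto simp: R_def\<close>)
    have Rm: "nbhd s R \<in> lmeasurable" by (rule fm) (auto simp: R_def)
    have badm: "measure lebesgue (nbhd s R) \<le> B * \<eta> * s"
      using bad B0 \<eta>(1) s unfolding emeasure_eq_measure2[OF Rm] by (subst (asm) ennreal_le_iff) auto
    \<comment> \<open>Radius s plus the distance l s to the nearest piece.\<close>
    define s' where "s' = (1 + l) * s"
    have s': "0 < s'" "s' < s1"
    proof -
      show "0 < s'" using l s by (simp add: s'_def)
      have "(1 + l) * s \<le> 2 * s" using l s by (intro mult_right_mono) auto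
      then show "s' < s1" using s unfolding s'_def by linarith
    qed
    have sub: "nbhd s K \<subseteq> (\<Union>k<m. nbhd s' (C k)) \<union> nbhd s R"
    proof
      fix x assume "x \<in> nbhd s K"
      then obtain y where y: "y \<in> K" "dist y x < s" by (auto simp: nbhd_def)
      show "x \<in> (\<Union>k<m. nbhd s' (C k)) \<union> nbhd s R"
      proof (cases "y \<in> R")
        case True then show ?thesis using y by (auto simp: nbhd_def)
      next
        case False
        then obtain k w where k: "k < m" "w \<in> C k" "dist y w < l * s" using y by (auto simp: R_def not_le)
        have "dist w x < s'" using dist_triangle[of w x y] k y by (simp add: s'_def dist_commute algebra_simps)
        then show ?thesis using k by (auto simp: nbhd_def)
      qed
    qed
    have Um: "(\<Union>k<m. nbhd s' (C k)) \<in> lmeasurable" using C(1) by (intro fmeasurable.finite_UN) (auto intro: fm)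
    have "measure lebesgue (nbhd s K) \<le> measure lebesgue ((\<Union>k<m. nbhd s' (C k)) \<union> nbhd s R)"
      by (rule measure_mono_fmeasurable[OF sub _ fmeasurable.Un[OF Um Rm]]) simp
    also have "\<dots> \<le> measure lebesgue (\<Union>k<m. nbhd s' (C k)) + measure lebesgue (nbhd s R)"
      by (rule measure_Un_le[OF fmeasurableD[OF Um] fmeasurableD[OF Rm]])
    also have "measure lebesgue (\<Union>k<m. nbhd s' (C k)) \<le> (\<Sum>k<m. measure lebesgue (nbhd s' (C k)))"
      by (rule measure_UNION_le) auto
    also have "\<dots> \<le> (\<Sum>k<m. 2 * s' * (1 + 2 * l) * (p k + \<eta>'))"
      by (intro sum_mono s0(2)) (use s' s1(2) in force)+
    also have "\<dots> = 2 * s' * (1 + 2 * l) * ((\<Sum>k<m. p k) + real m * \<eta>')"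
      by (simp add: sum_distrib_left[symmetric] sum.distrib)
    also have "\<dots> \<le> 2 * s' * (1 + 2 * l) * (M + \<eta>)"
      using sp \<eta>'(2) s' l by (intro mult_left_mono add_mono) auto
    also have "\<dots> = 2 * s * ((1 + l) * (1 + 2 * l)) * (M + \<eta>)" by (simp add: s'_def)
    also have "\<dots> \<le> 2 * s * (1 + 4 * l) * (M + \<eta>)"
    proof (intro mult_right_mono mult_left_mono)
      have "l * l \<le> l * (1/2)" using l by (intro mult_left_mono) auto
      then show "(1 + l) * (1 + 2 * l) \<le> 1 + 4 * l" by (simp add: algebra_simps)
    qed (use s M0 \<eta> in auto)
    finally have "measure lebesgue (nbhd s K) \<le> 2 * s * (1 + 4 * l) * (M + \<eta>) + B * \<eta> * s" using badm by simp
    also have "\<dots> = 2 * s * ((1 + 4 * l) * (M + \<eta>) + B * \<eta> / 2)" by (simp add: algebra_simps)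
    also have "\<dots> \<le> 2 * s * (M + \<zeta>)"
    proof (rule mult_left_mono)
      have "l * (8 * (M + 1)) \<le> \<zeta>" using l(4) M0 by (simp add: pos_le_divide_eq)
      moreover have "4 * l * \<eta> \<le> 2 * \<eta>" using l \<eta> by simp
      ultimately have "(1 + 4 * l) * (M + \<eta>) + B * \<eta> / 2 \<le> M + \<zeta> / 2 + \<eta> * (3 + B / 2)"
        using l M0 by (simp add: algebra_simps)
      then show "(1 + 4 * l) * (M + \<eta>) + B * \<eta> / 2 \<le> M + \<zeta>" using \<eta>(2) by simp
    qed (use s in simp)
    finally show ?thesis using s by (simp add: pos_divide_le_eq mult.commute)
  qed
  have "\<forall>\<^sub>F s in at_right (0::real). s < min (d / 2) (min (s1 / 2) r0)"
    by (rule order_tendstoD(2)[OF tendsto_ident_at]) (use d s1 c in simp)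
  moreover have "\<forall>\<^sub>F s in at_right (0::real). 0 < s" by (rule eventually_at_right_less)
  ultimately show "\<forall>\<^sub>F s in at_right 0. dist (measure lebesgue (nbhd s K) / (2 * s)) (enn2real (hausdorff ?n K)) < z"
  proof eventually_elim
    case (elim s)
    then have "M - \<zeta> \<le> measure lebesgue (nbhd s K) / (2 * s)" "measure lebesgue (nbhd s K) / (2 * s) \<le> M + \<zeta>"
      by (intro lower upper; simp)+
    then show ?case using \<zeta> by (simp add: M_def[symmetric] dist_real_def abs_less_iff)
  qed
qed

section \<open>One-dimensional profiles and layer integrals\<close>

lemma continuous_measurable_lebesgue:
  fixes f :: "'a::euclidean_space \<Rightarrow> real"
  shows "continuous_on UNIV f \<Longrightarrow> f \<in> borel_measurable lebesgue"
  by (intro measurable_completion) (simp add: borel_measurable_continuous_onI)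

text \<open>Moving from x in the direction of g itself changes u at the rate \<open>norm g\<close>
  per unit length, so a local Lipschitz bound at x bounds g.\<close>

lemma gradient_norm_le:
  fixes u :: "'a::euclidean_space \<Rightarrow> real"
  assumes u: "(u has_derivative (\<lambda>h. g \<bullet> h)) (at x)" and d: "d > 0" "L \<ge> 0"
    and L: "\<And>y. dist y x < d \<Longrightarrow> \<bar>u y - u x\<bar> \<le> L * dist y x"
  shows "norm g \<le> L"
proof (rule ccontr)
  assume "\<not> ?thesis"
  then have gL: "L < norm g" by simp
  then have ng: "norm g > 0" using d by linarith
  define e where "e = (norm g - L) / 2"
  have e: "e > 0" using gL by (simp add: e_def)
  have "\<forall>e>0. \<exists>d>0. \<forall>y. norm (y - x) < d \<longrightarrow> norm (u y - u x - g \<bullet> (y - x)) \<le> e * norm (y - x)"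
    using u unfolding has_derivative_at_alt by (rule conjunct2)
  with e obtain d' where d': "d' > 0" "\<And>y. norm (y - x) < d' \<Longrightarrow> norm (u y - u x - g \<bullet> (y - x)) \<le> e * norm (y - x)"
    by blast
  define t where "t = min d d' / (2 * norm g)"
  have "t * norm g = min d d' / 2" using ng by (simp add: t_def)
  then have t: "t * norm g < d" "t * norm g < d'" "t * norm g > 0" using d(1) d'(1) by linarith+
  then have t0: "t > 0" using ng by (simp add: zero_less_mult_iff)
  define y where "y = x + t *\<^sub>R g"
  have ny: "norm (y - x) = t * norm g" and yx: "y - x = t *\<^sub>R g" using t0 by (simp_all add: y_def)
  have 1: "\<bar>u y - u x - t * (norm g * norm g)\<bar> \<le> e * (t * norm g)"
    using d'(2)[of y] t(2) unfolding ny by (simp add: yx dot_square_norm power2_eq_square)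
  have 2: "\<bar>u y - u x\<bar> \<le> L * (t * norm g)" using L[of y] t(1) ny by (simp add: dist_norm)
  have "(norm g) * (t * norm g) \<le> (e + L) * (t * norm g)" using 1 2 by (simp add: algebra_simps)
  then have "norm g \<le> e + L" using t(3) by (rule mult_right_le_imp_le)
  then show False using gL by (simp add: e_def field_simps)
qed

text \<open>A chain rule inequality that does not ask \<phi> to be differentiable. It is enough that
  u varies near x at most as much as the composition, which admits truncation by
  \<open>max 0\<close>.\<close>

lemma gradient_comp_le:
  fixes u :: "'a::euclidean_space \<Rightarrow> real"
  assumes u: "(u has_derivative (\<lambda>h. g \<bullet> h)) (at x)" and f: "(f has_real_derivative D) (at (\<phi> x))"
    and \<phi>: "\<And>y. \<bar>\<phi> y - \<phi> x\<bar> \<le> dist y x" and d: "d > 0"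
    and near: "\<And>y. dist y x < d \<Longrightarrow> \<bar>u y - u x\<bar> \<le> \<bar>f (\<phi> y) - f (\<phi> x)\<bar>"
  shows "norm g \<le> \<bar>D\<bar>"
proof (rule field_le_epsilon)
  fix e :: real assume e: "e > 0"
  have "\<forall>e>0. \<exists>d>0. \<forall>s. norm (s - \<phi> x) < d \<longrightarrow> norm (f s - f (\<phi> x) - D * (s - \<phi> x)) \<le> e * norm (s - \<phi> x)"
    using f unfolding has_field_derivative_def has_derivative_at_alt by (rule conjunct2)
  with e obtain d' where d': "d' > 0" "\<And>s. norm (s - \<phi> x) < d' \<Longrightarrow> norm (f s - f (\<phi> x) - D * (s - \<phi> x)) \<le> e * norm (s - \<phi> x)"
    by blast
  show "norm g \<le> \<bar>D\<bar> + e"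
  proof (rule gradient_norm_le[OF u])
    show "min d d' > 0" using d d'(1) by simp
    fix y assume y: "dist y x < min d d'"
    have "\<bar>f (\<phi> y) - f (\<phi> x) - D * (\<phi> y - \<phi> x)\<bar> \<le> e * \<bar>\<phi> y - \<phi> x\<bar>"
      using d'(2)[of "\<phi> y"] \<phi>[of y] y by simp
    then have "\<bar>f (\<phi> y) - f (\<phi> x)\<bar> \<le> \<bar>D * (\<phi> y - \<phi> x)\<bar> + e * \<bar>\<phi> y - \<phi> x\<bar>" by linarith
    also have "\<dots> = (\<bar>D\<bar> + e) * \<bar>\<phi> y - \<phi> x\<bar>" by (simp add: abs_mult distrib_right)
    also have "\<dots> \<le> (\<bar>D\<bar> + e) * dist y x" using \<phi>[of y] e by (intro mult_left_mono) auto
    finally show "\<bar>u y - u x\<bar> \<le> (\<bar>D\<bar> + e) * dist y x" using near[of y] y by simp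
  qed (use e in simp)
qed

text \<open>Separation of variables: with F an antiderivative of 1 / h, the solution is the inverse
  of F run backwards from F a. The two-sided bounds on h make F a bijection of the line, so w exists
  for all times and reaches 0 at time F a - F 0.\<close>

lemma decreasing_profile:
  fixes h :: "real \<Rightarrow> real"
  assumes h: "continuous_on UNIV h" "m > 0" "\<And>t. m \<le> h t" "\<And>t. h t \<le> M" and a: "a > 0"
  obtains w S where "S > 0" "w 0 = a" "w S = 0" "\<And>r. (w has_real_derivative - h (w r)) (at r)"
    "integral {0..S} (\<lambda>r. (h (w r))\<^sup>2) = integral {0..a} h"
proof -
  have anti: "\<exists>F. \<forall>x. (F has_real_derivative f x) (at x)" if cf: "continuous_on UNIV f" for f :: "real \<Rightarrow> real"
    using einterval_antiderivative[of "-\<infinity>" "\<infinity>" f] cf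
    by (auto simp: continuous_on_eq_continuous_at has_real_derivative_iff_has_vector_derivative)
  have h0: "h t > 0" for t using h(2) h(3)[of t] by linarith
  have M: "M > 0" using h0[of 0] h(4)[of 0] by linarith
  have "continuous_on UNIV (\<lambda>t. 1 / h t)" by (intro continuous_intros h(1)) (use h0 in \<open>auto simp: less_imp_neq[symmetric]\<close>)
  from anti[OF this] obtain F where F: "\<And>x. (F has_real_derivative 1 / h x) (at x)" by auto
  have lin: "(y - x) / M \<le> F y - F x" if xy: "x \<le> y" for x y
  proof (cases "x = y")
    case False
    then have "x < y" using xy by simp
    then obtain z where "F y - F x = (y - x) * (1 / h z)" using MVT2[of x y F "\<lambda>x. 1 / h x"] F by auto
    moreover have "1 / M \<le> 1 / h z" using h0[of z] h(4)[of z] by (intro divide_left_mono) (auto simp: M)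
    then have "(y - x) * (1 / M) \<le> (y - x) * (1 / h z)" using xy by (intro mult_left_mono) auto
    ultimately show ?thesis by simp
  qed simp
  have Fc: "isCont F x" for x using F by (rule DERIV_isCont)
  have mono: "F x < F y" if "x < y" for x y
  proof -
    have "0 < (y - x) / M" using that M by (intro divide_pos_pos) auto
    then show ?thesis using lin[of x y] that by linarith
  qed
  have inj: "F x = F y \<Longrightarrow> x = y" for x y using mono by (metis less_irrefl linorder_neqE)
  have surj: "\<exists>x. F x = y" for y
  proof -
    define b where "b = M * \<bar>y - F 0\<bar>"
    have b: "b \<ge> 0" using M by (simp add: b_def)
    have "b / M = \<bar>y - F 0\<bar>" using M by (simp add: b_def)
    then have "F (- b) \<le> y" "y \<le> F b" using lin[of 0 b] lin[of "-b" 0] b by auto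
    then show ?thesis using IVT'[of F "-b" y b] b Fc by (auto intro: continuous_at_imp_continuous_on)
  qed
  define g where "g = inv F"
  have gF: "g (F x) = x" for x unfolding g_def by (rule inv_f_f) (use inj in \<open>auto simp: inj_def\<close>)
  have Fg: "F (g y) = y" for y unfolding g_def by (rule surj_f_inv_f) (use surj in \<open>auto simp: surj_def eq_commute\<close>)
  have gc: "isCont g y" for y
    using isCont_inverse_function[of 1 "g y" g F] gF Fc Fg by simp
  have gd: "(g has_real_derivative h (g y)) (at y)" for y
    using DERIV_inverse_function[of F "1 / h (g y)" g y "y - 1" "y + 1"] F gc Fg h0[of "g y"] by simp
  define w where "w r = g (F a - r)" for r
  define S where "S = F a - F 0"
  have wd: "(w has_real_derivative - h (w r)) (at r)" for r
  proof -
    have "((\<lambda>r. F a - r) has_real_derivative - 1) (at r)" by (auto intro!: derivative_eq_intros)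
    from DERIV_chain2[OF gd this] show ?thesis by (simp add: w_def[abs_def])
  qed
  have S0: "S > 0" using mono[OF a] by (simp add: S_def)
  have w0: "w 0 = a" "w S = 0" by (simp_all add: w_def S_def gF)
  from anti[OF h(1)] obtain Ha where H: "\<And>x. (Ha has_real_derivative h x) (at x)" by auto
  \<comment> \<open>The substitution t = w r, carried out on antiderivatives.\<close>
  have "((\<lambda>r. - Ha (w r)) has_real_derivative (h (w r))\<^sup>2) (at r)" for r
    using DERIV_minus[OF DERIV_chain2[OF H wd]] by (simp add: power2_eq_square)
  then have "((\<lambda>r. (h (w r))\<^sup>2) has_integral (- Ha (w S) - - Ha (w 0))) {0..S}"
    using S0 by (intro fundamental_theorem_of_calculus)
      (auto simp: has_real_derivative_iff_has_vector_derivative[symmetric] intro: has_field_derivative_at_within)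
  moreover have "(h has_integral (Ha a - Ha 0)) {0..a}"
    using a H by (intro fundamental_theorem_of_calculus)
      (auto simp: has_real_derivative_iff_has_vector_derivative[symmetric] intro: has_field_derivative_at_within)
  ultimately have "integral {0..S} (\<lambda>r. (h (w r))\<^sup>2) = integral {0..a} h"
    using w0 by (simp add: integral_unique)
  then show ?thesis using that S0 w0 wd by blast
qed

section \<open>Integrals over thin layers\<close>

lemma riemann_sum_le_integral:
  fixes G :: "real \<Rightarrow> real"
  assumes G: "continuous_on {0..real k * q} G" and q: "q \<ge> 0"
    and osc: "\<And>i r. i < k \<Longrightarrow> real i * q \<le> r \<Longrightarrow> r \<le> real (Suc i) * q \<Longrightarrow> G (real i * q) - \<eta> \<le> G r"
  shows "(\<Sum>i<k. (G (real i * q) - \<eta>) * q) \<le> integral {0..real k * q} G"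
  using assms(1,3)
proof (induction k)
  case (Suc k)
  have le: "real k * q \<le> real (Suc k) * q" using q by (intro mult_right_mono) auto
  have k0: "0 \<le> real k * q" using q by simp
  have co: "continuous_on {0..real k * q} G" "continuous_on {real k * q..real (Suc k) * q} G"
    by (rule continuous_on_subset[OF Suc.prems(1)]; use le k0 in auto)+
  have a: "(\<Sum>i<k. (G (real i * q) - \<eta>) * q) \<le> integral {0..real k * q} G"
    by (rule Suc.IH[OF co(1)]) (use Suc.prems(2) in auto)
  have b: "integral {real k * q..real (Suc k) * q} (\<lambda>_. G (real k * q) - \<eta>) \<le> integral {real k * q..real (Suc k) * q} G"
    by (rule integral_le[OF integrable_const_ivl integrable_continuous_interval[OF co(2)]]) (use Suc.prems(2)[of k] in auto)
  have c: "integral {real k * q..real (Suc k) * q} (\<lambda>_. G (real k * q) - \<eta>) = (G (real k * q) - \<eta>) * q"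
    using le by (simp add: algebra_simps)
  have d: "integral {0..real k * q} G + integral {real k * q..real (Suc k) * q} G = integral {0..real (Suc k) * q} G"
    by (rule Henstock_Kurzweil_Integration.integral_combine[OF k0 le integrable_continuous_interval[OF Suc.prems(1)]])
  show ?case unfolding sum.lessThan_Suc using a b[unfolded c] d by linarith
qed simp

text \<open>G is replaced by a step function constant on N layers of thickness q \<epsilon>. The
  volume of a layer is a difference of volumes of two sublevel sets, so the Minkowski limit at
  finitely many radii determines the limit of the integral, with no coarea formula.\<close>

lemma layer_integral_le:
  fixes \<phi> :: "'a::euclidean_space \<Rightarrow> real"
  assumes \<phi>: "continuous_on UNIV \<phi>" "\<And>x. 0 \<le> \<phi> x"
    and fin: "\<And>s. s \<le> s1 \<Longrightarrow> {x. \<phi> x < s} \<in> lmeasurable" and s1: "s1 > 0"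
    and lim: "((\<lambda>s. measure lebesgue {x. \<phi> x < s} / (2 * s)) \<longlongrightarrow> M) (at_right 0)" and M: "M \<ge> 0"
    and G: "continuous_on {0..S} G" "\<And>r. r \<in> {0..S} \<Longrightarrow> 0 \<le> G r" and S: "S > 0" and e: "e > 0"
  shows "\<forall>\<^sub>F \<epsilon> in at_right 0. (\<integral>\<^sup>+x. ennreal (G (\<phi> x / \<epsilon>)) * indicator {x. \<phi> x < S * \<epsilon>} x \<partial>lebesgue)
    \<le> ennreal (\<epsilon> * (2 * M * integral {0..S} G + e))"
proof -
  \<comment> \<open>The step function exceeds the lower Riemann sum by 2 \<eta> over a range of
    length S, which costs 4 M S \<eta> in the limit; the denominator puts this below e.\<close>
  define \<eta> where "\<eta> = e / (4 * (M + 1) * S + 1)"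
  have pos: "4 * (M + 1) * S + 1 > 0" using M S by (simp add: add_pos_pos)
  have \<eta>: "\<eta> > 0" using e pos by (simp add: \<eta>_def)
  have \<eta>e: "4 * M * S * \<eta> < e"
  proof -
    have "4 * M * S < 4 * (M + 1) * S + 1" using S by (simp add: algebra_simps)
    then have "4 * M * S * \<eta> < (4 * (M + 1) * S + 1) * \<eta>" using \<eta> by (rule mult_strict_right_mono)
    also have "\<dots> = e" using pos by (simp add: \<eta>_def)
    finally show ?thesis .
  qed
  have "uniformly_continuous_on {0..S} G" using G(1) by (rule compact_uniformly_continuous) simp
  then obtain d where d: "d > 0" "\<And>r r'. r \<in> {0..S} \<Longrightarrow> r' \<in> {0..S} \<Longrightarrow> dist r' r < d \<Longrightarrow> dist (G r') (G r) < \<eta>"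
    using \<eta> unfolding uniformly_continuous_on_def by metis
  obtain N where N: "S / d < real N" using reals_Archimedean2 by blast
  have N0: "N > 0" using N S d(1) by (cases N) (auto simp: divide_less_0_iff not_less)
  define q where "q = S / real N"
  have q: "q > 0" "real N * q = S" "q < d" using N N0 S d(1) by (auto simp: q_def field_simps)
  have inS: "real i * q \<in> {0..S}" if "i \<le> N" for i
    using mult_right_mono[of "real i" "real N" q] that q by auto
  have osc: "\<bar>G r - G (real i * q)\<bar> \<le> \<eta>" if "i < N" "real i * q \<le> r" "r \<le> real (Suc i) * q" for i r
  proof -
    have "r \<in> {0..S}" using inS[of i] inS[of "Suc i"] that by auto
    moreover have "dist r (real i * q) < d" using that q(3) by (auto simp: dist_real_def algebra_simps)
    ultimately show ?thesis using d(2)[of "real i * q" r] inS[of i] that(1) by (auto simp: dist_real_def)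
  qed
  define V where "V s = measure lebesgue {x. \<phi> x < s}" for s
  define f where "f \<epsilon> = (\<Sum>i<N. (G (real i * q) + \<eta>) * (V (real (Suc i) * q * \<epsilon>) / \<epsilon> - V (real i * q * \<epsilon>) / \<epsilon>))" for \<epsilon>
  have Vlim: "((\<lambda>\<epsilon>. V (r * \<epsilon>) / \<epsilon>) \<longlongrightarrow> 2 * M * r) (at_right 0)" if r: "r \<ge> 0" for r
  proof (cases "r = 0")
    case True
    have "{x. \<phi> x < 0} = {}" using \<phi>(2) by (auto simp: not_less)
    then show ?thesis using True by (simp add: V_def)
  next
    case False
    then have r0: "r > 0" using r by simp
    have "filterlim (\<lambda>\<epsilon>. r * \<epsilon>) (at_right 0) (at_right (0::real))"
      unfolding filterlim_at using r0 by (auto intro!: tendsto_eq_intros eventually_at_right_less[THEN eventually_mono])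
    from filterlim_compose[OF lim this]
    have "((\<lambda>\<epsilon>. V (r * \<epsilon>) / (2 * (r * \<epsilon>))) \<longlongrightarrow> M) (at_right 0)" by (simp add: V_def)
    then have "((\<lambda>\<epsilon>. 2 * r * (V (r * \<epsilon>) / (2 * (r * \<epsilon>)))) \<longlongrightarrow> 2 * r * M) (at_right 0)" by (rule tendsto_mult_left)
    moreover have "2 * r * (V (r * \<epsilon>) / (2 * (r * \<epsilon>))) = V (r * \<epsilon>) / \<epsilon>" for \<epsilon> using r0 by simp
    ultimately show ?thesis by (simp add: mult_ac)
  qed
  have "(f \<longlongrightarrow> (\<Sum>i<N. (G (real i * q) + \<eta>) * (2 * M * (real (Suc i) * q) - 2 * M * (real i * q)))) (at_right 0)"
    unfolding f_def[abs_def] using q by (intro tendsto_sum tendsto_mult tendsto_const tendsto_diff Vlim) auto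
  also have "(\<Sum>i<N. (G (real i * q) + \<eta>) * (2 * M * (real (Suc i) * q) - 2 * M * (real i * q))) =
      2 * M * ((\<Sum>i<N. (G (real i * q) - \<eta>) * q) + 2 * \<eta> * S)"
    by (simp add: q(2)[symmetric] sum_distrib_left sum.distrib sum_subtractf algebra_simps)
  finally have flim: "(f \<longlongrightarrow> 2 * M * ((\<Sum>i<N. (G (real i * q) - \<eta>) * q) + 2 * \<eta> * S)) (at_right 0)" .
  have "(\<Sum>i<N. (G (real i * q) - \<eta>) * q) \<le> integral {0..real N * q} G"
  proof (rule riemann_sum_le_integral)
    show "continuous_on {0..real N * q} G" using G(1) q(2) by simp
    show "G (real i * q) - \<eta> \<le> G r" if "i < N" "real i * q \<le> r" "r \<le> real (Suc i) * q" for i r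
      using osc[OF that] by linarith
  qed (use q in simp)
  then have "2 * M * ((\<Sum>i<N. (G (real i * q) - \<eta>) * q) + 2 * \<eta> * S) \<le> 2 * M * (integral {0..S} G + 2 * \<eta> * S)"
    using M q(2) by (intro mult_left_mono) auto
  also have "\<dots> < 2 * M * integral {0..S} G + e" using \<eta>e by (simp add: algebra_simps)
  finally have ev: "\<forall>\<^sub>F \<epsilon> in at_right 0. f \<epsilon> < 2 * M * integral {0..S} G + e" by (rule order_tendstoD(2)[OF flim])
  have ev2: "\<forall>\<^sub>F \<epsilon> in at_right (0::real). \<epsilon> < s1 / S"
    by (rule order_tendstoD(2)[OF tendsto_ident_at]) (use s1 S in simp)
  have ev3: "\<forall>\<^sub>F \<epsilon> in at_right (0::real). 0 < \<epsilon>" by (rule eventually_at_right_less)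
  show ?thesis using ev ev2 ev3
  proof eventually_elim
    case (elim \<epsilon>)
    then have \<epsilon>: "\<epsilon> > 0" "S * \<epsilon> < s1" using S by (auto simp: field_simps)
    define D where "D i = {x. \<phi> x < real (Suc i) * q * \<epsilon>} - {x. \<phi> x < real i * q * \<epsilon>}" for i
    have ms: "{x. \<phi> x < real i * q * \<epsilon>} \<in> lmeasurable" if "i \<le> N" for i
    proof (rule fin)
      have "real i * q * \<epsilon> \<le> S * \<epsilon>" using inS[OF that] \<epsilon> by (intro mult_right_mono) auto
      then show "real i * q * \<epsilon> \<le> s1" using \<epsilon> by linarith
    qed
    have mono: "real i * q * \<epsilon> \<le> real (Suc i) * q * \<epsilon>" for i using q \<epsilon> by (intro mult_right_mono) auto
    have Dm: "D i \<in> lmeasurable" if "i < N" for i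
      unfolding D_def using ms[of i] ms[of "Suc i"] that by (intro fmeasurable.Diff) auto
    have De: "emeasure lebesgue (D i) = ennreal (V (real (Suc i) * q * \<epsilon>) - V (real i * q * \<epsilon>))" if "i < N" for i
    proof -
      have "measure lebesgue (D i) = V (real (Suc i) * q * \<epsilon>) - V (real i * q * \<epsilon>)"
        unfolding D_def V_def
        by (rule measurable_measure_Diff) (use ms[of i] ms[of "Suc i"] that mono[of i] in \<open>auto intro: fmeasurableD\<close>)
      then show ?thesis using emeasure_eq_measure2[OF Dm[OF that]] by simp
    qed
    have G\<eta>: "0 \<le> G (real i * q) + \<eta>" if "i < N" for i using G(2)[OF inS[of i]] that \<eta> by simp
    have Vm: "V (real i * q * \<epsilon>) \<le> V (real (Suc i) * q * \<epsilon>)" if "i < N" for i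
      unfolding V_def using ms[of i] ms[of "Suc i"] that mono[of i]
      by (intro measure_mono_fmeasurable) (auto intro: fmeasurableD)
    have "(\<integral>\<^sup>+x. ennreal (G (\<phi> x / \<epsilon>)) * indicator {x. \<phi> x < S * \<epsilon>} x \<partial>lebesgue)
      \<le> (\<integral>\<^sup>+x. (\<Sum>i<N. ennreal (G (real i * q) + \<eta>) * indicator (D i) x) \<partial>lebesgue)"
    proof (rule nn_integral_mono)
      fix x
      show "ennreal (G (\<phi> x / \<epsilon>)) * indicator {x. \<phi> x < S * \<epsilon>} x \<le> (\<Sum>i<N. ennreal (G (real i * q) + \<eta>) * indicator (D i) x)"
      proof (cases "\<phi> x < S * \<epsilon>")
        case True
        \<comment> \<open>The index of the layer that contains x.\<close>
        define i where "i = nat \<lfloor>\<phi> x / (q * \<epsilon>)\<rfloor>"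
        have qe: "q * \<epsilon> > 0" using q \<epsilon> by simp
        have t0: "0 \<le> \<phi> x / (q * \<epsilon>)" using \<phi>(2) qe by simp
        have "real i \<le> \<phi> x / (q * \<epsilon>)" "\<phi> x / (q * \<epsilon>) < real i + 1" using t0 unfolding i_def by linarith+
        then have i: "real i * (q * \<epsilon>) \<le> \<phi> x" "\<phi> x < (real i + 1) * (q * \<epsilon>)"
          using qe by (simp_all add: pos_le_divide_eq pos_divide_less_eq)
        have "real i * (q * \<epsilon>) < real N * (q * \<epsilon>)" using i(1) True q(2) by (simp add: mult_ac)
        then have iN: "i < N" unfolding mult_less_cancel_right_pos[OF qe] by simp
        have xD: "x \<in> D i" using i by (simp add: D_def mult_ac add.commute)
        have "real i * q \<le> \<phi> x / \<epsilon>" "\<phi> x / \<epsilon> \<le> real (Suc i) * q"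
          using i \<epsilon> by (auto simp: pos_le_divide_eq pos_divide_le_eq mult_ac add.commute)
        from osc[OF iN this] have "ennreal (G (\<phi> x / \<epsilon>)) \<le> ennreal (G (real i * q) + \<eta>)" by (intro ennreal_leI) linarith
        also have "\<dots> = ennreal (G (real i * q) + \<eta>) * indicator (D i) x" using xD by simp
        also have "\<dots> \<le> (\<Sum>i<N. ennreal (G (real i * q) + \<eta>) * indicator (D i) x)"
          by (rule member_le_sum) (use iN in auto)
        finally show ?thesis using True by simp
      qed simp
    qed
    also have "\<dots> = (\<Sum>i<N. \<integral>\<^sup>+x. ennreal (G (real i * q) + \<eta>) * indicator (D i) x \<partial>lebesgue)"
      by (rule nn_integral_sum) (use Dm in \<open>auto intro!: borel_measurable_times_ennreal borel_measurable_indicator fmeasurableD\<close>)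
    also have "\<dots> = (\<Sum>i<N. ennreal (G (real i * q) + \<eta>) * emeasure lebesgue (D i))"
      by (intro sum.cong refl nn_integral_cmult_indicator) (use Dm in \<open>auto intro: fmeasurableD\<close>)
    also have "\<dots> = (\<Sum>i<N. ennreal ((G (real i * q) + \<eta>) * (V (real (Suc i) * q * \<epsilon>) - V (real i * q * \<epsilon>))))"
      by (intro sum.cong refl) (use De G\<eta> Vm in \<open>simp add: ennreal_mult\<close>)
    also have "\<dots> = ennreal (\<Sum>i<N. (G (real i * q) + \<eta>) * (V (real (Suc i) * q * \<epsilon>) - V (real i * q * \<epsilon>)))"
      by (rule sum_ennreal) (use G\<eta> Vm in \<open>auto intro!: mult_nonneg_nonneg\<close>)
    also have "(\<Sum>i<N. (G (real i * q) + \<eta>) * (V (real (Suc i) * q * \<epsilon>) - V (real i * q * \<epsilon>))) = \<epsilon> * f \<epsilon>"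
      unfolding f_def sum_distrib_left using \<epsilon> by (intro sum.cong refl) (simp add: diff_divide_distrib[symmetric])
    also have "ennreal (\<epsilon> * f \<epsilon>) \<le> ennreal (\<epsilon> * (2 * M * integral {0..S} G + e))"
      using elim(1) \<epsilon> by (intro ennreal_leI mult_left_mono) auto
    finally show ?case .
  qed
qed

section \<open>Energy and volume of the competitor\<close>

lemma admissible_W_continuous: "admissible_W W \<Longrightarrow> continuous_on {0..1} W"
  unfolding admissible_W_def by (blast intro: DERIV_continuous_on)

lemma admissible_W_ends:
  assumes "admissible_W W"
  shows "W 0 = 0" "W 1 = 0"
  using assms by (simp_all add: admissible_W_def)

lemma admissible_W_nonneg:
  assumes W: "admissible_W W" and t: "t \<in> {0..1}"
  shows "0 \<le> W t"
proof (cases "t = 0 \<or> t = 1")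
  case True
  then show ?thesis using admissible_W_ends[OF W] by auto
next
  case False
  have "\<forall>t\<in>{0<..<1}. W t > 0" using W by (simp add: admissible_W_def)
  moreover have "t \<in> {0<..<1}" using t False by auto
  ultimately show ?thesis by (simp add: less_imp_le)
qed

lemma sqrt_W_integrable:
  assumes "admissible_W W" "0 \<le> s" "t \<le> 1"
  shows "(\<lambda>t. sqrt (W t)) integrable_on {s..t}"
  by (intro integrable_continuous_interval continuous_intros continuous_on_subset[OF admissible_W_continuous[OF assms(1)]])
    (use assms in auto)

lemma Phi_0 [simp]: "Phi W 0 = 0"
  by (simp add: Phi_def)

lemma Phi_1: "admissible_W W \<Longrightarrow> Phi W 1 = 1"
  by (simp add: Phi_def admissible_W_def)

lemma Phi_continuous: "admissible_W W \<Longrightarrow> continuous_on {0..1} (Phi W)"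
  unfolding Phi_def[abs_def] by (intro indefinite_integral_continuous_1 sqrt_W_integrable) auto

lemma Phi_mono:
  assumes W: "admissible_W W" and st: "0 \<le> s" "s \<le> t" "t \<le> 1"
  shows "Phi W s \<le> Phi W t"
  unfolding Phi_def
  by (rule integral_subset_le) (use st admissible_W_nonneg[OF W] in \<open>auto intro!: sqrt_W_integrable[OF W]\<close>)

lemma Vpot_0 [simp]: "Vpot W n 0 = 0"
  by (simp add: Vpot_def)

lemma Vpot_1: "admissible_W W \<Longrightarrow> Vpot W n 1 = 1"
  by (simp add: Vpot_def Phi_1)

lemma Vpot_bounds:
  assumes W: "admissible_W W" and t: "t \<in> {0..1}"
  shows "0 \<le> Vpot W n t" "Vpot W n t \<le> 1"
proof -
  show "0 \<le> Vpot W n t" by (simp add: Vpot_def)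
  have "0 \<le> Phi W t" "Phi W t \<le> 1" using Phi_mono[OF W, of 0 t] Phi_mono[OF W, of t 1] Phi_1[OF W] t by auto
  then show "Vpot W n t \<le> 1" unfolding Vpot_def by (intro powr_le1) auto
qed

lemma Vpot_continuous:
  assumes W: "admissible_W W" and n: "n > 0"
  shows "continuous_on {0..1} (Vpot W n)"
  unfolding Vpot_def[abs_def]
proof (rule continuous_on_powr'[OF Phi_continuous[OF W] continuous_on_const], intro ballI conjI impI)
  fix t :: real assume t: "t \<in> {0..1}"
  show "0 \<le> Phi W t" using Phi_mono[OF W, of 0 t] t by simp
  show "0 < (real n + 1) / real n" using n by simp
qed

section \<open>A bump that supplies a prescribed volume\<close>

definition bump :: "'a::metric_space \<Rightarrow> real \<Rightarrow> real \<Rightarrow> 'a \<Rightarrow> real" where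
  "bump p R \<epsilon> x = max 0 (min 1 ((R - dist x p) / \<epsilon>))"

lemma bump_bounds: "0 \<le> bump p R \<epsilon> x" "bump p R \<epsilon> x \<le> 1"
  by (simp_all add: bump_def)

lemma bump_eq_0: "\<epsilon> > 0 \<Longrightarrow> R \<le> dist x p \<Longrightarrow> bump p R \<epsilon> x = 0"
  using divide_nonpos_pos[of "R - dist x p" \<epsilon>] by (simp add: bump_def)

lemma bump_eq_1: "\<epsilon> > 0 \<Longrightarrow> dist x p \<le> R - \<epsilon> \<Longrightarrow> bump p R \<epsilon> x = 1"
  by (simp add: bump_def max_def min_def field_simps)

lemma bump_lipschitz:
  assumes "\<epsilon> > 0"
  shows "\<bar>bump p R \<epsilon> x - bump p R \<epsilon> y\<bar> \<le> dist x y / \<epsilon>"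
proof -
  have "\<bar>(R - dist x p) / \<epsilon> - (R - dist y p) / \<epsilon>\<bar> = \<bar>dist y p - dist x p\<bar> / \<epsilon>"
    using assms by (simp add: diff_divide_distrib[symmetric] abs_div_pos[symmetric])
  also have "\<dots> \<le> dist x y / \<epsilon>"
    using assms dist_triangle[of x p y] dist_triangle[of y p x] by (intro divide_right_mono) (auto simp: dist_commute)
  finally show ?thesis unfolding bump_def by linarith
qed

lemma continuous_bump: "continuous_on UNIV (\<lambda>(R, x). bump p R \<epsilon> x)" if "\<epsilon> > 0"
  unfolding bump_def split_beta using that by (intro continuous_intros) auto

text \<open>The volume depends continuously on R, is 0 at R = 0 and at least that of the ball of
  radius 1/2 at R = 1, so the intermediate value theorem applies. The last conclusion bounds R from
  above when y is small.\<close>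

lemma bump_volume:
  fixes p :: "'a::euclidean_space"
  assumes V: "continuous_on {0..1} V" "\<And>t. t \<in> {0..1} \<Longrightarrow> 0 \<le> V t" "V 0 = 0" "V 1 = 1"
    and \<epsilon>: "0 < \<epsilon>" "\<epsilon> \<le> 1/2" and y: "0 \<le> y" "y \<le> measure lebesgue (ball p (1/2))"
  obtains R where "0 \<le> R" "R \<le> 1" "(\<integral>\<^sup>+x. ennreal (V (bump p R \<epsilon> x)) \<partial>lebesgue) = ennreal y"
    "measure lebesgue (ball p (R - \<epsilon>)) \<le> y"
proof -
  \<comment> \<open>For R <= 1 the bump vanishes outside one fixed box, over which integrals depend
    continuously on the parameter R.\<close>
  have "bounded (cball p 1)" by simp
  then obtain a where a: "cball p 1 \<subseteq> cbox (-a) a" by (rule bounded_subset_cbox_symmetric)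
  define F where "F R = integral (cbox (-a) a) (\<lambda>x. V (bump p R \<epsilon> x))" for R
  have co: "continuous_on UNIV (\<lambda>(R, x). V (bump p R \<epsilon> x))"
  proof -
    have "continuous_on UNIV (\<lambda>z. V ((\<lambda>(R, x). bump p R \<epsilon> x) z))"
      by (rule continuous_on_compose2[OF V(1) continuous_bump[OF \<epsilon>(1)]]) (auto simp: bump_bounds)
    then show ?thesis by (simp add: split_beta)
  qed
  have cF: "continuous_on UNIV F" unfolding F_def[abs_def]
    by (rule integral_continuous_on_param) (rule continuous_on_subset[OF co], simp)
  have cf: "continuous_on UNIV (\<lambda>x. V (bump p R \<epsilon> x))" for R
  proof -
    have "continuous_on UNIV (\<lambda>x. (\<lambda>(R, x). V (bump p R \<epsilon> x)) (R, x))"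
      by (rule continuous_on_compose2[OF co]) (auto intro!: continuous_intros)
    then show ?thesis by simp
  qed
  have eq: "(\<integral>\<^sup>+x. ennreal (V (bump p R \<epsilon> x)) \<partial>lebesgue) = ennreal (F R)" if R: "R \<le> 1" for R
  proof -
    have "((\<lambda>x. V (bump p R \<epsilon> x)) has_integral F R) (cbox (-a) a)"
      unfolding F_def by (intro integrable_integral integrable_continuous continuous_on_subset[OF cf]) simp
    then have "((\<lambda>x. V (bump p R \<epsilon> x)) has_integral F R) UNIV"
    proof (rule has_integral_on_superset)
      fix x assume "x \<notin> cbox (-a) a"
      then have "x \<notin> cball p 1" using a by blast
      then have "R \<le> dist x p" using R by (simp add: dist_commute)
      then show "V (bump p R \<epsilon> x) = 0" using V(3) bump_eq_0[OF \<epsilon>(1), of R x p] by simp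
    qed simp
    then have "(\<integral>\<^sup>+x. ennreal (V (bump p R \<epsilon> x)) \<partial>lborel) = ennreal (F R)"
      by (intro nn_integral_has_integral_lborel borel_measurable_continuous_onI cf V(2)) (simp_all add: bump_bounds)
    then show ?thesis unfolding nn_integral_completion .
  qed
  have F0: "0 \<le> F R" for R
    unfolding F_def by (rule integral_nonneg[OF integrable_continuous[OF continuous_on_subset[OF cf]]])
      (auto intro!: V(2) simp: bump_bounds)
  have low: "measure lebesgue (ball p (R - \<epsilon>)) \<le> F R" if R: "R \<le> 1" for R
  proof -
    have "ennreal (measure lebesgue (ball p (R - \<epsilon>))) = emeasure lebesgue (ball p (R - \<epsilon>))"
      by (rule emeasure_eq_measure2[symmetric]) simp
    also have "\<dots> = (\<integral>\<^sup>+x. indicator (ball p (R - \<epsilon>)) x \<partial>lebesgue)" by (rule nn_integral_indicator[symmetric]) simp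
    also have "\<dots> \<le> (\<integral>\<^sup>+x. ennreal (V (bump p R \<epsilon> x)) \<partial>lebesgue)"
    proof (rule nn_integral_mono)
      fix x
      show "indicator (ball p (R - \<epsilon>)) x \<le> ennreal (V (bump p R \<epsilon> x))"
        using bump_eq_1[OF \<epsilon>(1), of x p R] V(4) by (cases "x \<in> ball p (R - \<epsilon>)") (simp_all add: dist_commute)
    qed
    also have "\<dots> = ennreal (F R)" by (rule eq[OF R])
    finally show ?thesis using F0 by (simp add: ennreal_le_iff)
  qed
  have "bump p 0 \<epsilon> x = 0" for x using \<epsilon> by (intro bump_eq_0) auto
  then have "F 0 = 0" by (simp add: F_def V(3))
  moreover have "y \<le> F 1"
  proof -
    have "measure lebesgue (ball p (1/2)) \<le> measure lebesgue (ball p (1 - \<epsilon>))"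
      using \<epsilon> by (intro measure_mono_fmeasurable subset_ball) auto
    then show ?thesis using y low[of 1] by linarith
  qed
  ultimately obtain R where R: "0 \<le> R" "R \<le> 1" "F R = y"
    using IVT'[of F 0 y 1] y continuous_on_subset[OF cF] by auto
  show ?thesis using that[OF R(1,2)] eq[OF R(2)] low[OF R(2)] R(3) by simp
qed

lemma power_Suc_diff_le:
  fixes a b :: real
  assumes "0 \<le> b" "b \<le> a"
  shows "a ^ Suc n - b ^ Suc n \<le> real (Suc n) * (a - b) * a ^ n"
proof (induction n)
  case (Suc n)
  have "a ^ Suc (Suc n) - b ^ Suc (Suc n) = a * (a ^ Suc n - b ^ Suc n) + (a - b) * b ^ Suc n"
    by (simp add: algebra_simps)
  also have "\<dots> \<le> a * (real (Suc n) * (a - b) * a ^ n) + (a - b) * a ^ Suc n"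
    using assms Suc.IH by (intro add_mono mult_left_mono power_mono) auto
  also have "\<dots> = real (Suc (Suc n)) * (a - b) * a ^ Suc n" by (simp add: algebra_simps)
  finally show ?case .
qed simp

lemma annulus_le:
  fixes p :: "'a::euclidean_space"
  assumes R: "0 \<le> R" and \<epsilon>: "\<epsilon> > 0" and dim: "DIM('a) = Suc n"
  shows "emeasure lebesgue {x. R - \<epsilon> \<le> dist x p \<and> dist x p < R}
    \<le> ennreal (unit_ball_vol (real (Suc n)) * (real (Suc n) * \<epsilon> * R ^ n))"
proof -
  \<comment> \<open>If R < \<epsilon> the shell is the whole ball; the maximum covers both
    cases.\<close>
  define \<rho> where "\<rho> = max 0 (R - \<epsilon>)"
  have \<rho>: "0 \<le> \<rho>" "\<rho> \<le> R" "R - \<rho> \<le> \<epsilon>" using R \<epsilon> by (auto simp: \<rho>_def)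
  have m: "ball p R - ball p \<rho> \<in> lmeasurable" by (intro fmeasurable.Diff) auto
  have "{x. R - \<epsilon> \<le> dist x p \<and> dist x p < R} \<subseteq> ball p R - ball p \<rho>"
    by (auto simp: \<rho>_def dist_commute less_max_iff_disj)
  then have "emeasure lebesgue {x. R - \<epsilon> \<le> dist x p \<and> dist x p < R} \<le> emeasure lebesgue (ball p R - ball p \<rho>)"
    by (rule emeasure_mono) (use m in auto)
  also have "\<dots> = ennreal (measure lebesgue (ball p R - ball p \<rho>))" by (rule emeasure_eq_measure2[OF m])
  also have "measure lebesgue (ball p R - ball p \<rho>) = measure lebesgue (ball p R) - measure lebesgue (ball p \<rho>)"
    using \<rho> by (intro measurable_measure_Diff subset_ball) auto
  also have "\<dots> = unit_ball_vol (real (Suc n)) * (R ^ Suc n - \<rho> ^ Suc n)"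
    using \<rho> R dim by (simp add: content_ball right_diff_distrib del: of_nat_Suc)
  also have "ennreal \<dots> \<le> ennreal (unit_ball_vol (real (Suc n)) * (real (Suc n) * \<epsilon> * R ^ n))"
  proof (intro ennreal_leI mult_left_mono)
    have "R ^ Suc n - \<rho> ^ Suc n \<le> real (Suc n) * (R - \<rho>) * R ^ n" by (rule power_Suc_diff_le[OF \<rho>(1,2)])
    also have "\<dots> \<le> real (Suc n) * \<epsilon> * R ^ n" using \<rho>(3) R by (intro mult_right_mono mult_left_mono) auto
    finally show "R ^ Suc n - \<rho> ^ Suc n \<le> real (Suc n) * \<epsilon> * R ^ n" .
  qed simp
  finally show ?thesis .
qed

text \<open>The profile lives where \<phi> < S \<epsilon> <= 1, the bump within distance R <= 1 of
  p, and \<phi> >= 1 on the ball of radius 2 around p. The margin makes the maximum locally equal to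
  one of its two parts, so volume densities add and gradients can be estimated part by part.\<close>

lemma recovery_energy:
  fixes \<phi> :: "'a::euclidean_space \<Rightarrow> real"
  assumes \<phi>: "\<And>x y. \<bar>\<phi> x - \<phi> y\<bar> \<le> dist x y" "\<And>x. 0 \<le> \<phi> x"
    and w: "\<And>r. (w has_real_derivative - h (w r)) (at r)" "w 0 = a" "w S = 0"
    and h: "continuous_on UNIV h" "\<And>t. 0 \<le> h t" "\<And>t. h t \<le> M" "\<forall>t\<in>{0..1}. W t \<le> (h t)\<^sup>2"
    and W: "W 0 = 0" "W 1 = 0" "\<forall>t\<in>{0..1}. W t \<le> B" and B: "B \<ge> 0"
    and a: "0 < a" "a \<le> 1" and \<epsilon>: "0 < \<epsilon>" "S * \<epsilon> \<le> 1"
    and p: "\<forall>x\<in>ball p 2. 1 \<le> \<phi> x" and R: "0 \<le> R" "R \<le> 1" and U: "open U"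
  defines "u \<equiv> \<lambda>x. max (max 0 (w (\<phi> x / \<epsilon>))) (bump p R \<epsilon> x)"
  shows "\<exists>L. L-lipschitz_on UNIV u" and "\<And>x. u x \<in> {0..1}" and "\<And>x. \<phi> x = 0 \<Longrightarrow> u x = a"
    and "\<And>V x. V 0 = (0::real) \<Longrightarrow> V (u x) = V (max 0 (w (\<phi> x / \<epsilon>))) + V (bump p R \<epsilon> x)"
    and "\<And>x. S * \<epsilon> \<le> \<phi> x \<Longrightarrow> max 0 (w (\<phi> x / \<epsilon>)) = 0"
    and "\<And>x. max 0 (w (\<phi> x / \<epsilon>)) \<in> {0..1}"
    and "AC W \<epsilon> u U \<le> ennreal (2 / \<epsilon>) * (\<integral>\<^sup>+x. ennreal ((h (w (\<phi> x / \<epsilon>)))\<^sup>2) * indicator {x. \<phi> x < S * \<epsilon>} x \<partial>lebesgue)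
      + ennreal ((1 + B) / \<epsilon>) * emeasure lebesgue {x. R - \<epsilon> \<le> dist x p \<and> dist x p < R}"
proof -
  have M: "M \<ge> 0" using h(2)[of 0] h(3)[of 0] by linarith
  have wdec: "w s \<le> w r" if "r \<le> s" for r s
    by (rule DERIV_nonpos_imp_nonincreasing[OF that]) (use w(1) h(2) in \<open>meson neg_le_0_iff_le\<close>)
  have wlip: "\<bar>w r - w s\<bar> \<le> M * \<bar>r - s\<bar>" for r s
  proof -
    have *: "w r - w s \<le> M * (s - r)" if rs: "r < s" for r s
    proof -
      obtain z where "w s - w r = (s - r) * (- h (w z))" using MVT2[OF rs w(1)] by (elim exE conjE)
      moreover have "(s - r) * h (w z) \<le> (s - r) * M" using h(3) rs by (intro mult_left_mono) auto
      ultimately show ?thesis by (simp add: mult.commute)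
    qed
    show ?thesis using *[of r s] *[of s r] wdec[of r s] wdec[of s r] by (cases r s rule: linorder_cases) auto
  qed
  show far: "max 0 (w (\<phi> x / \<epsilon>)) = 0" if "S * \<epsilon> \<le> \<phi> x" for x
    using wdec[of S "\<phi> x / \<epsilon>"] w(3) that \<epsilon>(1) by (simp add: pos_le_divide_eq max_def)
  have wa: "w (\<phi> x / \<epsilon>) \<le> a" for x using wdec[of 0 "\<phi> x / \<epsilon>"] w(2) \<phi>(2)[of x] \<epsilon>(1) by simp
  show w01: "max 0 (w (\<phi> x / \<epsilon>)) \<in> {0..1}" for x using wa[of x] a by auto
  have uA: "u x = bump p R \<epsilon> x" "max 0 (w (\<phi> x / \<epsilon>)) = 0" if "dist x p < 2" for x
  proof -
    have "1 \<le> \<phi> x" using bspec[OF p, of x] that by (simp add: dist_commute)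
    then show "max 0 (w (\<phi> x / \<epsilon>)) = 0" using far[of x] \<epsilon>(2) by simp
    then show "u x = bump p R \<epsilon> x" using bump_bounds(1)[of p R \<epsilon> x] by (simp add: u_def)
  qed
  have uB: "u x = max 0 (w (\<phi> x / \<epsilon>))" "bump p R \<epsilon> x = 0" if "R \<le> dist x p" for x
    using bump_eq_0[OF \<epsilon>(1) that] by (simp_all add: u_def)
  show u01: "u x \<in> {0..1}" for x using w01[of x] bump_bounds[of p R \<epsilon> x] by (auto simp: u_def)
  show "u x = a" if "\<phi> x = 0" for x
  proof -
    have "\<not> dist x p < 2" using bspec[OF p, of x] that by (auto simp: dist_commute)
    then have "u x = max 0 (w (\<phi> x / \<epsilon>))" using uB(1)[of x] R by simp
    then show ?thesis using that w(2) a by simp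
  qed
  show "V (u x) = V (max 0 (w (\<phi> x / \<epsilon>))) + V (bump p R \<epsilon> x)" if V: "V 0 = (0::real)" for V x
    by (cases "dist x p < 2") (use uA[of x] uB[of x] V R in simp_all)
  have "((M + 1) / \<epsilon>)-lipschitz_on UNIV u"
  proof (rule lipschitz_onI)
    fix x y
    have "\<bar>w (\<phi> x / \<epsilon>) - w (\<phi> y / \<epsilon>)\<bar> \<le> M * \<bar>\<phi> x / \<epsilon> - \<phi> y / \<epsilon>\<bar>" by (rule wlip)
    also have "\<bar>\<phi> x / \<epsilon> - \<phi> y / \<epsilon>\<bar> = \<bar>\<phi> x - \<phi> y\<bar> / \<epsilon>"
      using \<epsilon> by (simp add: diff_divide_distrib[symmetric])
    also have "M * (\<bar>\<phi> x - \<phi> y\<bar> / \<epsilon>) \<le> M * (dist x y / \<epsilon>)"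
      using \<phi>(1)[of x y] \<epsilon> M by (intro mult_left_mono divide_right_mono) auto
    finally have 1: "\<bar>w (\<phi> x / \<epsilon>) - w (\<phi> y / \<epsilon>)\<bar> \<le> M * (dist x y / \<epsilon>)" .
    have "\<bar>u x - u y\<bar> \<le> M * (dist x y / \<epsilon>) + dist x y / \<epsilon>"
      using 1 bump_lipschitz[OF \<epsilon>(1), of p R x y] unfolding u_def by linarith
    also have "\<dots> = (M + 1) / \<epsilon> * dist x y" by (simp add: add_divide_distrib distrib_right)
    finally show "dist (u x) (u y) \<le> (M + 1) / \<epsilon> * dist x y" by (simp add: dist_real_def)
  qed (use M \<epsilon> in simp)
  then show "\<exists>L. L-lipschitz_on UNIV u" ..
  let ?G = "\<lambda>x. (h (w (\<phi> x / \<epsilon>)))\<^sup>2" and ?N = "{x. \<phi> x < S * \<epsilon>}" and ?A = "{x. R - \<epsilon> \<le> dist x p \<and> dist x p < R}"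
  let ?B = "\<lambda>x. ennreal (2 / \<epsilon>) * (ennreal (?G x) * indicator ?N x) + ennreal ((1 + B) / \<epsilon>) * indicator ?A x"
  have "AC W \<epsilon> u U \<le> (\<integral>\<^sup>+x\<in>U. ?B x \<partial>lebesgue)"
  proof (rule AC_le_nn_integral[OF \<open>((M + 1) / \<epsilon>)-lipschitz_on UNIV u\<close> U])
    fix x g assume "x \<in> U" and g: "(u has_derivative (\<lambda>h. g \<bullet> h)) (at x)"
    have zero: "ennreal (\<epsilon> * (norm g)\<^sup>2 + W (u x) / \<epsilon>) \<le> ?B x" if "norm g \<le> 0" "W (u x) = 0" using that by simp
    \<comment> \<open>Only the profile zone and the shell of the bump carry energy; in the other two
      regions u takes the values 0 and 1, where W vanishes.\<close>
    consider "\<phi> x < S * \<epsilon>" | "S * \<epsilon> \<le> \<phi> x" "R \<le> dist x p" | "dist x p < R - \<epsilon>" | "x \<in> ?A" by force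
    then show "ennreal (\<epsilon> * (norm g)\<^sup>2 + W (u x) / \<epsilon>) \<le> ?B x"
    proof cases
      case 1
      have far2: "2 \<le> dist x p"
      proof (rule ccontr)
        assume "\<not> ?thesis"
        then have "1 \<le> \<phi> x" using bspec[OF p, of x] by (simp add: dist_commute)
        then show False using 1 \<epsilon>(2) by simp
      qed
      define r where "r = \<phi> x / \<epsilon>"
      have rS: "r \<le> S" using 1 \<epsilon>(1) by (simp add: r_def pos_divide_le_eq)
      have wr: "0 \<le> w r" "w r \<le> 1" using wdec[OF rS] w(3) wa[of x] a by (auto simp: r_def)
      have ux: "u x = w r" using uB(1)[of x] far2 R wr by (simp add: r_def)
      have ders: "((\<lambda>s. w (s / \<epsilon>)) has_real_derivative - h (w r) * (1 / \<epsilon>)) (at (\<phi> x))"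
      proof -
        have "((\<lambda>s. s / \<epsilon>) has_real_derivative 1 / \<epsilon>) (at (\<phi> x))" by (rule DERIV_cdivide[OF DERIV_ident])
        from DERIV_chain2[OF w(1) this] show ?thesis by (simp add: r_def)
      qed
      have "norm g \<le> \<bar>- h (w r) * (1 / \<epsilon>)\<bar>"
      proof (rule gradient_comp_le[where \<phi>=\<phi> and f="\<lambda>s. w (s / \<epsilon>)" and d=1, OF g ders])
        show "\<bar>u y - u x\<bar> \<le> \<bar>w (\<phi> y / \<epsilon>) - w (\<phi> x / \<epsilon>)\<bar>" if y: "dist y x < 1" for y
        proof -
          have "R \<le> dist y p" using far2 y R dist_triangle[of x p y] by (simp add: dist_commute)
          then have "u y = max 0 (w (\<phi> y / \<epsilon>))" by (rule uB)
          then show ?thesis using ux wr by (simp add: r_def)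
        qed
      qed (use \<phi>(1) in auto)
      then have ng: "norm g \<le> h (w r) / \<epsilon>" using h(2)[of "w r"] \<epsilon>(1) by (simp add: abs_mult)
      \<comment> \<open>The gradient is at most h / \<epsilon> and W is at most h^2, so both terms
        receive the same bound and together give the factor 2 / \<epsilon>.\<close>
      have "\<epsilon> * (norm g)\<^sup>2 + W (u x) / \<epsilon> \<le> \<epsilon> * (h (w r) / \<epsilon>)\<^sup>2 + (h (w r))\<^sup>2 / \<epsilon>"
        unfolding ux using ng \<epsilon>(1) bspec[OF h(4), of "w r"] wr by (intro add_mono mult_left_mono power_mono divide_right_mono) auto
      also have "\<dots> = 2 / \<epsilon> * (h (w r))\<^sup>2" using \<epsilon>(1) by (simp add: power2_eq_square)
      finally have "ennreal (\<epsilon> * (norm g)\<^sup>2 + W (u x) / \<epsilon>) \<le> ennreal (2 / \<epsilon> * (h (w r))\<^sup>2)" by (rule ennreal_leI)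
      also have "\<dots> = ennreal (2 / \<epsilon>) * (ennreal (?G x) * indicator ?N x)"
        using 1 \<epsilon>(1) ennreal_mult[of "2 / \<epsilon>" "(h (w r))\<^sup>2"] by (simp add: r_def)
      also have "\<dots> \<le> ?B x" by simp
      finally show ?thesis .
    next
      case 2
      have ux: "u x = 0" using uB(1)[OF 2(2)] far[OF 2(1)] by simp
      \<comment> \<open>0 is the global minimum of u, so the derivative vanishes even at points on
        the edge of a support.\<close>
      have "(\<lambda>h. g \<bullet> h) = (\<lambda>h. 0)"
        by (rule differential_zero_maxmin[OF UNIV_I open_UNIV g]) (use u01 ux in auto)
      then have "g \<bullet> g = 0" by metis
      then show ?thesis using ux W(1) by (intro zero) auto
    next
      case 3
      have ub: "u y = 1" if y: "dist y x < R - \<epsilon> - dist x p" for y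
      proof -
        have "dist y p < R - \<epsilon>" using y dist_triangle[of y p x] by simp
        then show ?thesis using uA(1)[of y] bump_eq_1[OF \<epsilon>(1), of y p R] R \<epsilon>(1) by simp
      qed
      have ux: "u x = 1" using ub[of x] 3 by simp
      have "norm g \<le> 0" by (rule gradient_norm_le[OF g, of "R - \<epsilon> - dist x p"]) (use ub ux 3 in auto)
      then show ?thesis using ux W(2) by (intro zero) auto
    next
      case 4
      then have dR: "dist x p < R" by simp
      have uxb: "u x = bump p R \<epsilon> x" using uA(1)[of x] dR R by simp
      have "norm g \<le> 1 / \<epsilon>"
      proof (rule gradient_norm_le[OF g, of 1])
        fix y assume "dist y x < 1"
        then have "dist y p < 2" using dR R dist_triangle[of y p x] by simp
        then show "\<bar>u y - u x\<bar> \<le> 1 / \<epsilon> * dist y x" using uA(1)[of y] uxb bump_lipschitz[OF \<epsilon>(1), of p R y x] by simp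
      qed (use \<epsilon>(1) in auto)
      then have "\<epsilon> * (norm g)\<^sup>2 + W (u x) / \<epsilon> \<le> \<epsilon> * (1 / \<epsilon>)\<^sup>2 + B / \<epsilon>"
        using \<epsilon>(1) bspec[OF W(3) u01[of x]] by (intro add_mono mult_left_mono power_mono divide_right_mono) auto
      also have "\<dots> = (1 + B) / \<epsilon>" using \<epsilon>(1) by (simp add: power2_eq_square add_divide_distrib)
      finally have "ennreal (\<epsilon> * (norm g)\<^sup>2 + W (u x) / \<epsilon>) \<le> ennreal ((1 + B) / \<epsilon>)" by (rule ennreal_leI)
      also have "\<dots> = ennreal ((1 + B) / \<epsilon>) * indicator ?A x" using 4 by simp
      also have "\<dots> \<le> ?B x" by simp
      finally show ?thesis .
    qed
  qed
  also have "\<dots> \<le> (\<integral>\<^sup>+x. ?B x \<partial>lebesgue)"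
    by (rule nn_integral_mono) (simp add: indicator_def)
  also have "\<dots> = ennreal (2 / \<epsilon>) * (\<integral>\<^sup>+x. ennreal (?G x) * indicator ?N x \<partial>lebesgue) + ennreal ((1 + B) / \<epsilon>) * emeasure lebesgue ?A"
  proof -
    have c\<phi>: "continuous_on UNIV \<phi>"
      by (rule lipschitz_on_continuous_on[of 1]) (rule lipschitz_onI, use \<phi>(1) in \<open>auto simp: dist_real_def\<close>)
    have cw: "continuous_on UNIV w" using w(1) by (meson DERIV_isCont continuous_at_imp_continuous_on)
    have "continuous_on UNIV ?G"
      by (intro continuous_on_power continuous_on_compose2[OF h(1)] continuous_on_compose2[OF cw] continuous_on_divide c\<phi> continuous_on_const)
        (use \<epsilon>(1) in auto)
    then have Gm: "(\<lambda>x. ennreal (?G x)) \<in> borel_measurable lebesgue"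
      by (intro measurable_compose[OF continuous_measurable_lebesgue measurable_ennreal])
    have "open ?N" by (intro open_Collect_less c\<phi> continuous_on_const)
    then have Nm: "?N \<in> sets lebesgue" by simp
    have "?A = ball p R - ball p (R - \<epsilon>)" by (auto simp: dist_commute)
    then have Am: "?A \<in> sets lebesgue" by simp
    have 1: "(\<lambda>x. ennreal (?G x) * indicator ?N x) \<in> borel_measurable lebesgue"
      by (intro borel_measurable_times_ennreal Gm borel_measurable_indicator Nm)
    have "(\<integral>\<^sup>+x. ?B x \<partial>lebesgue) = (\<integral>\<^sup>+x. ennreal (2 / \<epsilon>) * (ennreal (?G x) * indicator ?N x) \<partial>lebesgue) + (\<integral>\<^sup>+x. ennreal ((1 + B) / \<epsilon>) * indicator ?A x \<partial>lebesgue)"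
      by (intro nn_integral_add borel_measurable_times_ennreal borel_measurable_const 1 borel_measurable_indicator Am)
    also have "(\<integral>\<^sup>+x. ennreal (2 / \<epsilon>) * (ennreal (?G x) * indicator ?N x) \<partial>lebesgue) = ennreal (2 / \<epsilon>) * (\<integral>\<^sup>+x. ennreal (?G x) * indicator ?N x \<partial>lebesgue)"
      by (rule nn_integral_cmult[OF 1])
    also have "(\<integral>\<^sup>+x. ennreal ((1 + B) / \<epsilon>) * indicator ?A x \<partial>lebesgue) = ennreal ((1 + B) / \<epsilon>) * emeasure lebesgue ?A"
      by (rule nn_integral_cmult_indicator[OF Am])
    finally show ?thesis .
  qed
  finally show "AC W \<epsilon> u U \<le> ennreal (2 / \<epsilon>) * (\<integral>\<^sup>+x. ennreal (?G x) * indicator ?N x \<partial>lebesgue) + ennreal ((1 + B) / \<epsilon>) * emeasure lebesgue ?A" .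
qed

section \<open>The recovery sequence\<close>

text \<open>Stated for an abstract 1-Lipschitz \<phi>, so that an empty K, which has no useful
  distance function, is included.\<close>

lemma recovery_function:
  fixes \<phi> :: "'a::euclidean_space \<Rightarrow> real"
  assumes W: "admissible_W W" and dim: "DIM('a) = Suc n" "n > 0" and U: "open U"
    and \<phi>: "\<And>x y. \<bar>\<phi> x - \<phi> y\<bar> \<le> dist x y" "\<And>x. 0 \<le> \<phi> x"
    and fin: "\<And>s. s \<le> 1 \<Longrightarrow> {x. \<phi> x < s} \<in> lmeasurable"
    and lim: "((\<lambda>s. measure lebesgue {x. \<phi> x < s} / (2 * s)) \<longlongrightarrow> M) (at_right 0)" and M: "M \<ge> 0"
    and p: "ball p 2 \<subseteq> U" "\<And>x. x \<in> ball p 2 \<Longrightarrow> 1 \<le> \<phi> x"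
    and a: "0 < a" "a \<le> 1" and e: "e > 0"
    and \<nu>: "\<And>\<epsilon>. 0 < \<epsilon> \<Longrightarrow> \<epsilon> < 1 \<Longrightarrow> \<nu> \<epsilon> > 0" "(\<nu> \<longlongrightarrow> 0) (at_right 0)" "((\<lambda>\<epsilon>. \<epsilon> / \<nu> \<epsilon>) \<longlongrightarrow> 0) (at_right 0)"
  shows "\<forall>\<^sub>F \<epsilon> in at_right 0. \<exists>u. (\<exists>L. L-lipschitz_on UNIV u) \<and> (\<forall>x. u x \<in> {0..1}) \<and> (\<forall>x. \<phi> x = 0 \<longrightarrow> u x = a) \<and>
    Vol W n u U = ennreal (\<nu> \<epsilon>) \<and> AC W \<epsilon> u U / 2 \<le> ennreal (2 * M * Phi W a + e)"
proof -
  note Wc = admissible_W_continuous[OF W] and W0 = admissible_W_nonneg[OF W]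
  obtain t0 where t0: "t0 \<in> {0..1}" "\<forall>t\<in>{0..1}. W t \<le> W t0"
    using continuous_attains_sup[of "{0..1::real}" W] Wc by auto
  define B where "B = W t0"
  have B: "B \<ge> 0" "\<And>t. t \<in> {0..1} \<Longrightarrow> W t \<le> B" using t0 W0 by (auto simp: B_def)
  \<comment> \<open>The square root of the regularisation. It raises the integral of the speed by at
    most k, hence the halved energy by at most 2 M k <= e / 3.\<close>
  define k where "k = e / (6 * (M + 1))"
  have k: "k > 0" using e M by (simp add: k_def)
  have Mk: "2 * M * k \<le> e / 3"
  proof -
    have "2 * M * k \<le> 2 * (M + 1) * k" using k by simp
    also have "\<dots> = e / 3" using M by (simp add: k_def field_simps)
    finally show ?thesis .
  qed
  \<comment> \<open>Clamping to the unit interval extends W continuously and boundedly to the whole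
    line, as the profile equation requires.\<close>
  define cl where "cl t = max 0 (min 1 t)" for t :: real
  have cl: "cl t \<in> {0..1}" for t by (simp add: cl_def)
  define h where "h t = sqrt (W (cl t) + k\<^sup>2)" for t
  have "continuous_on UNIV (\<lambda>t. W (cl t))"
    by (rule continuous_on_compose2[OF Wc]) (auto simp: cl_def intro!: continuous_intros)
  then have hc: "continuous_on UNIV h" unfolding h_def[abs_def] by (intro continuous_intros)
  have hk: "k \<le> h t" for t unfolding h_def using W0[OF cl[of t]] by (intro real_le_rsqrt) simp
  have hB: "h t \<le> sqrt (B + k\<^sup>2)" for t unfolding h_def using B(2)[OF cl[of t]] by simp
  have hW: "\<forall>t\<in>{0..1}. W t \<le> (h t)\<^sup>2"
  proof
    fix t :: real assume t: "t \<in> {0..1}"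
    then have "cl t = t" by (auto simp: cl_def)
    then show "W t \<le> (h t)\<^sup>2" using W0[OF t] by (simp add: h_def)
  qed
  have "\<exists>w S. S > 0 \<and> w 0 = a \<and> w S = 0 \<and> (\<forall>r. (w has_real_derivative - h (w r)) (at r)) \<and>
    integral {0..S} (\<lambda>r. (h (w r))\<^sup>2) = integral {0..a} h"
    by (rule decreasing_profile[OF hc k hk hB a(1)]) (intro exI conjI allI)
  then obtain w S where S: "S > 0" and w0: "w 0 = a" "w S = 0" "\<forall>r. (w has_real_derivative - h (w r)) (at r)"
    and I: "integral {0..S} (\<lambda>r. (h (w r))\<^sup>2) = integral {0..a} h"
    by (elim exE conjE)
  have w: "w 0 = a" "w S = 0" "(w has_real_derivative - h (w r)) (at r)" for r
    using w0 by simp_all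
  have I_le: "integral {0..a} h \<le> Phi W a + k"
  proof -
    have i1: "(\<lambda>t. sqrt (W t)) integrable_on {0..a}" using a by (intro sqrt_W_integrable[OF W]) auto
    have i2: "(\<lambda>t::real. k) integrable_on {0..a}" by (rule integrable_const_ivl)
    have "integral {0..a} h \<le> integral {0..a} (\<lambda>t. sqrt (W t) + k)"
    proof (rule integral_le)
      show "h integrable_on {0..a}" by (rule integrable_continuous_interval[OF continuous_on_subset[OF hc]]) simp
      show "(\<lambda>t. sqrt (W t) + k) integrable_on {0..a}" by (rule integrable_add[OF i1 i2])
      fix t assume t: "t \<in> {0..a}"
      then have "cl t = t" using a by (auto simp: cl_def)
      then have "h t = sqrt (W t + k\<^sup>2)" by (simp add: h_def)
      also have "\<dots> \<le> sqrt (W t) + sqrt (k\<^sup>2)" using W0[of t] t a by (intro sqrt_add_le_add_sqrt) auto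
      finally show "h t \<le> sqrt (W t) + k" using k by simp
    qed
    also have "\<dots> = Phi W a + a * k" using integral_add[OF i1 i2] a by (simp add: Phi_def)
    also have "a * k \<le> 1 * k" using a k by (intro mult_right_mono) auto
    finally show ?thesis by simp
  qed
  have I0: "0 \<le> integral {0..a} h"
    by (rule integral_nonneg[OF integrable_continuous_interval[OF continuous_on_subset[OF hc]]]) (use hk k in \<open>auto intro: order_trans[OF less_imp_le]\<close>)
  have cw: "continuous_on UNIV w" using w(3) by (meson DERIV_isCont continuous_at_imp_continuous_on)
  have c\<phi>: "continuous_on UNIV \<phi>"
    by (rule lipschitz_on_continuous_on[of 1]) (rule lipschitz_onI, use \<phi>(1) in \<open>auto simp: dist_real_def\<close>)
  have cG: "continuous_on {0..S} (\<lambda>r. (h (w r))\<^sup>2)"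
    by (intro continuous_on_power continuous_on_compose2[OF hc] continuous_on_subset[OF cw]) auto
  have e3: "e / 3 > 0" using e by simp
  have ev1: "\<forall>\<^sub>F \<epsilon> in at_right 0. (\<integral>\<^sup>+x. ennreal ((h (w (\<phi> x / \<epsilon>)))\<^sup>2) * indicator {x. \<phi> x < S * \<epsilon>} x \<partial>lebesgue)
      \<le> ennreal (\<epsilon> * (2 * M * integral {0..a} h + e / 3))"
    using layer_integral_le[OF c\<phi> \<phi>(2) fin zero_less_one lim M cG _ S e3] unfolding I by simp
  define V where "V s = measure lebesgue {x. \<phi> x < s}" for s
  \<comment> \<open>The profile occupies a volume of at most about 2 M S \<epsilon>, and \<epsilon>
    / \<nu> \<epsilon> tends to 0. M + 1 replaces M to leave room and to stay positive when M =
    0.\<close>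
  have ev2: "\<forall>\<^sub>F \<epsilon> in at_right 0. V (S * \<epsilon>) \<le> \<nu> \<epsilon>"
  proof -
    have "\<forall>\<^sub>F s in at_right 0. measure lebesgue {x. \<phi> x < s} / (2 * s) < M + 1" by (rule order_tendstoD(2)[OF lim]) simp
    then obtain b where b: "b > 0" "\<And>s. 0 < s \<Longrightarrow> s < b \<Longrightarrow> V s / (2 * s) < M + 1"
      unfolding eventually_at_right_field V_def by auto
    have 1: "\<forall>\<^sub>F \<epsilon> in at_right (0::real). \<epsilon> < min 1 (b / S)"
      by (rule order_tendstoD(2)[OF tendsto_ident_at]) (use b(1) S in simp)
    have 2: "\<forall>\<^sub>F \<epsilon> in at_right 0. \<epsilon> / \<nu> \<epsilon> < 1 / (2 * S * (M + 1))"
      by (rule order_tendstoD(2)[OF \<nu>(3)]) (use S M in simp)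
    have 3: "\<forall>\<^sub>F \<epsilon> in at_right (0::real). 0 < \<epsilon>" by (rule eventually_at_right_less)
    show ?thesis using 1 2 3
    proof eventually_elim
      case (elim \<epsilon>)
      then have s: "0 < S * \<epsilon>" "S * \<epsilon> < b" using S by (auto simp: field_simps)
      have \<nu>0: "\<nu> \<epsilon> > 0" using elim by (intro \<nu>(1)) auto
      have D: "2 * S * (M + 1) > 0" using S M by simp
      have "V (S * \<epsilon>) < (M + 1) * (2 * (S * \<epsilon>))" using b(2)[OF s] s by (simp add: pos_divide_less_eq)
      also have "\<dots> = \<epsilon> * (2 * S * (M + 1))" by (simp add: mult_ac)
      also have "\<dots> < \<nu> \<epsilon>" using elim(2) \<nu>0 D by (simp add: pos_divide_less_eq pos_less_divide_eq)
      finally show ?case by simp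
    qed
  qed
  define cc where "cc = (1 + B) * (unit_ball_vol (real (Suc n)) * real (Suc n))"
  have cc: "cc \<ge> 0" using B by (simp add: cc_def)
  \<comment> \<open>A bound for the radius of the bump under which its shell contributes at most e /
    3.\<close>
  define \<rho> where "\<rho> = e / 3 / (cc + 1)"
  have \<rho>: "\<rho> > 0" "cc * \<rho> \<le> e / 3"
  proof -
    show "\<rho> > 0" using e cc by (simp add: \<rho>_def)
    then have "cc * \<rho> \<le> (cc + 1) * \<rho>" by (intro mult_right_mono) auto
    also have "\<dots> = \<rho> * (cc + 1)" by (rule mult.commute)
    also have "\<dots> = e / 3" by (rule iffD1[OF nonzero_eq_divide_eq \<rho>_def]) (use cc in linarith)
    finally show "cc * \<rho> \<le> e / 3" .
  qed
  have ev3: "\<forall>\<^sub>F \<epsilon> in at_right (0::real). \<epsilon> < min (1/2) (min (1 / S) (\<rho> / 2))"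
    by (rule order_tendstoD(2)[OF tendsto_ident_at]) (use \<rho>(1) S in simp)
  \<comment> \<open>The first volume guarantees that a suitable bump radius exists; the second
    forces that radius to be at most \<rho>.\<close>
  have ev4: "\<forall>\<^sub>F \<epsilon> in at_right 0. \<nu> \<epsilon> < min (measure lebesgue (ball p (1/2))) (measure lebesgue (ball p (\<rho> / 2)))"
    by (rule order_tendstoD(2)[OF \<nu>(2)]) (use \<rho>(1) content_ball_pos[of "1/2" p] content_ball_pos[of "\<rho> / 2" p] in simp)
  have ev5: "\<forall>\<^sub>F \<epsilon> in at_right (0::real). 0 < \<epsilon>" by (rule eventually_at_right_less)
  show ?thesis using ev1 ev2 ev3 ev4 ev5
  proof eventually_elim
    case (elim \<epsilon>)
    have \<epsilon>: "0 < \<epsilon>" "\<epsilon> \<le> 1/2" "S * \<epsilon> \<le> 1" "\<epsilon> < \<rho> / 2" using elim(3,5) S by (auto simp: field_simps)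
    have "\<nu> \<epsilon> > 0" using \<epsilon> by (intro \<nu>(1)) auto
    define u1 where "u1 x = max 0 (w (\<phi> x / \<epsilon>))" for x
    have h0: "0 \<le> h t" for t using hk[of t] k by linarith
    have WB: "\<forall>t\<in>{0..1}. W t \<le> B" using B(2) by blast
    have pb: "\<forall>x\<in>ball p 2. 1 \<le> \<phi> x" using p(2) by blast
    note E = recovery_energy[where \<phi>=\<phi> and w=w and h=h and W=W and a=a and S=S and \<epsilon>=\<epsilon> and p=p,
      OF \<phi> w(3,1,2) hc h0 hB hW admissible_W_ends[OF W] WB B(1) a \<epsilon>(1,3) pb _ _ U]
    have u1: "S * \<epsilon> \<le> \<phi> x \<Longrightarrow> u1 x = 0" "u1 x \<in> {0..1}" for x
      unfolding u1_def using E(5,6)[of 0 x] by auto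
    have cV: "continuous_on UNIV (\<lambda>x. Vpot W n (f x))" if "continuous_on UNIV f" "\<And>x. f x \<in> {0..1}" for f :: "'a \<Rightarrow> real"
      by (rule continuous_on_compose2[OF Vpot_continuous[OF W dim(2)] that(1)]) (use that(2) in auto)
    have cu1: "continuous_on UNIV u1" unfolding u1_def[abs_def]
      by (intro continuous_on_max continuous_on_const continuous_on_compose2[OF cw] continuous_on_divide c\<phi>) (use \<epsilon> in auto)
    define near where "near = (\<integral>\<^sup>+x\<in>U. ennreal (Vpot W n (u1 x)) \<partial>lebesgue)"
    have "near \<le> (\<integral>\<^sup>+x. indicator {x. \<phi> x < S * \<epsilon>} x \<partial>lebesgue)" unfolding near_def
    proof (rule nn_integral_mono)
      fix x
      show "ennreal (Vpot W n (u1 x)) * indicator U x \<le> indicator {x. \<phi> x < S * \<epsilon>} x"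
        using u1[of x] Vpot_bounds(2)[OF W, of "u1 x" n]
        by (cases "\<phi> x < S * \<epsilon>"; cases "x \<in> U") (simp_all add: not_less)
    qed
    also have "\<dots> = emeasure lebesgue {x. \<phi> x < S * \<epsilon>}" using fin[OF \<epsilon>(3)] by (intro nn_integral_indicator) auto
    also have "\<dots> = ennreal (V (S * \<epsilon>))" unfolding V_def by (rule emeasure_eq_measure2[OF fin[OF \<epsilon>(3)]])
    also have "\<dots> \<le> ennreal (\<nu> \<epsilon>)" using elim(2) by (rule ennreal_leI)
    finally have near: "near \<le> ennreal (\<nu> \<epsilon>)" .
    define v where "v = enn2real near"
    have v: "near = ennreal v" "0 \<le> v" "v \<le> \<nu> \<epsilon>"
    proof -
      show "near = ennreal v" unfolding v_def using near by (intro ennreal_enn2real[symmetric]) (simp add: le_less_trans)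
      show "0 \<le> v" by (simp add: v_def)
      then show "v \<le> \<nu> \<epsilon>" using near \<open>near = ennreal v\<close> \<open>\<nu> \<epsilon> > 0\<close> by (simp add: ennreal_le_iff)
    qed
    \<comment> \<open>v is the volume already contributed by the profile inside U; the bump supplies
      exactly the rest.\<close>
    obtain R where R: "0 \<le> R" "R \<le> 1" "(\<integral>\<^sup>+x. ennreal (Vpot W n (bump p R \<epsilon> x)) \<partial>lebesgue) = ennreal (\<nu> \<epsilon> - v)"
      "measure lebesgue (ball p (R - \<epsilon>)) \<le> \<nu> \<epsilon> - v"
    proof (rule bump_volume[of "Vpot W n" \<epsilon> "\<nu> \<epsilon> - v" p])
      show "continuous_on {0..1} (Vpot W n)" by (rule Vpot_continuous[OF W dim(2)])
      show "0 \<le> Vpot W n t" if "t \<in> {0..1}" for t using Vpot_bounds(1)[OF W that] .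
      show "Vpot W n 1 = 1" by (rule Vpot_1[OF W])
      show "\<nu> \<epsilon> - v \<le> measure lebesgue (ball p (1/2))" using elim(4) v by simp
    qed (use \<epsilon> v in simp_all)
    have R\<rho>: "R \<le> \<rho>"
    proof (rule ccontr)
      assume "\<not> ?thesis"
      then have "measure lebesgue (ball p (\<rho> / 2)) \<le> measure lebesgue (ball p (R - \<epsilon>))"
        using \<epsilon>(4) by (intro measure_mono_fmeasurable subset_ball) auto
      then show False using R(4) v(2) elim(4) by simp
    qed
    define u where "u x = max (max 0 (w (\<phi> x / \<epsilon>))) (bump p R \<epsilon> x)" for x
    note E' = E[OF R(1,2), folded u_def]
    have cb: "continuous_on UNIV (bump p R \<epsilon>)"
      unfolding bump_def[abs_def] by (intro continuous_intros) (use \<epsilon> in auto)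
    have Vol: "Vol W n u U = ennreal (\<nu> \<epsilon>)"
    proof -
      have m: "(\<lambda>x. ennreal (Vpot W n (f x)) * indicator U x) \<in> borel_measurable lebesgue"
        if "continuous_on UNIV f" "\<And>x. f x \<in> {0..1}" for f :: "'a \<Rightarrow> real"
        by (intro borel_measurable_times_ennreal borel_measurable_indicator measurable_compose[OF continuous_measurable_lebesgue measurable_ennreal] cV that)
          (use U in simp)
      have "Vol W n u U = (\<integral>\<^sup>+x. ennreal (Vpot W n (u1 x)) * indicator U x + ennreal (Vpot W n (bump p R \<epsilon> x)) * indicator U x \<partial>lebesgue)"
        unfolding Vol_def
      proof (rule nn_integral_cong)
        fix x
        have "Vpot W n (u x) = Vpot W n (u1 x) + Vpot W n (bump p R \<epsilon> x)"
          using E'(4)[of "Vpot W n" x] by (simp add: u1_def)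
        moreover have "0 \<le> Vpot W n (u1 x)" "0 \<le> Vpot W n (bump p R \<epsilon> x)" by (simp_all add: Vpot_def)
        ultimately show "ennreal (Vpot W n (u x)) * indicator U x = ennreal (Vpot W n (u1 x)) * indicator U x + ennreal (Vpot W n (bump p R \<epsilon> x)) * indicator U x"
          by (simp add: ennreal_plus distrib_right)
      qed
      also have "\<dots> = near + (\<integral>\<^sup>+x. ennreal (Vpot W n (bump p R \<epsilon> x)) * indicator U x \<partial>lebesgue)"
        unfolding near_def by (rule nn_integral_add[OF m[OF cu1 u1(2)] m[OF cb]]) (simp add: bump_bounds)
      also have "(\<integral>\<^sup>+x. ennreal (Vpot W n (bump p R \<epsilon> x)) * indicator U x \<partial>lebesgue) = (\<integral>\<^sup>+x. ennreal (Vpot W n (bump p R \<epsilon> x)) \<partial>lebesgue)"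
      proof (rule nn_integral_cong)
        fix x
        show "ennreal (Vpot W n (bump p R \<epsilon> x)) * indicator U x = ennreal (Vpot W n (bump p R \<epsilon> x))"
        proof (cases "x \<in> U")
          case False
          then have "x \<notin> ball p 2" using p(1) by blast
          then have "bump p R \<epsilon> x = 0" using R by (intro bump_eq_0 \<epsilon>(1)) (simp add: dist_commute)
          then show ?thesis by simp
        qed simp
      qed
      also have "near + \<dots> = ennreal (\<nu> \<epsilon>)" using R(3) v by (simp add: ennreal_plus[symmetric] del: ennreal_plus)
      finally show ?thesis .
    qed
    have AC: "AC W \<epsilon> u U / 2 \<le> ennreal (2 * M * Phi W a + e)"
    proof -
      let ?J = "2 * M * integral {0..a} h + e / 3"
      have J0: "0 \<le> ?J" using M I0 e by simp
      have "AC W \<epsilon> u U \<le> ennreal (2 / \<epsilon>) * (\<integral>\<^sup>+x. ennreal ((h (w (\<phi> x / \<epsilon>)))\<^sup>2) * indicator {x. \<phi> x < S * \<epsilon>} x \<partial>lebesgue)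
          + ennreal ((1 + B) / \<epsilon>) * emeasure lebesgue {x. R - \<epsilon> \<le> dist x p \<and> dist x p < R}"
        unfolding u_def[abs_def] by (rule E(7)[OF R(1,2)])
      also have "\<dots> \<le> ennreal (2 / \<epsilon>) * ennreal (\<epsilon> * ?J) + ennreal ((1 + B) / \<epsilon>) * ennreal (unit_ball_vol (real (Suc n)) * (real (Suc n) * \<epsilon> * R ^ n))"
        by (intro add_mono mult_left_mono elim(1) annulus_le[OF R(1) \<epsilon>(1) dim(1)]) auto
      also have "ennreal (2 / \<epsilon>) * ennreal (\<epsilon> * ?J) = ennreal (2 * ?J)"
        using \<epsilon>(1) J0 by (subst ennreal_mult[symmetric]) auto
      also have "ennreal ((1 + B) / \<epsilon>) * ennreal (unit_ball_vol (real (Suc n)) * (real (Suc n) * \<epsilon> * R ^ n)) = ennreal (cc * R ^ n)"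
      proof -
        have "ennreal ((1 + B) / \<epsilon>) * ennreal (unit_ball_vol (real (Suc n)) * (real (Suc n) * \<epsilon> * R ^ n)) =
          ennreal ((1 + B) / \<epsilon> * (unit_ball_vol (real (Suc n)) * (real (Suc n) * \<epsilon> * R ^ n)))"
          by (rule ennreal_mult[symmetric]) (use \<epsilon>(1) B(1) R(1) in simp_all)
        also have "(1 + B) / \<epsilon> * (unit_ball_vol (real (Suc n)) * (real (Suc n) * \<epsilon> * R ^ n)) = cc * R ^ n"
          using \<epsilon>(1) by (simp add: cc_def del: of_nat_Suc)
        finally show ?thesis .
      qed
      also have "ennreal (2 * ?J) + ennreal (cc * R ^ n) = ennreal (2 * ?J + cc * R ^ n)"
        using J0 cc R by (intro ennreal_plus[symmetric]) auto
      \<comment> \<open>Before halving, the errors are 4 M k <= 2 e / 3, the layer error 2 e / 3,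
        and cc \<rho> <= e / 3, which is less than 2 e in total. R <= 1 and n >= 1 give R^n <=
        R.\<close>
      also have "\<dots> \<le> ennreal (2 * (2 * M * Phi W a + e))"
      proof (rule ennreal_leI)
        have "R ^ n \<le> R ^ 1" using R dim(2) by (intro power_decreasing) auto
        then have "cc * R ^ n \<le> cc * \<rho>" using R\<rho> cc by (intro mult_left_mono) auto
        moreover have "2 * M * integral {0..a} h \<le> 2 * M * (Phi W a + k)" using I_le M by (intro mult_left_mono) auto
        ultimately show "2 * ?J + cc * R ^ n \<le> 2 * (2 * M * Phi W a + e)" using Mk \<rho>(2) e by (simp add: distrib_left)
      qed
      finally have "AC W \<epsilon> u U / 2 \<le> ennreal (2 * (2 * M * Phi W a + e)) / 2" by (rule divide_right_mono_ennreal)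
      also have "\<dots> = ennreal (2 * M * Phi W a + e)"
      proof -
        have half: "ennreal (2 * X) / 2 = ennreal X" if "X \<ge> 0" for X using divide_ennreal[of "2 * X" 2] that by simp
        have "0 \<le> Phi W a" using Phi_mono[OF W, of 0 a] a by simp
        then show ?thesis using M e by (intro half) simp
      qed
      finally show ?thesis .
    qed
    show ?case
    proof (intro exI[of _ u] conjI allI impI Vol AC)
      show "\<exists>L. L-lipschitz_on UNIV u" by (rule E'(1))
      show "u x \<in> {0..1}" for x by (rule E'(2))
      show "u x = a" if "\<phi> x = 0" for x using that by (rule E'(3))
    qed
  qed
qed

text \<open>The same exceptional sets and partitions serve: a larger set only shrinks the part of
  the common essential boundary that remains uncovered.\<close>

lemma spanning_mono:
  fixes S :: "'a::euclidean_space set"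
  assumes S: "spanning TYPE('b::euclidean_space) \<Omega> C S" and sub: "S \<subseteq> S'" "S' \<in> sets borel" "S' \<subseteq> \<Omega>"
  shows "spanning TYPE('b) \<Omega> C S'"
proof -
  have mono: "ess_disconnects m (S' \<union> Q) T T1 T2" if ed: "ess_disconnects m (S \<union> Q) T T1 T2" for m Q T T1 T2
  proof -
    let ?A = "density_pts T 1 \<inter> ess_boundary T1 \<inter> ess_boundary T2"
    have "hausdorff m (?A - (S' \<union> Q)) \<le> hausdorff m (?A - (S \<union> Q))" using sub(1) by (intro hausdorff_mono) blast
    then show ?thesis using ed by (simp add: ess_disconnects_def H_contained_def)
  qed
  show ?thesis unfolding spanning_def
  proof (intro conjI sub(2,3) allI impI)
    fix \<gamma> and \<Phi> :: "complex \<times> 'b \<Rightarrow> 'a" and T assume "tube \<Omega> C \<gamma> \<Phi> T"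
    then obtain N where N: "hausdorff 1 N = 0" "\<forall>s\<in>S1 - N. \<exists>M. hausdorff DIM('b) M = 0 \<and>
          (\<forall>x\<in>\<Phi> ` ({s} \<times> ball 0 1) - M. \<exists>T1 T2. T1 \<inter> T2 = {} \<and> T1 \<union> T2 = T \<and>
             x \<in> ess_boundary T1 \<inter> ess_boundary T2 \<and>
             ess_disconnects DIM('b) (S \<union> \<Phi> ` ({s} \<times> ball 0 1)) T T1 T2)"
      using S unfolding spanning_def by blast
    show "\<exists>N. hausdorff 1 N = 0 \<and> (\<forall>s\<in>S1 - N. \<exists>M. hausdorff DIM('b) M = 0 \<and>
          (\<forall>x\<in>\<Phi> ` ({s} \<times> ball 0 1) - M. \<exists>T1 T2. T1 \<inter> T2 = {} \<and> T1 \<union> T2 = T \<and>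
             x \<in> ess_boundary T1 \<inter> ess_boundary T2 \<and>
             ess_disconnects DIM('b) (S' \<union> \<Phi> ` ({s} \<times> ball 0 1)) T T1 T2))"
      using N mono by (intro exI[of _ N] conjI ballI) meson+
  qed
qed

theorem theorem4p3:
  fixes W :: "real \<Rightarrow> real"
    and Wset :: "'a::euclidean_space set"
    and C :: "(complex \<Rightarrow> 'a) set"
    and K :: "'a set"
    and \<nu> \<delta> :: "real \<Rightarrow> real"
    and \<delta>0 c r0 :: real
  assumes dim: "DIM('a) = Suc DIM('b::euclidean_space)"
    and W: "admissible_W W"
    and Wset: "compact Wset" "smooth_boundary (- Wset)"
    and C: "spanning_class (- Wset) C"
    and K: "closedin (top_of_set (- Wset)) K" "H_rectifiable TYPE('b) K" "bounded K"
           "spanning TYPE('b) (- Wset) C K"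
    and dens: "c > 0" "r0 > 0"
              "\<forall>x\<in>closure K. \<forall>r. 0 < r \<and> r < r0 \<longrightarrow> hausdorff DIM('b) (K \<inter> ball x r) \<ge> ennreal (c * r ^ DIM('b))"
    and \<nu>: "\<forall>\<epsilon>\<in>{0<..<1}. \<nu> \<epsilon> > 0" "(\<nu> \<longlongrightarrow> 0) (at_right 0)"
    and \<delta>: "\<forall>\<epsilon>\<in>{0<..<1}. 1/2 < \<delta> \<epsilon> \<and> \<delta> \<epsilon> < 1" "(\<delta> \<longlongrightarrow> \<delta>0) (at_right 0)" "\<delta>0 \<in> {1/2..1}"
    and ratio: "((\<lambda>\<epsilon>. \<epsilon> / \<nu> \<epsilon>) \<longlongrightarrow> 0) (at_right 0)"
  shows "\<exists>(\<epsilon>s :: nat \<Rightarrow> real) (u :: nat \<Rightarrow> real \<Rightarrow> 'a \<Rightarrow> real).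
     (\<forall>j. 0 < \<epsilon>s j \<and> \<epsilon>s j < 1) \<and> \<epsilon>s \<longlonglongrightarrow> 0 \<and>
     (\<forall>j \<epsilon>. 0 < \<epsilon> \<and> \<epsilon> < \<epsilon>s j \<longrightarrow>
        (\<forall>x\<in>- Wset. u j \<epsilon> x \<in> {0..1}) \<and> W12loc (- Wset) (u j \<epsilon>) \<and>
        (\<exists>L. L-lipschitz_on (- Wset) (u j \<epsilon>)) \<and>
        spanning TYPE('b) (- Wset) C {x \<in> - Wset. u j \<epsilon> x \<ge> \<delta> \<epsilon>} \<and>
        Vol W DIM('b) (u j \<epsilon>) (- Wset) = ennreal (\<nu> \<epsilon>)) \<and>
     limsup (\<lambda>j. SUP \<epsilon>\<in>{0<..<\<epsilon>s j}. AC W \<epsilon> (u j \<epsilon>) (- Wset) / 2)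
       \<le> ennreal (2 * Phi W \<delta>0) * hausdorff DIM('b) K"
proof -
  let ?n = "DIM('b)" and ?U = "- Wset"
  have U: "open ?U" using compact_imp_closed[OF Wset(1)] by (simp add: open_Compl)
  have KU: "K \<subseteq> ?U" using closedin_imp_subset[OF K(1)] by simp
  have Kb: "K \<in> sets borel"
  proof -
    obtain T where "closed T" "K = ?U \<inter> T" using K(1) by (auto simp: closedin_closed)
    then show ?thesis using U by auto
  qed
  define M where "M = enn2real (hausdorff ?n K)"
  have M0: "M \<ge> 0" by (simp add: M_def)
  have HK: "hausdorff ?n K = ennreal M" using K(2) by (simp add: M_def H_rectifiable_def)
  \<comment> \<open>\<open>infdist x {}\<close> is 0, which would make every point count as a point
    of K; a constant of at least 1 gives empty sublevel sets up to height 1 instead.\<close>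
  define \<phi> where "\<phi> x = (if K = {} then 2 else infdist x K)" for x
  have \<phi>: "\<bar>\<phi> x - \<phi> y\<bar> \<le> dist x y" "0 \<le> \<phi> x" for x y
    by (simp_all add: \<phi>_def infdist_triangle_abs infdist_nonneg)
  have \<phi>K: "\<phi> x = 0" if "x \<in> K" for x using that by (auto simp: \<phi>_def)
  have nb: "{x. \<phi> x < s} = nbhd s K" if s: "s \<le> 1" for s
  proof (cases "K = {}")
    case False
    have "infdist x K < s \<longleftrightarrow> (\<exists>y\<in>K. dist x y < s)" for x
      using False by (simp add: infdist_notempty cINF_less_iff bdd_below_image_dist)
    then show ?thesis using False by (auto simp: \<phi>_def nbhd_def dist_commute)
  qed (use s in \<open>auto simp: \<phi>_def nbhd_def\<close>)
  have fin: "{x. \<phi> x < s} \<in> lmeasurable" if "s \<le> 1" for s using lmeasurable_nbhd[OF K(3)] nb[OF that] by simp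
  have lim: "((\<lambda>s. measure lebesgue {x. \<phi> x < s} / (2 * s)) \<longlongrightarrow> M) (at_right 0)"
  proof (rule Lim_transform_eventually)
    show "((\<lambda>s. measure lebesgue (nbhd s K) / (2 * s)) \<longlongrightarrow> M) (at_right 0)" unfolding M_def
      by (rule minkowski_content_rectifiable[OF Kb K(3,2) dim dens(1,2)]) (use dens(3) closure_subset[of K] in blast)
    have "\<forall>\<^sub>F s in at_right (0::real). s < 1" by (rule order_tendstoD(2)[OF tendsto_ident_at]) simp
    then show "\<forall>\<^sub>F s in at_right 0. measure lebesgue (nbhd s K) / (2 * s) = measure lebesgue {x. \<phi> x < s} / (2 * s)"
      by (rule eventually_mono) (simp add: nb)
  qed
  have "bounded (Wset \<union> K)" using compact_imp_bounded[OF Wset(1)] K(3) by simp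
  then obtain b where b: "b > 0" "\<And>x. x \<in> Wset \<union> K \<Longrightarrow> norm x \<le> b" by (auto simp: bounded_pos)
  obtain i :: 'a where i: "i \<in> Basis" by (rule SOME_Basis[THEN that])
  \<comment> \<open>\<open>Wset\<close> and K lie in the ball of radius b, so the ball of radius 2
    around a point of norm b + 4 is contained in the domain and stays 2 away from K.\<close>
  define p where "p = (b + 4) *\<^sub>R i"
  have far: "norm x > b + 2" if "x \<in> ball p 2" for x
  proof -
    have "norm p = b + 4" using i b(1) by (simp add: p_def)
    then show ?thesis using that norm_triangle_ineq2[of p x] norm_minus_commute[of p x] by (simp add: dist_norm)
  qed
  have p: "ball p 2 \<subseteq> ?U" "\<And>x. x \<in> ball p 2 \<Longrightarrow> 1 \<le> \<phi> x"
  proof -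
    show "ball p 2 \<subseteq> ?U" using far b(2) by force
    fix x assume x: "x \<in> ball p 2"
    show "1 \<le> \<phi> x"
    proof (rule ccontr)
      assume "\<not> ?thesis"
      then have "x \<in> nbhd 1 K" using nb[of 1] by auto
      then obtain y where y: "y \<in> K" "dist y x < 1" by (auto simp: nbhd_def)
      have "norm x \<le> norm y + dist y x" using norm_triangle_sub[of x y] by (simp add: dist_norm norm_minus_commute)
      then show False using far[OF x] b(2)[of y] y by simp
    qed
  qed
  \<comment> \<open>The excess 1 / (j + 1) lets a j dominate \<delta> \<epsilon> for all small
    \<epsilon>; the cap at 1 is harmless because \<delta> \<epsilon> < 1.\<close>
  define a where "a j = min 1 (\<delta>0 + inverse (real (Suc j)))" for j
  define e where "e j = inverse (real (Suc j))" for j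
  have a: "0 < a j" "a j \<le> 1" and e: "e j > 0" for j using \<delta>(3) by (auto simp: a_def e_def add_pos_pos)
  define Q where "Q j \<epsilon> u \<longleftrightarrow> (\<exists>L. L-lipschitz_on UNIV u) \<and> (\<forall>x. u x \<in> {0..1}) \<and> (\<forall>x. \<phi> x = 0 \<longrightarrow> u x = a j) \<and>
    Vol W ?n u ?U = ennreal (\<nu> \<epsilon>) \<and> AC W \<epsilon> u ?U / 2 \<le> ennreal (2 * M * Phi W (a j) + e j)" for j \<epsilon> and u :: "'a \<Rightarrow> real"
  have "\<exists>b>0. \<forall>\<epsilon>. 0 < \<epsilon> \<longrightarrow> \<epsilon> < b \<longrightarrow> \<delta> \<epsilon> \<le> a j \<and> (\<exists>u. Q j \<epsilon> u)" for j
  proof -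
    have 1: "\<forall>\<^sub>F \<epsilon> in at_right 0. \<exists>u. Q j \<epsilon> u" unfolding Q_def
      by (rule recovery_function[OF W dim DIM_positive U \<phi> fin lim M0 p a e]) (use \<nu> ratio in auto)
    have "\<forall>\<^sub>F \<epsilon> in at_right 0. \<delta> \<epsilon> < \<delta>0 + inverse (real (Suc j))" by (rule order_tendstoD(2)[OF \<delta>(2)]) simp
    moreover have "\<forall>\<^sub>F \<epsilon> in at_right (0::real). \<epsilon> < 1" by (rule order_tendstoD(2)[OF tendsto_ident_at]) simp
    moreover have "\<forall>\<^sub>F \<epsilon> in at_right (0::real). 0 < \<epsilon>" by (rule eventually_at_right_less)
    ultimately have 2: "\<forall>\<^sub>F \<epsilon> in at_right 0. \<delta> \<epsilon> \<le> a j"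
    proof eventually_elim
      case (elim \<epsilon>)
      then have "\<delta> \<epsilon> < 1" using \<delta>(1) by simp
      then show ?case using elim(1) by (simp add: a_def)
    qed
    show ?thesis using eventually_conj[OF 2 1] unfolding eventually_at_right_field by auto
  qed
  then obtain bb where bb: "\<And>j. bb j > 0" "\<And>j \<epsilon>. 0 < \<epsilon> \<Longrightarrow> \<epsilon> < bb j \<Longrightarrow> \<delta> \<epsilon> \<le> a j \<and> (\<exists>u. Q j \<epsilon> u)" by metis
  \<comment> \<open>The second bound forces convergence to 0; it starts at 1/2, so that every
    threshold is strictly below 1.\<close>
  define \<epsilon>s where "\<epsilon>s j = min (bb j) (inverse (real (Suc (Suc j))))" for j
  define u where "u j \<epsilon> = (SOME u. Q j \<epsilon> u)" for j \<epsilon>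
  have u: "\<delta> \<epsilon> \<le> a j" "Q j \<epsilon> (u j \<epsilon>)" if "0 < \<epsilon>" "\<epsilon> < \<epsilon>s j" for j \<epsilon>
  proof -
    have b: "\<epsilon> < bb j" using that by (simp add: \<epsilon>s_def)
    show "\<delta> \<epsilon> \<le> a j" using bb(2)[OF that(1) b] by simp
    have "\<exists>u. Q j \<epsilon> u" using bb(2)[OF that(1) b] by simp
    then show "Q j \<epsilon> (u j \<epsilon>)" unfolding u_def by (rule someI_ex)
  qed
  show ?thesis
  proof (intro exI[of _ \<epsilon>s] exI[of _ u] conjI allI impI)
    fix j
    show "0 < \<epsilon>s j" using bb(1) by (simp add: \<epsilon>s_def)
    have "inverse (real (Suc (Suc j))) < 1" by (rule inverse_less_1_iff[THEN iffD2]) simp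
    then show "\<epsilon>s j < 1" by (simp add: \<epsilon>s_def)
  next
    show "\<epsilon>s \<longlonglongrightarrow> 0"
    proof (rule tendsto_sandwich[OF _ _ tendsto_const])
      show "\<forall>\<^sub>F j in sequentially. 0 \<le> \<epsilon>s j" using bb(1) by (simp add: \<epsilon>s_def less_imp_le)
      show "\<forall>\<^sub>F j in sequentially. \<epsilon>s j \<le> inverse (real (Suc (Suc j)))" by (simp add: \<epsilon>s_def)
      show "(\<lambda>j. inverse (real (Suc (Suc j)))) \<longlonglongrightarrow> 0" using LIMSEQ_Suc[OF LIMSEQ_inverse_real_of_nat] .
    qed
  next
    fix j \<epsilon> assume "0 < \<epsilon> \<and> \<epsilon> < \<epsilon>s j"
    then have j: "\<delta> \<epsilon> \<le> a j" "Q j \<epsilon> (u j \<epsilon>)" using u by auto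
    then obtain L where L: "L-lipschitz_on UNIV (u j \<epsilon>)" and u01: "\<And>x. u j \<epsilon> x \<in> {0..1}"
      and uK: "\<And>x. \<phi> x = 0 \<Longrightarrow> u j \<epsilon> x = a j" and Vol: "Vol W ?n (u j \<epsilon>) ?U = ennreal (\<nu> \<epsilon>)"
      unfolding Q_def by blast
    show "\<forall>x\<in>?U. u j \<epsilon> x \<in> {0..1}" using u01 by (intro ballI)
    show "W12loc ?U (u j \<epsilon>)" by (rule W12loc_lipschitz[OF L, of 1]) (use u01 in \<open>simp add: abs_le_iff\<close>)
    show "\<exists>L. L-lipschitz_on ?U (u j \<epsilon>)" using lipschitz_on_subset[OF L subset_UNIV] by blast
    show "Vol W ?n (u j \<epsilon>) ?U = ennreal (\<nu> \<epsilon>)" by (rule Vol)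
    show "spanning TYPE('b) ?U C {x \<in> ?U. \<delta> \<epsilon> \<le> u j \<epsilon> x}"
    proof (rule spanning_mono[OF K(4)])
      show "K \<subseteq> {x \<in> ?U. \<delta> \<epsilon> \<le> u j \<epsilon> x}" using KU uK \<phi>K j(1) by auto
      have "closed {x. \<delta> \<epsilon> \<le> u j \<epsilon> x}"
        by (intro closed_Collect_le continuous_on_const lipschitz_on_continuous_on[OF L])
      moreover have "{x \<in> ?U. \<delta> \<epsilon> \<le> u j \<epsilon> x} = ?U \<inter> {x. \<delta> \<epsilon> \<le> u j \<epsilon> x}" by auto
      ultimately show "{x \<in> ?U. \<delta> \<epsilon> \<le> u j \<epsilon> x} \<in> sets borel" using U by (auto intro!: sets.Int)
    qed auto
  next
    have "(\<lambda>j. min 1 (\<delta>0 + inverse (real (Suc j)))) \<longlonglongrightarrow> min 1 (\<delta>0 + 0)"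
      by (intro tendsto_min tendsto_const tendsto_add LIMSEQ_inverse_real_of_nat)
    then have "a \<longlonglongrightarrow> \<delta>0" using \<delta>(3) by (simp add: a_def[abs_def] min_absorb2)
    then have "(\<lambda>j. Phi W (a j)) \<longlonglongrightarrow> Phi W \<delta>0"
      by (rule continuous_on_tendsto_compose[OF Phi_continuous[OF W]]) (use \<delta>(3) a in \<open>auto simp: less_imp_le\<close>)
    then have "(\<lambda>j. 2 * M * Phi W (a j) + e j) \<longlonglongrightarrow> 2 * M * Phi W \<delta>0 + 0"
      unfolding e_def by (intro tendsto_add tendsto_mult tendsto_const LIMSEQ_inverse_real_of_nat)
    then have lims: "(\<lambda>j. ennreal (2 * M * Phi W (a j) + e j)) \<longlonglongrightarrow> ennreal (2 * M * Phi W \<delta>0)"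
      by (intro tendsto_ennrealI) simp
    have "limsup (\<lambda>j. SUP \<epsilon>\<in>{0<..<\<epsilon>s j}. AC W \<epsilon> (u j \<epsilon>) ?U / 2) \<le> limsup (\<lambda>j. ennreal (2 * M * Phi W (a j) + e j))"
    proof (intro Limsup_mono always_eventually allI SUP_least)
      fix j \<epsilon> assume "\<epsilon> \<in> {0<..<\<epsilon>s j}"
      then show "AC W \<epsilon> (u j \<epsilon>) ?U / 2 \<le> ennreal (2 * M * Phi W (a j) + e j)" using u(2)[of \<epsilon> j] by (simp add: Q_def)
    qed
    also have "\<dots> = ennreal (2 * M * Phi W \<delta>0)" by (rule lim_imp_Limsup[OF trivial_limit_sequentially lims])
    also have "\<dots> = ennreal (2 * Phi W \<delta>0) * hausdorff ?n K"
      using Phi_mono[OF W, of 0 \<delta>0] \<delta>(3) M0 unfolding HK by (subst ennreal_mult[symmetric]) (auto simp: mult_ac)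
    finally show "limsup (\<lambda>j. SUP \<epsilon>\<in>{0<..<\<epsilon>s j}. AC W \<epsilon> (u j \<epsilon>) ?U / 2) \<le> ennreal (2 * Phi W \<delta>0) * hausdorff ?n K" .
  qed
qed

end
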